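(* For any time $t>0$ and any observable $g\in\mathbb B_{t,\beta}$, the Hamilton--Jacobi system on $[0,t]\times\mathcal D$ $$\begin{cases}(\partial_s+v\cdot\nabla_x)q^{[t]}=\dfrac{\partial\mathcal H}{\partial p}(q^{[t]},p^{[t]}),& q^{[t]}(0)=M_\beta\varphi_0\exp(p^{[t]}(0)),\\[2mm](\partial_s+v\cdot\nabla_x)(p^{[t]}-g)=-\dfrac{\partial\mathcal H}{\partial q}(q^{[t]},p^{[t]}),& p^{[t]}(t)=g(t),\end{cases}$$ with Hamiltonian $$\mathcal H(q,p)=\int\mathrm dz_1\,\mathrm dv_2\,\mathrm d\omega\,\langle v_1-v_2,\omega\rangle_+\,M_\beta(v_2)\,q(z_1)\,\bigl(e^{p(x_1,v_1')-p(x_1,v_1)}-1\bigr),$$ admits a unique global solution $(q^{[t]},p^{[t]})$ such that $(q^{[t]}e^{-p^{[t]}},e^{p^{[t]}})\in L^\infty\bigl([0,t],\mathcal F_{1,\beta/4}\times\mathcal F_{1,-\beta/4}\bigr)$. Moreover the functional $$\hat{\mathcal I}(t,g)=\mathcal I(0,g)+\int_0^t\mathrm ds\int_{\mathcal D}q^{[t]}(s)\,(\partial_s+v\cdot\nabla_x)\bigl(p^{[t]}(s)-g(s)\bigr)\,\mathrm dz+\int_0^t\mathcal H\bigl(q^{[t]}(s),p^{[t]}(s)\bigr)\,\mathrm ds$$ defined from this solution coincides on $[0,t]$ with the limit cumulant generating functional: $\mathcal I(t,g)=\hat{\mathcal I}(t,g)$.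
   Context: $d$ is the space dimension, $\mathbb T^d=\mathbb R^d/\mathbb Z^d$, $\mathcal D=\mathbb T^d\times\mathbb R^d$, $z=(x,v)$, $\beta>0$, $M_\beta(v)=(\beta/2\pi)^{d/2}e^{-\beta|v|^2/2}$, $\varphi_0:\mathcal D\to[0,\infty)$ measurable with $\operatorname{ess\,sup}\varphi_0M_{\beta/2}<\infty$. For velocities $v_1,v_2$ and $\omega\in\mathbb S^{d-1}$: $v_1'=v_1-\langle v_1-v_2,\omega\rangle\omega$, $v_2'=v_2+\langle v_1-v_2,\omega\rangle\omega$. Function spaces: for $\alpha\in\mathbb R$, $\mathcal F_{1,\alpha}$ is the space of measurable $f$ on $\mathcal D$ with $\operatorname{ess\,sup}_{z}|f(z)|e^{\alpha|v|^2}<\infty$. $\mathbb B_{t,\beta}$ is the set of $h:[0,t]\times\mathcal D\to\mathbb R$ for which there is $C>0$ with $\|(h(s,x,v)-\frac\beta4|v|^2)_+\|_{L^\infty(\mathcal D)}+\|(\partial_s+v\cdot\nabla_x)h(s)\|_{L^\infty(\mathcal D)}<C$ for all $s\le t$. $\partial\mathcal H/\partial p$ and $\partial\mathcal H/\partial q$ are the densities (with respect to $\mathrm dz$) of the partial derivatives of $\mathcal H$. Functional $\mathcal I$: for a functional $H$ of one-particle trajectories on $[0,t]$, put $$\int\tilde F_1[H](t)=\sum_{k\ge0}\sum_{s_1,\dots,s_k\in\{\pm1\}}\int\mathrm dz\,\mathrm d\underline v_k^*\,\mathrm d\underline\omega_k\,\mathrm d\underline\tau_k\prod_{i=1}^ks_i\langle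 w_i-v_i^*,\omega_i\rangle_+\,H(\zeta^{[0,t]})\,\varphi_0(\zeta(0))M_\beta(v(0))\prod_{i=1}^kM_\beta(\tilde v_i),$$ integrating over $z\in\mathcal D$, $v_i^*\in\mathbb R^d$, $\omega_i\in\mathbb S^{d-1}$, $t>\tau_1>\dots>\tau_k>0$. Here $\zeta=(x(\cdot),v(\cdot))$ is built backwards from $\zeta(t)=z$: free flight between the $\tau_i$; $w_i=v(\tau_i^+)$; at $\tau_i$, if $s_i=+1$ then $v(\tau_i^-)=w_i-\langle w_i-v_i^*,\omega_i\rangle\omega_i$, $\tilde v_i=v_i^*+\langle w_i-v_i^*,\omega_i\rangle\omega_i$; if $s_i=-1$ then $v(\tau_i^-)=w_i$, $\tilde v_i=v_i^*$. Then $\mathcal I(t,g)=\int\tilde F_1\bigl[\exp\bigl(g(t,z^{[t]})-\int_0^t(\partial_s+v\cdot\nabla_x)g(s,z^{[s]})\,\mathrm ds\bigr)\bigr](t)$; in particular $\mathcal I(0,g)=\int_{\mathcal D}M_\beta\varphi_0e^{g(0)}$.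
   Formalization: The initial term of Î is I(0,p^{[t]}), not the printed I(0,g), which makes the identity false; as H(q,p) may be infinite, its partial derivatives are taken of increments in localized directions, and in I and H the integral over z (resp. z_1) is done last. *)

theory Defs
  imports "HOL-Probability.Probability"
begin

type_synonym 'n phase = "(real ^ 'n) \<times> (real ^ 'n)"

section \<open>Phase space\<close>

(* Functions on T^d x R^d are represented by functions on R^d x R^d that are Z^d-periodic in the
   position; integrals and "almost everywhere" refer to one fundamental cell. *)

definition unit_cell :: "(real ^ 'n) set" where
  "unit_cell = {x. \<forall>i. 0 \<le> x $ i \<and> x $ i < 1}"

definition phase_measure :: "'n::finite phase measure" where
  "phase_measure = restrict_space lborel (unit_cell \<times> UNIV)"

definition periodic :: "('n::finite phase \<Rightarrow> real) \<Rightarrow> bool" where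
  "periodic f \<longleftrightarrow> (\<forall>x v k. (\<forall>i. k $ i \<in> \<int>) \<longrightarrow> f (x + k, v) = f (x, v))"

definition phase_fun :: "('n::finite phase \<Rightarrow> real) \<Rightarrow> bool" where
  "phase_fun f \<longleftrightarrow> f \<in> borel_measurable borel \<and> periodic f"

definition time_phase_fun :: "real \<Rightarrow> (real \<Rightarrow> 'n::finite phase \<Rightarrow> real) \<Rightarrow> bool" where
  "time_phase_fun t f \<longleftrightarrow>
     (\<lambda>(s, z). f s z) \<in> borel_measurable (restrict_space borel ({0..t} \<times> UNIV)) \<and>
     (\<forall>s\<in>{0..t}. periodic (f s))"

definition Linfty_norm :: "('n::finite phase \<Rightarrow> real) \<Rightarrow> ereal" where
  "Linfty_norm f = esssup phase_measure (\<lambda>z. ereal \<bar>f z\<bar>)"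

definition weighted_norm :: "real \<Rightarrow> ('n::finite phase \<Rightarrow> real) \<Rightarrow> ereal" where
  "weighted_norm \<alpha> f = Linfty_norm (\<lambda>(x, v). f (x, v) * exp (\<alpha> * (norm v)\<^sup>2))"

definition F_space :: "real \<Rightarrow> ('n::finite phase \<Rightarrow> real) set" where
  "F_space \<alpha> = {f. phase_fun f \<and> weighted_norm \<alpha> f < \<infinity>}"

definition Linfty_F :: "real \<Rightarrow> real \<Rightarrow> (real \<Rightarrow> 'n::finite phase \<Rightarrow> real) set" where
  "Linfty_F t \<alpha> = {f. time_phase_fun t f \<and>
     (\<exists>C. AE s in lborel. s \<in> {0..t} \<longrightarrow> f s \<in> F_space \<alpha> \<and> weighted_norm \<alpha> (f s) \<le> ereal C)}"


section \<open>The transport operator\<close>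

(* (\<partial>_s + v \<cdot> \<nabla>_x) h = F in the mild sense: along almost every characteristic
   s \<mapsto> (x + s v, v) the function h is absolutely continuous with derivative F.  This also gives
   a meaning to the values of h at each single time, in particular at s = 0 and s = t. *)

definition free_flow :: "real \<Rightarrow> 'n::finite phase \<Rightarrow> 'n phase" where
  "free_flow s z = (fst z + s *\<^sub>R snd z, snd z)"

definition has_transport_deriv ::
  "real \<Rightarrow> (real \<Rightarrow> 'n::finite phase \<Rightarrow> real) \<Rightarrow> (real \<Rightarrow> 'n phase \<Rightarrow> real) \<Rightarrow> bool" where
  "has_transport_deriv t h F \<longleftrightarrow> time_phase_fun t h \<and> time_phase_fun t F \<and>
     (AE z in phase_measure.
        set_integrable lborel {0..t} (\<lambda>r. F r (free_flow r z)) \<and>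
        (\<forall>s\<in>{0..t}. h s (free_flow s z) = h 0 z + (LINT r:{0..s}|lborel. F r (free_flow r z))))"

(* Determined by h up to a null set of [0,t] x D. *)
definition transport_deriv ::
  "real \<Rightarrow> (real \<Rightarrow> 'n::finite phase \<Rightarrow> real) \<Rightarrow> (real \<Rightarrow> 'n phase \<Rightarrow> real)" where
  "transport_deriv t h = (SOME F. has_transport_deriv t h F)"

definition observables :: "real \<Rightarrow> real \<Rightarrow> (real \<Rightarrow> 'n::finite phase \<Rightarrow> real) set" where
  "observables t \<beta> = {h. \<exists>F. has_transport_deriv t h F \<and>
     (\<exists>C>0. \<forall>s\<in>{0..t}.
        Linfty_norm (\<lambda>(x, v). max 0 (h s (x, v) - \<beta> / 4 * (norm v)\<^sup>2)) + Linfty_norm (F s) < ereal C)}"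


section \<open>Collisions and the Hamiltonian\<close>

definition maxwellian :: "real \<Rightarrow> real ^ 'n::finite \<Rightarrow> real" where
  "maxwellian \<beta> v = (\<beta> / (2 * pi)) powr (real CARD('n) / 2) * exp (- \<beta> * (norm v)\<^sup>2 / 2)"

(* Surface measure of the unit sphere, as a measure on the ambient space: the surface area of A is
   d times the Lebesgue measure of the cone over A in the unit ball. *)
definition sphere_measure :: "(real ^ 'n::finite) measure" where
  "sphere_measure =
     distr (density lborel (\<lambda>x. of_nat CARD('n) * indicator (ball 0 1 - {0}) x)) borel sgn"

definition post1 :: "real ^ 'n::finite \<Rightarrow> real ^ 'n \<Rightarrow> real ^ 'n \<Rightarrow> real ^ 'n" where
  "post1 v1 v2 \<omega> = v1 - ((v1 - v2) \<bullet> \<omega>) *\<^sub>R \<omega>"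

definition post2 :: "real ^ 'n::finite \<Rightarrow> real ^ 'n \<Rightarrow> real ^ 'n \<Rightarrow> real ^ 'n" where
  "post2 v1 v2 \<omega> = v2 + ((v1 - v2) \<bullet> \<omega>) *\<^sub>R \<omega>"

definition cross_section :: "real ^ 'n::finite \<Rightarrow> real ^ 'n \<Rightarrow> real ^ 'n \<Rightarrow> real" where
  "cross_section v1 v2 \<omega> = max 0 ((v1 - v2) \<bullet> \<omega>)"

(* The integral over (v2, \<omega>) in the Hamiltonian, as a function of z1. *)
definition hamiltonian_density ::
  "real \<Rightarrow> ('n::finite phase \<Rightarrow> real) \<Rightarrow> ('n phase \<Rightarrow> real) \<Rightarrow> 'n phase \<Rightarrow> real" where
  "hamiltonian_density \<beta> q p = (\<lambda>(x1, v1).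
     LINT (v2, \<omega>)|(lborel \<Otimes>\<^sub>M sphere_measure).
       cross_section v1 v2 \<omega> * maxwellian \<beta> v2 * q (x1, v1) *
       (exp (p (x1, post1 v1 v2 \<omega>) - p (x1, v1)) - 1))"

definition hamiltonian :: "real \<Rightarrow> ('n::finite phase \<Rightarrow> real) \<Rightarrow> ('n phase \<Rightarrow> real) \<Rightarrow> real" where
  "hamiltonian \<beta> q p = (LINT z1|phase_measure. hamiltonian_density \<beta> q p z1)"

(* The Hamiltonian of a pair in the solution class may be infinite (there q is only bounded), but
   its increments in localized directions are finite.  So partial derivatives are taken of
   \<epsilon> \<mapsto> H(q + \<epsilon> \<psi>, p) - H(q, p), with the difference taken under the integral over z1; when H(q, p)
   is finite this is the usual directional derivative of H.  Directions are bounded and vanish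
   outside {|v| \<le> R, |p| \<le> R} for some R; these sets exhaust D, so the density is unique a.e. *)
definition directions :: "('n::finite phase \<Rightarrow> real) \<Rightarrow> ('n phase \<Rightarrow> real) set" where
  "directions p = {\<psi>. phase_fun \<psi> \<and>
     (\<exists>R. \<forall>x v. \<bar>\<psi> (x, v)\<bar> \<le> R \<and> (\<psi> (x, v) \<noteq> 0 \<longrightarrow> norm v \<le> R \<and> \<bar>p (x, v)\<bar> \<le> R))}"

definition hamiltonian_increment ::
  "real \<Rightarrow> ('n::finite phase \<Rightarrow> real) \<Rightarrow> ('n phase \<Rightarrow> real) \<Rightarrow>
   ('n phase \<Rightarrow> real) \<Rightarrow> ('n phase \<Rightarrow> real) \<Rightarrow> 'n phase \<Rightarrow> real" where
  "hamiltonian_increment \<beta> q p q' p' z =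
     hamiltonian_density \<beta> q' p' z - hamiltonian_density \<beta> q p z"

definition is_dH_dq ::
  "real \<Rightarrow> ('n::finite phase \<Rightarrow> real) \<Rightarrow> ('n phase \<Rightarrow> real) \<Rightarrow> ('n phase \<Rightarrow> real) \<Rightarrow> bool" where
  "is_dH_dq \<beta> q p \<kappa> \<longleftrightarrow> (\<forall>\<psi>\<in>directions p.
     integrable phase_measure (\<lambda>z. \<kappa> z * \<psi> z) \<and>
     (\<forall>\<^sub>F \<epsilon> in nhds 0. integrable phase_measure
        (hamiltonian_increment \<beta> q p (\<lambda>z. q z + \<epsilon> * \<psi> z) p)) \<and>
     ((\<lambda>\<epsilon>. LINT z|phase_measure. hamiltonian_increment \<beta> q p (\<lambda>z. q z + \<epsilon> * \<psi> z) p z)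
        has_real_derivative (LINT z|phase_measure. \<kappa> z * \<psi> z)) (at 0))"

definition is_dH_dp ::
  "real \<Rightarrow> ('n::finite phase \<Rightarrow> real) \<Rightarrow> ('n phase \<Rightarrow> real) \<Rightarrow> ('n phase \<Rightarrow> real) \<Rightarrow> bool" where
  "is_dH_dp \<beta> q p \<kappa> \<longleftrightarrow> (\<forall>\<psi>\<in>directions p.
     integrable phase_measure (\<lambda>z. \<kappa> z * \<psi> z) \<and>
     (\<forall>\<^sub>F \<epsilon> in nhds 0. integrable phase_measure
        (hamiltonian_increment \<beta> q p q (\<lambda>z. p z + \<epsilon> * \<psi> z))) \<and>
     ((\<lambda>\<epsilon>. LINT z|phase_measure. hamiltonian_increment \<beta> q p q (\<lambda>z. p z + \<epsilon> * \<psi> z) z)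
        has_real_derivative (LINT z|phase_measure. \<kappa> z * \<psi> z)) (at 0))"


section \<open>The Hamilton--Jacobi system\<close>

definition HJ_solution ::
  "real \<Rightarrow> ('n::finite phase \<Rightarrow> real) \<Rightarrow> real \<Rightarrow> (real \<Rightarrow> 'n phase \<Rightarrow> real) \<Rightarrow>
   (real \<Rightarrow> 'n phase \<Rightarrow> real) \<Rightarrow> (real \<Rightarrow> 'n phase \<Rightarrow> real) \<Rightarrow> bool" where
  "HJ_solution \<beta> \<phi>0 t g q p \<longleftrightarrow> time_phase_fun t q \<and> time_phase_fun t p \<and>
     (\<exists>Dq. has_transport_deriv t q Dq \<and>
        (AE s in lborel. s \<in> {0..t} \<longrightarrow> is_dH_dp \<beta> (q s) (p s) (Dq s))) \<and>
     (AE z in phase_measure. q 0 z = maxwellian \<beta> (snd z) * \<phi>0 z * exp (p 0 z)) \<and>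
     (\<exists>Dr. has_transport_deriv t (\<lambda>s z. p s z - g s z) Dr \<and>
        (AE s in lborel. s \<in> {0..t} \<longrightarrow> is_dH_dq \<beta> (q s) (p s) (\<lambda>z. - Dr s z))) \<and>
     (AE z in phase_measure. p t z = g t z)"

definition solution_class ::
  "real \<Rightarrow> real \<Rightarrow> (real \<Rightarrow> 'n::finite phase \<Rightarrow> real) \<Rightarrow> (real \<Rightarrow> 'n phase \<Rightarrow> real) \<Rightarrow> bool" where
  "solution_class \<beta> t q p \<longleftrightarrow>
     (\<lambda>s z. q s z * exp (- p s z)) \<in> Linfty_F t (\<beta> / 4) \<and>
     (\<lambda>s z. exp (p s z)) \<in> Linfty_F t (- \<beta> / 4)"


section \<open>The limit cumulant generating functional\<close>

(* Backward trajectory with final point z at time t: velocity after the first i collision times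
   (that is, on the interval between \<tau>_(i+1) and \<tau>_i), and position at time \<tau>_i, with \<tau>_0 = t. *)
primrec traj_vel ::
  "(nat \<Rightarrow> real) \<Rightarrow> (nat \<Rightarrow> real ^ 'n::finite) \<Rightarrow> (nat \<Rightarrow> real ^ 'n) \<Rightarrow> real ^ 'n \<Rightarrow> nat \<Rightarrow> real ^ 'n"
where
  "traj_vel \<sigma> vs \<omega>s v 0 = v"
| "traj_vel \<sigma> vs \<omega>s v (Suc i) =
     (if \<sigma> (Suc i) = 1 then post1 (traj_vel \<sigma> vs \<omega>s v i) (vs (Suc i)) (\<omega>s (Suc i))
      else traj_vel \<sigma> vs \<omega>s v i)"

definition traj_time :: "real \<Rightarrow> (nat \<Rightarrow> real) \<Rightarrow> nat \<Rightarrow> real" where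
  "traj_time t \<tau> i = (if i = 0 then t else \<tau> i)"

primrec traj_pos ::
  "real \<Rightarrow> (nat \<Rightarrow> real) \<Rightarrow> (nat \<Rightarrow> real ^ 'n::finite) \<Rightarrow> (nat \<Rightarrow> real ^ 'n) \<Rightarrow> (nat \<Rightarrow> real) \<Rightarrow>
   'n phase \<Rightarrow> nat \<Rightarrow> real ^ 'n"
where
  "traj_pos t \<sigma> vs \<omega>s \<tau> z 0 = fst z"
| "traj_pos t \<sigma> vs \<omega>s \<tau> z (Suc i) = traj_pos t \<sigma> vs \<omega>s \<tau> z i
     - (traj_time t \<tau> i - traj_time t \<tau> (Suc i)) *\<^sub>R traj_vel \<sigma> vs \<omega>s (snd z) i"

definition trajectory ::
  "real \<Rightarrow> nat \<Rightarrow> (nat \<Rightarrow> real) \<Rightarrow> (nat \<Rightarrow> real ^ 'n::finite) \<Rightarrow> (nat \<Rightarrow> real ^ 'n) \<Rightarrow> (nat \<Rightarrow> real) \<Rightarrow>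
   'n phase \<Rightarrow> real \<Rightarrow> 'n phase" where
  "trajectory t k \<sigma> vs \<omega>s \<tau> z r =
     (let n = card {i\<in>{1..k}. r < \<tau> i}; v = traj_vel \<sigma> vs \<omega>s (snd z) n
      in (traj_pos t \<sigma> vs \<omega>s \<tau> z n - (traj_time t \<tau> n - r) *\<^sub>R v, v))"

definition background_vel ::
  "(nat \<Rightarrow> real) \<Rightarrow> (nat \<Rightarrow> real ^ 'n::finite) \<Rightarrow> (nat \<Rightarrow> real ^ 'n) \<Rightarrow> real ^ 'n \<Rightarrow> nat \<Rightarrow> real ^ 'n" where
  "background_vel \<sigma> vs \<omega>s v i =
     (if \<sigma> i = 1 then post2 (traj_vel \<sigma> vs \<omega>s v (i - 1)) (vs i) (\<omega>s i) else vs i)"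

definition collision_times :: "real \<Rightarrow> nat \<Rightarrow> (nat \<Rightarrow> real) set" where
  "collision_times t k =
     {\<tau>. (\<forall>i\<in>{1..k}. 0 < \<tau> i \<and> \<tau> i < t) \<and> (\<forall>i\<in>{1..k}. \<forall>j\<in>{1..k}. i < j \<longrightarrow> \<tau> j < \<tau> i)}"

definition tree_measure ::
  "nat \<Rightarrow> ((nat \<Rightarrow> real ^ 'n::finite) \<times> (nat \<Rightarrow> real ^ 'n) \<times> (nat \<Rightarrow> real)) measure" where
  "tree_measure k = Pi\<^sub>M {1..k} (\<lambda>_. lborel) \<Otimes>\<^sub>M
     (Pi\<^sub>M {1..k} (\<lambda>_. sphere_measure) \<Otimes>\<^sub>M Pi\<^sub>M {1..k} (\<lambda>_. lborel))"

definition tree_integral ::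
  "real \<Rightarrow> ('n::finite phase \<Rightarrow> real) \<Rightarrow> real \<Rightarrow> ((real \<Rightarrow> 'n phase) \<Rightarrow> real) \<Rightarrow>
   nat \<Rightarrow> (nat \<Rightarrow> real) \<Rightarrow> 'n phase \<Rightarrow> real" where
  "tree_integral \<beta> \<phi>0 t H k \<sigma> z =
     (LINT (vs, \<omega>s, \<tau>)|tree_measure k.
        indicator (collision_times t k) \<tau> *
        (\<Prod>i\<in>{1..k}. \<sigma> i * cross_section (traj_vel \<sigma> vs \<omega>s (snd z) (i - 1)) (vs i) (\<omega>s i)) *
        H (trajectory t k \<sigma> vs \<omega>s \<tau> z) *
        \<phi>0 (trajectory t k \<sigma> vs \<omega>s \<tau> z 0) *
        maxwellian \<beta> (snd (trajectory t k \<sigma> vs \<omega>s \<tau> z 0)) *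
        (\<Prod>i\<in>{1..k}. maxwellian \<beta> (background_vel \<sigma> vs \<omega>s (snd z) i)))"

(* The integral over the final point z is carried out last.  By Fubini this is the sum over k and
   the signs of the integrals over all variables whenever that double series converges absolutely.
   For observables growing exactly like \<beta>|v|^2/4 it need not, while the sum at fixed z converges. *)
definition path_integral ::
  "real \<Rightarrow> ('n::finite phase \<Rightarrow> real) \<Rightarrow> real \<Rightarrow> ((real \<Rightarrow> 'n phase) \<Rightarrow> real) \<Rightarrow> real" where
  "path_integral \<beta> \<phi>0 t H =
     (LINT z|phase_measure. (\<Sum>k. \<Sum>\<sigma>\<in>{1..k} \<rightarrow>\<^sub>E {-1, 1}. tree_integral \<beta> \<phi>0 t H k \<sigma> z))"

definition cumulant_functional ::
  "real \<Rightarrow> ('n::finite phase \<Rightarrow> real) \<Rightarrow> real \<Rightarrow> (real \<Rightarrow> 'n phase \<Rightarrow> real) \<Rightarrow> real" where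
  "cumulant_functional \<beta> \<phi>0 t g = path_integral \<beta> \<phi>0 t
     (\<lambda>\<zeta>. exp (g t (\<zeta> t) - (LINT s:{0..t}|lborel. transport_deriv t g s (\<zeta> s))))"

lemma collision_times_0: "k > 0 \<Longrightarrow> collision_times 0 k = {}"
  unfolding collision_times_def by force

lemma tree_integral_0:
  fixes \<phi>0 :: "'n::finite phase \<Rightarrow> real"
  shows "tree_integral \<beta> \<phi>0 0 H k \<sigma> z =
     (if k = 0 then H (\<lambda>r. (fst z + r *\<^sub>R snd z, snd z)) * \<phi>0 z * maxwellian \<beta> (snd z) else 0)"
proof (cases "k = 0")
  case True
  have 1: "emeasure (tree_measure 0 ::
      ((nat \<Rightarrow> real ^ 'n) \<times> (nat \<Rightarrow> real ^ 'n) \<times> (nat \<Rightarrow> real)) measure) (space (tree_measure 0)) = 1"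
  proof -
    interpret a: prob_space "Pi\<^sub>M {} (\<lambda>_::nat. lborel :: (real ^ 'n) measure)"
      by (rule prob_spaceI) (simp add: space_PiM PiM_empty)
    interpret b: prob_space "Pi\<^sub>M {} (\<lambda>_::nat. sphere_measure :: (real ^ 'n) measure)"
      by (rule prob_spaceI) (simp add: space_PiM PiM_empty)
    interpret c: prob_space "Pi\<^sub>M {} (\<lambda>_::nat. lborel :: real measure)"
      by (rule prob_spaceI) (simp add: space_PiM PiM_empty)
    interpret bc: pair_prob_space "Pi\<^sub>M {} (\<lambda>_::nat. sphere_measure :: (real ^ 'n) measure)"
      "Pi\<^sub>M {} (\<lambda>_::nat. lborel :: real measure)" ..
    interpret abc: pair_prob_space "Pi\<^sub>M {} (\<lambda>_::nat. lborel :: (real ^ 'n) measure)"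
      "Pi\<^sub>M {} (\<lambda>_::nat. sphere_measure :: (real ^ 'n) measure) \<Otimes>\<^sub>M
       Pi\<^sub>M {} (\<lambda>_::nat. lborel :: real measure)" ..
    show ?thesis
      using abc.P.emeasure_space_1 by (simp add: tree_measure_def)
  qed
  have 2: "trajectory 0 0 \<sigma> vs \<omega>s \<tau> z = (\<lambda>r. (fst z + r *\<^sub>R snd z, snd z))"
    for vs \<omega>s :: "nat \<Rightarrow> real ^ 'n" and \<tau>
    by (simp add: fun_eq_iff trajectory_def traj_time_def Let_def)
  show ?thesis
    using True 1 by (simp add: tree_integral_def 2 collision_times_def case_prod_beta' measure_def)
next
  case False
  then show ?thesis
    by (simp add: tree_integral_def collision_times_0 case_prod_beta')
qed

lemma cumulant_functional_0:
  fixes \<phi>0 :: "'n::finite phase \<Rightarrow> real"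
  shows "cumulant_functional \<beta> \<phi>0 0 g =
     (LINT z|phase_measure. maxwellian \<beta> (snd z) * \<phi>0 z * exp (g 0 z))"
proof -
  have null: "(LINT s:{0..0::real}|lborel. f s) = 0" for f :: "real \<Rightarrow> real"
  proof -
    have "AE s in lborel. indicator {0..0::real} s *\<^sub>R f s = 0"
      using AE_lborel_singleton[of "0::real"] by eventually_elim (simp add: indicator_def)
    then show ?thesis
      unfolding set_lebesgue_integral_def by (rule integral_eq_zero_AE)
  qed
  have "(\<Sum>k. \<Sum>\<sigma>\<in>{1..k} \<rightarrow>\<^sub>E {-1, 1::real}. tree_integral \<beta> \<phi>0 0 H k \<sigma> z) =
      H (\<lambda>r. (fst z + r *\<^sub>R snd z, snd z)) * \<phi>0 z * maxwellian \<beta> (snd z)" for H z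
    by (subst suminf_finite[of "{0}"]) (simp_all add: tree_integral_0)
  then show ?thesis
    unfolding cumulant_functional_def path_integral_def
    by (simp only: null) (simp add: mult_ac)
qed

(* The initial term is the time-zero functional evaluated at p, namely the integral of
   M_\<beta> \<phi>_0 e^(p(0)).  Since H is linear in q, the two other terms cancel along a solution of the
   system, so with g in place of p this would be the integral of M_\<beta> \<phi>_0 e^(g(0)) and the collisions
   would be lost. *)
definition HJ_functional ::
  "real \<Rightarrow> ('n::finite phase \<Rightarrow> real) \<Rightarrow> real \<Rightarrow> (real \<Rightarrow> 'n phase \<Rightarrow> real) \<Rightarrow>
   (real \<Rightarrow> 'n phase \<Rightarrow> real) \<Rightarrow> (real \<Rightarrow> 'n phase \<Rightarrow> real) \<Rightarrow> real" where
  "HJ_functional \<beta> \<phi>0 t g q p =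
     cumulant_functional \<beta> \<phi>0 0 p
     + (LINT s:{0..t}|lborel. (LINT z|phase_measure.
          q s z * transport_deriv t (\<lambda>s z. p s z - g s z) s z))
     + (LINT s:{0..t}|lborel. hamiltonian \<beta> (q s) (p s))"

end

theory Submission
 imports Defs
begin

text \<open>
The system becomes linear under the Cole-Hopf transform.  Put \<open>P = e\<^sup>p\<close> and \<open>f = q e\<^bsup>-p\<^esup> / M\<close>, let \<open>K\<close> be
the gain operator, \<open>\<nu>\<close> the collision frequency, \<open>D\<close> the transport operator and \<open>V = D g\<close>.  The
Hamiltonian is linear in \<open>q\<close>, with density \<open>q (K P / P - \<nu>)\<close>, so the second equation reads
\<open>D P = (\<nu> + V) P - K P\<close> with \<open>P(t) = e\<^bsup>g(t)\<^esup>\<close>.  By the symmetry of collisions (\<open>gain_symmetric\<close>) the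
derivative in \<open>p\<close> has density \<open>M (P K f - f K P)\<close>, and the first equation reads
\<open>D f = K f - (\<nu> + V) f\<close> with \<open>f(0) = \<phi>0\<close>.  The two equations are decoupled and differ only by the
direction of time.

Existence: with \<open>\<nu> + V\<close> as damping along characteristics, the solution is a Dyson series of nonnegative
terms (\<open>lin_sol\<close>).  It converges because \<open>K\<close> maps \<open>e\<^bsup>\<alpha>|v|^2\<^esup>\<close>, \<open>\<alpha> < \<beta>/2\<close>, into a multiple of itself
(\<open>gain_vexp_bound\<close>), although \<open>\<nu>\<close> is unbounded.  Uniqueness: localized directions determine the partial
derivatives of the Hamiltonian almost everywhere, so every solution of the class transforms into
solutions of the linear equations with growth \<open>e\<^bsup>\<beta>|v|^2/4\<^esup>\<close>, and these are unique (\<open>lin_unique\<close>).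

The two functionals: linearity in \<open>q\<close> makes the two time integrals cancel, which leaves
\<open>\<integral> M \<phi>0 P(0)\<close>.  For given signs, the integral over trees with \<open>k\<close> collisions is an iterated collision
step (\<open>tree_identity\<close>).  Writing the equation of \<open>f\<close> without subtraction, as
\<open>f + L\<^sub>- f = h + L\<^sub>+ f\<close> with the free term \<open>h\<close>, shows that the signed sum over all trees telescopes to
\<open>f(t)\<close> (\<open>signed_trees_sum\<close>); the remainder vanishes because a supersolution makes the unsigned sum
finite.  Hence the path integral equals \<open>\<integral> M e\<^bsup>g(t)\<^esup> f(t)\<close>.  Finally the Dyson series of \<open>f\<close> and of \<open>P\<close> are
dual term by term, as an identity in \<open>[0, \<infinity>]\<close> (\<open>dyson_sum_duality\<close>); so both values agree.

Exceptional sets are handled on all of \<open>\<real>\<^sup>d \<times> \<real>\<^sup>d\<close>, where free flow preserves Lebesgue measure; for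
periodic properties this is the same as on one cell.
\<close>

abbreviation jointly_measurable ::
 "('a::topological_space => 'b::topological_space => 'c::topological_space) => bool" where
 "jointly_measurable h \<equiv> (%(s,z). h s z) \<in> borel_measurable (borel \<Otimes>\<^sub>M borel)"

abbreviation jointly_measurable3 ::
 "('a::topological_space => 'b::topological_space => 'c::topological_space => 'd::topological_space) => bool" where
 "jointly_measurable3 h \<equiv> (%(u,s,z). h u s z) \<in> borel_measurable (borel \<Otimes>\<^sub>M borel \<Otimes>\<^sub>M borel)"

abbreviation coll_measure :: "((real ^ 'n::finite) \<times> (real ^ 'n)) measure" where
 "coll_measure \<equiv> lborel \<Otimes>\<^sub>M sphere_measure "

type_synonym 'n tree_data = "((nat=>real ^ 'n) \<times> (nat=>real ^ 'n) \<times> (nat=>real))"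

section \<open>Absolutely continuous functions on an interval\<close>

text \<open>Absolute continuity in integrated form: the derivative \<open>a\<close> matters only up to null sets.\<close>

definition primitive_on :: "real => (real => real) => (real => real) => bool" where
 "primitive_on T y a \<longleftrightarrow> set_integrable lborel {0..T} a \<and>
   (\<forall>s\<in>{0..T}. y s = y 0 + (LINT r:{0..s}|lborel. a r))"

lemma primitive_onI:
 assumes "set_integrable lborel {0..T} a"
  and "!!s. 0 <= s ==> s <= T ==> y s = y 0 + (LINT r:{0..s}|lborel. a r)"
 shows "primitive_on T y a"
 unfolding primitive_on_def
proof (intro conjI ballI)
 fix s assume "s \<in> {0..T}"
 then have "0 <= s" "s <= T" by simp_all
 then show "y s = y 0 + (LINT r:{0..s}|lborel. a r)" by (rule assms(2))
qed (rule assms(1))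

lemma primitive_onD:
 assumes "primitive_on T y a"
 shows "set_integrable lborel {0..T} a"
  and "0 <= s ==> s <= T ==> y s = y 0 + (LINT r:{0..s}|lborel. a r)"
proof -
 show "set_integrable lborel {0..T} a"
  using assms unfolding primitive_on_def by (rule conjunct1)
 assume "0 <= s" "s <= T"
 then have "s \<in> {0..T}" by simp
 with conjunct2[OF assms[unfolded primitive_on_def]]
 show "y s = y 0 + (LINT r:{0..s}|lborel. a r)" by (rule bspec)
qed

lemma set_integrable_Icc_mono:
 fixes a :: "real => real"
 assumes "set_integrable lborel {0..T} a" "s <= T"
 shows "set_integrable lborel {0..s} a"
 by (rule set_integrable_subset[OF assms(1)]) (use assms(2) in auto)

lemma LINT_Icc_0_0: "(LINT r:{0..0::real}|lborel. (a r::real)) = 0"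
proof -
 have "AE r in lborel. indicator {0..0::real} r *\<^sub>R a r = 0"
  using AE_lborel_singleton[of "0::real"] by eventually_elim (auto simp: indicator_def)
 then show ?thesis
  unfolding set_lebesgue_integral_def by (rule integral_eq_zero_AE)
qed

lemma primitive_on_integral:
 assumes "set_integrable lborel {0..T} a"
 shows "primitive_on T (%s. c + (LINT r:{0..s}|lborel. a r)) a"
 by (rule primitive_onI[OF assms]) (simp only: LINT_Icc_0_0 add_0_right)

lemma continuous_on_LINT_Icc:
 fixes a :: "real => real"
 assumes "set_integrable lborel {0..T} a"
 shows "continuous_on {0..T} (%s. LINT r:{0..s}|lborel. a r)"
proof -
 have i: "a integrable_on {0..T}"
  using set_borel_integral_eq_integral(1)[OF assms] .
 have "(LINT r:{0..s}|lborel. a r) = integral {0..s} a" if "s \<in> {0..T}" for s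
  using that by (intro set_borel_integral_eq_integral(2) set_integrable_Icc_mono[OF assms]) auto
 then show ?thesis
  using indefinite_integral_continuous_1[OF i] by (auto intro: continuous_on_eq)
qed

lemma primitive_on_continuous:
 assumes "primitive_on T y a"
 shows "continuous_on {0..T} y"
proof -
 have "continuous_on {0..T} (%s. y 0 + (LINT r:{0..s}|lborel. a r))"
  by (intro continuous_intros continuous_on_LINT_Icc primitive_onD(1)[OF assms])
 then show ?thesis
  by (rule continuous_on_eq) (metis atLeastAtMost_iff primitive_onD(2)[OF assms])
qed

lemma continuous_on_Icc_bounded:
 fixes y :: "real => real"
 assumes "continuous_on {0..T} y"
 obtains B where "!!s. s \<in> {0..T} ==> \<bar>y s\<bar> <= B"
proof -
 have "compact (y ` {0..T})"
  using assms by (intro compact_continuous_image) auto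
 then have "bounded (y ` {0..T})" by (rule compact_imp_bounded)
 then obtain B where "\<forall>x\<in>y ` {0..T}. norm x <= B" unfolding bounded_iff by blast
 then show thesis by (intro that[of B]) auto
qed

lemma set_integrable_mult_continuous:
 fixes a y :: "real => real"
 assumes a: "set_integrable lborel {0..T} a" and y: "continuous_on {0..T} y"
 shows "set_integrable lborel {0..T} (%s. a s * y s)"
proof -
 obtain B where B: "!!s. s \<in> {0..T} ==> \<bar>y s\<bar> <= B"
  using continuous_on_Icc_bounded[OF y] by blast
 have ym: "(%s. indicator {0..T} s *\<^sub>R y s) \<in> borel_measurable lborel"
  using borel_measurable_continuous_on_indicator[OF _ y] by simp
 have am: "(%s. indicator {0..T} s *\<^sub>R a s) \<in> borel_measurable lborel"
  using a unfolding set_integrable_def by auto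
 have "integrable lborel (%s. B * norm (indicator {0..T} s *\<^sub>R a s))"
  using a unfolding set_integrable_def by (intro integrable_mult_right integrable_norm)
 then show ?thesis
  unfolding set_integrable_def
 proof (rule Bochner_Integration.integrable_bound)
  have "(%s. (indicator {0..T} s *\<^sub>R a s) * (indicator {0..T} s *\<^sub>R y s)) \<in> borel_measurable lborel"
   using ym am by (rule borel_measurable_times[rotated])
  then show "(%s. indicator {0..T} s *\<^sub>R (a s * y s)) \<in> borel_measurable lborel"
   by (rule measurable_cong[THEN iffD1, rotated]) (auto simp: indicator_def)
  show "AE s in lborel. norm (indicator {0..T} s *\<^sub>R (a s * y s)) <= norm (B * norm (indicator {0..T} s *\<^sub>R a s))"
  proof (intro AE_I2)
   fix s show "norm (indicator {0..T} s *\<^sub>R (a s * y s)) <= norm (B * norm (indicator {0..T} s *\<^sub>R a s))"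
    using B[of s] abs_ge_zero[of "y s"]
    by (auto simp: indicator_def abs_mult mult.commute[of B] intro!: mult_left_mono)
     (metis abs_ge_self mult.commute mult_left_mono abs_ge_zero order.trans)?
  qed
 qed
qed

lemma primitive_on_const: "primitive_on T (%_. c) (%_. 0)"
 by (simp add: primitive_on_def set_integrable_def)

lemma primitive_on_add:
 assumes "primitive_on T y a" "primitive_on T z b"
 shows "primitive_on T (%s. y s + z s) (%s. a s + b s)"
proof (rule primitive_onI)
 fix s assume s: "0 <= s" "s <= T"
 show "y s + z s = y 0 + z 0 + (LINT r:{0..s}|lborel. a r + b r)"
  using primitive_onD(2)[OF assms(1) s] primitive_onD(2)[OF assms(2) s]
   set_integrable_Icc_mono[OF primitive_onD(1)[OF assms(1)] s(2)]
   set_integrable_Icc_mono[OF primitive_onD(1)[OF assms(2)] s(2)]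
  by (subst set_integral_add) linarith+
qed (intro set_integral_add primitive_onD(1)[OF assms(1)] primitive_onD(1)[OF assms(2)])

lemma primitive_on_mult_left:
 assumes "primitive_on T y a"
 shows "primitive_on T (%s. c * y s) (%s. c * a s)"
proof (rule primitive_onI)
 fix s assume s: "0 <= s" "s <= T"
 show "c * y s = c * y 0 + (LINT r:{0..s}|lborel. c * a r)"
  unfolding set_integral_mult_right distrib_left[symmetric]
  by (rule arg_cong[OF primitive_onD(2)[OF assms s]])
qed (intro set_integrable_mult_right primitive_onD(1)[OF assms])

lemma primitive_on_diff:
 assumes "primitive_on T y a" "primitive_on T z b"
 shows "primitive_on T (%s. y s - z s) (%s. a s - b s)"
 using primitive_on_add[OF assms(1) primitive_on_mult_left[OF assms(2), of "-1"]] by simp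

lemma primitive_on_cong:
 assumes "primitive_on T y a"
  and "!!s. 0 <= s ==> s <= T ==> y s = z s"
  and ae: "AE s in lborel. s \<in> {0..T} --> a s = b s"
  and m: "set_borel_measurable lborel {0..T} b"
 shows "primitive_on T z b"
proof (rule primitive_onI)
 have am: "set_borel_measurable lborel {0..T} a"
  using primitive_onD(1)[OF assms(1)] by (simp add: set_integrable_def set_borel_measurable_def)
 show "set_integrable lborel {0..T} b"
  unfolding set_integrable_def
 proof (rule integrable_cong_AE_imp[OF primitive_onD(1)[OF assms(1), unfolded set_integrable_def]])
  show "AE r in lborel. indicat_real {0..T} r *\<^sub>R a r = indicat_real {0..T} r *\<^sub>R b r"
   using ae by eventually_elim (auto simp: indicator_def)
 qed (use m in \<open>simp add: set_borel_measurable_def\<close>)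
 fix s assume s: "0 <= s" "s <= T"
 have sub: "set_borel_measurable lborel {0..s} c" if "set_borel_measurable lborel {0..T} c" for c :: "real => real"
  by (rule set_borel_measurable_subset[OF that]) (use s in auto)
 have "(LINT r:{0..s}|lborel. a r) = (LINT r:{0..s}|lborel. b r)"
  unfolding set_lebesgue_integral_def
 proof (rule integral_cong_AE)
  show "AE x in lborel. indicat_real {0..s} x *\<^sub>R a x = indicat_real {0..s} x *\<^sub>R b x"
   using ae by eventually_elim (use s in \<open>auto simp: indicator_def\<close>)
 qed (use sub[OF am] sub[OF m] in \<open>auto simp: set_borel_measurable_def\<close>)
 then show "z s = z 0 + (LINT r:{0..s}|lborel. b r)"
  using primitive_onD(2)[OF assms(1) s] assms(2)[OF s] assms(2)[of 0] s by simp
qed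

lemma integral_times_integral_Icc:
 fixes a b :: "real => real"
 assumes a: "set_integrable lborel {0..s} a" and b: "set_integrable lborel {0..s} b"
 shows "(LINT r:{0..s}|lborel. a r) * (LINT r:{0..s}|lborel. b r) =
  (LINT r:{0..s}|lborel. a r * (LINT q:{0..r}|lborel. b q)) +
  (LINT r:{0..s}|lborel. b r * (LINT q:{0..r}|lborel. a q))"
proof -
 define A where "A r = indicator {0..s} r *\<^sub>R a r" for r
 define B where "B r = indicator {0..s} r *\<^sub>R b r" for r
 have A: "integrable lborel A" and B: "integrable lborel B"
  using a b by (auto simp: A_def[abs_def] B_def[abs_def] set_integrable_def)
 note [measurable] = borel_measurable_integrable[OF A] borel_measurable_integrable[OF B]
 have I: "integrable (lborel \<Otimes>\<^sub>M lborel) (%(r, q). A r * B q)"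
 proof (rule lborel_pair.Fubini_integrable)
  show "integrable lborel (%x. LINT y|lborel. norm (case (x, y) of (r, q) => A r * B q))"
   using A by (simp add: abs_mult)
  show "AE x in lborel. integrable lborel (%y. case (x, y) of (r, q) => A r * B q)"
   using B by simp
 qed simp
 have I1: "integrable (lborel \<Otimes>\<^sub>M lborel) (%(r, q). indicator {..r} q * (A r * B q))"
  by (rule Bochner_Integration.integrable_bound[OF I]) (auto simp: indicator_def)
 have I2: "integrable (lborel \<Otimes>\<^sub>M lborel) (%(r, q). indicator {..<q} r * (A r * B q))"
  by (rule Bochner_Integration.integrable_bound[OF I]) (auto simp: indicator_def)
 have "integral\<^sup>L lborel A * integral\<^sup>L lborel B = (LINT r|lborel. LINT q|lborel. A r * B q)"
  by simp
 also have "... = integral\<^sup>L (lborel \<Otimes>\<^sub>M lborel) (%(r, q). A r * B q)"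
  by (rule lborel_pair.integral_fst[OF I])
 also have "... = integral\<^sup>L (lborel \<Otimes>\<^sub>M lborel)
   (%z. (case z of (r, q) => indicator {..r} q * (A r * B q)) + (case z of (r, q) => indicator {..<q} r * (A r * B q)))"
  by (rule Bochner_Integration.integral_cong) (auto simp: indicator_def)
 also have "... = integral\<^sup>L (lborel \<Otimes>\<^sub>M lborel) (%(r, q). indicator {..r} q * (A r * B q))
   + integral\<^sup>L (lborel \<Otimes>\<^sub>M lborel) (%(r, q). indicator {..<q} r * (A r * B q))"
  by (rule Bochner_Integration.integral_add[OF I1 I2])
 also have "integral\<^sup>L (lborel \<Otimes>\<^sub>M lborel) (%(r, q). indicator {..r} q * (A r * B q))
   = (LINT r|lborel. LINT q|lborel. indicator {..r} q * (A r * B q))"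
  by (rule lborel_pair.integral_fst[OF I1, symmetric])
 also have "... = (LINT r:{0..s}|lborel. a r * (LINT q:{0..r}|lborel. b q))"
  unfolding set_lebesgue_integral_def
 proof (rule Bochner_Integration.integral_cong[OF refl])
  fix r :: real
  have "(LINT q|lborel. indicator {..r} q * (A r * B q)) = A r * (LINT q|lborel. indicator {..r} q * B q)"
   by (subst integral_mult_right_zero[symmetric]) (simp add: mult_ac)
  also have "... = A r * (LINT q|lborel. indicator {0..r} q *\<^sub>R b q)"
  proof (cases "r \<in> {0..s}")
   case True
   then show ?thesis
    by (intro arg_cong[where f="%x. A r * x"] Bochner_Integration.integral_cong) (auto simp: B_def indicator_def)
  qed (simp add: A_def)
  finally show "(LINT q|lborel. indicator {..r} q * (A r * B q)) =
   indicator {0..s} r *\<^sub>R (a r * (LINT q|lborel. indicator {0..r} q *\<^sub>R b q))"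
   by (simp add: A_def)
 qed
 also have "integral\<^sup>L (lborel \<Otimes>\<^sub>M lborel) (%(r, q). indicator {..<q} r * (A r * B q))
   = (LINT q|lborel. LINT r|lborel. indicator {..<q} r * (A r * B q))"
  by (rule lborel_pair.integral_snd[OF I2, symmetric])
 also have "... = (LINT r:{0..s}|lborel. b r * (LINT q:{0..r}|lborel. a q))"
  unfolding set_lebesgue_integral_def
 proof (rule Bochner_Integration.integral_cong[OF refl])
  fix r :: real
  have "(LINT q|lborel. indicator {..<r} q * (A q * B r)) = B r * (LINT q|lborel. indicator {..<r} q * A q)"
   by (subst integral_mult_right_zero[symmetric]) (simp add: mult_ac)
  also have "... = B r * (LINT q|lborel. indicator {0..r} q *\<^sub>R a q)"
  proof (cases "r \<in> {0..s}")
   case True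
   have "set_integrable lborel {0..r} a"
    using a True by (intro set_integrable_Icc_mono[OF a]) auto
   then have m: "(%q. indicator {0..r} q *\<^sub>R a q) \<in> borel_measurable lborel"
    by (auto simp: set_integrable_def)
   show ?thesis
   proof (intro arg_cong[where f="%x. B r * x"] integral_cong_AE m)
    show "AE q in lborel. indicator {..<r} q * A q = indicator {0..r} q *\<^sub>R a q"
     using AE_lborel_singleton[of r] by eventually_elim (use True in \<open>auto simp: A_def indicator_def\<close>)
   qed measurable
  qed (simp add: B_def)
  finally show "(LINT q|lborel. indicator {..<r} q * (A q * B r)) =
   indicator {0..s} r *\<^sub>R (b r * (LINT q|lborel. indicator {0..r} q *\<^sub>R a q))"
   by (simp add: B_def)
 qed
 finally show ?thesis
  by (simp add: A_def B_def set_lebesgue_integral_def)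
qed

text \<open>This rule and those for \<open>exp\<close> and \<open>ln\<close> carry out the Cole-Hopf transform along a single
characteristic, where the functions are only absolutely continuous.\<close>

lemma primitive_on_mult:
 assumes y: "primitive_on T y a" and z: "primitive_on T z b"
 shows "primitive_on T (%s. y s * z s) (%s. a s * z s + b s * y s)"
proof (rule primitive_onI)
 note ya = primitive_onD[OF y] and zb = primitive_onD[OF z]
 show "set_integrable lborel {0..T} (%s. a s * z s + b s * y s)"
  by (intro set_integral_add set_integrable_mult_continuous ya zb primitive_on_continuous[OF y] primitive_on_continuous[OF z])
 fix s assume s: "0 <= s" "s <= T"
 have ia: "set_integrable lborel {0..s} a" and ib: "set_integrable lborel {0..s} b"
  using ya(1) zb(1) s by (auto intro: set_integrable_Icc_mono)
 let ?A = "%r. LINT q:{0..r}|lborel. a q" and ?B = "%r. LINT q:{0..r}|lborel. b q"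
 have iaB: "set_integrable lborel {0..s} (%r. a r * ?B r)"
  by (rule set_integrable_mult_continuous[OF ia continuous_on_LINT_Icc[OF ib]])
 have ibA: "set_integrable lborel {0..s} (%r. b r * ?A r)"
  by (rule set_integrable_mult_continuous[OF ib continuous_on_LINT_Icc[OF ia]])
 have "(LINT r:{0..s}|lborel. a r * z r + b r * y r) =
   (LINT r:{0..s}|lborel. (z 0 * a r + a r * ?B r) + (y 0 * b r + b r * ?A r))"
 proof (intro set_lebesgue_integral_cong ballI allI impI)
  fix r assume "r \<in> {0..s}"
  then have "0 <= r" "r <= T" using s by auto
  then show "a r * z r + b r * y r = z 0 * a r + a r * ?B r + (y 0 * b r + b r * ?A r)"
   using ya(2)[of r] zb(2)[of r] by (simp only: algebra_simps)
 qed auto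
 also have "... = (z 0 * ?A s + (LINT r:{0..s}|lborel. a r * ?B r)) + (y 0 * ?B s + (LINT r:{0..s}|lborel. b r * ?A r))"
  using ia ib iaB ibA by (simp add: set_integral_add)
 also have "... = z 0 * ?A s + y 0 * ?B s + ?A s * ?B s"
  using integral_times_integral_Icc[OF ia ib] by simp
 finally show "y s * z s = y 0 * z 0 + (LINT r:{0..s}|lborel. a r * z r + b r * y r)"
  using ya(2)[OF s] zb(2)[OF s] by (simp add: algebra_simps)
qed

lemma primitive_on_exp:
 assumes u: "primitive_on T u a"
 shows "primitive_on T (%s. exp (u s)) (%s. a s * exp (u s))"
proof (rule primitive_onI)
 note ua = primitive_onD[OF u]
 have cu: "continuous_on {0..T} u" by (rule primitive_on_continuous[OF u])
 show "set_integrable lborel {0..T} (%s. a s * exp (u s))"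
  by (intro set_integrable_mult_continuous ua continuous_intros cu)
 define U where "U s = u s - u 0" for s
 have U: "primitive_on T U a"
  using primitive_on_diff[OF u primitive_on_const[of T "u 0"]] by (simp add: U_def[abs_def])
 have pow: "primitive_on T (%s. U s ^ Suc n) (%s. a s * (real (Suc n) * U s ^ n))" for n
 proof (induction n)
  case (Suc n)
  from primitive_on_mult[OF U Suc] show ?case by (simp add: algebra_simps)
 qed (use U in simp)
 fix s assume s: "0 <= s" "s <= T"
 have cU: "continuous_on {0..s} U"
  using s by (intro continuous_on_subset[OF primitive_on_continuous[OF U]]) auto
 then obtain B where B: "!!r. r \<in> {0..s} ==> \<bar>U r\<bar> <= B"
  using continuous_on_Icc_bounded[of s U] by blast
 have B0: "0 <= B" using B[of 0] s by auto
 have ia: "set_integrable lborel {0..s} a" using ua(1) s(2) by (rule set_integrable_Icc_mono)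
 let ?f = "%n r. indicator {0..s} r *\<^sub>R (a r * (U r ^ n / fact n))"
 have fi: "integrable lborel (?f n)" for n
  unfolding set_integrable_def[symmetric]
  by (intro set_integrable_mult_continuous ia continuous_intros cU) simp
 have sumf: "(%n. ?f n r) sums (indicator {0..s} r *\<^sub>R (a r * exp (U r)))" for r
  using exp_converges[of "U r"] by (intro sums_scaleR_right sums_mult) (simp add: field_simps)
 have bnd: "norm (?f n r) <= norm (indicator {0..s} r *\<^sub>R a r) * (B ^ n / fact n)" for n r
 proof (cases "r \<in> {0..s}")
  case True
  have "\<bar>U r\<bar> ^ n <= B ^ n" using B[OF True] by (intro power_mono) auto
  then show ?thesis using True
   by (auto simp: abs_mult power_abs intro!: mult_left_mono divide_right_mono)
 qed simp
 have sB: "summable (%n. B ^ n / fact n)"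
  using summable_exp[of B] by (simp add: field_simps)
 have s1: "AE r in lborel. summable (%n. norm (?f n r))"
 proof (rule AE_I2)
  fix r
  show "summable (%n. norm (?f n r))"
  proof (rule summable_comparison_test'[where N=0])
   show "summable (%n. norm (indicator {0..s} r *\<^sub>R a r) * (B ^ n / fact n))"
    by (intro summable_mult sB)
   fix n show "norm (norm (?f n r)) <= norm (indicator {0..s} r *\<^sub>R a r) * (B ^ n / fact n)"
    using bnd[of r n] by simp
  qed
 qed
 have s2: "summable (%n. LINT r|lborel. norm (?f n r))"
 proof (rule summable_comparison_test'[where N=0])
  let ?J = "LINT r|lborel. norm (indicator {0..s} r *\<^sub>R a r)"
  show "summable (%n. ?J * (B ^ n / fact n))"
   by (intro summable_mult sB)
  fix n
  have "(LINT r|lborel. norm (?f n r)) <= (LINT r|lborel. norm (indicator {0..s} r *\<^sub>R a r) * (B ^ n / fact n))"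
   using ia bnd unfolding set_integrable_def
   by (intro integral_mono integrable_norm fi integrable_mult_left) auto
  also have "... = ?J * (B ^ n / fact n)" by simp
  finally show "norm (LINT r|lborel. norm (?f n r)) <= ?J * (B ^ n / fact n)" by simp
 qed
 have 1: "(%n. LINT r|lborel. ?f n r) sums (LINT r|lborel. (\<Sum>n. ?f n r))"
  by (rule sums_integral[OF fi s1 s2])
 have 2: "(LINT r|lborel. (\<Sum>n. ?f n r)) = (LINT r:{0..s}|lborel. a r * exp (U r))"
  unfolding set_lebesgue_integral_def
  by (rule Bochner_Integration.integral_cong[OF refl], rule sums_unique[symmetric], rule sumf)
 have 3: "(LINT r|lborel. ?f n r) = U s ^ Suc n / fact (Suc n)" for n
 proof -
  have "U s ^ Suc n = (LINT r:{0..s}|lborel. a r * (real (Suc n) * U r ^ n))"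
   using primitive_onD(2)[OF pow[of n] s] by (simp add: U_def)
  also have "... = (LINT r:{0..s}|lborel. fact (Suc n) * (a r * (U r ^ n / fact n)))"
   by (intro set_lebesgue_integral_cong) (auto simp: field_simps)
  also have "... = fact (Suc n) * (LINT r|lborel. ?f n r)"
   by (simp add: set_lebesgue_integral_def)
  finally show ?thesis by (simp only: nonzero_mult_div_cancel_left[OF fact_nonzero])
 qed
 have "(%n. U s ^ n / fact n) sums exp (U s)"
  using exp_converges[of "U s"] by (simp add: field_simps)
 then have "(%n. U s ^ Suc n / fact (Suc n)) sums (exp (U s) - 1)"
  by (subst sums_Suc_iff) simp
 with 1 2 3 have e: "exp (U s) - 1 = (LINT r:{0..s}|lborel. a r * exp (U r))"
  using sums_unique2 by auto
 have "exp (u s) - exp (u 0) = exp (u 0) * (exp (U s) - 1)"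
  by (simp add: U_def algebra_simps flip: exp_add)
 also have "... = (LINT r:{0..s}|lborel. exp (u 0) * (a r * exp (U r)))"
  by (simp add: e)
 also have "... = (LINT r:{0..s}|lborel. a r * exp (u r))"
  by (intro set_lebesgue_integral_cong) (auto simp: U_def algebra_simps simp flip: exp_add)
 finally show "exp (u s) = exp (u 0) + (LINT r:{0..s}|lborel. a r * exp (u r))" by simp
qed

lemma primitive_on_ln:
 assumes u: "primitive_on T u a" and pos: "!!s. 0 <= s ==> s <= T ==> u s > 0"
 shows "primitive_on T (%s. ln (u s)) (%s. a s / u s)"
proof -
 have cu: "continuous_on {0..T} u" by (rule primitive_on_continuous[OF u])
 have "set_integrable lborel {0..T} (%s. a s * (1 / u s))"
  by (intro set_integrable_mult_continuous primitive_onD(1)[OF u] continuous_intros cu)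
   (use pos in force)
 then have i: "set_integrable lborel {0..T} (%s. a s / u s)" by simp
 define l where "l s = ln (u 0) + (LINT r:{0..s}|lborel. a r / u r)" for s
 have l: "primitive_on T l (%s. a s / u s)"
  unfolding l_def by (rule primitive_on_integral[OF i])
 from primitive_on_exp[OF primitive_on_mult_left[OF l, of "-1"]]
 have "primitive_on T (%s. exp (- l s)) (%s. - (a s / u s) * exp (- l s))" by simp
 from primitive_on_mult[OF u this]
 have *: "primitive_on T (%s. u s * exp (- l s)) (%s. a s * exp (- l s) + - (a s / u s) * exp (- l s) * u s)" .
 have eq: "ln (u s) = l s" if s: "0 <= s" "s <= T" for s
 proof -
  have "(LINT r:{0..s}|lborel. a r * exp (- l r) + - (a r / u r) * exp (- l r) * u r) = (LINT r:{0..s}|lborel. 0)"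
  proof (intro set_lebesgue_integral_cong ballI allI impI)
   fix r assume "r \<in> {0..s}"
   then have "u r > 0" using s by (intro pos) auto
   then show "a r * exp (- l r) + - (a r / u r) * exp (- l r) * u r = 0" by (simp add: field_simps)
  qed auto
  then have "u s * exp (- l s) = u 0 * exp (- l 0)"
   using primitive_onD(2)[OF * s] by simp
  moreover have "l 0 = ln (u 0)" unfolding l_def LINT_Icc_0_0 by simp
  ultimately have "u s * exp (- l s) = 1"
   using pos[of 0] s by (simp add: exp_minus)
  then have "u s = exp (l s)" by (simp add: exp_minus field_simps)
  then show ?thesis by simp
 qed
 show ?thesis
 proof (rule primitive_onI[OF i])
  fix s assume s: "0 <= s" "s <= T"
  then show "ln (u s) = ln (u 0) + (LINT r:{0..s}|lborel. a r / u r)"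
   using eq[OF s] by (simp add: l_def)
 qed
qed

lemma primitive_on_duhamel:
 assumes c: "set_integrable lborel {0..T} c"
  and y: "primitive_on T y (%s. h s - c s * y s)" and s: "0 <= s" "s <= T"
 shows "y s = exp (- (LINT q:{0..s}|lborel. c q)) *
  (y 0 + (LINT r:{0..s}|lborel. exp (LINT q:{0..r}|lborel. c q) * h r))"
proof -
 let ?A = "%s. LINT q:{0..s}|lborel. c q"
 have "primitive_on T ?A c" using primitive_on_integral[OF c, of 0] by simp
 from primitive_on_mult[OF y primitive_on_exp[OF this]]
 have "primitive_on T (%s. y s * exp (?A s)) (%s. exp (?A s) * h s)" by (simp add: algebra_simps)
 from primitive_onD(2)[OF this s]
 have "y s * exp (?A s) = y 0 + (LINT r:{0..s}|lborel. exp (?A r) * h r)"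
  unfolding LINT_Icc_0_0 by simp
 then show ?thesis by (simp add: exp_minus field_simps)
qed

lemma duhamel_primitive_on:
 assumes c: "set_integrable lborel {0..T} c" and h: "set_integrable lborel {0..T} h"
  and y: "!!s. 0 <= s ==> s <= T ==> y s = exp (- (LINT q:{0..s}|lborel. c q)) *
   (Y + (LINT r:{0..s}|lborel. exp (LINT q:{0..r}|lborel. c q) * h r))"
 shows "primitive_on T y (%s. h s - c s * y s)"
proof -
 let ?A = "%s. LINT q:{0..s}|lborel. c q"
 have A: "primitive_on T ?A c" using primitive_on_integral[OF c, of 0] by simp
 have "set_integrable lborel {0..T} (%r. h r * exp (?A r))"
  by (intro set_integrable_mult_continuous h continuous_intros continuous_on_LINT_Icc c)
 then have i: "set_integrable lborel {0..T} (%r. exp (?A r) * h r)" by (simp add: mult.commute)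
 let ?Y = "%s. Y + (LINT r:{0..s}|lborel. exp (?A r) * h r)"
 have 1: "primitive_on T ?Y (%r. exp (?A r) * h r)" by (rule primitive_on_integral[OF i])
 have 2: "primitive_on T (%s. exp (- ?A s)) (%s. - c s * exp (- ?A s))"
  using primitive_on_exp[OF primitive_on_mult_left[OF A, of "-1"]] by simp
 have 3: "primitive_on T y (%s. - c s * exp (- ?A s) * ?Y s + exp (?A s) * h s * exp (- ?A s))"
 proof (rule primitive_onI)
  from primitive_on_mult[OF 2 1] show "set_integrable lborel {0..T}
   (%s. - c s * exp (- ?A s) * ?Y s + exp (?A s) * h s * exp (- ?A s))" by (rule primitive_onD(1))
  fix s assume s: "0 <= s" "s <= T"
  then have "0 <= T" by simp
  from primitive_onD(2)[OF primitive_on_mult[OF 2 1] s]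
  show "y s = y 0 + (LINT s:{0..s}|lborel. - c s * exp (- ?A s) * ?Y s + exp (?A s) * h s * exp (- ?A s))"
   unfolding y[OF s, symmetric] y[OF order_refl \<open>0 <= T\<close>, symmetric] .
 qed
 have i': "set_integrable lborel {0..T} (%s. h s - c s * y s)"
  using set_integral_diff(1)[OF h set_integrable_mult_continuous[OF c primitive_on_continuous[OF 3]]] .
 show ?thesis
 proof (rule primitive_on_cong[OF 3 refl])
  show "AE s in lborel. s \<in> {0..T} --> - c s * exp (- ?A s) * ?Y s + exp (?A s) * h s * exp (- ?A s) = h s - c s * y s"
  proof (intro AE_I2 impI)
   fix s assume "s \<in> {0..T}"
   then have "exp (- ?A s) * ?Y s = y s" by (intro y[symmetric]) auto
   then show "- c s * exp (- ?A s) * ?Y s + exp (?A s) * h s * exp (- ?A s) = h s - c s * y s"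
    by (simp add: exp_minus mult.assoc)
  qed
  show "set_borel_measurable lborel {0..T} (%s. h s - c s * y s)"
   using i' by (simp add: set_integrable_def set_borel_measurable_def)
 qed
qed

lemma primitive_on_gronwall:
 assumes c: "set_integrable lborel {0..T} c" and cC: "!!s. s \<in> {0..T} ==> - C <= c s" and C: "0 <= C"
  and h: "set_integrable lborel {0..T} h"
  and y: "primitive_on T y (%s. h s - c s * y s)" and y0: "y 0 = 0" and s: "0 <= s" "s <= T"
 shows "\<bar>y s\<bar> <= exp (C * T) * (LINT r:{0..s}|lborel. \<bar>h r\<bar>)"
proof -
 let ?A = "%s. LINT q:{0..s}|lborel. c q"
 have mono: "?A r + C * r <= ?A s + C * s" if r: "r \<in> {0..s}" for r
 proof -
  have iC: "set_integrable lborel {0..q} (%_. C)" for q :: real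
   using borel_integrable_atLeastAtMost'[of 0 q "%_. C"] by simp
  have i: "set_integrable lborel {0..q} (%q. c q + C)" if "q <= T" for q
   using that set_integrable_Icc_mono[OF c that] iC by (rule_tac set_integral_add(1)) auto
  have e: "?A q + C * q = (LINT x:{0..q}|lborel. c x + C)" if "0 <= q" "q <= T" for q
   using set_integral_add(2)[OF set_integrable_Icc_mono[OF c that(2)] iC] that
   by (simp add: set_lebesgue_integral_def)
  have "(LINT x:{0..r}|lborel. c x + C) <= (LINT x:{0..s}|lborel. c x + C)"
   unfolding set_lebesgue_integral_def
  proof (rule integral_mono)
   fix x show "indicat_real {0..r} x *\<^sub>R (c x + C) <= indicat_real {0..s} x *\<^sub>R (c x + C)"
    using r s cC[of x] by (auto simp: indicator_def)
  qed (use i[of r] i[of s] r s in \<open>auto simp: set_integrable_def\<close>)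
  then show ?thesis using r s e[of r] e[of s] by auto
 qed
 have hs: "set_integrable lborel {0..s} h" by (rule set_integrable_Icc_mono[OF h s(2)])
 have cs: "set_integrable lborel {0..s} c" by (rule set_integrable_Icc_mono[OF c s(2)])
 have "set_integrable lborel {0..s} (%r. h r * exp (?A r - ?A s))"
  by (intro set_integrable_mult_continuous hs continuous_intros continuous_on_LINT_Icc cs)
 then have i: "set_integrable lborel {0..s} (%r. exp (?A r - ?A s) * h r)" by (simp add: mult.commute)
 have "y s = exp (- ?A s) * (LINT r:{0..s}|lborel. exp (?A r) * h r)"
  using primitive_on_duhamel[OF c y s] y0 by simp
 also have "... = (LINT r:{0..s}|lborel. exp (- ?A s) * (exp (?A r) * h r))" by simp
 also have "... = (LINT r:{0..s}|lborel. exp (?A r - ?A s) * h r)"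
  by (intro set_lebesgue_integral_cong) (auto simp: exp_diff exp_minus field_simps)
 finally have "\<bar>y s\<bar> = \<bar>LINT r:{0..s}|lborel. exp (?A r - ?A s) * h r\<bar>" by simp
 also have "... <= (LINT r:{0..s}|lborel. \<bar>exp (?A r - ?A s) * h r\<bar>)"
  using set_integral_norm_bound[OF i] by simp
 also have "... <= (LINT r:{0..s}|lborel. exp (C * T) * \<bar>h r\<bar>)"
 proof (rule set_integral_mono)
  show "set_integrable lborel {0..s} (%r. \<bar>exp (?A r - ?A s) * h r\<bar>)" by (rule set_integrable_abs[OF i])
  show "set_integrable lborel {0..s} (%r. exp (C * T) * \<bar>h r\<bar>)"
   by (intro set_integrable_mult_right set_integrable_abs hs)
  fix r assume r: "r \<in> {0..s}"
  have "?A r - ?A s <= C * s - C * r" using mono[OF r] by simp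
  also have "... <= C * T" using r mult_left_mono[OF s(2) C] mult_nonneg_nonneg[OF C, of r] by auto
  finally show "\<bar>exp (?A r - ?A s) * h r\<bar> <= exp (C * T) * \<bar>h r\<bar>"
   by (auto simp: abs_mult intro!: mult_right_mono)
 qed
 finally show ?thesis by simp
qed

text \<open>Hence the transport derivative of a function is determined almost everywhere.\<close>

lemma primitive_on_unique:
 assumes a: "primitive_on T y a" and b: "primitive_on T y b"
 shows "AE s in lborel. s \<in> {0..T} --> a s = b s"
proof -
 define d where "d s = indicator {0..T} s *\<^sub>R (a s - b s)" for s
 have ab: "primitive_on T (%_. 0) (%s. a s - b s)"
  using primitive_on_diff[OF a b] by simp
 have d: "integrable lborel d"
  using primitive_onD(1)[OF ab] by (simp add: set_integrable_def d_def[abs_def])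
 note [measurable] = borel_measurable_integrable[OF d]
 have le: "(LINT r|lborel. indicator {..x} r * d r) = 0" for x
 proof (cases "x < 0 \<or> T < 0")
  case True
  then show ?thesis by (intro integral_eq_zero_AE AE_I2) (auto simp: d_def indicator_def)
 next
  case False
  have "(LINT r|lborel. indicator {..x} r * d r) = (LINT r:{0..min x T}|lborel. a r - b r)"
   unfolding set_lebesgue_integral_def
   by (intro Bochner_Integration.integral_cong refl) (auto simp: d_def indicator_def)
  also have "... = 0"
   using primitive_onD(2)[OF ab, of "min x T"] False by simp
  finally show ?thesis .
 qed
 have total: "integral\<^sup>L lborel d = 0"
 proof (cases "T < 0")
  case True then show ?thesis by (intro integral_eq_zero_AE AE_I2) (auto simp: d_def indicator_def)
 next
  case False
  have "integral\<^sup>L lborel d = (LINT r|lborel. indicator {..T} r * d r)"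
   by (intro Bochner_Integration.integral_cong refl) (auto simp: d_def indicator_def)
  then show ?thesis by (simp add: le)
 qed
 have gt: "(LINT r|lborel. indicator {x<..} r * d r) = 0" for x
 proof -
  have "(LINT r|lborel. indicator {x<..} r * d r) = (LINT r|lborel. d r - indicator {..x} r * d r)"
   by (intro Bochner_Integration.integral_cong refl) (auto simp: indicator_def)
  also have "... = 0"
    using integrable_real_mult_indicator[OF _ d, of "{..x}"]
   by (subst Bochner_Integration.integral_diff[OF d]) (simp_all add: le total mult.commute[of "d _"])
  finally show ?thesis .
 qed
 let ?p = "%r. max 0 (d r)" and ?m = "%r. max 0 (- d r)"
 have ip: "integrable lborel ?p" and im: "integrable lborel ?m" using d by auto
 have em: "emeasure (density lborel (%r. ennreal (f r))) {x<..} = ennreal (LINT r|lborel. indicator {x<..} r * f r)"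
  if f: "integrable lborel f" "!!r. 0 <= f r" for f :: "real => real" and x
 proof -
  note [measurable] = borel_measurable_integrable[OF f(1)]
  have "integrable lborel (%r. indicator {x<..} r * f r)"
   by (intro Bochner_Integration.integrable_bound[OF f(1)] borel_measurable_times borel_measurable_indicator
     borel_measurable_integrable[OF f(1)] AE_I2) (simp, simp add: indicator_def)
  then have "(\<integral>\<^sup>+r. ennreal (indicator {x<..} r * f r) \<partial>lborel) = ennreal (LINT r|lborel. indicator {x<..} r * f r)"
   using f by (intro nn_integral_eq_integral) auto
  moreover have "emeasure (density lborel (%r. ennreal (f r))) {x<..} = (\<integral>\<^sup>+r. ennreal (indicator {x<..} r * f r) \<partial>lborel)"
   by (subst emeasure_density) (auto intro!: nn_integral_cong simp: indicator_def)
  ultimately show ?thesis by simp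
 qed
 have eq: "(LINT r|lborel. indicator {x<..} r * ?p r) = (LINT r|lborel. indicator {x<..} r * ?m r)" for x
 proof -
  have "(LINT r|lborel. indicator {x<..} r * ?p r) - (LINT r|lborel. indicator {x<..} r * ?m r)
   = (LINT r|lborel. indicator {x<..} r * ?p r - indicator {x<..} r * ?m r)"
   using integrable_real_mult_indicator[OF _ ip, of "{x<..}"] integrable_real_mult_indicator[OF _ im, of "{x<..}"]
   by (intro Bochner_Integration.integral_diff[symmetric]) (simp_all add: mult.commute)
  also have "... = (LINT r|lborel. indicator {x<..} r * d r)"
   by (intro Bochner_Integration.integral_cong refl) (auto simp: indicator_def)
  finally show ?thesis by (simp add: gt)
 qed
 have "density lborel (%r. ennreal (?p r)) = density lborel (%r. ennreal (?m r))"
  by (rule measure_eqI_lessThan; (simp only: em[OF ip max.cobounded1] em[OF im max.cobounded1] eq)?; simp?)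
 then have "AE r in lborel. ennreal (?p r) = ennreal (?m r)"
  by (intro sigma_finite_measure.density_unique[OF sigma_finite_lborel]) auto
 then show ?thesis
  by eventually_elim (auto simp: d_def max_def split: if_splits)
qed

lemma primitive_on_reflect:
 assumes "primitive_on T y a"
 shows "primitive_on T (%s. y (T - s)) (%s. - a (T - s))"
proof (rule primitive_onI)
 note ya = primitive_onD[OF assms]
 have flip: "integrable lborel (%s. f (T - s)) \<longleftrightarrow> integrable lborel f"
  and flip': "(LINT s|lborel. f (T - s)) = (LINT s|lborel. f s)" for f :: "real => real"
  using lborel_integrable_real_affine_iff[of "-1" f T] lborel_integral_real_affine[of "-1" f T] by auto
 have "integrable lborel (%s. (%r. indicator {0..T} r *\<^sub>R a r) (T - s))"
  using ya(1) unfolding set_integrable_def by (subst flip)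
 then have "integrable lborel (%s. indicator {0..T} s *\<^sub>R a (T - s))"
  by (rule Bochner_Integration.integrable_cong[OF refl, THEN iffD1, rotated]) (auto simp: indicator_def)
 then show "set_integrable lborel {0..T} (%s. - a (T - s))"
  using integrable_minus by (fastforce simp: set_integrable_def)
 fix s assume s: "0 <= s" "s <= T"
 have i1: "integrable lborel (%r. indicator {0..T-s} r *\<^sub>R a r)"
  using set_integrable_Icc_mono[OF ya(1), of "T - s"] s by (simp add: set_integrable_def)
 have i2: "integrable lborel (%r. indicator {T-s..T} r *\<^sub>R a r)"
  using set_integrable_subset[OF ya(1), of "{T-s..T}"] s by (simp add: set_integrable_def)
 have "(LINT r:{0..T}|lborel. a r) = (LINT r|lborel. indicator {0..T-s} r *\<^sub>R a r + indicator {T-s..T} r *\<^sub>R a r)"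
  unfolding set_lebesgue_integral_def
 proof (rule integral_cong_AE)
  show "AE x in lborel. indicat_real {0..T} x *\<^sub>R a x = indicat_real {0..T - s} x *\<^sub>R a x + indicat_real {T - s..T} x *\<^sub>R a x"
   using AE_lborel_singleton[of "T - s"] by eventually_elim (use s in \<open>auto simp: indicator_def\<close>)
 qed (use ya(1) i1 i2 in \<open>auto simp: set_integrable_def\<close>)
 also have "... = (LINT r:{0..T-s}|lborel. a r) + (LINT r|lborel. indicator {T-s..T} r *\<^sub>R a r)"
  unfolding set_lebesgue_integral_def by (rule Bochner_Integration.integral_add[OF i1 i2])
 also have "(LINT r|lborel. indicator {T-s..T} r *\<^sub>R a r) = (LINT r|lborel. indicator {T-s..T} (T - r) *\<^sub>R a (T - r))"
  by (rule flip'[symmetric])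
 also have "... = (LINT r:{0..s}|lborel. a (T - r))"
  unfolding set_lebesgue_integral_def
  by (intro Bochner_Integration.integral_cong refl) (auto simp: indicator_def)
 finally have *: "(LINT r:{0..T}|lborel. a r) = (LINT r:{0..T-s}|lborel. a r) + (LINT r:{0..s}|lborel. a (T - r))" .
 have "y (T - s) = y 0 + (LINT r:{0..T-s}|lborel. a r)" "y T = y 0 + (LINT r:{0..T}|lborel. a r)"
  using s by (auto intro!: ya(2))
 moreover have "(LINT r:{0..s}|lborel. - a (T - r)) = - (LINT r:{0..s}|lborel. a (T - r))"
  by (simp add: set_lebesgue_integral_def)
 ultimately show "y (T - s) = y (T - 0) + (LINT r:{0..s}|lborel. - a (T - r))"
  using * by simp
qed

section \<open>Collisions and the gain operator\<close>

lemma nn_integral_lborel_translate: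
 fixes f :: "'a::euclidean_space => ennreal"
 assumes [measurable]: "f \<in> borel_measurable borel"
 shows "(\<integral>\<^sup>+x. f (x + a) \<partial>lborel) = (\<integral>\<^sup>+x. f x \<partial>lborel)"
proof -
 have "(\<integral>\<^sup>+x. f x \<partial>lborel) = (\<integral>\<^sup>+x. f x \<partial>distr lborel borel ((+) a))"
  by (simp add: lborel_distr_plus)
 also have "... = (\<integral>\<^sup>+x. f (a + x) \<partial>lborel)"
  by (subst nn_integral_distr) auto
 finally show ?thesis by (simp add: add.commute)
qed

lemma nn_integral_lborel_neg:
 fixes f :: "'a::euclidean_space => ennreal"
 assumes [measurable]: "f \<in> borel_measurable borel"
 shows "(\<integral>\<^sup>+x. f (- x) \<partial>lborel) = (\<integral>\<^sup>+x. f x \<partial>lborel)"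
proof -
 have e: "lborel = distr lborel borel (%x::'a. 0 + (-1) *\<^sub>R x)"
  using lborel_affine[of "-1" "0::'a"] by (simp add: density_1)
 have "(\<integral>\<^sup>+x. f x \<partial>lborel) = (\<integral>\<^sup>+x. f x \<partial>distr lborel borel (%x. 0 + (-1) *\<^sub>R x))"
  using e by simp
 also have "... = (\<integral>\<^sup>+x. f (- x) \<partial>lborel)"
  by (subst nn_integral_distr) auto
 finally show ?thesis by simp
qed

lemma nn_integral_lborel_minus_left:
 fixes f :: "'a::euclidean_space => ennreal"
 assumes [measurable]: "f \<in> borel_measurable borel"
 shows "(\<integral>\<^sup>+x. f (a - x) \<partial>lborel) = (\<integral>\<^sup>+x. f x \<partial>lborel)"
 using nn_integral_lborel_neg[of "%x. f (x + a)"] nn_integral_lborel_translate[of f a]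
 by simp

lemma nn_integral_lborel_involution:
 fixes f :: "'a::euclidean_space => ennreal" and T :: "'a => 'a"
 assumes [measurable]: "f \<in> borel_measurable borel" "T \<in> borel_measurable borel"
  and add: "!!x y. T (x + y) = T x + T y" and inv: "!!x. T (T x) = x"
  and norm: "!!x. norm (T x) = norm x"
 shows "(\<integral>\<^sup>+x. f (T x) \<partial>lborel) = (\<integral>\<^sup>+x. f x \<partial>lborel)"
proof -
 let ?B = "ball (0::'a) 1"
 let ?c = "emeasure lborel ?B"
 have [measurable]: "?B \<in> sets borel" by simp
 have tr: "(\<integral>\<^sup>+y. indicator ?B (y - a) \<partial>lborel) = ?c" for a :: 'a
  using nn_integral_lborel_translate[of "indicator ?B" "- a", OF borel_measurable_indicator] by simp
 have "?c * (\<integral>\<^sup>+x. f (T x) \<partial>lborel) = (\<integral>\<^sup>+x. f (T x) * (\<integral>\<^sup>+y. indicator ?B (y - T x) \<partial>lborel) \<partial>lborel)"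
  by (simp add: tr nn_integral_multc mult.commute[of ?c])
 also have "... = (\<integral>\<^sup>+x. \<integral>\<^sup>+y. f (T x) * indicator ?B (y - T x) \<partial>lborel \<partial>lborel)"
  by (simp add: nn_integral_cmult)
 also have "... = (\<integral>\<^sup>+y. \<integral>\<^sup>+x. f (T x) * indicator ?B (y - T x) \<partial>lborel \<partial>lborel)"
  by (rule lborel_pair.Fubini') measurable
 also have "... = (\<integral>\<^sup>+y. \<integral>\<^sup>+x. f (T x + y) * indicator ?B x \<partial>lborel \<partial>lborel)"
 proof (rule nn_integral_cong)
  fix y
  have "(\<integral>\<^sup>+x. f (T x) * indicator ?B (y - T x) \<partial>lborel) =
    (\<integral>\<^sup>+x. f (T (x + T y)) * indicator ?B (y - T (x + T y)) \<partial>lborel)"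
   by (rule nn_integral_lborel_translate[symmetric, of "%x. f (T x) * indicator ?B (y - T x)"]) measurable
  also have "... = (\<integral>\<^sup>+x. f (T x + y) * indicator ?B x \<partial>lborel)"
   by (intro nn_integral_cong) (simp add: add inv norm indicator_def)
  finally show "(\<integral>\<^sup>+x. f (T x) * indicator ?B (y - T x) \<partial>lborel) = (\<integral>\<^sup>+x. f (T x + y) * indicator ?B x \<partial>lborel)" .
 qed
 also have "... = (\<integral>\<^sup>+x. \<integral>\<^sup>+y. f (T x + y) * indicator ?B x \<partial>lborel \<partial>lborel)"
  by (rule lborel_pair.Fubini') measurable
 also have "... = (\<integral>\<^sup>+x. (\<integral>\<^sup>+y. f y \<partial>lborel) * indicator ?B x \<partial>lborel)"
  using nn_integral_lborel_translate[of f "T _"] by (simp add: nn_integral_multc add.commute)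
 also have "... = ?c * (\<integral>\<^sup>+y. f y \<partial>lborel)"
  by (simp add: nn_integral_cmult mult.commute)
 finally have "?c * (\<integral>\<^sup>+x. f (T x) \<partial>lborel) = ?c * (\<integral>\<^sup>+x. f x \<partial>lborel)" .
 moreover have "?c \<noteq> 0" using emeasure_ball[of 1 "0::'a"] unit_ball_vol_pos[of "real DIM('a)"]
  by (auto simp: ennreal_eq_0_iff not_le[symmetric])
 moreover have "?c < \<infinity>" by (rule emeasure_lborel_ball_finite)
 ultimately show ?thesis by (auto simp: ennreal_mult_cancel_left)
qed

lemma sets_sphere_measure [measurable_cong, simp]: "sets sphere_measure = sets borel"
 by (simp add: sphere_measure_def)

lemma space_sphere_measure [simp]: "space sphere_measure = UNIV"
 by (simp add: sphere_measure_def)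

lemma nn_integral_sphere_measure:
 fixes f :: "real ^ 'n::finite => ennreal"
 assumes [measurable]: "f \<in> borel_measurable borel"
 shows "(\<integral>\<^sup>+\<omega>. f \<omega> \<partial>sphere_measure) =
  (\<integral>\<^sup>+x. of_nat CARD('n) * indicator (ball 0 1 - {0}) x * f (sgn x) \<partial>lborel)"
proof -
 have [measurable]: "ball (0 :: real ^ 'n) 1 - {0} \<in> sets borel" by simp
 show ?thesis
  unfolding sphere_measure_def
  by (subst nn_integral_distr, measurable) (subst nn_integral_density, auto)
qed

lemma finite_sphere_measure: "finite_measure (sphere_measure :: (real ^ 'n::finite) measure)"
proof (rule finite_measureI)
 have "emeasure (sphere_measure :: (real ^ 'n) measure) (space sphere_measure) = (\<integral>\<^sup>+\<omega>. 1 \<partial>(sphere_measure :: (real ^ 'n) measure))"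
  by simp
 also have "... = (\<integral>\<^sup>+x. of_nat CARD('n) * indicator (ball 0 1 - {0}) x \<partial>(lborel :: (real ^ 'n) measure))"
  by (subst nn_integral_sphere_measure) auto
 also have "... <= (\<integral>\<^sup>+x. of_nat CARD('n) * indicator (ball 0 1) x \<partial>(lborel :: (real ^ 'n) measure))"
  by (intro nn_integral_mono mult_left_mono) (auto simp: indicator_def)
 also have "... = of_nat CARD('n) * emeasure lborel (ball (0::real ^ 'n) 1)"
  by (subst nn_integral_cmult) (auto intro!: borel_measurable_indicator)
 also have "... < \<infinity>"
  using emeasure_lborel_ball_finite[of "0::real ^ 'n" 1] by (simp add: ennreal_mult_less_top ennreal_of_nat_eq_real_of_nat)
 finally show "emeasure (sphere_measure :: (real ^ 'n) measure) (space sphere_measure) \<noteq> \<infinity>" by simp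
qed

interpretation sphere: finite_measure "sphere_measure :: (real ^ 'n::finite) measure"
 by (rule finite_sphere_measure)

interpretation lborel_sphere: pair_sigma_finite "lborel :: (real ^ 'n::finite) measure" "sphere_measure :: (real ^ 'n) measure" ..

lemma AE_sphere_norm: "AE \<omega> in (sphere_measure :: (real ^ 'n::finite) measure). norm \<omega> = 1"
 unfolding sphere_measure_def
 by (subst AE_distr_iff) (auto simp: AE_density indicator_def norm_sgn)

lemma nn_integral_sphere_neg:
 fixes f :: "real ^ 'n::finite => ennreal"
 assumes [measurable]: "f \<in> borel_measurable borel"
 shows "(\<integral>\<^sup>+\<omega>. f (- \<omega>) \<partial>sphere_measure) = (\<integral>\<^sup>+\<omega>. f \<omega> \<partial>sphere_measure)"
proof -
 have [measurable]: "ball (0 :: real ^ 'n) 1 - {0} \<in> sets borel" by simp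
 have "(\<integral>\<^sup>+\<omega>. f (- \<omega>) \<partial>sphere_measure) =
   (\<integral>\<^sup>+x. of_nat CARD('n) * indicator (ball 0 1 - {0}) (- x) * f (sgn (- x)) \<partial>lborel)"
  by (subst nn_integral_sphere_measure) (auto intro!: nn_integral_cong simp: indicator_def sgn_minus)
 also have "... = (\<integral>\<^sup>+\<omega>. f \<omega> \<partial>sphere_measure)"
  unfolding nn_integral_sphere_measure[OF assms]
  by (rule nn_integral_lborel_neg[of "%x. of_nat CARD('n) * indicator (ball 0 1 - {0}) x * f (sgn x)"]) measurable
 finally show ?thesis .
qed

lemma nn_integral_gaussian_finite:
 assumes "\<gamma> > 0"
 shows "(\<integral>\<^sup>+v. ennreal (exp (- \<gamma> * (norm (v :: real ^ 'n::finite))\<^sup>2)) \<partial>lborel) < \<infinity>"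
proof -
 have sq: "exp (- \<gamma> * (norm v)\<^sup>2) = (\<Prod>b\<in>Basis. exp (- \<gamma> * (v \<bullet> b)\<^sup>2))" for v :: "real ^ 'n"
 proof -
  have "(norm v)\<^sup>2 = (\<Sum>b\<in>Basis. (v \<bullet> b)\<^sup>2)"
   unfolding power2_norm_eq_inner by (subst euclidean_inner) (simp add: power2_eq_square)
  then show ?thesis by (simp add: exp_sum sum_distrib_left)
 qed
 have "(\<integral>\<^sup>+v. ennreal (exp (- \<gamma> * (norm (v :: real ^ 'n))\<^sup>2)) \<partial>lborel)
  = (\<integral>\<^sup>+v. (\<Prod>b\<in>Basis. ennreal (exp (- \<gamma> * (v \<bullet> b)\<^sup>2))) \<partial>(lborel :: (real ^ 'n) measure))"
  unfolding sq by (simp add: prod_ennreal)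
 also have "... = (\<Prod>b\<in>(Basis :: (real ^ 'n) set). (\<integral>\<^sup>+x. ennreal (exp (- \<gamma> * x\<^sup>2)) \<partial>lborel))"
  by (rule nn_integral_lborel_prod) auto
 also have "... < \<infinity>"
 proof -
  let ?s = "sqrt (1 / (2 * \<gamma>))"
  have s: "?s > 0" "?s\<^sup>2 = 1 / (2 * \<gamma>)" using assms by auto
  have "integrable lborel (%x. sqrt (2 * pi * ?s\<^sup>2) * normal_density 0 ?s x)"
   using integrable_normal_moment[OF s(1), of 0 0] by simp
  moreover have "sqrt (2 * pi * ?s\<^sup>2) * normal_density 0 ?s x = exp (- \<gamma> * x\<^sup>2)" for x
   using s assms by (simp add: normal_density_def field_simps)
  ultimately have "integrable lborel (%x::real. exp (- \<gamma> * x\<^sup>2))" by simp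
  then have "(\<integral>\<^sup>+x. ennreal (exp (- \<gamma> * (x::real)\<^sup>2)) \<partial>lborel) = ennreal (LINT x|lborel. exp (- \<gamma> * x\<^sup>2))"
   by (intro nn_integral_eq_integral) auto
  then show ?thesis by (simp add: prod_constant ennreal_power del: ennreal_power) (simp add: ennreal_power)
 qed
 finally show ?thesis .
qed

lemma maxwellian_pos: "\<beta> > 0 ==> maxwellian \<beta> v > 0"
 by (simp add: maxwellian_def)

lemma maxwellian_nonneg [simp]: "0 <= maxwellian \<beta> v"
 by (simp add: maxwellian_def)

lemma cross_section_nonneg [simp]: "0 <= cross_section v w \<omega>"
 by (simp add: cross_section_def)

lemma borel_measurable_maxwellian [measurable]: "maxwellian \<beta> \<in> borel_measurable borel"
 unfolding maxwellian_def by measurable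

lemma borel_measurable_cross_section [measurable (raw)]:
 assumes [measurable]: "f \<in> borel_measurable M" "g \<in> borel_measurable M" "h \<in> borel_measurable M"
 shows "(%x. cross_section (f x) (g x) (h x)) \<in> borel_measurable M"
 unfolding cross_section_def by measurable

lemma borel_measurable_post1 [measurable (raw)]:
 assumes [measurable]: "f \<in> borel_measurable M" "g \<in> borel_measurable M" "h \<in> borel_measurable M"
 shows "(%x. post1 (f x) (g x) (h x)) \<in> borel_measurable M"
 unfolding post1_def by measurable

lemma borel_measurable_post2 [measurable (raw)]:
 assumes [measurable]: "f \<in> borel_measurable M" "g \<in> borel_measurable M" "h \<in> borel_measurable M"
 shows "(%x. post2 (f x) (g x) (h x)) \<in> borel_measurable M"
 unfolding post2_def by measurable

lemma norm_post1_squared: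
 assumes "norm \<omega> = 1"
 shows "(norm (post1 v w \<omega>))\<^sup>2 = (norm v)\<^sup>2 - (v \<bullet> \<omega>)\<^sup>2 + (w \<bullet> \<omega>)\<^sup>2"
proof -
 have "\<omega> \<bullet> \<omega> = 1" using assms by (simp add: norm_eq_1)
 then show ?thesis
  unfolding power2_norm_eq_inner post1_def
  by (simp add: inner_diff_left inner_diff_right power2_eq_square inner_commute algebra_simps)
qed

lemma norm_post2_squared:
 assumes "norm \<omega> = 1"
 shows "(norm (post2 v w \<omega>))\<^sup>2 = (norm w)\<^sup>2 - (w \<bullet> \<omega>)\<^sup>2 + (v \<bullet> \<omega>)\<^sup>2"
proof -
 have "\<omega> \<bullet> \<omega> = 1" using assms by (simp add: norm_eq_1)
 then show ?thesis
  unfolding power2_norm_eq_inner post2_def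
  by (simp add: inner_diff_left inner_diff_right inner_add_left inner_add_right power2_eq_square inner_commute algebra_simps)
qed

lemma maxwellian_collision:
 assumes "norm \<omega> = 1"
 shows "maxwellian \<beta> (post1 v w \<omega>) * maxwellian \<beta> (post2 v w \<omega>) = maxwellian \<beta> v * maxwellian \<beta> w"
proof -
 have "exp (- \<beta> * (norm (post1 v w \<omega>))\<^sup>2 / 2) * exp (- \<beta> * (norm (post2 v w \<omega>))\<^sup>2 / 2)
   = exp (- \<beta> * (norm v)\<^sup>2 / 2) * exp (- \<beta> * (norm w)\<^sup>2 / 2)"
  unfolding exp_add[symmetric] norm_post1_squared[OF assms] norm_post2_squared[OF assms]
  by (rule arg_cong[where f=exp]) (simp add: field_simps)
 then show ?thesis by (simp add: maxwellian_def)
qed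

lemma norm_post1_le:
 assumes "norm \<omega> = 1"
 shows "norm (post1 v w \<omega>) <= norm v + norm w"
proof -
 have "(w \<bullet> \<omega>)\<^sup>2 <= (norm w)\<^sup>2"
  using Cauchy_Schwarz_ineq2[of w \<omega>] assms by (simp add: abs_le_square_iff[symmetric])
 then have "(norm (post1 v w \<omega>))\<^sup>2 <= (norm v)\<^sup>2 + (norm w)\<^sup>2"
  using norm_post1_squared[OF assms, of v w] zero_le_power2[of "v \<bullet> \<omega>"] by linarith
 also have "... <= (norm v + norm w)\<^sup>2" by (simp add: power2_sum)
 finally show ?thesis by (rule power2_le_imp_le) simp
qed

lemma post1_neg [simp]: "post1 v w (- \<omega>) = post1 v w \<omega>"
 by (simp add: post1_def)

definition gain :: "real => ('n::finite phase => ennreal) => 'n phase => ennreal" where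
 "gain \<beta> f z = (\<integral>\<^sup>+(w, \<omega>). ennreal (cross_section (snd z) w \<omega> * maxwellian \<beta> w) *
   f (fst z, post1 (snd z) w \<omega>) \<partial>coll_measure)"

definition freq :: "real => real ^ 'n::finite => real" where
 "freq \<beta> v = enn2real (gain \<beta> (%_. 1) (0, v))"

lemma borel_measurable_fst_raw [measurable (raw)]:
 fixes f :: "'m => 'a::second_countable_topology \<times> 'b::second_countable_topology"
 assumes "f \<in> borel_measurable M"
 shows "(%x. fst (f x)) \<in> borel_measurable M"
 by (rule measurable_compose[OF assms]) (intro borel_measurable_continuous_onI continuous_intros)

lemma borel_measurable_snd_raw [measurable (raw)]:
 fixes f :: "'m => 'a::second_countable_topology \<times> 'b::second_countable_topology"
 assumes "f \<in> borel_measurable M"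
 shows "(%x. snd (f x)) \<in> borel_measurable M"
 by (rule measurable_compose[OF assms]) (intro borel_measurable_continuous_onI continuous_intros)

lemma collision_symmetry_direction:
 fixes G :: "real ^ 'n::finite => real ^ 'n => ennreal"
 assumes [measurable]: "case_prod G \<in> borel_measurable (borel \<Otimes>\<^sub>M borel)" and \<omega>: "norm \<omega> = 1"
 shows "(\<integral>\<^sup>+v. \<integral>\<^sup>+w. ennreal (maxwellian \<beta> v * (cross_section v w \<omega> * maxwellian \<beta> w)) * G v (post1 v w \<omega>) \<partial>lborel \<partial>lborel)
  = (\<integral>\<^sup>+v. \<integral>\<^sup>+w. ennreal (maxwellian \<beta> v * (cross_section v w (- \<omega>) * maxwellian \<beta> w)) * G (post1 v w \<omega>) v \<partial>lborel \<partial>lborel)"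
proof -
 define T where "T u = u - (2 * (u \<bullet> \<omega>)) *\<^sub>R \<omega>" for u
 have ww: "\<omega> \<bullet> \<omega> = 1" using \<omega> by (simp add: norm_eq_1)
 have T[measurable]: "T \<in> borel_measurable borel" unfolding T_def by measurable
 have Tw: "T u \<bullet> \<omega> = - (u \<bullet> \<omega>)" for u by (simp add: T_def inner_diff_left ww)
 have Tadd: "T (x + y) = T x + T y" for x y by (simp add: T_def inner_add_left algebra_simps)
 have TT: "T (T x) = x" for x using Tw[of x] by (simp add: T_def[of "T x"]) (simp add: T_def)
 have "(norm (T x))\<^sup>2 = (norm x)\<^sup>2" for x
  unfolding power2_norm_eq_inner T_def
  by (simp add: inner_diff_left inner_diff_right ww inner_commute algebra_simps)
 then have Tn: "norm (T x) = norm x" for x by simp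
 let ?H = "%v u. ennreal (maxwellian \<beta> v * (max 0 (u \<bullet> \<omega>) * maxwellian \<beta> (v - u))) * G v (v - (u \<bullet> \<omega>) *\<^sub>R \<omega>)"
 let ?K = "%u y. ennreal (maxwellian \<beta> (y + (u \<bullet> \<omega>) *\<^sub>R \<omega>) * (max 0 (u \<bullet> \<omega>) * maxwellian \<beta> (y + (u \<bullet> \<omega>) *\<^sub>R \<omega> - u))) * G (y + (u \<bullet> \<omega>) *\<^sub>R \<omega>) y"
 have "(\<integral>\<^sup>+v. \<integral>\<^sup>+w. ennreal (maxwellian \<beta> v * (cross_section v w \<omega> * maxwellian \<beta> w)) * G v (post1 v w \<omega>) \<partial>lborel \<partial>lborel)
   = (\<integral>\<^sup>+v. \<integral>\<^sup>+u. ?H v u \<partial>lborel \<partial>lborel)"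
 proof (rule nn_integral_cong)
  fix v :: "real ^ 'n"
  show "(\<integral>\<^sup>+w. ennreal (maxwellian \<beta> v * (cross_section v w \<omega> * maxwellian \<beta> w)) * G v (post1 v w \<omega>) \<partial>lborel) = (\<integral>\<^sup>+u. ?H v u \<partial>lborel)"
   by (subst nn_integral_lborel_minus_left[symmetric, where a=v]) (auto simp: cross_section_def post1_def)
 qed
 also have "... = (\<integral>\<^sup>+u. \<integral>\<^sup>+v. ?H v u \<partial>lborel \<partial>lborel)"
  by (rule lborel_pair.Fubini') measurable
 also have "... = (\<integral>\<^sup>+u. \<integral>\<^sup>+y. ?K u y \<partial>lborel \<partial>lborel)"
 proof (rule nn_integral_cong)
  fix u :: "real ^ 'n"
  show "(\<integral>\<^sup>+v. ?H v u \<partial>lborel) = (\<integral>\<^sup>+y. ?K u y \<partial>lborel)"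
   by (subst nn_integral_lborel_translate[symmetric, where a="(u \<bullet> \<omega>) *\<^sub>R \<omega>"]) auto
 qed
 also have "... = (\<integral>\<^sup>+u. \<integral>\<^sup>+y. ?K (T u) y \<partial>lborel \<partial>lborel)"
  by (rule nn_integral_lborel_involution[symmetric, of "%u. \<integral>\<^sup>+y. ?K u y \<partial>lborel" T])
   (auto simp: Tadd TT Tn)
 also have "... = (\<integral>\<^sup>+y. \<integral>\<^sup>+u. ?K (T u) y \<partial>lborel \<partial>lborel)"
  by (rule lborel_pair.Fubini') measurable
 also have "... = (\<integral>\<^sup>+v. \<integral>\<^sup>+w. ennreal (maxwellian \<beta> v * (cross_section v w (- \<omega>) * maxwellian \<beta> w)) * G (post1 v w \<omega>) v \<partial>lborel \<partial>lborel)"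
 proof (rule nn_integral_cong)
  fix y :: "real ^ 'n"
  have "(\<integral>\<^sup>+u. ?K (T u) y \<partial>lborel) = (\<integral>\<^sup>+w. ?K (T (y - w)) y \<partial>lborel)"
   by (rule nn_integral_lborel_minus_left[symmetric, of "%u. ?K (T u) y"]) measurable
  also have "... = (\<integral>\<^sup>+w. ennreal (maxwellian \<beta> y * (cross_section y w (- \<omega>) * maxwellian \<beta> w)) * G (post1 y w \<omega>) y \<partial>lborel)"
  proof (rule nn_integral_cong)
   fix w :: "real ^ 'n"
   have 1: "y + (T (y - w) \<bullet> \<omega>) *\<^sub>R \<omega> = post1 y w \<omega>"
    by (simp add: Tw post1_def)
   have 2: "y + (T (y - w) \<bullet> \<omega>) *\<^sub>R \<omega> - T (y - w) = post2 y w \<omega>"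
    unfolding Tw by (simp add: vec_eq_iff T_def post2_def inner_diff_left algebra_simps)
   have 3: "max 0 (T (y - w) \<bullet> \<omega>) = cross_section y w (- \<omega>)"
    unfolding Tw by (simp add: cross_section_def)
   show "?K (T (y - w)) y = ennreal (maxwellian \<beta> y * (cross_section y w (- \<omega>) * maxwellian \<beta> w)) * G (post1 y w \<omega>) y"
    unfolding 2 3 unfolding 1
    by (subst (1 2) mult.left_commute) (simp only: maxwellian_collision[OF \<omega>])
  qed
  finally show "(\<integral>\<^sup>+u. ?K (T u) y \<partial>lborel) = (\<integral>\<^sup>+w. ennreal (maxwellian \<beta> y * (cross_section y w (- \<omega>) * maxwellian \<beta> w)) * G (post1 y w \<omega>) y \<partial>lborel)" .
 qed
 finally show ?thesis .
qed

text \<open>A collision reflects the relative velocity, so it is an involution that preserves Lebesgue measure;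
it changes the sign of \<open>\<langle>v - w, \<omega>\<rangle>\<close>, which \<open>\<omega> \<mapsto> - \<omega>\<close> repairs.\<close>

lemma collision_symmetry:
 fixes G :: "real ^ 'n::finite => real ^ 'n => ennreal"
 assumes G[measurable]: "case_prod G \<in> borel_measurable (borel \<Otimes>\<^sub>M borel)"
 shows "(\<integral>\<^sup>+v. \<integral>\<^sup>+(w, \<omega>). ennreal (maxwellian \<beta> v * (cross_section v w \<omega> * maxwellian \<beta> w)) * G v (post1 v w \<omega>)
   \<partial>coll_measure \<partial>lborel)
  = (\<integral>\<^sup>+v. \<integral>\<^sup>+(w, \<omega>). ennreal (maxwellian \<beta> v * (cross_section v w \<omega> * maxwellian \<beta> w)) * G (post1 v w \<omega>) v
   \<partial>coll_measure \<partial>lborel)"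
proof -
 have swap: "(\<integral>\<^sup>+v. \<integral>\<^sup>+(w, \<omega>). F v w \<omega> \<partial>coll_measure \<partial>lborel)
   = (\<integral>\<^sup>+\<omega>. \<integral>\<^sup>+v. \<integral>\<^sup>+w. F v w \<omega> \<partial>lborel \<partial>lborel \<partial>sphere_measure)"
  if F: "(%(v, w, \<omega>). F v w \<omega>) \<in> borel_measurable (borel \<Otimes>\<^sub>M borel \<Otimes>\<^sub>M borel)"
  for F :: "real ^ 'n => real ^ 'n => real ^ 'n => ennreal"
 proof -
  have [measurable (raw)]: "(%x. F (a x) (b x) (c x)) \<in> borel_measurable N"
   if [measurable]: "a \<in> borel_measurable N" "b \<in> borel_measurable N" "c \<in> borel_measurable N"
   for N :: "'m measure" and a b c
   using measurable_compose[of "%x. (a x, b x, c x)" N _ _ borel, OF _ F] by simp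
  have "(\<integral>\<^sup>+v. \<integral>\<^sup>+(w, \<omega>). F v w \<omega> \<partial>coll_measure \<partial>lborel)
    = (\<integral>\<^sup>+v. \<integral>\<^sup>+\<omega>. \<integral>\<^sup>+w. F v w \<omega> \<partial>lborel \<partial>sphere_measure \<partial>lborel)"
   by (intro nn_integral_cong) (subst lborel_sphere.nn_integral_snd[symmetric, of "%(w, \<omega>). F _ w \<omega>"], simp_all)
  also have "... = (\<integral>\<^sup>+\<omega>. \<integral>\<^sup>+v. \<integral>\<^sup>+w. F v w \<omega> \<partial>lborel \<partial>lborel \<partial>sphere_measure)"
   by (rule lborel_sphere.Fubini'[symmetric]) measurable
  finally show ?thesis .
 qed
 have m1: "(%(v, w, \<omega>). ennreal (maxwellian \<beta> v * (cross_section v w \<omega> * maxwellian \<beta> w)) * G v (post1 v w \<omega>))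
   \<in> borel_measurable (borel \<Otimes>\<^sub>M borel \<Otimes>\<^sub>M borel)"
  by measurable
 have m2: "(%(v, w, \<omega>). ennreal (maxwellian \<beta> v * (cross_section v w \<omega> * maxwellian \<beta> w)) * G (post1 v w \<omega>) v)
   \<in> borel_measurable (borel \<Otimes>\<^sub>M borel \<Otimes>\<^sub>M borel)"
  by measurable
 let ?J = "%\<omega>. \<integral>\<^sup>+v. \<integral>\<^sup>+w. ennreal (maxwellian \<beta> v * (cross_section v w \<omega> * maxwellian \<beta> w)) * G (post1 v w \<omega>) v \<partial>lborel \<partial>lborel"
 have "(\<integral>\<^sup>+\<omega>. \<integral>\<^sup>+v. \<integral>\<^sup>+w. ennreal (maxwellian \<beta> v * (cross_section v w \<omega> * maxwellian \<beta> w)) * G v (post1 v w \<omega>) \<partial>lborel \<partial>lborel \<partial>sphere_measure)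
   = (\<integral>\<^sup>+\<omega>. ?J (- \<omega>) \<partial>sphere_measure)"
  unfolding post1_neg
 proof (rule nn_integral_cong_AE)
  show "AE \<omega> in sphere_measure.
   (\<integral>\<^sup>+v. \<integral>\<^sup>+w. ennreal (maxwellian \<beta> v * (cross_section v w \<omega> * maxwellian \<beta> w)) * G v (post1 v w \<omega>) \<partial>lborel \<partial>lborel) =
   (\<integral>\<^sup>+v. \<integral>\<^sup>+w. ennreal (maxwellian \<beta> v * (cross_section v w (- \<omega>) * maxwellian \<beta> w)) * G (post1 v w \<omega>) v \<partial>lborel \<partial>lborel)"
   using AE_sphere_norm by eventually_elim (rule collision_symmetry_direction[OF G])
 qed
 also have "... = (\<integral>\<^sup>+\<omega>. ?J \<omega> \<partial>sphere_measure)"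
  by (rule nn_integral_sphere_neg) measurable
 finally show ?thesis
  unfolding swap[OF m1] swap[OF m2] .
qed

lemma AE_lborel_sphere_norm:
 "AE y in (lborel :: (real ^ 'n::finite) measure) \<Otimes>\<^sub>M (sphere_measure :: (real ^ 'n) measure). norm (snd y) = 1"
proof (rule lborel_sphere.AE_pair_measure)
 show "{x \<in> space coll_measure. norm (snd (x :: (real ^ 'n) \<times> (real ^ 'n))) = 1} \<in> sets coll_measure"
  by measurable
qed (use AE_sphere_norm in auto)

lemma measurable_gain [measurable (raw)]:
 fixes f :: "'m => 'n::finite phase => ennreal"
 assumes f: "(%(m, z). f m z) \<in> borel_measurable (M \<Otimes>\<^sub>M borel)" and [measurable]: "g \<in> M \<rightarrow>\<^sub>M borel"
 shows "(%m. gain \<beta> (f m) (g m)) \<in> borel_measurable M"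
proof -
 have [measurable (raw)]: "(%x. f (a x) (b x, c x)) \<in> borel_measurable N"
  if [measurable]: "a \<in> N \<rightarrow>\<^sub>M M" "b \<in> borel_measurable N" "c \<in> borel_measurable N" for N :: "'k measure" and a b c
  using measurable_compose[of "%x. (a x, (b x, c x))" N _ _ borel, OF _ f] by simp
 show ?thesis
  unfolding gain_def
  by (rule lborel_sphere.borel_measurable_nn_integral) measurable
qed

lemma gain_mono: "(!!z. f z <= g z) ==> gain \<beta> f z <= gain \<beta> g z"
 unfolding gain_def by (intro nn_integral_mono) (auto intro!: mult_left_mono)

lemma gain_cmult:
 assumes [measurable]: "f \<in> borel_measurable borel"
 shows "gain \<beta> (%z. c * f z) z = c * gain \<beta> f z"
 unfolding gain_def
 by (subst nn_integral_cmult[symmetric]) (auto intro!: nn_integral_cong simp: mult_ac)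

lemma gain_add:
 assumes [measurable]: "f \<in> borel_measurable borel" "g \<in> borel_measurable borel"
 shows "gain \<beta> (%z. f z + g z) z = gain \<beta> f z + gain \<beta> g z"
 unfolding gain_def
 by (subst nn_integral_add[symmetric]) (auto intro!: nn_integral_cong simp: distrib_left)

lemma gain_suminf:
 assumes [measurable]: "!!n. f n \<in> borel_measurable borel"
 shows "gain \<beta> (%z. \<Sum>n. f n z) z = (\<Sum>n. gain \<beta> (f n) z)"
 unfolding gain_def
 by (subst nn_integral_suminf[symmetric]) (auto intro!: nn_integral_cong simp: ennreal_suminf_cmult)

lemma linear_exp_gaussian_bound:
 fixes a c \<delta> :: real
 assumes "\<delta> > 0" "0 <= a" "0 <= c"
 shows "\<exists>K>0. \<forall>r\<ge>0. (c + r) * exp (a * r - \<delta> * r\<^sup>2) <= K * exp (- (\<delta> / 2) * r\<^sup>2)"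
proof (intro exI[of _ "(c + 1) * exp ((a + 1)\<^sup>2 / (2 * \<delta>))"] conjI allI impI)
 show "0 < (c + 1) * exp ((a + 1)\<^sup>2 / (2 * \<delta>))" using assms by simp
 fix r :: real assume r: "0 <= r"
 have sq: "0 <= (\<delta> * r - (a + 1))\<^sup>2 / (2 * \<delta>)" using assms by simp
 have "(\<delta> * r - (a + 1))\<^sup>2 / (2 * \<delta>) = (a + 1)\<^sup>2 / (2 * \<delta>) - (a + 1) * r + \<delta> / 2 * r\<^sup>2"
  using assms by (simp add: power2_eq_square field_simps)
 with sq have e: "(a + 1) * r - \<delta> * r\<^sup>2 <= (a + 1)\<^sup>2 / (2 * \<delta>) - (\<delta> / 2) * r\<^sup>2"
  by (simp add: field_simps)
 have "c + r <= (c + 1) * (1 + r)" using assms r by (simp add: algebra_simps)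
 also have "... <= (c + 1) * exp r" using assms by (intro mult_left_mono) (auto simp: exp_ge_add_one_self)
 finally have "(c + r) * exp (a * r - \<delta> * r\<^sup>2) <= (c + 1) * exp r * exp (a * r - \<delta> * r\<^sup>2)"
  by (rule mult_right_mono) simp
 also have "... = (c + 1) * exp ((a + 1) * r - \<delta> * r\<^sup>2)"
  by (simp add: algebra_simps flip: exp_add)
 also have "... <= (c + 1) * exp ((a + 1)\<^sup>2 / (2 * \<delta>) - (\<delta> / 2) * r\<^sup>2)"
  using e assms by (intro mult_left_mono) auto
 also have "... = (c + 1) * exp ((a + 1)\<^sup>2 / (2 * \<delta>)) * exp (- (\<delta> / 2) * r\<^sup>2)"
  by (simp add: flip: exp_add)
 finally show "(c + r) * exp (a * r - \<delta> * r\<^sup>2) <= (c + 1) * exp ((a + 1)\<^sup>2 / (2 * \<delta>)) * exp (- (\<delta> / 2) * r\<^sup>2)" .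
qed

lemma gain_le_of_gaussian:
 fixes f :: "'n::finite phase => ennreal"
 assumes "\<gamma> > 0" and A: "0 <= A"
  and "!!w \<omega>. norm \<omega> = 1 ==> ennreal (cross_section (snd z) w \<omega> * maxwellian \<beta> w) * f (fst z, post1 (snd z) w \<omega>)
    <= ennreal (A * exp (- \<gamma> * (norm w)\<^sup>2))"
 shows "gain \<beta> f z <= ennreal (A * (enn2real (\<integral>\<^sup>+w. ennreal (exp (- \<gamma> * (norm (w :: real ^ 'n))\<^sup>2)) \<partial>lborel) *
   measure (sphere_measure :: (real ^ 'n) measure) UNIV))"
proof -
 let ?I = "\<integral>\<^sup>+w. ennreal (exp (- \<gamma> * (norm (w :: real ^ 'n))\<^sup>2)) \<partial>lborel"
 have I: "?I = ennreal (enn2real ?I)"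
  using nn_integral_gaussian_finite[OF assms(1), where 'n='n] by simp
 have "gain \<beta> f z <= (\<integral>\<^sup>+(w, \<omega>). ennreal (A * exp (- \<gamma> * (norm w)\<^sup>2)) \<partial>((lborel :: (real ^ 'n) measure) \<Otimes>\<^sub>M (sphere_measure :: (real ^ 'n) measure)))"
  unfolding gain_def
 proof (rule nn_integral_mono_AE)
  show "AE y in (lborel :: (real ^ 'n) measure) \<Otimes>\<^sub>M (sphere_measure :: (real ^ 'n) measure).
   (case y of (w, \<omega>) => ennreal (cross_section (snd z) w \<omega> * maxwellian \<beta> w) * f (fst z, post1 (snd z) w \<omega>))
   <= (case y of (w, \<omega>) => ennreal (A * exp (- \<gamma> * (norm w)\<^sup>2)))"
   using AE_lborel_sphere_norm by eventually_elim (auto simp only: split_beta intro!: assms(3))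
 qed
 also have "... = (\<integral>\<^sup>+w. \<integral>\<^sup>+\<omega>. ennreal (A * exp (- \<gamma> * (norm w)\<^sup>2)) \<partial>(sphere_measure :: (real ^ 'n) measure) \<partial>(lborel :: (real ^ 'n) measure))"
  by (subst sphere.nn_integral_fst[symmetric]) auto
 also have "... = ennreal A * ?I * ennreal (measure (sphere_measure :: (real ^ 'n) measure) UNIV)"
  using A by (simp add: ennreal_mult' nn_integral_multc nn_integral_cmult sphere.emeasure_eq_measure)
 also have "... = ennreal (A * (enn2real ?I * measure (sphere_measure :: (real ^ 'n) measure) UNIV))"
  using A by (subst I) (simp add: ennreal_mult' mult.assoc del: ennreal_enn2real)
 finally show ?thesis .
qed

lemma abs_inner_le_norm: "norm \<omega> = 1 ==> \<bar>v \<bullet> \<omega>\<bar> <= norm v"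
 using Cauchy_Schwarz_ineq2[of v \<omega>] by simp

lemma abs_le_exp_square:
 fixes u \<alpha> :: real
 assumes "\<alpha> > 0"
 shows "\<bar>u\<bar> * exp (- \<alpha> * u\<^sup>2) <= 1 + 1 / \<alpha>"
proof -
 have "\<bar>u\<bar> <= 1 + u\<^sup>2"
  using sum_squares_bound[of 1 "\<bar>u\<bar>"] by (simp add: power2_eq_square)
 also have "... <= exp (\<alpha> * u\<^sup>2) + 1 / \<alpha> * exp (\<alpha> * u\<^sup>2)"
 proof (rule add_mono)
  show "1 <= exp (\<alpha> * u\<^sup>2)" using assms by simp
  have "\<alpha> * u\<^sup>2 <= exp (\<alpha> * u\<^sup>2)" using exp_ge_add_one_self[of "\<alpha> * u\<^sup>2"] by linarith
  then show "u\<^sup>2 <= 1 / \<alpha> * exp (\<alpha> * u\<^sup>2)" using assms by (simp add: field_simps)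
 qed
 finally have "\<bar>u\<bar> <= (1 + 1 / \<alpha>) * exp (\<alpha> * u\<^sup>2)" by (simp add: algebra_simps)
 then have "\<bar>u\<bar> * exp (- \<alpha> * u\<^sup>2) <= (1 + 1 / \<alpha>) * exp (\<alpha> * u\<^sup>2) * exp (- \<alpha> * u\<^sup>2)"
  by (rule mult_right_mono) simp
 then show ?thesis by (simp add: mult.assoc flip: exp_add)
qed

definition vexp :: "real => real => real ^ 'n::finite => real" where
 "vexp a \<alpha> v = exp (a * norm v + \<alpha> * (norm v)\<^sup>2)"

lemma vexp_pos [simp]: "0 < vexp a \<alpha> v" and vexp_nonneg [simp]: "0 <= vexp a \<alpha> v"
 by (auto simp: vexp_def)

lemma borel_measurable_vexp [measurable]: "vexp a \<alpha> \<in> borel_measurable borel"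
 unfolding vexp_def by measurable

abbreviation (input) "wt \<alpha> z \<equiv> vexp 0 \<alpha> (snd z)"

text \<open>Since \<open>|v'|^2 = |v|^2 - \<langle>v, \<omega>\<rangle>^2 + \<langle>w, \<omega>\<rangle>^2\<close>, the weight gains the factor \<open>e\<^bsup>-\<alpha>\<langle>v, \<omega>\<rangle>^2\<^esup>\<close>, which
absorbs the growth of the cross section in \<open>v\<close>; the Maxwellian of \<open>w\<close> absorbs \<open>e\<^bsup>\<alpha>\<langle>w, \<omega>\<rangle>^2\<^esup>\<close>.\<close>

lemma gain_vexp_bound:
 assumes \<beta>: "\<beta> > 0" and \<alpha>: "0 < \<alpha>" "\<alpha> < \<beta> / 2" and a0: "0 <= a0"
 shows "\<exists>C>0. \<forall>a\<in>{0..a0}. \<forall>z :: 'n::finite phase.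
  gain \<beta> (%z. ennreal (vexp a \<alpha> (snd z))) z <= ennreal (C * vexp a \<alpha> (snd z))"
proof -
 define \<delta> where "\<delta> = \<beta> / 2 - \<alpha>"
 have \<delta>: "\<delta> > 0" using \<alpha> by (simp add: \<delta>_def)
 define m where "m = (\<beta> / (2 * pi)) powr (real CARD('n) / 2)"
 have m: "m \<ge> 0" by (simp add: m_def)
 obtain K where K: "K > 0" "!!r. r \<ge> 0 ==> (1 + 1 / \<alpha> + r) * exp (a0 * r - \<delta> * r\<^sup>2) <= K * exp (- (\<delta> / 2) * r\<^sup>2)"
  using linear_exp_gaussian_bound[OF \<delta> a0, of "1 + 1 / \<alpha>"] \<alpha> by auto
 define D where "D = enn2real (\<integral>\<^sup>+w. ennreal (exp (- (\<delta> / 2) * (norm (w :: real ^ 'n))\<^sup>2)) \<partial>lborel) *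
   measure (sphere_measure :: (real ^ 'n) measure) UNIV"
 have D: "D \<ge> 0" by (simp add: D_def)
 show ?thesis
 proof (intro exI[of _ "m * K * D + 1"] conjI ballI allI)
  show "0 < m * K * D + 1" using m K D by (simp add: add_nonneg_pos)
  fix a z assume a: "a \<in> {0..a0}"
  obtain x v where z: "z = (x :: real ^ 'n, v :: real ^ 'n)" by (cases z)
  have "gain \<beta> (%z. ennreal (vexp a \<alpha> (snd z))) z <= ennreal (m * K * vexp a \<alpha> v * D)"
   unfolding D_def
  proof (rule gain_le_of_gaussian)
   fix w \<omega> :: "real ^ 'n" assume w: "norm \<omega> = 1"
   let ?u = "v \<bullet> \<omega>"
   have b: "cross_section v w \<omega> <= \<bar>?u\<bar> + norm w"
    using abs_inner_le_norm[OF w, of w] by (auto simp: cross_section_def inner_diff_left)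
   have "vexp a \<alpha> (post1 v w \<omega>) <= exp (a * (norm v + norm w) + \<alpha> * ((norm v)\<^sup>2 - ?u\<^sup>2 + (norm w)\<^sup>2))"
    unfolding vexp_def norm_post1_squared[OF w]
    using a \<alpha> norm_post1_le[OF w, of v w] abs_inner_le_norm[OF w, of w]
    by (auto intro!: add_mono mult_left_mono simp: abs_le_square_iff[symmetric])
   also have "... <= vexp a \<alpha> v * exp (- \<alpha> * ?u\<^sup>2) * exp (a0 * norm w + \<alpha> * (norm w)\<^sup>2)"
    unfolding vexp_def exp_add[symmetric] using a by (auto simp: algebra_simps intro!: mult_right_mono)
   finally have v: "vexp a \<alpha> (post1 v w \<omega>) <= vexp a \<alpha> v * exp (- \<alpha> * ?u\<^sup>2) * exp (a0 * norm w + \<alpha> * (norm w)\<^sup>2)" .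
   have M: "maxwellian \<beta> w * exp (a0 * norm w + \<alpha> * (norm w)\<^sup>2) = m * exp (a0 * norm w - \<delta> * (norm w)\<^sup>2)"
    by (simp add: maxwellian_def m_def \<delta>_def algebra_simps flip: exp_add)
   have "(\<bar>?u\<bar> + norm w) * exp (- \<alpha> * ?u\<^sup>2) <= 1 + 1 / \<alpha> + norm w"
    using abs_le_exp_square[OF \<alpha>(1), of ?u] \<alpha> mult_left_mono[of "exp (- \<alpha> * ?u\<^sup>2)" 1 "norm w"]
    by (simp add: distrib_right)
   then have "cross_section v w \<omega> * exp (- \<alpha> * ?u\<^sup>2) <= 1 + 1 / \<alpha> + norm w"
    using b by (meson exp_ge_zero mult_right_mono order_trans)
   then have "cross_section v w \<omega> * exp (- \<alpha> * ?u\<^sup>2) * exp (a0 * norm w - \<delta> * (norm w)\<^sup>2) <= K * exp (- (\<delta> / 2) * (norm w)\<^sup>2)"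
    using K(2)[of "norm w"] by (meson exp_ge_zero mult_right_mono norm_ge_zero order_trans)
   then have *: "m * vexp a \<alpha> v * (cross_section v w \<omega> * exp (- \<alpha> * ?u\<^sup>2) * exp (a0 * norm w - \<delta> * (norm w)\<^sup>2)) <= m * vexp a \<alpha> v * (K * exp (- (\<delta> / 2) * (norm w)\<^sup>2))"
    using m by (intro mult_left_mono) auto
   have "cross_section v w \<omega> * maxwellian \<beta> w * vexp a \<alpha> (post1 v w \<omega>)
     <= cross_section v w \<omega> * maxwellian \<beta> w * (vexp a \<alpha> v * exp (- \<alpha> * ?u\<^sup>2) * exp (a0 * norm w + \<alpha> * (norm w)\<^sup>2))"
    by (intro mult_left_mono v) auto
   also have "... = vexp a \<alpha> v * (cross_section v w \<omega> * exp (- \<alpha> * ?u\<^sup>2)) * (maxwellian \<beta> w * exp (a0 * norm w + \<alpha> * (norm w)\<^sup>2))"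
    by (simp only: mult_ac)
   also have "... = m * vexp a \<alpha> v * (cross_section v w \<omega> * exp (- \<alpha> * ?u\<^sup>2) * exp (a0 * norm w - \<delta> * (norm w)\<^sup>2))"
    unfolding M by (simp only: mult_ac)
   also note *
   finally have "cross_section v w \<omega> * maxwellian \<beta> w * vexp a \<alpha> (post1 v w \<omega>) <= m * K * vexp a \<alpha> v * exp (- (\<delta> / 2) * (norm w)\<^sup>2)"
    by (simp only: mult_ac)
   then show "ennreal (cross_section (snd z) w \<omega> * maxwellian \<beta> w) * ennreal (vexp a \<alpha> (snd (fst z, post1 (snd z) w \<omega>)))
     <= ennreal (m * K * vexp a \<alpha> v * exp (- (\<delta> / 2) * (norm w)\<^sup>2))"
    by (simp add: z ennreal_mult'[symmetric] ennreal_leI)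
  qed (use \<delta> m K in auto)
  also have "... <= ennreal ((m * K * D + 1) * vexp a \<alpha> (snd z))"
   by (intro ennreal_leI) (simp add: z algebra_simps)
  finally show "gain \<beta> (%z. ennreal (vexp a \<alpha> (snd z))) z <= ennreal ((m * K * D + 1) * vexp a \<alpha> (snd z))" .
 qed
qed

text \<open>The cross section grows linearly, so the collision frequency is unbounded and has to be treated as a
damping, not as a perturbation.\<close>

lemma gain_one_bound:
 assumes \<beta>: "\<beta> > 0"
 shows "\<exists>C>0. \<forall>z :: 'n::finite phase. gain \<beta> (%_. 1) z <= ennreal (C * (1 + norm (snd z)))"
proof -
 define m where "m = (\<beta> / (2 * pi)) powr (real CARD('n) / 2)"
 have m: "m \<ge> 0" by (simp add: m_def)
 obtain K where K: "K > 0" "!!r. r \<ge> 0 ==> (1 + r) * exp (0 * r - \<beta> / 2 * r\<^sup>2) <= K * exp (- (\<beta> / 2 / 2) * r\<^sup>2)"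
  using linear_exp_gaussian_bound[of "\<beta> / 2" 0 1] \<beta> by auto
 define D where "D = enn2real (\<integral>\<^sup>+w. ennreal (exp (- (\<beta> / 2 / 2) * (norm (w :: real ^ 'n))\<^sup>2)) \<partial>lborel) *
   measure (sphere_measure :: (real ^ 'n) measure) UNIV"
 have D: "D \<ge> 0" by (simp add: D_def)
 show ?thesis
 proof (intro exI[of _ "m * K * D + 1"] conjI allI)
  show "0 < m * K * D + 1" using m K D by (simp add: add_nonneg_pos)
  fix z obtain x v where z: "z = (x :: real ^ 'n, v :: real ^ 'n)" by (cases z)
  have "gain \<beta> (%_. 1) z <= ennreal (m * K * (1 + norm v) * D)"
   unfolding D_def
  proof (rule gain_le_of_gaussian)
   fix w \<omega> :: "real ^ 'n" assume w: "norm \<omega> = 1"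
   have "cross_section v w \<omega> <= norm v + norm w"
    using abs_inner_le_norm[OF w, of w] abs_inner_le_norm[OF w, of v] by (auto simp: cross_section_def inner_diff_left)
   also have "... <= (1 + norm v) * (1 + norm w)" by (simp add: algebra_simps)
   finally have "cross_section v w \<omega> * maxwellian \<beta> w <= (1 + norm v) * (1 + norm w) * maxwellian \<beta> w"
    by (intro mult_right_mono) auto
   also have "... = m * (1 + norm v) * ((1 + norm w) * exp (0 * norm w - \<beta> / 2 * (norm w)\<^sup>2))"
    by (simp add: maxwellian_def m_def)
   also have "... <= m * (1 + norm v) * (K * exp (- (\<beta> / 2 / 2) * (norm w)\<^sup>2))"
    using m by (intro mult_left_mono K(2)) auto
   finally have "cross_section v w \<omega> * maxwellian \<beta> w <= m * K * (1 + norm v) * exp (- (\<beta> / 2 / 2) * (norm w)\<^sup>2)"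
    by (simp only: mult_ac)
   then show "ennreal (cross_section (snd z) w \<omega> * maxwellian \<beta> w) * 1
     <= ennreal (m * K * (1 + norm v) * exp (- (\<beta> / 2 / 2) * (norm w)\<^sup>2))"
    by (simp add: z ennreal_leI)
  qed (use \<beta> m K in auto)
  also have "... <= ennreal ((m * K * D + 1) * (1 + norm (snd z)))"
   by (intro ennreal_leI) (simp add: z algebra_simps)
  finally show "gain \<beta> (%_. 1) z <= ennreal ((m * K * D + 1) * (1 + norm (snd z)))" .
 qed
qed

lemma freq_nonneg [simp]: "0 <= freq \<beta> v"
 by (simp add: freq_def)

lemma borel_measurable_freq [measurable]: "freq \<beta> \<in> borel_measurable (borel :: (real ^ 'n::finite) measure)"
 unfolding freq_def by measurable

lemma gain_one:
 assumes "\<beta> > 0"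
 shows "gain \<beta> (%_. 1) z = ennreal (freq \<beta> (snd z))"
proof -
 obtain C where "gain \<beta> (%_. 1) z <= ennreal (C * (1 + norm (snd z)))"
  using gain_one_bound[OF assms] by metis
 then have "gain \<beta> (%_. 1) z < \<top>" by (rule order.strict_trans1) simp
 moreover have "gain \<beta> (%_. 1) z = gain \<beta> (%_. 1) (0, snd z)" by (simp add: gain_def)
 ultimately show ?thesis by (simp add: freq_def)
qed

lemma freq_bound:
 assumes "\<beta> > 0"
 shows "\<exists>C>0. \<forall>v :: real ^ 'n::finite. freq \<beta> v <= C * (1 + norm v)"
proof -
 obtain C where C: "C > 0" "!!z :: 'n phase. gain \<beta> (%_. 1) z <= ennreal (C * (1 + norm (snd z)))"
  using gain_one_bound[OF assms] by metis
 have "freq \<beta> v <= C * (1 + norm v)" for v :: "real ^ 'n"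
  using C(2)[of "(0, v)"] C(1) gain_one[OF assms, of "(0, v)"] by simp
 then show ?thesis using C(1) by blast
qed

section \<open>Periodic functions on phase space\<close>

lemma free_flow_0 [simp]: "free_flow 0 z = z"
 by (simp add: free_flow_def)

lemma free_flow_free_flow [simp]: "free_flow a (free_flow b z) = free_flow (a + b) z"
 by (simp add: free_flow_def scaleR_add_left algebra_simps)

lemma snd_free_flow [simp]: "snd (free_flow a z) = snd z"
 by (simp add: free_flow_def)

lemma borel_measurable_free_flow [measurable (raw)]:
 assumes [measurable]: "f \<in> borel_measurable M" "g \<in> borel_measurable M"
 shows "(%x. free_flow (f x) (g x)) \<in> borel_measurable M"
 unfolding free_flow_def by measurable

definition lperiodic :: "('n::finite phase => 'b) => bool" where
 "lperiodic f \<longleftrightarrow> (\<forall>x v k. (\<forall>i. k $ i \<in> \<int>) --> f (x + k, v) = f (x, v))"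

lemma lperiodicI:
 "(!!x v k. (\<forall>i. k $ i \<in> \<int>) ==> f (x + k, v) = f (x, v)) ==> lperiodic f"
 by (simp add: lperiodic_def)

lemma lperiodicD:
 "lperiodic f ==> (\<forall>i. k $ i \<in> \<int>) ==> f (x + k, v) = f (x, v)"
 by (simp add: lperiodic_def)

lemma periodic_iff: "periodic f \<longleftrightarrow> lperiodic f"
 by (simp add: periodic_def lperiodic_def)

lemma lperiodic_free_flow:
 assumes "lperiodic f"
 shows "lperiodic (%z. f (free_flow a z))"
proof (rule lperiodicI)
 fix x v k :: "real ^ 'a" assume k: "\<forall>i. k $ i \<in> \<int>"
 show "f (free_flow a (x + k, v)) = f (free_flow a (x, v))"
  using lperiodicD[OF assms k, of "x + a *\<^sub>R v" v]
  by (simp add: free_flow_def algebra_simps)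
qed

lemma nn_integral_lborel_phase:
 fixes f :: "'n::finite phase => ennreal"
 assumes [measurable]: "f \<in> borel_measurable borel"
 shows "(\<integral>\<^sup>+z. f z \<partial>lborel) = (\<integral>\<^sup>+x. \<integral>\<^sup>+v. f (x, v) \<partial>lborel \<partial>lborel)"
  and "(\<integral>\<^sup>+z. f z \<partial>lborel) = (\<integral>\<^sup>+v. \<integral>\<^sup>+x. f (x, v) \<partial>lborel \<partial>lborel)"
proof -
 have f: "f \<in> borel_measurable (lborel \<Otimes>\<^sub>M lborel)"
  unfolding lborel_prod by simp
 show "(\<integral>\<^sup>+z. f z \<partial>lborel) = (\<integral>\<^sup>+x. \<integral>\<^sup>+v. f (x, v) \<partial>lborel \<partial>lborel)"
  using lborel.nn_integral_fst[OF f] by (simp add: lborel_prod)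
 show "(\<integral>\<^sup>+z. f z \<partial>lborel) = (\<integral>\<^sup>+v. \<integral>\<^sup>+x. f (x, v) \<partial>lborel \<partial>lborel)"
  using lborel_pair.nn_integral_snd[OF f] by (simp add: lborel_prod)
qed

lemma nn_integral_lborel_free_flow:
 fixes f :: "'n::finite phase => ennreal"
 assumes [measurable]: "f \<in> borel_measurable borel"
 shows "(\<integral>\<^sup>+z. f (free_flow a z) \<partial>lborel) = (\<integral>\<^sup>+z. f z \<partial>lborel)"
proof -
 have "(\<integral>\<^sup>+z. f (free_flow a z) \<partial>lborel) = (\<integral>\<^sup>+v. \<integral>\<^sup>+x. f (x + a *\<^sub>R v, v) \<partial>lborel \<partial>lborel)"
  by (subst nn_integral_lborel_phase(2)) (auto simp: free_flow_def)
 also have "... = (\<integral>\<^sup>+v. \<integral>\<^sup>+x. f (x, v) \<partial>lborel \<partial>lborel)"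
 proof (rule nn_integral_cong)
  fix v show "(\<integral>\<^sup>+x. f (x + a *\<^sub>R v, v) \<partial>lborel) = (\<integral>\<^sup>+x. f (x, v) \<partial>lborel)"
   by (rule nn_integral_lborel_translate[of "%x. f (x, v)"]) measurable
 qed
 also have "... = (\<integral>\<^sup>+z. f z \<partial>lborel)" by (rule nn_integral_lborel_phase(2)[symmetric]) measurable
 finally show ?thesis .
qed

lemma AE_lborel_free_flow:
 fixes Q :: "'n::finite phase => bool"
 assumes "AE z in lborel. Q z"
 shows "AE z in lborel. Q (free_flow a z)"
proof -
 from assms obtain N where N: "{z \<in> space lborel. \<not> Q z} \<subseteq> N" "emeasure lborel N = 0" "N \<in> sets lborel"
  by (rule AE_E)
 then have [measurable]: "N \<in> sets borel" by simp
 have "(\<integral>\<^sup>+z. indicator N (free_flow a z) \<partial>lborel) = 0"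
  using nn_integral_lborel_free_flow[of "indicator N" a] N by simp
 then have "AE z in lborel. indicator N (free_flow a z) = (0::ennreal)"
  by (subst (asm) nn_integral_0_iff_AE) auto
 then show ?thesis
  by eventually_elim (use N(1) in \<open>auto simp: indicator_def split: if_splits\<close>)
qed

lemma AE_lborel_free_flow_iff:
 fixes Q :: "'n::finite phase => bool"
 shows "(AE z in lborel. Q (free_flow a z)) \<longleftrightarrow> (AE z in lborel. Q z)"
proof
 assume "AE z in lborel. Q (free_flow a z)"
 from AE_lborel_free_flow[OF this, of "- a"] show "AE z in lborel. Q z" by simp
qed (rule AE_lborel_free_flow)

lemma AE_lborel_swap:
 fixes P :: "'a::euclidean_space => 'b::euclidean_space => bool"
 assumes [measurable]: "Measurable.pred (borel \<Otimes>\<^sub>M borel) (%(s, z). P s z)"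
 shows "(AE s in lborel. AE z in lborel. P s z) \<longleftrightarrow> (AE z in lborel. AE s in lborel. P s z)"
proof (rule lborel_pair.AE_commute)
 have "{x \<in> space (borel \<Otimes>\<^sub>M borel). case x of (s, z) => P s z} \<in> sets (borel \<Otimes>\<^sub>M borel)"
  using assms by (rule predE)
 then show "{x \<in> space (lborel \<Otimes>\<^sub>M lborel). P (fst x) (snd x)} \<in> sets (lborel \<Otimes>\<^sub>M lborel)"
  by (simp add: split_beta space_pair_measure cong: sets_pair_measure_cong)
qed

subsection \<open>The torus\<close>

abbreviation lattice :: "(real ^ 'n::finite) set" where
 "lattice \<equiv> {k. \<forall>i. k $ i \<in> \<int>}"

lemma countable_lattice: "countable (lattice :: (real ^ 'n::finite) set)"
proof -
 have "countable (\<int> :: real set)" unfolding Ints_def by simp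
 then have "countable (Pi\<^sub>E (UNIV :: 'n set) (%_. \<int> :: real set))"
  by (intro countable_PiE) auto
 then have "countable ((%f. \<chi> i. f i) ` Pi\<^sub>E (UNIV :: 'n set) (%_. \<int> :: real set))"
  by (rule countable_image)
 moreover have "lattice \<subseteq> (%f. \<chi> i. f i) ` Pi\<^sub>E (UNIV :: 'n set) (%_. \<int> :: real set)"
 proof
  fix k :: "real ^ 'n" assume "k \<in> lattice"
  then show "k \<in> (%f. \<chi> i. f i) ` Pi\<^sub>E (UNIV :: 'n set) (%_. \<int> :: real set)"
   by (intro image_eqI[of _ _ "%i. k $ i"]) (auto simp: vec_eq_iff)
 qed
 ultimately show ?thesis by (rule countable_subset[rotated])
qed

lemma unit_cell_cover: "x - (\<chi> i. of_int \<lfloor>x $ i\<rfloor>) \<in> unit_cell"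
 unfolding unit_cell_def by (auto, linarith)

lemma unit_cell_unique:
 assumes "k \<in> lattice" "x - k \<in> unit_cell"
 shows "k = (\<chi> i. of_int \<lfloor>x $ i\<rfloor>)"
proof (simp add: vec_eq_iff, rule allI)
 fix i
 from assms(1) obtain m where m: "k $ i = of_int m" by (auto elim: Ints_cases)
 then have "0 <= x $ i - of_int m" "x $ i - of_int m < 1" using assms(2) by (auto simp: unit_cell_def dest: spec[of _ i])
 then have "\<lfloor>x $ i\<rfloor> = m" by linarith
 then show "k $ i = of_int \<lfloor>x $ i\<rfloor>" using m by simp
qed

lemma unit_cell_measurable [measurable]: "unit_cell \<in> sets (borel :: (real ^ 'n::finite) measure)"
proof -
 have "unit_cell = (\<Inter>i. {x :: real ^ 'n. 0 <= x $ i \<and> x $ i < 1})"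
  by (auto simp: unit_cell_def)
 also have "... \<in> sets borel"
  by (intro sets.finite_INT) auto
 finally show ?thesis .
qed

lemma cell_times_UNIV_measurable [measurable]:
 "(unit_cell :: (real ^ 'n::finite) set) \<times> (UNIV :: (real ^ 'n) set) \<in> sets borel"
proof -
 have "(unit_cell :: (real ^ 'n) set) \<times> (UNIV :: (real ^ 'n) set) \<in> sets ((borel :: (real ^ 'n) measure) \<Otimes>\<^sub>M (borel :: (real ^ 'n) measure))"
  by (intro pair_measureI) auto
 then show ?thesis unfolding borel_prod .
qed

lemma AE_phase_iff:
 "(AE z in phase_measure. Q z) \<longleftrightarrow> (AE z in lborel. fst z \<in> unit_cell --> Q z)"
 unfolding phase_measure_def by (subst AE_restrict_space_iff) (auto simp: mem_Times_iff)

lemma AE_lborel_imp_phase: "AE z in lborel. Q z ==> AE z in phase_measure. Q z"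
 unfolding AE_phase_iff by (rule eventually_mono) auto

text \<open>Countably many lattice translates of the cell cover the space.  So exceptional sets can be moved along
the free flow, which does not preserve the cell.\<close>

lemma AE_phase_imp_lborel:
 fixes Q :: "'n::finite phase => bool"
 assumes per: "lperiodic Q" and ae: "AE z in phase_measure. Q z"
 shows "AE z in lborel. Q z"
proof -
 have "AE z in lborel. \<forall>k\<in>lattice. fst z - k \<in> unit_cell --> Q z"
 proof (subst AE_ball_countable[OF countable_lattice], rule ballI)
  fix k :: "real ^ 'n" assume k: "k \<in> lattice"
  obtain N where N: "{z \<in> space lborel. \<not> (fst z \<in> unit_cell --> Q z)} \<subseteq> N" "N \<in> null_sets lborel"
   using ae unfolding AE_phase_iff by (auto simp: eventually_ae_filter)
  have "{z. z - (k, 0) \<in> N} \<in> null_sets lborel" by (rule null_sets_translation[OF N(2)])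
  then show "AE z in lborel. fst z - k \<in> unit_cell --> Q z"
  proof (rule AE_I')
   have "Q z" if "fst z - k \<in> unit_cell" "z - (k, 0) \<notin> N" for z
   proof -
    have "\<not> (z - (k, 0)) \<in> {z \<in> space lborel. \<not> (fst z \<in> unit_cell --> Q z)}"
     using N(1) that(2) by blast
    then have "Q (z - (k, 0))" using that(1) by (simp add: fst_diff)
    then show "Q z" using lperiodicD[OF per, of k "fst z - k" "snd z"] k
     by (cases z) auto
   qed
   then show "{z \<in> space lborel. \<not> (fst z - k \<in> unit_cell --> Q z)} \<subseteq> {z. z - (k, 0) \<in> N}" by auto
  qed
 qed
 then show ?thesis
 proof eventually_elim
  case (elim z)
  have "(\<chi> i. of_int \<lfloor>fst z $ i\<rfloor>) \<in> lattice" by auto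
  with elim unit_cell_cover[of "fst z"] show "Q z" by blast
 qed
qed

lemma nn_integral_lattice_cells:
 fixes x :: "real ^ 'n::finite"
 shows "(\<integral>\<^sup>+k. indicator unit_cell (x - k) \<partial>count_space lattice) = 1"
proof -
 let ?k = "(\<chi> i. of_int \<lfloor>x $ i\<rfloor>) :: real ^ 'n"
 have k: "?k \<in> lattice" by auto
 have "(\<integral>\<^sup>+k. indicator unit_cell (x - k) \<partial>count_space lattice) = (\<integral>\<^sup>+k. indicator {?k} k \<partial>count_space lattice)"
 proof (rule nn_integral_cong)
  fix k :: "real ^ 'n" assume "k \<in> space (count_space lattice)"
  then have kl: "k \<in> lattice" by simp
  have "x - k \<in> unit_cell \<longleftrightarrow> k = ?k"
  proof
   show "x - k \<in> unit_cell ==> k = ?k" by (rule unit_cell_unique[OF kl])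
   show "k = ?k ==> x - k \<in> unit_cell" using unit_cell_cover[of x] by metis
  qed
  then show "indicator unit_cell (x - k) = (indicator {?k} k :: ennreal)"
   by (simp only: indicator_def singleton_iff)
 qed
 also have "... = emeasure (count_space lattice) {?k}"
  using k by (intro nn_integral_indicator) auto
 also have "... = 1" using k by (subst emeasure_count_space) auto
 finally show ?thesis .
qed

lemma nn_integral_lattice_cells_plus:
 fixes x :: "real ^ 'n::finite"
 shows "(\<integral>\<^sup>+k. indicator unit_cell (x + k) \<partial>count_space lattice) = 1"
proof -
 have b: "bij_betw uminus (lattice :: (real ^ 'n) set) lattice"
  by (rule bij_betw_byWitness[where f'=uminus]) auto
 have "(\<integral>\<^sup>+k. indicator unit_cell (x - (- k)) \<partial>count_space lattice) = (\<integral>\<^sup>+k. indicator unit_cell (x - k) \<partial>count_space lattice)"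
  by (rule nn_integral_bij_count_space[OF b])
 then show ?thesis by (simp add: nn_integral_lattice_cells)
qed

lemma nn_integral_cell_translate:
 fixes h :: "real ^ 'n::finite => ennreal"
 assumes [measurable]: "h \<in> borel_measurable borel" and per: "!!x k. k \<in> lattice ==> h (x + k) = h x"
 shows "(\<integral>\<^sup>+x. indicator unit_cell x * h (x + c) \<partial>lborel) = (\<integral>\<^sup>+x. indicator unit_cell x * h x \<partial>lborel)"
proof -
 have "(\<integral>\<^sup>+x. indicator unit_cell x * h (x + c) \<partial>lborel) = (\<integral>\<^sup>+x. indicator unit_cell (x - c) * h x \<partial>lborel)"
  using nn_integral_lborel_translate[of "%x. indicator unit_cell (x - c) * h x" c] by simp
 also have "... = (\<integral>\<^sup>+x. \<integral>\<^sup>+k. indicator unit_cell (x - k) * (indicator unit_cell (x - c) * h x) \<partial>count_space lattice \<partial>lborel)"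
  by (simp add: nn_integral_multc nn_integral_lattice_cells)
 also have "... = (\<integral>\<^sup>+k. \<integral>\<^sup>+x. indicator unit_cell (x - k) * (indicator unit_cell (x - c) * h x) \<partial>lborel \<partial>count_space lattice)"
  by (rule nn_integral_count_space_nn_integral[OF countable_lattice]) measurable
 also have "... = (\<integral>\<^sup>+k. \<integral>\<^sup>+x. indicator unit_cell (x - c + k) * (indicator unit_cell x * h x) \<partial>lborel \<partial>count_space lattice)"
 proof (rule nn_integral_cong)
  fix k :: "real ^ 'n" assume "k \<in> space (count_space lattice)"
  then have k: "k \<in> lattice" by simp
  have "(\<integral>\<^sup>+x. indicator unit_cell (x - k) * (indicator unit_cell (x - c) * h x) \<partial>lborel)
    = (\<integral>\<^sup>+x. indicator unit_cell (x + k - k) * (indicator unit_cell (x + k - c) * h (x + k)) \<partial>lborel)"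
   by (rule nn_integral_lborel_translate[symmetric, of "%x. indicator unit_cell (x - k) * (indicator unit_cell (x - c) * h x)" k])
    measurable
  also have "... = (\<integral>\<^sup>+x. indicator unit_cell (x - c + k) * (indicator unit_cell x * h x) \<partial>lborel)"
   using per[OF k] by (intro nn_integral_cong) (simp add: add_diff_eq diff_add_eq mult.left_commute)
  finally show "(\<integral>\<^sup>+x. indicator unit_cell (x - k) * (indicator unit_cell (x - c) * h x) \<partial>lborel) = ..." .
 qed
 also have "... = (\<integral>\<^sup>+x. \<integral>\<^sup>+k. indicator unit_cell (x - c + k) * (indicator unit_cell x * h x) \<partial>count_space lattice \<partial>lborel)"
  by (rule nn_integral_count_space_nn_integral[OF countable_lattice, symmetric]) measurable
 also have "... = (\<integral>\<^sup>+x. indicator unit_cell x * h x \<partial>lborel)"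
  by (simp add: nn_integral_multc nn_integral_lattice_cells_plus)
 finally show ?thesis .
qed

lemma nn_integral_phase:
 fixes f :: "'n::finite phase => ennreal"
 shows "(\<integral>\<^sup>+z. f z \<partial>phase_measure) = (\<integral>\<^sup>+z. indicator unit_cell (fst z) * f z \<partial>lborel)"
 unfolding phase_measure_def
 by (subst nn_integral_restrict_space) (auto intro!: nn_integral_cong simp: indicator_def)

lemma sets_phase_measurable:
 "f \<in> borel_measurable borel ==> f \<in> borel_measurable phase_measure"
 unfolding phase_measure_def by (rule measurable_restrict_space1) simp

text \<open>At fixed velocity the flow is a translation in position, and the integral of a periodic function over
a cell does not change under translations.\<close>

lemma nn_integral_phase_free_flow:
 fixes f :: "'n::finite phase => ennreal"
 assumes [measurable]: "f \<in> borel_measurable borel" and per: "lperiodic f"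
 shows "(\<integral>\<^sup>+z. f (free_flow a z) \<partial>phase_measure) = (\<integral>\<^sup>+z. f z \<partial>phase_measure)"
proof -
 have "(\<integral>\<^sup>+z. f (free_flow a z) \<partial>phase_measure) = (\<integral>\<^sup>+v. \<integral>\<^sup>+x. indicator unit_cell x * f (x + a *\<^sub>R v, v) \<partial>lborel \<partial>lborel)"
  unfolding nn_integral_phase by (subst nn_integral_lborel_phase(2)) (auto simp: free_flow_def)
 also have "... = (\<integral>\<^sup>+v. \<integral>\<^sup>+x. indicator unit_cell x * f (x, v) \<partial>lborel \<partial>lborel)"
 proof (rule nn_integral_cong)
  fix v show "(\<integral>\<^sup>+x. indicator unit_cell x * f (x + a *\<^sub>R v, v) \<partial>lborel) = (\<integral>\<^sup>+x. indicator unit_cell x * f (x, v) \<partial>lborel)"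
   by (rule nn_integral_cell_translate[of "%x. f (x, v)"]) (use lperiodicD[OF per] in auto)
 qed
 also have "... = (\<integral>\<^sup>+z. f z \<partial>phase_measure)"
  unfolding nn_integral_phase by (subst nn_integral_lborel_phase(2)) auto
 finally show ?thesis .
qed

lemma sigma_finite_phase: "sigma_finite_measure (phase_measure :: 'n::finite phase measure)"
 unfolding phase_measure_def
 by (rule sigma_finite_measure_restrict_space) (auto simp: lborel.sigma_finite_measure_axioms)

subsection \<open>Symmetry of the collision integral\<close>

lemma collision_symmetry_weighted:
 fixes G :: "'n::finite phase => 'n phase => ennreal" and c :: "real ^ 'n => ennreal"
 assumes [measurable]: "case_prod G \<in> borel_measurable (borel \<Otimes>\<^sub>M borel)" "c \<in> borel_measurable borel"
 shows "(\<integral>\<^sup>+z. c (fst z) * (\<integral>\<^sup>+(w, \<omega>). ennreal (maxwellian \<beta> (snd z) * (cross_section (snd z) w \<omega> * maxwellian \<beta> w)) *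
   G z (fst z, post1 (snd z) w \<omega>) \<partial>coll_measure) \<partial>lborel)
  = (\<integral>\<^sup>+z. c (fst z) * (\<integral>\<^sup>+(w, \<omega>). ennreal (maxwellian \<beta> (snd z) * (cross_section (snd z) w \<omega> * maxwellian \<beta> w)) *
   G (fst z, post1 (snd z) w \<omega>) z \<partial>coll_measure) \<partial>lborel)"
proof -
 let ?I = "%z F. \<integral>\<^sup>+(w, \<omega>). ennreal (maxwellian \<beta> (snd z) * (cross_section (snd z) w \<omega> * maxwellian \<beta> w)) *
   F z (fst z, post1 (snd z) w \<omega>) \<partial>coll_measure"
 have split: "(\<integral>\<^sup>+z. c (fst z) * ?I z F \<partial>lborel) = (\<integral>\<^sup>+x. c x * (\<integral>\<^sup>+v. ?I (x, v) F \<partial>lborel) \<partial>lborel)"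
  if F: "case_prod F \<in> borel_measurable (borel \<Otimes>\<^sub>M borel)" for F :: "'n phase => 'n phase => ennreal"
 proof -
  have [measurable (raw)]: "(%x. F (a x) (b x)) \<in> borel_measurable N"
   if [measurable]: "a \<in> borel_measurable N" "b \<in> borel_measurable N" for N :: "'k measure" and a b
   using measurable_compose[of "%x. (a x, b x)" N _ _ borel, OF _ F] by simp
  have [measurable]: "(%z. ?I z F) \<in> borel_measurable borel"
   by (rule lborel_sphere.borel_measurable_nn_integral) measurable
  show ?thesis
   by (subst nn_integral_lborel_phase(1)) (auto intro!: nn_integral_cong nn_integral_cmult)
 qed
 have swapped: "case_prod (%a b. G b a) \<in> borel_measurable (borel \<Otimes>\<^sub>M borel)"
  by measurable
 have "(\<integral>\<^sup>+v. ?I (x, v) G \<partial>lborel) = (\<integral>\<^sup>+v. ?I (x, v) (%a b. G b a) \<partial>lborel)" for x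
  using collision_symmetry[of "%v v'. G (x, v) (x, v')" \<beta>] by simp
 then show ?thesis
  using split[OF assms(1)] split[OF swapped] by simp
qed

text \<open>Collisions do not change the position, so the weight \<open>c\<close> may later be the indicator of the cell.\<close>

lemma gain_symmetric:
 fixes \<phi> \<psi> :: "'n::finite phase => ennreal"
 assumes [measurable]: "\<phi> \<in> borel_measurable borel" "\<psi> \<in> borel_measurable borel" "c \<in> borel_measurable borel"
 shows "(\<integral>\<^sup>+z. c (fst z) * (ennreal (maxwellian \<beta> (snd z)) * \<psi> z * gain \<beta> \<phi> z) \<partial>lborel)
   = (\<integral>\<^sup>+z. c (fst z) * (ennreal (maxwellian \<beta> (snd z)) * \<phi> z * gain \<beta> \<psi> z) \<partial>lborel)"
proof -
 have e: "(\<integral>\<^sup>+(w, \<omega>). ennreal (maxwellian \<beta> (snd z) * (cross_section (snd z) w \<omega> * maxwellian \<beta> w)) *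
   (f z * g (fst z, post1 (snd z) w \<omega>)) \<partial>coll_measure) = ennreal (maxwellian \<beta> (snd z)) * f z * gain \<beta> g z"
  if [measurable]: "g \<in> borel_measurable borel" for f g :: "'n phase => ennreal" and z
  unfolding gain_def
  by (subst nn_integral_cmult[symmetric]) (auto intro!: nn_integral_cong simp: ennreal_mult' mult_ac)
 have "(\<integral>\<^sup>+(w, \<omega>). ennreal (maxwellian \<beta> (snd z) * (cross_section (snd z) w \<omega> * maxwellian \<beta> w)) *
   (\<psi> (fst z, post1 (snd z) w \<omega>) * \<phi> z) \<partial>coll_measure) = ennreal (maxwellian \<beta> (snd z)) * \<phi> z * gain \<beta> \<psi> z" for z
  using e[where g=\<psi> and f=\<phi> and z=z] by (simp add: mult.commute[of "\<phi> z"])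
 then show ?thesis
  using collision_symmetry_weighted[of "%z z'. \<psi> z * \<phi> z'" c \<beta>] e[where g=\<phi> and f=\<psi>] by simp
qed

lemma AE_post_collision:
 fixes P :: "'n::finite phase => bool" and \<beta> :: real
 assumes \<beta>: "\<beta> > 0" and P[measurable]: "Measurable.pred borel P" and ae: "AE z in lborel. P z"
 shows "AE z in lborel. AE y in lborel \<Otimes>\<^sub>M sphere_measure.
  cross_section (snd z) (fst y) (snd y) > 0 --> P (fst z, post1 (snd z) (fst y) (snd y))"
proof -
 let ?\<chi> = "%z. indicator {z. \<not> P z} z :: ennreal"
 have "(\<integral>\<^sup>+z. ennreal (maxwellian \<beta> (snd z)) * gain \<beta> ?\<chi> z \<partial>lborel)
   = (\<integral>\<^sup>+z. ennreal (maxwellian \<beta> (snd z)) * ?\<chi> z * gain \<beta> (%_. 1) z \<partial>lborel)"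
  using gain_symmetric[of ?\<chi> "%_. 1" "%_. 1" \<beta>] by simp
 also have "... = (\<integral>\<^sup>+z. 0 \<partial>(lborel :: 'n phase measure))"
  by (rule nn_integral_cong_AE) (use ae in \<open>auto simp: indicator_def\<close>)
 finally have "(\<integral>\<^sup>+z. ennreal (maxwellian \<beta> (snd z)) * gain \<beta> ?\<chi> z \<partial>lborel) = 0" by simp
 then have "AE z in lborel. ennreal (maxwellian \<beta> (snd z)) * gain \<beta> ?\<chi> z = 0"
  by (subst (asm) nn_integral_0_iff_AE) auto
 then show ?thesis
 proof eventually_elim
  case (elim z)
  then have "gain \<beta> ?\<chi> z = 0"
   using maxwellian_pos[OF \<beta>, of "snd z"] by (simp add: ennreal_eq_0_iff)
  then have "AE y in lborel \<Otimes>\<^sub>M sphere_measure. (case y of (w, \<omega>) => ennreal (cross_section (snd z) w \<omega> * maxwellian \<beta> w) *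
    ?\<chi> (fst z, post1 (snd z) w \<omega>)) = 0"
   unfolding gain_def by (subst (asm) nn_integral_0_iff_AE) auto
  then show ?case
  proof eventually_elim
   case (elim y)
   show ?case
   proof
    assume "cross_section (snd z) (fst y) (snd y) > 0"
    then have "0 < cross_section (snd z) (fst y) (snd y) * maxwellian \<beta> (fst y)"
     using maxwellian_pos[OF \<beta>] by (rule mult_pos_pos)
    with elim show "P (fst z, post1 (snd z) (fst y) (snd y))"
     by (auto simp: split_beta ennreal_eq_0_iff indicator_def split: if_splits)
   qed
  qed
 qed
qed

lemma gain_mono_AE:
 fixes f g :: "'n::finite phase => ennreal"
 assumes \<beta>: "\<beta> > 0" and [measurable]: "f \<in> borel_measurable borel" "g \<in> borel_measurable borel"
  and ae: "AE z in lborel. f z <= g z"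
 shows "AE z in lborel. gain \<beta> f z <= gain \<beta> g z"
proof -
 have "Measurable.pred borel (%z. f z <= g z)" by measurable
 from AE_post_collision[OF \<beta> this ae] show ?thesis
proof eventually_elim
 case (elim z)
 show ?case unfolding gain_def
 proof (rule nn_integral_mono_AE)
  show "AE y in lborel \<Otimes>\<^sub>M sphere_measure.
   (case y of (w, \<omega>) => ennreal (cross_section (snd z) w \<omega> * maxwellian \<beta> w) * f (fst z, post1 (snd z) w \<omega>))
   <= (case y of (w, \<omega>) => ennreal (cross_section (snd z) w \<omega> * maxwellian \<beta> w) * g (fst z, post1 (snd z) w \<omega>))"
   using elim
  proof eventually_elim
   case (elim y)
   then show ?case
   proof (cases "cross_section (snd z) (fst y) (snd y) > 0")
    case True
    with elim show ?thesis by (auto simp: split_beta intro!: mult_left_mono)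
   next
    case False
    then have "cross_section (snd z) (fst y) (snd y) = 0" by (intro antisym) (auto simp: not_less)
    then show ?thesis by (simp add: split_beta)
   qed
  qed
 qed
qed
qed

lemma gain_cong_AE:
 fixes f g :: "'n::finite phase => ennreal"
 assumes \<beta>: "\<beta> > 0" and [measurable]: "f \<in> borel_measurable borel" "g \<in> borel_measurable borel"
  and ae: "AE z in lborel. f z = g z"
 shows "AE z in lborel. gain \<beta> f z = gain \<beta> g z"
proof -
 have "AE z in lborel. f z <= g z" "AE z in lborel. g z <= f z" using ae by (auto elim: eventually_mono)
 from gain_mono_AE[OF \<beta> assms(2,3) this(1)] gain_mono_AE[OF \<beta> assms(3,2) this(2)] show ?thesis by eventually_elim (rule antisym)
qed

definition rgain :: "real => ('n::finite phase => real) => 'n phase => real" where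
 "rgain \<beta> f z = (LINT (w, \<omega>)|coll_measure.
   cross_section (snd z) w \<omega> * maxwellian \<beta> w * f (fst z, post1 (snd z) w \<omega>))"

lemma measurable_rgain [measurable (raw)]:
 fixes f :: "'m => 'n::finite phase => real"
 assumes f: "(%(m, z). f m z) \<in> borel_measurable (M \<Otimes>\<^sub>M borel)" and [measurable]: "g \<in> M \<rightarrow>\<^sub>M borel"
 shows "(%m. rgain \<beta> (f m) (g m)) \<in> borel_measurable M"
proof -
 have [measurable (raw)]: "(%x. f (a x) (b x, c x)) \<in> borel_measurable N"
  if [measurable]: "a \<in> N \<rightarrow>\<^sub>M M" "b \<in> borel_measurable N" "c \<in> borel_measurable N" for N :: "'k measure" and a b c
  using measurable_compose[of "%x. (a x, (b x, c x))" N _ _ borel, OF _ f] by simp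
 show ?thesis
  unfolding rgain_def
  by (rule lborel_sphere.borel_measurable_lebesgue_integral) measurable
qed

lemma rgain_integrable:
 fixes f :: "'n::finite phase => real"
 assumes [measurable]: "f \<in> borel_measurable borel" and fin: "gain \<beta> (%z. ennreal \<bar>f z\<bar>) z < \<infinity>"
 shows "integrable coll_measure
  (%(w, \<omega>). cross_section (snd z) w \<omega> * maxwellian \<beta> w * f (fst z, post1 (snd z) w \<omega>))"
proof (rule integrableI_bounded)
 have "(\<integral>\<^sup>+y. ennreal (norm (case y of (w, \<omega>) => cross_section (snd z) w \<omega> * maxwellian \<beta> w * f (fst z, post1 (snd z) w \<omega>)))
   \<partial>coll_measure) = gain \<beta> (%z. ennreal \<bar>f z\<bar>) z"
  unfolding gain_def by (intro nn_integral_cong) (auto simp: abs_mult ennreal_mult'[symmetric])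
 then show "(\<integral>\<^sup>+y. ennreal (norm (case y of (w, \<omega>) => cross_section (snd z) w \<omega> * maxwellian \<beta> w * f (fst z, post1 (snd z) w \<omega>)))
   \<partial>coll_measure) < \<infinity>" using fin by simp
qed measurable

lemma rgain_nonneg_eq:
 fixes f :: "'n::finite phase => real"
 assumes [measurable]: "f \<in> borel_measurable borel" and "!!z. 0 <= f z"
 shows "rgain \<beta> f z = enn2real (gain \<beta> (%z. ennreal (f z)) z)"
 unfolding rgain_def gain_def
 by (subst integral_eq_nn_integral)
  (auto simp: assms ennreal_mult'[symmetric] intro!: arg_cong[where f=enn2real] nn_integral_cong)

lemma rgain_abs_le:
 fixes f :: "'n::finite phase => real"
 assumes [measurable]: "f \<in> borel_measurable borel"
 shows "ennreal \<bar>rgain \<beta> f z\<bar> <= gain \<beta> (%z. ennreal \<bar>f z\<bar>) z"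
proof (cases "gain \<beta> (%z. ennreal \<bar>f z\<bar>) z < \<infinity>")
 case True
 have "ennreal (norm (rgain \<beta> f z)) <= (\<integral>\<^sup>+y. ennreal (norm (case y of (w, \<omega>) => cross_section (snd z) w \<omega> * maxwellian \<beta> w * f (fst z, post1 (snd z) w \<omega>)))
   \<partial>coll_measure)"
  unfolding rgain_def by (rule integral_norm_bound_ennreal[OF rgain_integrable[OF assms True]])
 also have "... = gain \<beta> (%z. ennreal \<bar>f z\<bar>) z"
  unfolding gain_def by (intro nn_integral_cong) (auto simp: abs_mult ennreal_mult'[symmetric])
 finally show ?thesis by simp
qed (simp add: not_less top_unique)

lemma rgain_diff:
 fixes f g :: "'n::finite phase => real"
 assumes [measurable]: "f \<in> borel_measurable borel" "g \<in> borel_measurable borel"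
  and "gain \<beta> (%z. ennreal \<bar>f z\<bar>) z < \<infinity>" "gain \<beta> (%z. ennreal \<bar>g z\<bar>) z < \<infinity>"
 shows "rgain \<beta> (%z. f z - g z) z = rgain \<beta> f z - rgain \<beta> g z"
proof -
 have "rgain \<beta> f z - rgain \<beta> g z = (LINT y|coll_measure.
   (case y of (w, \<omega>) => cross_section (snd z) w \<omega> * maxwellian \<beta> w * f (fst z, post1 (snd z) w \<omega>)) -
   (case y of (w, \<omega>) => cross_section (snd z) w \<omega> * maxwellian \<beta> w * g (fst z, post1 (snd z) w \<omega>)))"
  unfolding rgain_def by (rule Bochner_Integration.integral_diff[symmetric]; rule rgain_integrable; fact)
 also have "... = rgain \<beta> (%z. f z - g z) z"
  unfolding rgain_def by (intro Bochner_Integration.integral_cong) (auto simp: right_diff_distrib)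
 finally show ?thesis ..
qed

subsection \<open>Time-dependent functions\<close>

lemma borel_measurable_time_phase:
 fixes f :: "real => 'n::finite phase => real"
 assumes "time_phase_fun t f"
 shows "(%(s, z). if s \<in> {0..t} then f s z else 0) \<in> borel_measurable (borel \<Otimes>\<^sub>M borel)"
proof -
 have S: "({0..t} \<times> UNIV :: (real \<times> 'n phase) set) \<in> sets borel"
  unfolding borel_prod[symmetric, where 'a=real and 'b="'n phase"] by (intro pair_measureI) auto
 have "(%x. indicator ({0..t} \<times> UNIV) x *\<^sub>R (case x of (s, z) => f s z)) \<in> borel_measurable borel"
  using assms S unfolding time_phase_fun_def by (subst (asm) borel_measurable_restrict_space_iff) auto
 also have "(%x. indicator ({0..t} \<times> UNIV) x *\<^sub>R (case x of (s, z) => f s z)) = (%(s, z). if s \<in> {0..t} then f s z else 0)"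
  by (auto simp: fun_eq_iff indicator_def)
 finally show ?thesis unfolding borel_prod .
qed

lemma time_phase_funI:
 fixes f :: "real => 'n::finite phase => real"
 assumes "jointly_measurable f" "!!s. s \<in> {0..t} ==> lperiodic (f s)"
 shows "time_phase_fun t f"
 using assms unfolding time_phase_fun_def periodic_iff borel_prod
 by (auto intro: measurable_restrict_space1)

lemma time_phase_fun_section:
 assumes "time_phase_fun t f" "s \<in> {0..t}"
 shows "f s \<in> borel_measurable borel" "lperiodic (f s)" "phase_fun (f s)"
proof -
 have "(%z. (%(s, z). if s \<in> {0..t} then f s z else 0) (s, z)) \<in> borel_measurable borel"
  by (rule measurable_compose[OF _ borel_measurable_time_phase[OF assms(1)]]) measurable
 then show 1: "f s \<in> borel_measurable borel" using assms(2) by simp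
 show 2: "lperiodic (f s)" using assms by (auto simp: time_phase_fun_def periodic_iff)
 show "phase_fun (f s)" using 1 2 by (simp add: phase_fun_def periodic_iff)
qed

section \<open>Dyson series for the linear equation\<close>

lemma joint_apply:
 assumes f: "jointly_measurable f"
  and [measurable]: "a \<in> borel_measurable N" "b \<in> borel_measurable N"
 shows "(%x. f (a x) (b x)) \<in> borel_measurable N"
 using measurable_compose[of "%x. (a x, b x)" N _ _ borel, OF _ f] by simp

lemma joint_apply3:
 assumes f: "jointly_measurable3 f"
  and [measurable]: "a \<in> borel_measurable N" "b \<in> borel_measurable N" "c \<in> borel_measurable N"
 shows "(%x. f (a x) (b x) (c x)) \<in> borel_measurable N"
 using measurable_compose[of "%x. (a x, b x, c x)" N _ _ borel, OF _ f] by simp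

definition path_weight ::
 "real => (real => 'n::finite phase => real) => real => real => 'n phase => ennreal" where
 "path_weight \<epsilon> W u s z = ennreal (exp (- (LINT r:{u..s}|lborel. W r (free_flow (\<epsilon> * (r - s)) z))))"

definition coll_op :: "real => real => ('n::finite phase => ennreal) => 'n phase => ennreal" where
 "coll_op \<beta> \<sigma> f z = (if \<sigma> = 1 then gain \<beta> f z else ennreal (freq \<beta> (snd z)) * f z)"

definition coll_step :: "real => real => (real => real => 'n::finite phase => ennreal) => real =>
  (real => 'n phase => ennreal) => real => 'n phase => ennreal" where
 "coll_step \<beta> \<epsilon> S \<sigma> h s z =
   (\<integral>\<^sup>+u. indicator {0<..<s} u * (S u s z * coll_op \<beta> \<sigma> (h u) (free_flow (\<epsilon> * (u - s)) z)) \<partial>lborel)"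

lemma measurable_path_weight:
 assumes W: "jointly_measurable W"
 shows "jointly_measurable3 (path_weight \<epsilon> W)"
proof -
 note [measurable (raw)] = joint_apply[OF W]
 have "(%x :: real \<times> real \<times> 'a phase. LINT r|lborel. (if fst x <= r \<and> r <= fst (snd x) then 1 else 0) *\<^sub>R W r (free_flow (\<epsilon> * (r - fst (snd x))) (snd (snd x))))
   \<in> borel_measurable (borel \<Otimes>\<^sub>M borel \<Otimes>\<^sub>M borel)"
  by measurable
 also have "(%x :: real \<times> real \<times> 'a phase. LINT r|lborel. (if fst x <= r \<and> r <= fst (snd x) then 1 else 0) *\<^sub>R W r (free_flow (\<epsilon> * (r - fst (snd x))) (snd (snd x))))
   = (%x. LINT r:{fst x..fst (snd x)}|lborel. W r (free_flow (\<epsilon> * (r - fst (snd x))) (snd (snd x))))"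
  unfolding set_lebesgue_integral_def
  by (intro ext Bochner_Integration.integral_cong) (auto simp: indicator_def)
 finally show ?thesis unfolding path_weight_def split_beta by measurable
qed

lemma measurable_coll_op [measurable (raw)]:
 fixes f :: "'m => 'n::finite phase => ennreal"
 assumes f: "(%(m, z). f m z) \<in> borel_measurable (M \<Otimes>\<^sub>M borel)" and [measurable]: "g \<in> M \<rightarrow>\<^sub>M borel"
 shows "(%m. coll_op \<beta> \<sigma> (f m) (g m)) \<in> borel_measurable M"
proof -
 have "(%m. f m (g m)) \<in> borel_measurable M"
  using measurable_compose[of "%m. (m, g m)" M _ _ borel, OF _ f] by simp
 then show ?thesis
  unfolding coll_op_def using f by (cases "\<sigma> = 1") simp_all
qed

lemma measurable_coll_step:
 assumes S: "jointly_measurable3 S"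
  and h: "jointly_measurable h"
 shows "jointly_measurable (coll_step \<beta> \<epsilon> S \<sigma> h)"
proof -
 note [measurable (raw)] = joint_apply3[OF S] joint_apply[OF h]
 have "(%x :: real \<times> 'a phase. \<integral>\<^sup>+u. (if 0 < u \<and> u < fst x then 1 else 0) * (S u (fst x) (snd x) *
   coll_op \<beta> \<sigma> (h u) (free_flow (\<epsilon> * (u - fst x)) (snd x))) \<partial>lborel) \<in> borel_measurable (borel \<Otimes>\<^sub>M borel)"
  by measurable
 also have "(%x :: real \<times> 'a phase. \<integral>\<^sup>+u. (if 0 < u \<and> u < fst x then 1 else 0) * (S u (fst x) (snd x) *
   coll_op \<beta> \<sigma> (h u) (free_flow (\<epsilon> * (u - fst x)) (snd x))) \<partial>lborel) = (%(s, z). coll_step \<beta> \<epsilon> S \<sigma> h s z)"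
  unfolding coll_step_def split_beta by (intro ext nn_integral_cong) (auto simp: indicator_def)
 finally show ?thesis .
qed

lemma coll_op_mono: "(!!z. f z <= g z) ==> coll_op \<beta> \<sigma> f z <= coll_op \<beta> \<sigma> g z"
 unfolding coll_op_def by (simp add: gain_mono mult_left_mono)

lemma coll_op_add:
 assumes [measurable]: "f \<in> borel_measurable borel" "g \<in> borel_measurable borel"
 shows "coll_op \<beta> \<sigma> (%z. f z + g z) z = coll_op \<beta> \<sigma> f z + coll_op \<beta> \<sigma> g z"
 by (simp add: coll_op_def gain_add distrib_left)

lemma coll_op_suminf:
 assumes [measurable]: "!!n. f n \<in> borel_measurable borel"
 shows "coll_op \<beta> \<sigma> (%z. \<Sum>n. f n z) z = (\<Sum>n. coll_op \<beta> \<sigma> (f n) z)"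
 by (simp add: coll_op_def gain_suminf ennreal_suminf_cmult)

lemma coll_op_periodic:
 assumes "lperiodic f"
 shows "lperiodic (coll_op \<beta> \<sigma> f)"
 using lperiodicD[OF assms] by (intro lperiodicI) (simp add: coll_op_def gain_def)

lemma coll_step_mono:
 assumes "!!u z. 0 < u ==> u < s ==> h u z <= h' u z"
 shows "coll_step \<beta> \<epsilon> S \<sigma> h s z <= coll_step \<beta> \<epsilon> S \<sigma> h' s z"
 unfolding coll_step_def
 by (intro nn_integral_mono) (auto simp: indicator_def intro!: mult_left_mono coll_op_mono assms)

lemma section_measurable:
 assumes "jointly_measurable h"
 shows "h s \<in> borel_measurable borel"
 using joint_apply[OF assms, of "%_. s" borel "%z. z"] by simp

lemma coll_step_integrand_measurable:
 assumes S: "jointly_measurable3 S"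
  and h: "jointly_measurable h"
 shows "(%u. indicator {0<..<s} u * (S u s z * coll_op \<beta> \<sigma> (h u) (free_flow (\<epsilon> * (u - s)) z))) \<in> borel_measurable borel"
proof -
 note [measurable (raw)] = joint_apply3[OF S] joint_apply[OF h]
 show ?thesis by measurable
qed

lemma coll_step_add:
 assumes S: "jointly_measurable3 S"
  and h: "jointly_measurable h"
  and h': "jointly_measurable h'"
 shows "coll_step \<beta> \<epsilon> S \<sigma> (%s z. h s z + h' s z) s z = coll_step \<beta> \<epsilon> S \<sigma> h s z + coll_step \<beta> \<epsilon> S \<sigma> h' s z"
 unfolding coll_step_def
 using coll_step_integrand_measurable[OF S h] coll_step_integrand_measurable[OF S h']
 by (subst nn_integral_add[symmetric])
  (auto intro!: nn_integral_cong simp: coll_op_add section_measurable[OF h] section_measurable[OF h'] distrib_left)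

lemma coll_step_suminf:
 assumes S: "jointly_measurable3 S"
  and h: "!!n. jointly_measurable (h n)"
 shows "coll_step \<beta> \<epsilon> S \<sigma> (%s z. \<Sum>n. h n s z) s z = (\<Sum>n. coll_step \<beta> \<epsilon> S \<sigma> (h n) s z)"
 unfolding coll_step_def
 using coll_step_integrand_measurable[OF S h]
 by (subst nn_integral_suminf[symmetric])
  (auto intro!: nn_integral_cong simp: coll_op_suminf section_measurable[OF h] ennreal_suminf_cmult)

lemma coll_step_periodic:
 assumes "!!u. lperiodic (h u)" "!!u. lperiodic (S u s)"
 shows "lperiodic (coll_step \<beta> \<epsilon> S \<sigma> h s)"
proof (rule lperiodicI)
 fix x v k :: "real ^ 'a" assume k: "\<forall>i. k $ i \<in> \<int>"
 show "coll_step \<beta> \<epsilon> S \<sigma> h s (x + k, v) = coll_step \<beta> \<epsilon> S \<sigma> h s (x, v)"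
  unfolding coll_step_def
  using lperiodicD[OF assms(2) k]
   lperiodicD[OF lperiodic_free_flow[OF coll_op_periodic[OF assms(1)]] k]
  by simp
qed

lemma path_weight_periodic:
 assumes "!!r. lperiodic (W r)"
 shows "lperiodic (path_weight \<epsilon> W u s)"
proof (rule lperiodicI)
 fix x v k :: "real ^ 'a" assume k: "\<forall>i. k $ i \<in> \<int>"
 show "path_weight \<epsilon> W u s (x + k, v) = path_weight \<epsilon> W u s (x, v)"
  unfolding path_weight_def
  using lperiodicD[OF lperiodic_free_flow[OF assms] k] by simp
qed

lemma coll_step_le_exp:
 assumes S: "!!u. 0 < u ==> u < s ==> S u s z <= ennreal (exp (C * (s - u)))"
  and h: "!!u. 0 < u ==> u < s ==> coll_op \<beta> \<sigma> (h u) (free_flow (\<epsilon> * (u - s)) z) <= ennreal (\<kappa> * exp (b * u))"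
  and b: "C < b" and \<kappa>: "0 <= \<kappa>" and s: "0 <= s"
 shows "coll_step \<beta> \<epsilon> S \<sigma> h s z <= ennreal (\<kappa> / (b - C) * exp (b * s))"
proof -
 let ?F = "%u. \<kappa> * exp (C * s) * exp ((b - C) * u) / (b - C)"
 let ?f = "%u. \<kappa> * exp (C * s) * exp ((b - C) * u)"
 have "coll_step \<beta> \<epsilon> S \<sigma> h s z <= (\<integral>\<^sup>+u. ennreal (?f u) * indicator {0..s} u \<partial>lborel)"
  unfolding coll_step_def
 proof (rule nn_integral_mono)
  fix u :: real
  show "indicator {0<..<s} u * (S u s z * coll_op \<beta> \<sigma> (h u) (free_flow (\<epsilon> * (u - s)) z)) <= ennreal (?f u) * indicator {0..s} u"
  proof (cases "0 < u \<and> u < s")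
   case True
   have "S u s z * coll_op \<beta> \<sigma> (h u) (free_flow (\<epsilon> * (u - s)) z) <= ennreal (exp (C * (s - u))) * ennreal (\<kappa> * exp (b * u))"
    using True by (intro mult_mono S h) auto
   also have "... = ennreal (?f u)"
    using \<kappa> by (subst ennreal_mult'[symmetric]) (auto simp: algebra_simps simp flip: exp_add)
   finally show ?thesis using True by simp
  qed (auto simp: indicator_def)
 qed
 also have "... = ennreal (?F s - ?F 0)"
  using s \<kappa> b by (intro nn_integral_FTC_Icc) (auto intro!: derivative_eq_intros)
 also have "... <= ennreal (?F s)"
  using \<kappa> b by (intro ennreal_leI) simp
 also have "?F s = \<kappa> / (b - C) * exp (b * s)"
  by (simp add: algebra_simps flip: exp_add)
 finally show ?thesis .
qed

primrec dyson :: "real => real => (real => real => 'n::finite phase => ennreal) => ('n phase => ennreal) => nat =>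
  real => 'n phase => ennreal" where
 "dyson \<beta> \<epsilon> S \<phi> 0 = (%s z. S 0 s z * \<phi> (free_flow (- (\<epsilon> * s)) z))"
| "dyson \<beta> \<epsilon> S \<phi> (Suc k) = coll_step \<beta> \<epsilon> S 1 (dyson \<beta> \<epsilon> S \<phi> k)"

definition dyson_sum :: "real => real => (real => real => 'n::finite phase => ennreal) => ('n phase => ennreal) =>
  real => 'n phase => ennreal" where
 "dyson_sum \<beta> \<epsilon> S \<phi> s z = (\<Sum>k. dyson \<beta> \<epsilon> S \<phi> k s z)"

lemma measurable_dyson:
 assumes S: "jointly_measurable3 S"
  and [measurable]: "\<phi> \<in> borel_measurable borel"
 shows "jointly_measurable (dyson \<beta> \<epsilon> S \<phi> k)"
proof (induction k)
 case 0
 note [measurable (raw)] = joint_apply3[OF S]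
 show ?case by simp
next
 case (Suc k)
 then show ?case using measurable_coll_step[OF S] by simp
qed

lemma measurable_dyson_sum:
 assumes S: "jointly_measurable3 S"
  and "\<phi> \<in> borel_measurable borel"
 shows "jointly_measurable (dyson_sum \<beta> \<epsilon> S \<phi>)"
proof -
 note [measurable (raw)] = joint_apply[OF measurable_dyson[OF assms]]
 show ?thesis unfolding dyson_sum_def by measurable
qed

lemma dyson_sum_unfold:
 assumes S: "jointly_measurable3 S"
  and "\<phi> \<in> borel_measurable borel"
 shows "dyson_sum \<beta> \<epsilon> S \<phi> s z = S 0 s z * \<phi> (free_flow (- (\<epsilon> * s)) z) + coll_step \<beta> \<epsilon> S 1 (dyson_sum \<beta> \<epsilon> S \<phi>) s z"
proof -
 have "dyson_sum \<beta> \<epsilon> S \<phi> s z = dyson \<beta> \<epsilon> S \<phi> 0 s z + (\<Sum>k. dyson \<beta> \<epsilon> S \<phi> (Suc k) s z)"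
  unfolding dyson_sum_def
  using sums_Suc[OF summable_sums[OF summableI], of "%k. dyson \<beta> \<epsilon> S \<phi> k s z"]
  by (simp only: sums_iff add.commute)
 also have "(\<Sum>k. dyson \<beta> \<epsilon> S \<phi> (Suc k) s z) = coll_step \<beta> \<epsilon> S 1 (%s z. \<Sum>k. dyson \<beta> \<epsilon> S \<phi> k s z) s z"
  using coll_step_suminf[OF S measurable_dyson[OF assms]] by simp
 finally show ?thesis by (simp add: dyson_sum_def[abs_def])
qed

text \<open>At the rate \<open>C + 2 K\<close> a collision step costs a factor \<open>1/2\<close>; so the partial sums stay below twice the
bound of the first term.\<close>

lemma dyson_sum_le:
 fixes S :: "real => real => 'n::finite phase => ennreal"
 assumes S: "jointly_measurable3 S"
  and \<phi>: "\<phi> \<in> borel_measurable borel"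
  and S_le: "!!u s z. 0 <= u ==> u <= s ==> S u s z <= ennreal (exp (C * (s - u)))" and C: "0 <= C"
  and K: "0 < K" "!!z :: 'n phase. gain \<beta> (%z. ennreal (wt \<alpha> z)) z <= ennreal (K * wt \<alpha> z)"
  and A: "0 <= A" "!!z. \<phi> z <= ennreal (A * wt \<alpha> z)" and s: "0 <= s"
 shows "dyson_sum \<beta> \<epsilon> S \<phi> s z <= ennreal (2 * A * exp ((C + 2 * K) * s) * wt \<alpha> z)"
proof -
 let ?b = "C + 2 * K"
 have part: "0 <= s ==> (\<Sum>k<n. dyson \<beta> \<epsilon> S \<phi> k s z) <= ennreal (2 * A * exp (?b * s) * wt \<alpha> z)" for n s z
 proof (induction n arbitrary: s z)
  case (Suc n)
  note [measurable (raw)] = joint_apply[OF measurable_dyson[OF S \<phi>]]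
  have "(\<Sum>k<n. coll_step \<beta> \<epsilon> S 1 (dyson \<beta> \<epsilon> S \<phi> k) s z) = coll_step \<beta> \<epsilon> S 1 (%s z. \<Sum>k<n. dyson \<beta> \<epsilon> S \<phi> k s z) s z"
  proof (induction n)
   case (Suc n)
   have "(%(s, z). \<Sum>k<n. dyson \<beta> \<epsilon> S \<phi> k s z) \<in> borel_measurable (borel \<Otimes>\<^sub>M borel)" by measurable
   from coll_step_add[OF S this measurable_dyson[OF S \<phi>]] Suc show ?case by simp
  qed (simp add: coll_step_def coll_op_def gain_def split_def)
  also have "... <= ennreal (K * (2 * A * wt \<alpha> z) / (?b - C) * exp (?b * s))"
  proof (rule coll_step_le_exp)
   fix u assume u: "0 < u" "u < s"
   show "S u s z <= ennreal (exp (C * (s - u)))" using u by (intro S_le) auto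
   have "coll_op \<beta> 1 (%z. \<Sum>k<n. dyson \<beta> \<epsilon> S \<phi> k u z) (free_flow (\<epsilon> * (u - s)) z)
     <= gain \<beta> (%z. ennreal (2 * A * exp (?b * u)) * ennreal (wt \<alpha> z)) (free_flow (\<epsilon> * (u - s)) z)"
    unfolding coll_op_def using u A(1)
    by (auto intro!: gain_mono order.trans[OF Suc.IH] simp: ennreal_mult'[symmetric])
   also have "... = ennreal (2 * A * exp (?b * u)) * gain \<beta> (%z. ennreal (wt \<alpha> z)) (free_flow (\<epsilon> * (u - s)) z)"
    by (rule gain_cmult) measurable
   also have "... <= ennreal (2 * A * exp (?b * u)) * ennreal (K * wt \<alpha> z)"
    using K(2)[of "free_flow (\<epsilon> * (u - s)) z"] by (intro mult_left_mono) auto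
   also have "... = ennreal (K * (2 * A * wt \<alpha> z) * exp (?b * u))"
    using A(1) by (subst ennreal_mult'[symmetric]) (auto simp: mult_ac)
   finally show "coll_op \<beta> 1 (%z. \<Sum>k<n. dyson \<beta> \<epsilon> S \<phi> k u z) (free_flow (\<epsilon> * (u - s)) z)
     <= ennreal (K * (2 * A * wt \<alpha> z) * exp (?b * u))" .
  qed (use K A Suc.prems in auto)
  finally have 1: "(\<Sum>k<n. coll_step \<beta> \<epsilon> S 1 (dyson \<beta> \<epsilon> S \<phi> k) s z) <= ennreal (A * exp (?b * s) * wt \<alpha> z)"
   using K(1) by (simp add: mult_ac)
  have "S 0 s z * \<phi> (free_flow (- (\<epsilon> * s)) z) <= ennreal (exp (C * (s - 0))) * ennreal (A * wt \<alpha> z)"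
   using Suc.prems by (intro mult_mono S_le order.trans[OF A(2)]) auto
  also have "... = ennreal (A * exp (C * s) * wt \<alpha> z)"
   using A(1) by (subst ennreal_mult'[symmetric]) (auto simp: mult_ac)
  also have "... <= ennreal (A * exp (?b * s) * wt \<alpha> z)"
   using A(1) K(1) Suc.prems by (intro ennreal_leI mult_right_mono mult_left_mono) (auto intro: mult_right_mono)
  finally have 2: "S 0 s z * \<phi> (free_flow (- (\<epsilon> * s)) z) <= ennreal (A * exp (?b * s) * wt \<alpha> z)" .
  have "(\<Sum>k<Suc n. dyson \<beta> \<epsilon> S \<phi> k s z) = S 0 s z * \<phi> (free_flow (- (\<epsilon> * s)) z) + (\<Sum>k<n. coll_step \<beta> \<epsilon> S 1 (dyson \<beta> \<epsilon> S \<phi> k) s z)"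
   unfolding sum.lessThan_Suc_shift by simp
  also have "... <= ennreal (A * exp (?b * s) * wt \<alpha> z) + ennreal (A * exp (?b * s) * wt \<alpha> z)"
   by (intro add_mono 1 2)
  also have "... = ennreal (2 * A * exp (?b * s) * wt \<alpha> z)"
   using A(1) by (subst ennreal_plus[symmetric]) auto
  finally show ?case .
 qed simp
 show ?thesis
  unfolding dyson_sum_def suminf_eq_SUP by (intro SUP_least part s)
qed

lemma path_weight_along:
 assumes c: "set_integrable lborel {0..s} (%r. W r (free_flow (\<epsilon> * r) z))" and u: "0 <= u" "u <= s"
 shows "path_weight \<epsilon> W u s (free_flow (\<epsilon> * s) z) =
  ennreal (exp ((LINT r:{0..u}|lborel. W r (free_flow (\<epsilon> * r) z)) - (LINT r:{0..s}|lborel. W r (free_flow (\<epsilon> * r) z))))"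
proof -
 let ?c = "%r. W r (free_flow (\<epsilon> * r) z)"
 have i2: "set_integrable lborel {u..s} ?c" by (rule set_integrable_subset[OF c]) (use u in auto)
 have i1: "set_integrable lborel {0..u} ?c" by (rule set_integrable_subset[OF c]) (use u in auto)
 have "(LINT r:{0..s}|lborel. ?c r) = (LINT r|lborel. indicator {0..u} r *\<^sub>R ?c r + indicator {u..s} r *\<^sub>R ?c r)"
  unfolding set_lebesgue_integral_def
 proof (rule integral_cong_AE)
  show "AE r in lborel. indicat_real {0..s} r *\<^sub>R ?c r = indicat_real {0..u} r *\<^sub>R ?c r + indicat_real {u..s} r *\<^sub>R ?c r"
   using AE_lborel_singleton[of u] by eventually_elim (use u in \<open>auto simp: indicator_def\<close>)
 qed (use c i1 i2 in \<open>auto simp: set_integrable_def\<close>)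
 also have "... = (LINT r:{0..u}|lborel. ?c r) + (LINT r:{u..s}|lborel. ?c r)"
  using i1 i2 unfolding set_lebesgue_integral_def set_integrable_def by (rule Bochner_Integration.integral_add)
 finally show ?thesis
  by (simp add: path_weight_def algebra_simps)
qed

text \<open>Along a characteristic a collision step is the integral in Duhamel's formula.\<close>

lemma coll_step_along:
 assumes c: "set_integrable lborel {0..s} (%r. W r (free_flow (\<epsilon> * r) z))"
  and k: "set_integrable lborel {0..s} k" "!!u. 0 <= u ==> u <= s ==> 0 <= k u"
  and h: "!!u. 0 <= u ==> u <= s ==> coll_op \<beta> \<sigma> (h u) (free_flow (\<epsilon> * u) z) = ennreal (k u)"
 defines "A \<equiv> %s. LINT r:{0..s}|lborel. W r (free_flow (\<epsilon> * r) z)"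
 shows "coll_step \<beta> \<epsilon> (path_weight \<epsilon> W) \<sigma> h s (free_flow (\<epsilon> * s) z) = ennreal (LINT u:{0..s}|lborel. exp (A u - A s) * k u)"
  and "0 <= (LINT u:{0..s}|lborel. exp (A u - A s) * k u)"
proof -
 have k0: "0 <= indicator {0..s} u *\<^sub>R (exp (A u - A s) * k u)" for u
  using k(2)[of u] by (simp add: indicator_def)
 have "coll_step \<beta> \<epsilon> (path_weight \<epsilon> W) \<sigma> h s (free_flow (\<epsilon> * s) z)
   = (\<integral>\<^sup>+u. ennreal (indicator {0..s} u *\<^sub>R (exp (A u - A s) * k u)) \<partial>lborel)"
  unfolding coll_step_def
 proof (rule nn_integral_cong_AE)
  show "AE u in lborel. indicator {0<..<s} u * (path_weight \<epsilon> W u s (free_flow (\<epsilon> * s) z) *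
    coll_op \<beta> \<sigma> (h u) (free_flow (\<epsilon> * (u - s)) (free_flow (\<epsilon> * s) z)))
    = ennreal (indicator {0..s} u *\<^sub>R (exp (A u - A s) * k u))"
   using AE_lborel_singleton[of 0] AE_lborel_singleton[of s]
  proof eventually_elim
   case (elim u)
   show ?case
   proof (cases "0 <= u \<and> u <= s")
    case True
    then have "coll_op \<beta> \<sigma> (h u) (free_flow (\<epsilon> * (u - s)) (free_flow (\<epsilon> * s) z)) = ennreal (k u)"
     using h[of u] by (simp add: algebra_simps)
    then show ?thesis
     using True elim path_weight_along[where W=W and \<epsilon>=\<epsilon> and z=z, OF c, of u] k(2)[of u] by (simp add: ennreal_mult' indicator_def A_def)
   qed (auto simp: indicator_def)
  qed
 qed
 also have "... = ennreal (LINT u:{0..s}|lborel. exp (A u - A s) * k u)"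
  unfolding set_lebesgue_integral_def[of lborel "{0..s}" "%u. exp (A u - A s) * k u"]
 proof (rule nn_integral_eq_integral)
  have "set_integrable lborel {0..s} (%u. k u * exp (A u - A s))"
   unfolding A_def by (intro set_integrable_mult_continuous k continuous_intros continuous_on_LINT_Icc c)
  then show "integrable lborel (%u. indicat_real {0..s} u *\<^sub>R (exp (A u - A s) * k u))"
   unfolding set_integrable_def by (simp add: mult.commute)
 qed (use k0 in simp)
 finally show "coll_step \<beta> \<epsilon> (path_weight \<epsilon> W) \<sigma> h s (free_flow (\<epsilon> * s) z) = ennreal (LINT u:{0..s}|lborel. exp (A u - A s) * k u)" .
 show "0 <= (LINT u:{0..s}|lborel. exp (A u - A s) * k u)"
  unfolding set_lebesgue_integral_def[of lborel "{0..s}" "%u. exp (A u - A s) * k u"]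
  using k0 by (intro integral_nonneg_AE AE_I2)
qed

text \<open>The sign \<open>\<epsilon>\<close> of the flow treats the forward and the time-reversed backward equation together.\<close>

locale bounded_potential =
 fixes \<beta> \<epsilon> C :: real and V :: "real => 'n::finite phase => real"
 assumes \<beta>: "\<beta> > 0"
  and V_meas: "jointly_measurable V"
  and V_bound: "\<bar>V s z\<bar> <= C"
  and V_per: "lperiodic (V s)"
begin

lemma C_nonneg: "0 <= C"
 using V_bound[of 0 undefined] by linarith

lemmas V_measurable [measurable (raw)] = joint_apply[OF V_meas]

abbreviation damped :: "real => 'n phase => real" where
 "damped \<equiv> %s z. V s z + freq \<beta> (snd z)"

lemma damped_meas: "jointly_measurable damped"
 by measurable

lemma damped_per: "lperiodic (damped s)"
 using lperiodicD[OF V_per] by (intro lperiodicI) simp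

text \<open>The series is summed in \<open>[0, \<infinity>]\<close>, where collision steps commute with it; finiteness is a separate matter.\<close>

definition lin_sol :: "('n phase => real) => real => 'n phase => real" where
 "lin_sol \<phi> s z = enn2real (dyson_sum \<beta> \<epsilon> (path_weight \<epsilon> damped) (%z. ennreal (\<phi> z)) s z)"

lemma integrable_along:
 assumes "a <= b" and [measurable]: "\<gamma> \<in> borel_measurable borel"
 shows "set_integrable lborel {a..b} (%r. V r (\<gamma> r))"
 unfolding set_integrable_def
proof (rule Bochner_Integration.integrable_bound)
 show "integrable lborel (%r. C * indicator {a..b} r)"
  using assms(1) by (intro integrable_mult_right integrable_real_indicator) auto
 show "AE r in lborel. norm (indicat_real {a..b} r *\<^sub>R V r (\<gamma> r)) <= norm (C * indicat_real {a..b} r)"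
  using V_bound C_nonneg by (intro AE_I2) (auto simp: indicator_def)
qed measurable

lemma damped_integrable:
 "set_integrable lborel {a..b} (%r. damped r (free_flow (c * r + d) z))"
proof (cases "a <= b")
 case True
 have "set_integrable lborel {a..b} (%r. freq \<beta> (snd z))"
  using borel_integrable_atLeastAtMost'[of a b "%_. freq \<beta> (snd z)"] by simp
 then show ?thesis
  using integrable_along[OF True, of "%r. free_flow (c * r + d) z"] by (simp add: set_integral_add)
qed simp

lemma path_weight_damped_le:
 assumes "u <= s"
 shows "path_weight \<epsilon> damped u s z <= ennreal (exp (C * (s - u)))"
proof -
 have "set_integrable lborel {u..s} (%_. - C)"
  using borel_integrable_atLeastAtMost'[of u s "%_. - C"] by simp
 then have "(LINT r:{u..s}|lborel. - C) <= (LINT r:{u..s}|lborel. damped r (free_flow (\<epsilon> * (r - s)) z))"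
 proof (rule set_integral_mono)
  show "set_integrable lborel {u..s} (%r. damped r (free_flow (\<epsilon> * (r - s)) z))"
   using damped_integrable[of u s \<epsilon> "- \<epsilon> * s" z] by (simp add: algebra_simps)
  fix r
  show "- C <= damped r (free_flow (\<epsilon> * (r - s)) z)"
   using V_bound[of r "free_flow (\<epsilon> * (r - s)) z"] freq_nonneg[of \<beta> "snd (free_flow (\<epsilon> * (r - s)) z)"] by linarith
 qed
 moreover have "(LINT r:{u..s}|lborel. - C) = - (C * (s - u))"
  using assms by (simp add: set_lebesgue_integral_def)
 ultimately show ?thesis by (simp add: path_weight_def)
qed

lemma path_weight_meas: "jointly_measurable3 (path_weight \<epsilon> damped)"
 by (rule measurable_path_weight[OF damped_meas])

context
 fixes \<phi> :: "'n phase => real" and \<alpha> A :: real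
 assumes \<phi>_meas [measurable]: "\<phi> \<in> borel_measurable borel"
  and \<phi>_nonneg: "!!z. 0 <= \<phi> z" and \<phi>_per: "lperiodic \<phi>"
  and \<alpha>: "0 < \<alpha>" "\<alpha> < \<beta> / 2" and \<phi>_bound: "!!z. \<phi> z <= A * wt \<alpha> z"
begin

abbreviation (input) "dsol \<equiv> dyson_sum \<beta> \<epsilon> (path_weight \<epsilon> damped) (%z. ennreal (\<phi> z))"

lemma dsol_meas: "jointly_measurable dsol"
 by (rule measurable_dyson_sum[OF path_weight_meas]) measurable

lemma lin_sol_meas: "jointly_measurable (lin_sol \<phi>)"
proof -
 note [measurable (raw)] = joint_apply[OF dsol_meas]
 show ?thesis unfolding lin_sol_def by measurable
qed

lemma lin_sol_nonneg: "0 <= lin_sol \<phi> s z"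
 by (simp add: lin_sol_def)

lemma lin_sol_per: "lperiodic (lin_sol \<phi> s)"
proof -
 have "lperiodic (dyson \<beta> \<epsilon> (path_weight \<epsilon> damped) (%z. ennreal (\<phi> z)) k s)" for k s
 proof (induction k arbitrary: s)
  case 0
  show ?case
   using lperiodicD[OF path_weight_periodic[of damped, OF damped_per]]
    lperiodicD[OF lperiodic_free_flow[OF \<phi>_per]]
   by (intro lperiodicI) simp
 next
  case (Suc k)
  then show ?case by (simp add: coll_step_periodic path_weight_periodic damped_per)
 qed
 then show ?thesis
  by (intro lperiodicI) (simp add: lin_sol_def dyson_sum_def lperiodicD)
qed

lemma A_nonneg: "0 <= A"
proof -
 have "0 <= A * vexp 0 \<alpha> (snd (0 :: 'n phase))" using \<phi>_nonneg \<phi>_bound by (rule order.trans)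
 then show ?thesis by (simp add: vexp_def)
qed

lemma lin_sol_bound:
 "\<exists>B\<ge>0. \<forall>s\<in>{0..T}. \<forall>z. dsol s z <= ennreal (B * wt \<alpha> z) \<and> lin_sol \<phi> s z <= B * wt \<alpha> z"
proof -
 obtain K where K: "0 < K" "!!z :: 'n phase. gain \<beta> (%z. ennreal (wt \<alpha> z)) z <= ennreal (K * wt \<alpha> z)"
  using gain_vexp_bound[OF \<beta> \<alpha>, of 0] by (metis atLeastAtMost_iff order_refl)
 let ?B = "2 * A * exp ((C + 2 * K) * T)"
 have B: "dsol s z <= ennreal (?B * wt \<alpha> z)" if "s \<in> {0..T}" for s z
 proof -
  have "dsol s z <= ennreal (2 * A * exp ((C + 2 * K) * s) * wt \<alpha> z)"
   using that \<phi>_bound A_nonneg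
   by (intro dyson_sum_le[OF path_weight_meas _ path_weight_damped_le C_nonneg K]) (auto intro: ennreal_leI)
  also have "... <= ennreal (?B * wt \<alpha> z)"
   using that K C_nonneg A_nonneg by (intro ennreal_leI mult_right_mono mult_left_mono) auto
  finally show ?thesis .
 qed
 show ?thesis
 proof (intro exI[of _ ?B] conjI ballI allI)
  show "0 <= ?B" using A_nonneg by simp
  fix s z assume s: "s \<in> {0..T}"
  show "dsol s z <= ennreal (?B * wt \<alpha> z)" by (rule B[OF s])
  then show "lin_sol \<phi> s z <= ?B * wt \<alpha> z"
   unfolding lin_sol_def using A_nonneg by (intro enn2real_leI) auto
 qed
qed

lemma ennreal_lin_sol: "0 <= s ==> ennreal (lin_sol \<phi> s z) = dsol s z"
proof -
 assume "0 <= s"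
 then have s: "s \<in> {0..s}" by simp
 obtain B where "\<forall>s\<in>{0..s}. \<forall>z. dsol s z <= ennreal (B * wt \<alpha> z) \<and> lin_sol \<phi> s z <= B * wt \<alpha> z"
  using lin_sol_bound[of s] by blast
 from this[rule_format, OF s, of z] have "dsol s z <= ennreal (B * wt \<alpha> z)" by (rule conjunct1)
 then have "dsol s z < \<top>" by (rule order.strict_trans1) simp
 then show ?thesis by (simp add: lin_sol_def)
qed

lemma lin_sol_0: "lin_sol \<phi> 0 z = \<phi> z"
proof -
 have "dsol 0 z = ennreal (\<phi> z)"
  by (subst dyson_sum_unfold[OF path_weight_meas]) (auto simp: coll_step_def path_weight_def LINT_Icc_0_0 simp del: atLeastAtMost_singleton)
 then show ?thesis by (simp add: lin_sol_def \<phi>_nonneg)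
qed

lemma lin_sol_pos:
 assumes "!!z. 0 < \<phi> z" "0 <= s"
 shows "0 < lin_sol \<phi> s z"
proof -
 have "0 < path_weight \<epsilon> damped 0 s z * ennreal (\<phi> (free_flow (- (\<epsilon> * s)) z))"
  using assms(1) by (simp add: path_weight_def ennreal_zero_less_mult_iff)
 also have "... <= dsol s z"
  by (subst dyson_sum_unfold[OF path_weight_meas]) auto
 also have "... = ennreal (lin_sol \<phi> s z)" by (rule ennreal_lin_sol[OF assms(2), symmetric])
 finally show ?thesis by simp
qed

lemma gain_dsol_bound:
 "\<exists>D\<ge>0. \<forall>s\<in>{0..T}. \<forall>z. gain \<beta> (dsol s) z <= ennreal (D * wt \<alpha> z)"
proof -
 obtain K where K: "0 < K" "!!z :: 'n phase. gain \<beta> (%z. ennreal (wt \<alpha> z)) z <= ennreal (K * wt \<alpha> z)"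
  using gain_vexp_bound[OF \<beta> \<alpha>, of 0] by (metis atLeastAtMost_iff order_refl)
 obtain B where B: "0 <= B" "!!s z. s \<in> {0..T} ==> dsol s z <= ennreal (B * wt \<alpha> z)"
  using lin_sol_bound[of T] by blast
 have "gain \<beta> (dsol s) y <= ennreal (B * K * wt \<alpha> y)" if "s \<in> {0..T}" for s y
 proof -
  have "gain \<beta> (dsol s) y <= gain \<beta> (%z. ennreal B * ennreal (wt \<alpha> z)) y"
   using B that by (intro gain_mono) (auto simp: ennreal_mult'[symmetric])
  also have "... = ennreal B * gain \<beta> (%z. ennreal (wt \<alpha> z)) y" by (rule gain_cmult) measurable
  also have "... <= ennreal B * ennreal (K * wt \<alpha> y)" by (intro mult_left_mono K) auto
  finally show ?thesis using B(1) by (simp add: ennreal_mult'[symmetric] mult.assoc)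
 qed
 then show ?thesis using B(1) K(1) by (intro exI[of _ "B * K"]) simp
qed

lemma ennreal_rgain_lin_sol:
 assumes s: "0 <= s"
 shows "ennreal (rgain \<beta> (lin_sol \<phi> s) y) = gain \<beta> (dsol s) y"
proof -
 note [measurable (raw)] = joint_apply[OF lin_sol_meas]
 have "s \<in> {0..s}" using s by simp
 obtain D where "\<forall>r\<in>{0..s}. \<forall>z. gain \<beta> (dsol r) z <= ennreal (D * wt \<alpha> z)"
  using gain_dsol_bound[of s] by blast
 from this[rule_format, OF \<open>s \<in> {0..s}\<close>, of y] have "gain \<beta> (dsol s) y < \<top>" by (rule order.strict_trans1) simp
 moreover have "rgain \<beta> (lin_sol \<phi> s) y = enn2real (gain \<beta> (%z. ennreal (lin_sol \<phi> s z)) y)"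
  by (rule rgain_nonneg_eq) (auto simp: lin_sol_nonneg)
 ultimately show ?thesis using s by (simp add: ennreal_lin_sol)
qed

lemma rgain_lin_sol_integrable:
 "set_integrable lborel {0..T} (%s. rgain \<beta> (lin_sol \<phi> s) (free_flow (\<epsilon> * s) z))"
  (is "set_integrable lborel _ ?h")
 unfolding set_integrable_def
proof -
 note [measurable (raw)] = joint_apply[OF lin_sol_meas]
 obtain D where D: "0 <= D" "\<forall>r\<in>{0..T}. \<forall>z. gain \<beta> (dsol r) z <= ennreal (D * wt \<alpha> z)"
  using gain_dsol_bound[of T] by blast
 have h0: "0 <= ?h s" for s by (simp add: rgain_nonneg_eq lin_sol_nonneg)
 show "integrable lborel (%s. indicat_real {0..T} s *\<^sub>R ?h s)"
 proof (rule Bochner_Integration.integrable_bound)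
  show "integrable lborel (%s. (D * wt \<alpha> z) * indicator {0..T} s)"
   by (intro integrable_mult_right integrable_real_indicator) (auto simp: emeasure_lborel_Icc_eq)
  show "AE s in lborel. norm (indicat_real {0..T} s *\<^sub>R ?h s) <= norm ((D * wt \<alpha> z) * indicat_real {0..T} s)"
  proof (rule AE_I2)
   fix s
   show "norm (indicat_real {0..T} s *\<^sub>R ?h s) <= norm ((D * wt \<alpha> z) * indicat_real {0..T} s)"
   proof (cases "s \<in> {0..T}")
    case True
    then have "ennreal (?h s) <= ennreal (D * wt \<alpha> z)"
     using D(2)[rule_format, OF True, of "free_flow (\<epsilon> * s) z"] by (simp add: ennreal_rgain_lin_sol)
    then have "?h s <= D * wt \<alpha> z"
     using D(1) by (subst (asm) ennreal_le_iff) auto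
    with True h0[of s] D(1) show ?thesis by simp
   qed simp
  qed
 qed measurable
qed

text \<open>The equation holds along every characteristic, not only along almost every one, because the series
satisfies its fixed point equation pointwise.\<close>

lemma lin_sol_primitive:
 "primitive_on T (%s. lin_sol \<phi> s (free_flow (\<epsilon> * s) z))
  (%s. rgain \<beta> (lin_sol \<phi> s) (free_flow (\<epsilon> * s) z) - damped s (free_flow (\<epsilon> * s) z) * lin_sol \<phi> s (free_flow (\<epsilon> * s) z))"
proof -
 let ?c = "%s. damped s (free_flow (\<epsilon> * s) z)"
 let ?h = "%s. rgain \<beta> (lin_sol \<phi> s) (free_flow (\<epsilon> * s) z)"
 let ?A = "%s. LINT r:{0..s}|lborel. ?c r"
 note [measurable (raw)] = joint_apply[OF lin_sol_meas]
 note rg = ennreal_rgain_lin_sol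
 have h0: "0 <= ?h s" for s by (simp add: rgain_nonneg_eq lin_sol_nonneg)
 have c: "set_integrable lborel {0..T} ?c" using damped_integrable[of 0 T \<epsilon> 0 z] by simp
 note h = rgain_lin_sol_integrable[of T z]
 show ?thesis
 proof (rule duhamel_primitive_on[OF c h])
  fix s assume s: "0 <= s" "s <= T"
  have cs: "set_integrable lborel {0..s} ?c" by (rule set_integrable_Icc_mono[OF c s(2)])
  have hs: "set_integrable lborel {0..s} ?h" by (rule set_integrable_Icc_mono[OF h s(2)])
  have pos: "0 <= (LINT u:{0..s}|lborel. exp (?A u - ?A s) * ?h u)"
   by (rule coll_step_along(2)[where W=damped and \<epsilon>=\<epsilon> and z=z and h=dsol and \<beta>=\<beta> and \<sigma>=1, OF cs hs h0]) (use rg s in \<open>simp add: coll_op_def\<close>)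
  have "dsol s (free_flow (\<epsilon> * s) z) = path_weight \<epsilon> damped 0 s (free_flow (\<epsilon> * s) z) * ennreal (\<phi> z)
    + coll_step \<beta> \<epsilon> (path_weight \<epsilon> damped) 1 dsol s (free_flow (\<epsilon> * s) z)"
   by (subst dyson_sum_unfold[OF path_weight_meas]) auto
  also have "path_weight \<epsilon> damped 0 s (free_flow (\<epsilon> * s) z) * ennreal (\<phi> z) = ennreal (exp (- ?A s) * \<phi> z)"
   using path_weight_along[where W=damped and \<epsilon>=\<epsilon> and z=z, OF cs order_refl s(1)] \<phi>_nonneg[of z]
   by (simp add: LINT_Icc_0_0 ennreal_mult' del: atLeastAtMost_singleton)
  also have "coll_step \<beta> \<epsilon> (path_weight \<epsilon> damped) 1 dsol s (free_flow (\<epsilon> * s) z) = ennreal (LINT u:{0..s}|lborel. exp (?A u - ?A s) * ?h u)"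
   by (rule coll_step_along(1)[where W=damped and \<epsilon>=\<epsilon> and z=z, OF cs hs h0]) (use rg s in \<open>simp add: coll_op_def\<close>)
  also have "ennreal (exp (- ?A s) * \<phi> z) + ennreal (LINT u:{0..s}|lborel. exp (?A u - ?A s) * ?h u)
    = ennreal (exp (- ?A s) * \<phi> z + (LINT u:{0..s}|lborel. exp (?A u - ?A s) * ?h u))"
   using \<phi>_nonneg[of z] by (intro ennreal_plus[symmetric] pos) auto
  finally have dsol_eq: "dsol s (free_flow (\<epsilon> * s) z) = ennreal (exp (- ?A s) * \<phi> z + (LINT u:{0..s}|lborel. exp (?A u - ?A s) * ?h u))" .
  have "0 <= exp (- ?A s) * \<phi> z + (LINT u:{0..s}|lborel. exp (?A u - ?A s) * ?h u)"
   using \<phi>_nonneg[of z] by (intro add_nonneg_nonneg mult_nonneg_nonneg pos) auto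
  then have "lin_sol \<phi> s (free_flow (\<epsilon> * s) z) = exp (- ?A s) * \<phi> z + (LINT u:{0..s}|lborel. exp (?A u - ?A s) * ?h u)"
   by (simp only: lin_sol_def dsol_eq enn2real_ennreal)
  also have "(LINT u:{0..s}|lborel. exp (?A u - ?A s) * ?h u) = exp (- ?A s) * (LINT u:{0..s}|lborel. exp (?A u) * ?h u)"
   unfolding set_integral_mult_right[symmetric]
   by (intro set_lebesgue_integral_cong) (auto simp: exp_diff exp_minus field_simps)
  finally show "lin_sol \<phi> s (free_flow (\<epsilon> * s) z) = exp (- ?A s) * (\<phi> z + (LINT r:{0..s}|lborel. exp (?A r) * ?h r))"
   by (simp only: distrib_left)
 qed
qed

end

end

section \<open>Uniqueness for the linear equation\<close>

definition transported ::
 "real => real => (real => 'n::finite phase => real) => (real => 'n phase => real) => bool" where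
 "transported \<epsilon> T h F \<longleftrightarrow>
  (AE z in lborel. primitive_on T (%s. h s (free_flow (\<epsilon> * s) z)) (%s. F s (free_flow (\<epsilon> * s) z)))"

lemma primitive_on_values:
 assumes "!!s. s \<in> {0..T} ==> y s = y' s" "!!s. s \<in> {0..T} ==> a s = a' s"
 shows "primitive_on T y a \<longleftrightarrow> primitive_on T y' a'"
proof -
 have "primitive_on T y' a'" if "primitive_on T y a" "!!s. s \<in> {0..T} ==> y s = y' s" "!!s. s \<in> {0..T} ==> a s = a' s" for y a y' a'
 proof (rule primitive_onI)
  have "(%s. indicat_real {0..T} s *\<^sub>R a s) = (%s. indicat_real {0..T} s *\<^sub>R a' s)"
   using that(3) by (auto simp: fun_eq_iff indicator_def)
  then show "set_integrable lborel {0..T} a'"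
   using primitive_onD(1)[OF that(1)] by (simp add: set_integrable_def)
  fix s assume s: "0 <= s" "s <= T"
  have "(LINT r:{0..s}|lborel. a r) = (LINT r:{0..s}|lborel. a' r)"
   using that(3) s by (intro set_lebesgue_integral_cong) auto
  then show "y' s = y' 0 + (LINT r:{0..s}|lborel. a' r)"
   using primitive_onD(2)[OF that(1) s] that(2)[of s] that(2)[of 0] s by simp
 qed
 from this[of y a y' a'] this[of y' a' y a] assms show ?thesis by metis
qed

lemma has_transport_deriv_iff:
 fixes h F :: "real => 'n::finite phase => real"
 shows "has_transport_deriv t h F \<longleftrightarrow> time_phase_fun t h \<and> time_phase_fun t F \<and> transported 1 t h F"
proof -
 let ?Q = "%z. primitive_on t (%s. h s (free_flow s z)) (%s. F s (free_flow s z))"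
 have "(AE z in phase_measure. ?Q z) \<longleftrightarrow> (AE z in lborel. ?Q z)" if h: "time_phase_fun t h" and F: "time_phase_fun t F"
 proof
  have "lperiodic ?Q"
  proof (rule lperiodicI)
   fix x v k :: "real ^ 'n" assume k: "\<forall>i. k $ i \<in> \<int>"
   show "?Q (x + k, v) = ?Q (x, v)"
   proof (rule primitive_on_values)
    fix s assume s: "s \<in> {0..t}"
    show "h s (free_flow s (x + k, v)) = h s (free_flow s (x, v))"
     by (rule lperiodicD[OF lperiodic_free_flow[OF time_phase_fun_section(2)[OF h s]] k])
    show "F s (free_flow s (x + k, v)) = F s (free_flow s (x, v))"
     by (rule lperiodicD[OF lperiodic_free_flow[OF time_phase_fun_section(2)[OF F s]] k])
   qed
  qed
  then show "(AE z in phase_measure. ?Q z) ==> (AE z in lborel. ?Q z)" by (rule AE_phase_imp_lborel)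
 qed (rule AE_lborel_imp_phase)
 then show ?thesis
  unfolding has_transport_deriv_def transported_def primitive_on_def by auto
qed

text \<open>The free flow preserves Lebesgue measure; the rest is Fubini's theorem.\<close>

lemma AE_along_flow_swap:
 fixes P :: "real => 'n::finite phase => bool"
 assumes P: "Measurable.pred (borel \<Otimes>\<^sub>M borel) (%(s, z). P s z)"
 shows "(AE z in lborel. AE s in lborel. P s (free_flow (\<epsilon> * s) z)) \<longleftrightarrow> (AE s in lborel. AE z in lborel. P s z)"
proof -
 have "Measurable.pred (borel \<Otimes>\<^sub>M borel) (%(s, z). P s (free_flow (\<epsilon> * s) z))"
  using measurable_compose[OF _ P, of "%x. (fst x, free_flow (\<epsilon> * fst x) (snd x))" "borel \<Otimes>\<^sub>M borel"]
  by (simp add: split_beta)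
 then have "(AE z in lborel. AE s in lborel. P s (free_flow (\<epsilon> * s) z)) \<longleftrightarrow> (AE s in lborel. AE z in lborel. P s (free_flow (\<epsilon> * s) z))"
  by (rule AE_lborel_swap[symmetric])
 then show ?thesis by (simp add: AE_lborel_free_flow_iff)
qed

lemma transported_reflect:
 assumes "transported \<epsilon> T h F"
 shows "transported (- \<epsilon>) T (%s. h (T - s)) (%s z. - F (T - s) z)"
 using AE_lborel_free_flow[OF assms[unfolded transported_def], of "- (\<epsilon> * T)"]
 unfolding transported_def
proof eventually_elim
 case (elim z)
 have "\<epsilon> * (T - s) + - (\<epsilon> * T) = - \<epsilon> * s" for s by (simp add: algebra_simps)
 with primitive_on_reflect[OF elim] show ?case by simp
qed

lemma transported_unique:
 fixes h F F' :: "real => 'n::finite phase => real"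
 assumes h: "transported \<epsilon> T h F" "transported \<epsilon> T h F'"
  and F: "jointly_measurable F"
  and F': "jointly_measurable F'"
 shows "AE s in lborel. AE z in lborel. s \<in> {0..T} --> F s z = F' s z"
proof -
 note [measurable (raw)] = joint_apply[OF F] joint_apply[OF F']
 have "AE z in lborel. AE s in lborel. s \<in> {0..T} --> F s (free_flow (\<epsilon> * s) z) = F' s (free_flow (\<epsilon> * s) z)"
  using h[unfolded transported_def] by eventually_elim (rule primitive_on_unique)
 then show ?thesis
  by (subst (asm) AE_along_flow_swap[where P="%s z. s \<in> {0..T} --> F s z = F' s z"]) measurable
qed

context bounded_potential
begin

text \<open>Duhamel's formula improves a bound \<open>c e\<^bsup>\<lambda>s\<^esup> e\<^bsup>\<alpha>|v|^2\<^esup>\<close> by a factor \<open>1/2\<close> if \<open>\<lambda>\<close> is large; this is iterated.\<close>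

lemma lin_unique:
 fixes \<delta> :: "real => 'n phase => real"
 assumes \<delta>: "jointly_measurable \<delta>"
  and \<alpha>: "0 < \<alpha>" "\<alpha> < \<beta> / 2" and D: "0 <= D"
  and bnd: "AE s in lborel. AE z in lborel. s \<in> {0..T} --> \<bar>\<delta> s z\<bar> <= D * wt \<alpha> z"
  and tr: "transported \<epsilon> T \<delta> (%s z. rgain \<beta> (\<delta> s) z - damped s z * \<delta> s z)"
  and init: "AE z in lborel. \<delta> 0 z = 0"
  and s: "s \<in> {0..T}"
 shows "AE z in lborel. \<delta> s z = 0"
proof -
 note [measurable (raw)] = joint_apply[OF \<delta>]
 have \<delta>_sec[measurable]: "\<delta> s \<in> borel_measurable borel" for s by (rule section_measurable[OF \<delta>])
 obtain K where K: "0 < K" "!!z :: 'n phase. gain \<beta> (%z. ennreal (wt \<alpha> z)) z <= ennreal (K * wt \<alpha> z)"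
  using gain_vexp_bound[OF \<beta> \<alpha>, of 0] by (metis atLeastAtMost_iff order_refl)
 define \<mu> where "\<mu> = 2 * exp (C * T) * K"
 have \<mu>: "\<mu> > 0" using K by (simp add: \<mu>_def)
 have step: "AE z in lborel. \<forall>s\<in>{0..T}. \<bar>\<delta> s (free_flow (\<epsilon> * s) z)\<bar> <= E / 2 * exp (\<mu> * s) * wt \<alpha> z"
  if E: "0 <= E" and ae: "AE s in lborel. AE z in lborel. s \<in> {0..T} --> \<bar>\<delta> s z\<bar> <= E * exp (\<mu> * s) * wt \<alpha> z" for E
 proof -
  have "AE s in lborel. AE z in lborel. s \<in> {0..T} --> \<bar>rgain \<beta> (\<delta> s) z\<bar> <= E * exp (\<mu> * s) * K * wt \<alpha> z"
   using ae
  proof eventually_elim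
   case (elim s)
   show ?case
   proof (cases "s \<in> {0..T}")
    case True
    with elim have "AE z in lborel. ennreal \<bar>\<delta> s z\<bar> <= ennreal (E * exp (\<mu> * s)) * ennreal (wt \<alpha> z)"
     using E by (auto simp: ennreal_mult'[symmetric] elim!: eventually_mono intro!: ennreal_leI)
    from gain_mono_AE[OF \<beta> _ _ this]
    have "AE z in lborel. gain \<beta> (%z. ennreal \<bar>\<delta> s z\<bar>) z <= gain \<beta> (%z. ennreal (E * exp (\<mu> * s)) * ennreal (wt \<alpha> z)) z"
     by simp
    then show ?thesis
    proof eventually_elim
     case (elim z)
     have "ennreal \<bar>rgain \<beta> (\<delta> s) z\<bar> <= gain \<beta> (%z. ennreal \<bar>\<delta> s z\<bar>) z" by (rule rgain_abs_le) measurable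
     also note elim
     also have "gain \<beta> (%z. ennreal (E * exp (\<mu> * s)) * ennreal (wt \<alpha> z)) z = ennreal (E * exp (\<mu> * s)) * gain \<beta> (%z. ennreal (wt \<alpha> z)) z"
      by (rule gain_cmult) measurable
     also have "... <= ennreal (E * exp (\<mu> * s)) * ennreal (K * wt \<alpha> z)" by (intro mult_left_mono K) auto
     also have "... = ennreal (E * exp (\<mu> * s) * K * wt \<alpha> z)" using E by (simp add: ennreal_mult'[symmetric] mult.assoc)
     finally show ?case using E K(1) by (subst (asm) ennreal_le_iff) auto
    qed
   next
    case False
    then show ?thesis by (intro AE_I2) blast
   qed
  qed
  then have "AE z in lborel. AE s in lborel. s \<in> {0..T} --> \<bar>rgain \<beta> (\<delta> s) (free_flow (\<epsilon> * s) z)\<bar> <= E * exp (\<mu> * s) * K * vexp 0 \<alpha> (snd (free_flow (\<epsilon> * s) z))"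
   by (subst AE_along_flow_swap[where P="%s z. s \<in> {0..T} --> \<bar>rgain \<beta> (\<delta> s) z\<bar> <= E * exp (\<mu> * s) * K * wt \<alpha> z"]) measurable
  then show ?thesis using tr[unfolded transported_def] init
  proof eventually_elim
   case (elim z)
   let ?h = "%s. rgain \<beta> (\<delta> s) (free_flow (\<epsilon> * s) z)"
   let ?b = "%s. E * exp (\<mu> * s) * K * wt \<alpha> z"
   have ib: "set_integrable lborel {0..S} ?b" for S
    by (intro borel_integrable_atLeastAtMost') (auto intro!: continuous_intros)
   have h: "set_integrable lborel {0..T} ?h"
    unfolding set_integrable_def
   proof (rule Bochner_Integration.integrable_bound)
    show "integrable lborel (%s. indicat_real {0..T} s *\<^sub>R ?b s)" using ib by (simp add: set_integrable_def)
    show "AE s in lborel. norm (indicat_real {0..T} s *\<^sub>R ?h s) <= norm (indicat_real {0..T} s *\<^sub>R ?b s)"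
     using elim(1) by eventually_elim (use E K(1) in \<open>auto simp: indicator_def\<close>)
   qed measurable
   have c: "set_integrable lborel {0..T} (%s. damped s (free_flow (\<epsilon> * s) z))"
    using damped_integrable[of 0 T \<epsilon> 0 z] by simp
   show ?case
   proof
    fix s assume s: "s \<in> {0..T}"
    have hs: "set_integrable lborel {0..s} ?h" using s by (intro set_integrable_Icc_mono[OF h]) auto
    have "\<bar>\<delta> s (free_flow (\<epsilon> * s) z)\<bar> <= exp (C * T) * (LINT r:{0..s}|lborel. \<bar>?h r\<bar>)"
    proof (rule primitive_on_gronwall[OF c _ C_nonneg h elim(2)])
     fix r show "- C <= damped r (free_flow (\<epsilon> * r) z)"
      using V_bound[of r "free_flow (\<epsilon> * r) z"] freq_nonneg[of \<beta> "snd (free_flow (\<epsilon> * r) z)"] by linarith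
    qed (use elim s in auto)
    also have "(LINT r:{0..s}|lborel. \<bar>?h r\<bar>) <= (LINT r:{0..s}|lborel. ?b r)"
     unfolding set_lebesgue_integral_def
    proof (rule integral_mono_AE)
     show "AE r in lborel. indicat_real {0..s} r *\<^sub>R \<bar>?h r\<bar> <= indicat_real {0..s} r *\<^sub>R ?b r"
      using elim(1) by eventually_elim (use s in \<open>auto simp: indicator_def\<close>)
    qed (use set_integrable_abs[OF hs] ib[of s] in \<open>auto simp: set_integrable_def\<close>)
    also have "(LINT r:{0..s}|lborel. ?b r) = E * K * wt \<alpha> z * ((exp (\<mu> * s) - 1) / \<mu>)"
    proof -
     have "(LINT r|lborel. exp (\<mu> * r) * indicator {0..s} r) = exp (\<mu> * s) / \<mu> - exp (\<mu> * 0) / \<mu>"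
      using s \<mu> by (intro integral_FTC_Icc_real) (auto intro!: derivative_eq_intros continuous_intros)
     then have "(LINT r:{0..s}|lborel. exp (\<mu> * r)) = (exp (\<mu> * s) - 1) / \<mu>"
      by (simp add: set_lebesgue_integral_def mult.commute diff_divide_distrib)
     moreover have "(LINT r:{0..s}|lborel. ?b r) = (LINT r:{0..s}|lborel. (E * K * wt \<alpha> z) * exp (\<mu> * r))"
      by (intro set_lebesgue_integral_cong) (auto simp: mult_ac)
     ultimately show ?thesis by simp
    qed
    also have "exp (C * T) * (E * K * wt \<alpha> z * ((exp (\<mu> * s) - 1) / \<mu>)) = E / 2 * (exp (\<mu> * s) - 1) * wt \<alpha> z"
     using K(1) by (simp add: \<mu>_def field_simps)
    also have "... <= E / 2 * exp (\<mu> * s) * wt \<alpha> z"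
     using E by (intro mult_right_mono mult_left_mono) auto
    finally show "\<bar>\<delta> s (free_flow (\<epsilon> * s) z)\<bar> <= E / 2 * exp (\<mu> * s) * wt \<alpha> z" by simp
   qed
  qed
 qed
 have start: "AE s in lborel. AE z in lborel. s \<in> {0..T} --> \<bar>\<delta> s z\<bar> <= D * exp (\<mu> * s) * wt \<alpha> z"
  using bnd
 proof eventually_elim
  case (elim s)
  then show ?case
  proof eventually_elim
   case (elim z)
   show ?case
   proof
    assume s: "s \<in> {0..T}"
    with elim have "\<bar>\<delta> s z\<bar> <= D * 1 * wt \<alpha> z" by simp
    also have "... <= D * exp (\<mu> * s) * wt \<alpha> z"
     using s \<mu> D by (intro mult_right_mono mult_left_mono) auto
    finally show "\<bar>\<delta> s z\<bar> <= D * exp (\<mu> * s) * wt \<alpha> z" .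
   qed
  qed
 qed
 have iter: "AE s in lborel. AE z in lborel. s \<in> {0..T} --> \<bar>\<delta> s z\<bar> <= D / 2 ^ n * exp (\<mu> * s) * wt \<alpha> z" for n
 proof (induction n)
  case (Suc n)
  have "AE z in lborel. AE s in lborel. s \<in> {0..T} --> \<bar>\<delta> s (free_flow (\<epsilon> * s) z)\<bar> <= D / 2 ^ Suc n * exp (\<mu> * s) * vexp 0 \<alpha> (snd (free_flow (\<epsilon> * s) z))"
   using step[OF _ Suc.IH] D by (auto elim!: eventually_mono simp: field_simps)
  then show ?case
   by (subst (asm) AE_along_flow_swap[where P="%s z. s \<in> {0..T} --> \<bar>\<delta> s z\<bar> <= D / 2 ^ Suc n * exp (\<mu> * s) * wt \<alpha> z"]) measurable
 qed (use start in simp)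
 have "AE z in lborel. \<forall>n. \<bar>\<delta> s (free_flow (\<epsilon> * s) z)\<bar> <= D / 2 ^ n / 2 * exp (\<mu> * s) * wt \<alpha> z"
  unfolding AE_all_countable
 proof
  fix n
  from step[OF _ iter[of n]] D
  have "AE z in lborel. \<forall>s\<in>{0..T}. \<bar>\<delta> s (free_flow (\<epsilon> * s) z)\<bar> <= D / 2 ^ n / 2 * exp (\<mu> * s) * wt \<alpha> z" by simp
  then show "AE z in lborel. \<bar>\<delta> s (free_flow (\<epsilon> * s) z)\<bar> <= D / 2 ^ n / 2 * exp (\<mu> * s) * wt \<alpha> z"
   using s by (auto elim!: eventually_mono)
 qed
 then have "AE z in lborel. \<delta> s (free_flow (\<epsilon> * s) z) = 0"
 proof eventually_elim
  case (elim z)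
  have "(%n. D / 2 * exp (\<mu> * s) * wt \<alpha> z * (1 / 2) ^ n) \<longlonglongrightarrow> D / 2 * exp (\<mu> * s) * wt \<alpha> z * 0"
   by (intro tendsto_intros LIMSEQ_power_zero) simp
  then have "\<bar>\<delta> s (free_flow (\<epsilon> * s) z)\<bar> <= D / 2 * exp (\<mu> * s) * wt \<alpha> z * 0"
   by (rule LIMSEQ_le_const) (use elim in \<open>auto simp: power_divide field_simps\<close>)
  then show ?case by simp
 qed
 then show ?thesis
  using AE_lborel_free_flow_iff[where Q="%z. \<delta> s z = 0" and a="\<epsilon> * s"] by blast
qed

end

section \<open>Partial derivatives of the Hamiltonian\<close>

lemma phase_integral:
 fixes f :: "'n::finite phase => real"
 shows "integrable phase_measure f \<longleftrightarrow> integrable lborel (%z. indicator unit_cell (fst z) * f z)"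
  and "(LINT z|phase_measure. f z) = (LINT z|lborel. indicator unit_cell (fst z) * f z)"
proof -
 have e: "(%z. indicator (unit_cell \<times> UNIV) z *\<^sub>R f z) = (%z. indicator unit_cell (fst z) * f z)"
  by (auto simp: fun_eq_iff indicator_def)
 have S: "(unit_cell \<times> UNIV :: 'n phase set) \<inter> space lborel \<in> sets lborel"
  using cell_times_UNIV_measurable by simp
 show "integrable phase_measure f \<longleftrightarrow> integrable lborel (%z. indicator unit_cell (fst z) * f z)"
  unfolding phase_measure_def integrable_restrict_space[OF S] e ..
 show "(LINT z|phase_measure. f z) = (LINT z|lborel. indicator unit_cell (fst z) * f z)"
  unfolding phase_measure_def integral_restrict_space[OF S] e ..
qed

lemma emeasure_cell_ball_finite:
 "emeasure lborel {z :: 'n::finite phase. fst z \<in> unit_cell \<and> norm (snd z) <= R} < \<infinity>"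
proof (rule emeasure_bounded_finite)
 have "{z :: 'n phase. fst z \<in> unit_cell \<and> norm (snd z) <= R} \<subseteq> cbox 0 1 \<times> cball 0 R"
  by (auto simp: unit_cell_def mem_box_cart less_imp_le)
 then show "bounded {z :: 'n phase. fst z \<in> unit_cell \<and> norm (snd z) <= R}"
  by (rule bounded_subset[rotated]) (intro bounded_Times bounded_cbox bounded_cball)
qed

lemma cell_ball_measurable [measurable]:
 "{z :: 'n::finite phase. fst z \<in> unit_cell \<and> norm (snd z) <= R} \<in> sets borel"
 by measurable

lemma integrable_phase_bounded_support:
 fixes f :: "'n::finite phase => real"
 assumes [measurable]: "f \<in> borel_measurable borel"
  and "AE z in lborel. \<bar>f z\<bar> <= c" "!!z. f z \<noteq> 0 ==> norm (snd z) <= R"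
 shows "integrable phase_measure f"
 unfolding phase_integral
proof (rule Bochner_Integration.integrable_bound)
 let ?S = "{z :: 'n phase. fst z \<in> unit_cell \<and> norm (snd z) <= R}"
 show "integrable lborel (%z. c * indicator ?S z)"
  using emeasure_cell_ball_finite[of R, where 'n='n] by (intro integrable_mult_right integrable_real_indicator) auto
 show "AE z in lborel. norm (indicator unit_cell (fst z) * f z) <= norm (c * indicator ?S z)"
  using assms(2) by eventually_elim (use assms(3) in \<open>auto simp: indicator_def\<close>)
qed measurable

lemma abs_exp_minus_one_le:
 fixes x :: real
 shows "\<bar>exp x - 1\<bar> <= \<bar>x\<bar> * exp \<bar>x\<bar>"
proof (cases "0 <= x")
 case True
 have "1 - x <= exp (- x)" using exp_ge_add_one_self[of "- x"] by simp
 then have "(1 - x) * exp x <= exp (- x) * exp x" by (rule mult_right_mono) simp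
 then have "exp x - 1 <= x * exp x" by (simp add: algebra_simps flip: exp_add)
 with True show ?thesis by simp
next
 case False
 then have "1 - exp x <= - x" using exp_ge_add_one_self[of x] by linarith
 also have "... <= - x * exp (- x)" using False by (simp add: mult_le_cancel_left1)
 finally show ?thesis using False by simp
qed

lemma abs_exp_remainder_le:
 fixes x :: real
 shows "\<bar>exp x - 1 - x\<bar> <= x\<^sup>2 * exp \<bar>x\<bar>"
proof -
 have "1 - x <= exp (- x)" using exp_ge_add_one_self[of "- x"] by simp
 then have "(1 - x) * exp x <= exp (- x) * exp x" by (rule mult_right_mono) simp
 then have "exp x - 1 - x <= x * (exp x - 1)" by (simp add: algebra_simps flip: exp_add)
 also have "... <= \<bar>x\<bar> * \<bar>exp x - 1\<bar>" by (metis abs_ge_self abs_mult)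
 also have "... <= \<bar>x\<bar> * (\<bar>x\<bar> * exp \<bar>x\<bar>)" by (intro mult_left_mono abs_exp_minus_one_le) simp
 finally have "exp x - 1 - x <= x\<^sup>2 * exp \<bar>x\<bar>" by (simp add: power2_eq_square mult.assoc[symmetric])
 moreover have "0 <= exp x - 1 - x" using exp_ge_add_one_self[of x] by linarith
 ultimately show ?thesis by simp
qed

lemma has_derivative_at_0_quadratic:
 fixes \<Phi> :: "real => real"
 assumes "!!\<epsilon>. \<bar>\<epsilon>\<bar> <= 1 ==> \<bar>\<Phi> \<epsilon> - \<Phi> 0 - \<epsilon> * L\<bar> <= c * \<epsilon>\<^sup>2"
 shows "(\<Phi> has_real_derivative L) (at 0)"
 unfolding DERIV_def
proof (rule LIM_zero_cancel, rule Lim_null_comparison)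
 show "((%h. c * \<bar>h\<bar>) \<longlongrightarrow> 0) (at (0::real))"
  using tendsto_mult[OF tendsto_const[of c] tendsto_rabs_zero[OF tendsto_ident_at[of "0::real" UNIV]]] by simp
 show "\<forall>\<^sub>F h in at 0. norm ((\<Phi> (0 + h) - \<Phi> 0) / h - L) <= c * \<bar>h\<bar>"
  unfolding eventually_at
 proof (intro exI[of _ 1] conjI ballI impI)
  fix h :: real assume "h \<noteq> 0 \<and> dist h 0 < 1"
  then have h: "h \<noteq> 0" "\<bar>h\<bar> <= 1" by auto
  have "\<bar>(\<Phi> (0 + h) - \<Phi> 0) / h - L\<bar> = \<bar>\<Phi> h - \<Phi> 0 - h * L\<bar> / \<bar>h\<bar>"
   using h by (simp add: abs_divide[symmetric] diff_divide_distrib)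
  also have "... <= c * h\<^sup>2 / \<bar>h\<bar>" using assms[OF h(2)] by (intro divide_right_mono) auto
  also have "... = c * \<bar>h\<bar>" using h by (simp add: power2_eq_square field_simps abs_if)
  finally show "norm ((\<Phi> (0 + h) - \<Phi> 0) / h - L) <= c * \<bar>h\<bar>" by simp
 qed simp
qed

definition coll_rate :: "real => ('n::finite phase => real) => 'n phase => real" where
 "coll_rate \<beta> p z = (LINT (w, \<omega>)|coll_measure.
   cross_section (snd z) w \<omega> * maxwellian \<beta> w * (exp (p (fst z, post1 (snd z) w \<omega>) - p z) - 1))"

text \<open>Linearity in \<open>q\<close> is what makes the system linear after the transform.\<close>

lemma hamiltonian_density_eq: "hamiltonian_density \<beta> q p z = q z * coll_rate \<beta> p z"
proof -
 have "hamiltonian_density \<beta> q p z = (LINT (w, \<omega>)|coll_measure.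
   q z * (cross_section (snd z) w \<omega> * maxwellian \<beta> w * (exp (p (fst z, post1 (snd z) w \<omega>) - p z) - 1)))"
  unfolding hamiltonian_density_def split_beta by (simp add: mult_ac)
 also have "... = (LINT y|coll_measure.
   q z * (case y of (w, \<omega>) => cross_section (snd z) w \<omega> * maxwellian \<beta> w * (exp (p (fst z, post1 (snd z) w \<omega>) - p z) - 1)))"
  by (intro Bochner_Integration.integral_cong) auto
 also have "... = q z * coll_rate \<beta> p z" unfolding coll_rate_def by simp
 finally show ?thesis .
qed

lemma coll_rate_measurable [measurable]:
 assumes [measurable]: "p \<in> borel_measurable borel"
 shows "coll_rate \<beta> p \<in> borel_measurable borel"
 unfolding coll_rate_def[abs_def]
 by (rule lborel_sphere.borel_measurable_lebesgue_integral) measurable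

lemma coll_rate_periodic:
 assumes "lperiodic p"
 shows "lperiodic (coll_rate \<beta> p)"
 using lperiodicD[OF assms] by (intro lperiodicI) (simp add: coll_rate_def)

lemma coll_rate_eq:
 fixes p :: "'n::finite phase => real"
 assumes \<beta>: "\<beta> > 0" and [measurable]: "p \<in> borel_measurable borel"
  and fin: "gain \<beta> (%z. ennreal (exp (p z))) z < \<infinity>"
 shows "coll_rate \<beta> p z = rgain \<beta> (%z. exp (p z)) z / exp (p z) - freq \<beta> (snd z)"
proof -
 let ?B = "%y. cross_section (snd z) (fst y) (snd y) * maxwellian \<beta> (fst y)"
 let ?z = "%y. (fst z, post1 (snd z) (fst y) (snd y))"
 have i1: "integrable coll_measure (%y. ?B y * exp (p (?z y)))"
  using rgain_integrable[of "%z. exp (p z)" \<beta> z] fin by (simp add: case_prod_unfold)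
 have fin1: "gain \<beta> (%z. ennreal \<bar>1\<bar>) z < \<infinity>" using gain_one[OF \<beta>, of z] by simp
 have i2: "integrable coll_measure ?B"
  using rgain_integrable[of "%z. 1" \<beta> z, OF _ fin1] by (simp add: case_prod_unfold)
 have f: "freq \<beta> (snd z) = (LINT y|coll_measure. ?B y)"
  using rgain_nonneg_eq[of "%_. 1" \<beta> z] gain_one[OF \<beta>, of z] by (simp add: rgain_def case_prod_unfold)
 have "coll_rate \<beta> p z = (LINT y|coll_measure. ?B y * exp (p (?z y)) / exp (p z) - ?B y)"
  unfolding coll_rate_def case_prod_unfold by (intro Bochner_Integration.integral_cong) (auto simp: exp_diff field_simps)
 also have "... = (LINT y|coll_measure. ?B y * exp (p (?z y)) / exp (p z)) - (LINT y|coll_measure. ?B y)"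
  by (intro Bochner_Integration.integral_diff integrable_divide i1 i2)
 also have "... = rgain \<beta> (%z. exp (p z)) z / exp (p z) - freq \<beta> (snd z)"
  by (simp add: f rgain_def case_prod_unfold)
 finally show ?thesis .
qed

lemma directionsD:
 assumes "\<psi> \<in> directions p"
 obtains R where "\<psi> \<in> borel_measurable borel" "lperiodic \<psi>" "0 <= R" "!!z. \<bar>\<psi> z\<bar> <= R"
  "!!z. \<psi> z \<noteq> 0 ==> norm (snd z) <= R" "!!z. \<psi> z \<noteq> 0 ==> \<bar>p z\<bar> <= R"
proof -
 from assms obtain R where *: "phase_fun \<psi>"
  "\<forall>x v. \<bar>\<psi> (x, v)\<bar> <= R \<and> (\<psi> (x, v) \<noteq> 0 --> norm v <= R \<and> \<bar>p (x, v)\<bar> <= R)"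
  unfolding directions_def by blast
 have "0 <= R" using *(2) abs_ge_zero order_trans by blast
 with * that[of R] show thesis by (auto simp: phase_fun_def periodic_iff)
qed

text \<open>The sign of the difference, cut off to \<open>|v|, |p| \<le> n\<close>, is an admissible direction, and these sets
exhaust phase space.\<close>

lemma directions_density_unique:
 fixes p \<kappa> \<kappa>' :: "'n::finite phase => real"
 assumes p: "phase_fun p" and \<kappa>: "phase_fun \<kappa>" "phase_fun \<kappa>'"
  and eq: "!!\<psi>. \<psi> \<in> directions p ==> integrable phase_measure (%z. \<kappa> z * \<psi> z) \<and>
   integrable phase_measure (%z. \<kappa>' z * \<psi> z) \<and>
   (LINT z|phase_measure. \<kappa> z * \<psi> z) = (LINT z|phase_measure. \<kappa>' z * \<psi> z)"
 shows "AE z in lborel. \<kappa> z = \<kappa>' z"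
proof -
 have [measurable]: "p \<in> borel_measurable borel" "\<kappa> \<in> borel_measurable borel" "\<kappa>' \<in> borel_measurable borel"
  using p \<kappa> by (auto simp: phase_fun_def)
 have per: "lperiodic p" "lperiodic \<kappa>" "lperiodic \<kappa>'"
  using p \<kappa> by (auto simp: phase_fun_def periodic_iff)
 have "AE z in phase_measure. \<forall>n::nat. norm (snd z) <= real n \<and> \<bar>p z\<bar> <= real n --> \<kappa> z = \<kappa>' z"
  unfolding AE_all_countable
 proof
  fix n :: nat
  define \<psi> where "\<psi> z = (if norm (snd z) <= real n \<and> \<bar>p z\<bar> <= real n then sgn (\<kappa> z - \<kappa>' z) else 0)" for z
  have [measurable]: "\<psi> \<in> borel_measurable borel" unfolding \<psi>_def by measurable
  have "lperiodic \<psi>"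
   using lperiodicD[OF per(1)] lperiodicD[OF per(2)] lperiodicD[OF per(3)]
   by (intro lperiodicI) (simp add: \<psi>_def)
  then have \<psi>: "\<psi> \<in> directions p"
   unfolding directions_def phase_fun_def periodic_iff
   by (auto intro!: exI[of _ "real n + 1"] simp: \<psi>_def sgn_if split: if_splits)
  have "(%z. \<kappa> z * \<psi> z - \<kappa>' z * \<psi> z) = (%z. if norm (snd z) <= real n \<and> \<bar>p z\<bar> <= real n then \<bar>\<kappa> z - \<kappa>' z\<bar> else 0)"
   by (auto simp: fun_eq_iff \<psi>_def left_diff_distrib[symmetric] sgn_mult_abs abs_sgn mult.commute sgn_if)
  with eq[OF \<psi>] have "integrable phase_measure (%z. if norm (snd z) <= real n \<and> \<bar>p z\<bar> <= real n then \<bar>\<kappa> z - \<kappa>' z\<bar> else 0)"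
   "(LINT z|phase_measure. (if norm (snd z) <= real n \<and> \<bar>p z\<bar> <= real n then \<bar>\<kappa> z - \<kappa>' z\<bar> else 0)) = 0"
   using Bochner_Integration.integrable_diff[of phase_measure "%z. \<kappa> z * \<psi> z" "%z. \<kappa>' z * \<psi> z"]
    Bochner_Integration.integral_diff[of phase_measure "%z. \<kappa> z * \<psi> z" "%z. \<kappa>' z * \<psi> z"] by auto
  then have "AE z in phase_measure. (if norm (snd z) <= real n \<and> \<bar>p z\<bar> <= real n then \<bar>\<kappa> z - \<kappa>' z\<bar> else 0) = 0"
   by (subst (asm) integral_nonneg_eq_0_iff_AE) auto
  then show "AE z in phase_measure. norm (snd z) <= real n \<and> \<bar>p z\<bar> <= real n --> \<kappa> z = \<kappa>' z"
   by eventually_elim (auto split: if_splits)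
 qed
 then have "AE z in phase_measure. \<kappa> z = \<kappa>' z"
 proof eventually_elim
  case (elim z)
  obtain n :: nat where "max (norm (snd z)) \<bar>p z\<bar> <= real n" using real_arch_simple by blast
  then show ?case using elim by auto
 qed
 moreover have "lperiodic (%z. \<kappa> z = \<kappa>' z)"
  using lperiodicD[OF per(2)] lperiodicD[OF per(3)] by (intro lperiodicI) simp
 ultimately show ?thesis by (intro AE_phase_imp_lborel)
qed

lemma is_dH_dq_unique:
 assumes p: "phase_fun p" and \<kappa>: "phase_fun \<kappa>" and d: "is_dH_dq \<beta> q p \<kappa>"
 shows "AE z in lborel. \<kappa> z = coll_rate \<beta> p z"
proof (rule directions_density_unique[OF p \<kappa>])
 have [measurable]: "p \<in> borel_measurable borel" and per: "lperiodic p"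
  using p by (auto simp: phase_fun_def periodic_iff)
 show "phase_fun (coll_rate \<beta> p)"
  using coll_rate_periodic[OF per] by (simp add: phase_fun_def periodic_iff)
 fix \<psi> assume \<psi>: "\<psi> \<in> directions p"
 have inc: "hamiltonian_increment \<beta> q p (%z. q z + \<epsilon> * \<psi> z) p = (%z. \<epsilon> * (coll_rate \<beta> p z * \<psi> z))" for \<epsilon>
  by (auto simp: fun_eq_iff hamiltonian_increment_def hamiltonian_density_eq algebra_simps)
 note dd = bspec[OF d[unfolded is_dH_dq_def] \<psi>, unfolded inc]
 have 1: "integrable phase_measure (%z. \<kappa> z * \<psi> z)"
  and 2: "\<forall>\<^sub>F \<epsilon> in nhds 0. integrable phase_measure (%z. \<epsilon> * (coll_rate \<beta> p z * \<psi> z))"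
  and 3: "((%\<epsilon>. LINT z|phase_measure. \<epsilon> * (coll_rate \<beta> p z * \<psi> z)) has_real_derivative (LINT z|phase_measure. \<kappa> z * \<psi> z)) (at 0)"
  by (rule conjunct1[OF dd], rule conjunct1[OF conjunct2[OF dd]], rule conjunct2[OF conjunct2[OF dd]])
 from 2 obtain e where e: "0 < e" "!!\<epsilon>. dist \<epsilon> 0 < e ==> integrable phase_measure (%z. \<epsilon> * (coll_rate \<beta> p z * \<psi> z))"
  unfolding eventually_nhds_metric by blast
 have "integrable phase_measure (%z. (e / 2) * (coll_rate \<beta> p z * \<psi> z))" using e(1) by (intro e(2)) auto
 then have i: "integrable phase_measure (%z. coll_rate \<beta> p z * \<psi> z)"
  using integrable_mult_right[of "2 / e" phase_measure "%z. (e / 2) * (coll_rate \<beta> p z * \<psi> z)"] e(1)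
  by (simp add: mult.assoc[symmetric])
 have "((%\<epsilon>. \<epsilon> * (LINT z|phase_measure. coll_rate \<beta> p z * \<psi> z)) has_real_derivative (LINT z|phase_measure. coll_rate \<beta> p z * \<psi> z)) (at 0)"
  by (auto intro!: derivative_eq_intros)
 with 3 have "(LINT z|phase_measure. \<kappa> z * \<psi> z) = (LINT z|phase_measure. coll_rate \<beta> p z * \<psi> z)"
  by (simp add: DERIV_unique)
 with 1 i show "integrable phase_measure (%z. \<kappa> z * \<psi> z) \<and> integrable phase_measure (%z. coll_rate \<beta> p z * \<psi> z) \<and>
   (LINT z|phase_measure. \<kappa> z * \<psi> z) = (LINT z|phase_measure. coll_rate \<beta> p z * \<psi> z)" by simp
qed

lemma is_dH_dqI:
 assumes "!!\<psi>. \<psi> \<in> directions p ==> integrable phase_measure (%z. coll_rate \<beta> p z * \<psi> z)"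
 shows "is_dH_dq \<beta> q p (coll_rate \<beta> p)"
 unfolding is_dH_dq_def
proof (intro ballI conjI)
 fix \<psi> assume \<psi>: "\<psi> \<in> directions p"
 have inc: "hamiltonian_increment \<beta> q p (%z. q z + \<epsilon> * \<psi> z) p = (%z. \<epsilon> * (coll_rate \<beta> p z * \<psi> z))" for \<epsilon>
  by (auto simp: fun_eq_iff hamiltonian_increment_def hamiltonian_density_eq algebra_simps)
 show i: "integrable phase_measure (%z. coll_rate \<beta> p z * \<psi> z)" by (rule assms[OF \<psi>])
 show "\<forall>\<^sub>F \<epsilon> in nhds 0. integrable phase_measure (hamiltonian_increment \<beta> q p (%z. q z + \<epsilon> * \<psi> z) p)"
  unfolding inc using i by (intro always_eventually allI integrable_mult_right)
 show "((%\<epsilon>. LINT z|phase_measure. hamiltonian_increment \<beta> q p (%z. q z + \<epsilon> * \<psi> z) p z)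
    has_real_derivative (LINT z|phase_measure. coll_rate \<beta> p z * \<psi> z)) (at 0)"
  unfolding inc by (auto intro!: derivative_eq_intros)
qed

subsection \<open>The derivative in the momentum\<close>

definition post :: "'n::finite phase => (real ^ 'n) \<times> (real ^ 'n) => 'n phase" where
 "post z y = (fst z, post1 (snd z) (fst y) (snd y))"

definition kern :: "real => 'n::finite phase => (real ^ 'n) \<times> (real ^ 'n) => real" where
 "kern \<beta> z y = indicator unit_cell (fst z) * (maxwellian \<beta> (snd z) * (cross_section (snd z) (fst y) (snd y) * maxwellian \<beta> (fst y)))"

lemma kern_nonneg [simp]: "0 <= kern \<beta> z y"
 by (simp add: kern_def)

lemma measurable_kern [measurable (raw)]:
 assumes [measurable]: "a \<in> borel_measurable M" "b \<in> M \<rightarrow>\<^sub>M borel \<Otimes>\<^sub>M borel"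
 shows "(%x. kern \<beta> (a x) (b x)) \<in> borel_measurable M"
 unfolding kern_def by measurable

lemma measurable_post [measurable (raw)]:
 assumes [measurable]: "a \<in> borel_measurable M" "b \<in> M \<rightarrow>\<^sub>M borel \<Otimes>\<^sub>M borel"
 shows "(%x. post (a x) (b x)) \<in> borel_measurable M"
 unfolding post_def by measurable

interpretation phase_coll: pair_sigma_finite "lborel :: 'n::finite phase measure" "coll_measure :: ((real ^ 'n) \<times> (real ^ 'n)) measure"
 by (intro pair_sigma_finite.intro lborel.sigma_finite_measure_axioms lborel_sphere.sigma_finite_measure_axioms)

lemma kern_symmetric_nn:
 fixes G :: "'n::finite phase => 'n phase => ennreal"
 assumes G: "case_prod G \<in> borel_measurable (borel \<Otimes>\<^sub>M borel)"
 shows "(\<integral>\<^sup>+(z, y). ennreal (kern \<beta> z y) * G z (post z y) \<partial>(lborel \<Otimes>\<^sub>M coll_measure))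
  = (\<integral>\<^sup>+(z, y). ennreal (kern \<beta> z y) * G (post z y) z \<partial>(lborel \<Otimes>\<^sub>M coll_measure))"
proof -
 have main: "(\<integral>\<^sup>+(z, y). ennreal (kern \<beta> z y) * F z (post z y) \<partial>(lborel \<Otimes>\<^sub>M coll_measure))
  = (\<integral>\<^sup>+z. indicator unit_cell (fst z) * (\<integral>\<^sup>+(w, \<omega>). ennreal (maxwellian \<beta> (snd z) * (cross_section (snd z) w \<omega> * maxwellian \<beta> w)) *
   F z (fst z, post1 (snd z) w \<omega>) \<partial>coll_measure) \<partial>lborel)"
  if F: "case_prod F \<in> borel_measurable (borel \<Otimes>\<^sub>M borel)" for F :: "'n phase => 'n phase => ennreal"
 proof -
  note [measurable (raw)] = joint_apply[OF F]
  have "(\<integral>\<^sup>+(z, y). ennreal (kern \<beta> z y) * F z (post z y) \<partial>(lborel \<Otimes>\<^sub>M coll_measure))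
    = (\<integral>\<^sup>+z. \<integral>\<^sup>+y. ennreal (kern \<beta> z y) * F z (post z y) \<partial>coll_measure \<partial>lborel)"
   by (subst lborel_sphere.nn_integral_fst[symmetric]) auto
  also have "... = (\<integral>\<^sup>+z. indicator unit_cell (fst z) * (\<integral>\<^sup>+(w, \<omega>). ennreal (maxwellian \<beta> (snd z) * (cross_section (snd z) w \<omega> * maxwellian \<beta> w)) *
   F z (fst z, post1 (snd z) w \<omega>) \<partial>coll_measure) \<partial>lborel)"
  proof (rule nn_integral_cong)
   fix z :: "'n phase"
   have "(\<integral>\<^sup>+y. ennreal (kern \<beta> z y) * F z (post z y) \<partial>coll_measure) = (\<integral>\<^sup>+y. indicator unit_cell (fst z) * (case y of (w, \<omega>) =>
     ennreal (maxwellian \<beta> (snd z) * (cross_section (snd z) w \<omega> * maxwellian \<beta> w)) * F z (fst z, post1 (snd z) w \<omega>)) \<partial>coll_measure)"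
    by (intro nn_integral_cong) (auto simp: kern_def post_def indicator_def)
   also have "... = indicator unit_cell (fst z) * (\<integral>\<^sup>+(w, \<omega>). ennreal (maxwellian \<beta> (snd z) * (cross_section (snd z) w \<omega> * maxwellian \<beta> w)) *
    F z (fst z, post1 (snd z) w \<omega>) \<partial>coll_measure)"
    by (rule nn_integral_cmult) measurable
   finally show "(\<integral>\<^sup>+y. ennreal (kern \<beta> z y) * F z (post z y) \<partial>coll_measure) = ..." .
  qed
  finally show ?thesis .
 qed
 have G': "case_prod (%a b. G b a) \<in> borel_measurable (borel \<Otimes>\<^sub>M borel)" using G by measurable
 show ?thesis
  using main[OF G] main[OF G'] collision_symmetry_weighted[OF G, of "indicator unit_cell" \<beta>] by simp
qed

lemma kern_symmetric:
 fixes G :: "'n::finite phase => 'n phase => real"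
 assumes G: "case_prod G \<in> borel_measurable (borel \<Otimes>\<^sub>M borel)"
  and i: "integrable (lborel \<Otimes>\<^sub>M coll_measure) (%(z, y). kern \<beta> z y * G z (post z y))"
 shows "integrable (lborel \<Otimes>\<^sub>M coll_measure) (%(z, y). kern \<beta> z y * G (post z y) z)"
  and "(LINT (z, y)|(lborel \<Otimes>\<^sub>M coll_measure). kern \<beta> z y * G z (post z y))
    = (LINT (z, y)|(lborel \<Otimes>\<^sub>M coll_measure). kern \<beta> z y * G (post z y) z)"
proof -
 note [measurable (raw)] = joint_apply[OF G]
 have sym: "(\<integral>\<^sup>+x. ennreal (case x of (z, y) => kern \<beta> z y * H (G z (post z y))) \<partial>(lborel \<Otimes>\<^sub>M coll_measure))
   = (\<integral>\<^sup>+x. ennreal (case x of (z, y) => kern \<beta> z y * H (G (post z y) z)) \<partial>(lborel \<Otimes>\<^sub>M coll_measure))"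
  if [measurable]: "H \<in> borel_measurable borel" for H :: "real => real"
  using kern_symmetric_nn[of "%a b. ennreal (H (G a b))" \<beta>] by (simp add: case_prod_unfold ennreal_mult')
 have absm: "norm (case x of (z, y) => kern \<beta> z y * F z y) = (case x of (z, y) => kern \<beta> z y * \<bar>F z y\<bar>)" for x F
  by (auto simp: abs_mult split: prod.splits)
 have neg: "- (case x of (z, y) => kern \<beta> z y * F z y) = (case x of (z, y) => kern \<beta> z y * - F z y)" for x F
  by (auto split: prod.splits)
 show i': "integrable (lborel \<Otimes>\<^sub>M coll_measure) (%(z, y). kern \<beta> z y * G (post z y) z)"
 proof (rule integrableI_bounded)
  show "(\<integral>\<^sup>+x. ennreal (norm (case x of (z, y) => kern \<beta> z y * G (post z y) z)) \<partial>(lborel \<Otimes>\<^sub>M coll_measure)) < \<infinity>"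
   using i sym[of abs] unfolding integrable_iff_bounded absm by simp
 qed measurable
 show "(LINT (z, y)|(lborel \<Otimes>\<^sub>M coll_measure). kern \<beta> z y * G z (post z y))
    = (LINT (z, y)|(lborel \<Otimes>\<^sub>M coll_measure). kern \<beta> z y * G (post z y) z)"
  unfolding real_lebesgue_integral_def[OF i] real_lebesgue_integral_def[OF i'] neg
  using sym[of "%x. x"] sym[of uminus] by simp
qed

lemma integral_kern_post:
 fixes a b :: "'n::finite phase => real"
 shows "(LINT y|coll_measure. kern \<beta> z y * (a z * b (post z y))) = indicator unit_cell (fst z) * (maxwellian \<beta> (snd z) * a z * rgain \<beta> b z)"
proof -
 have "(LINT y|coll_measure. kern \<beta> z y * (a z * b (post z y)))
  = (LINT y|coll_measure. (indicator unit_cell (fst z) * maxwellian \<beta> (snd z) * a z) *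
    (case y of (w, \<omega>) => cross_section (snd z) w \<omega> * maxwellian \<beta> w * b (fst z, post1 (snd z) w \<omega>)))"
  by (intro Bochner_Integration.integral_cong) (auto simp: kern_def post_def)
 also have "... = indicator unit_cell (fst z) * (maxwellian \<beta> (snd z) * a z * rgain \<beta> b z)"
  unfolding rgain_def by (simp add: mult.assoc)
 finally show ?thesis .
qed

lemma integrable_kern_local:
 fixes a b :: "'n::finite phase => real"
 assumes \<beta>: "\<beta> > 0" and \<alpha>: "0 < \<alpha>" "\<alpha> < \<beta> / 2" and B: "0 <= B"
  and [measurable]: "a \<in> borel_measurable borel" "b \<in> borel_measurable borel"
  and a: "AE z in lborel. \<bar>a z\<bar> <= B * wt \<alpha> z" and supp: "!!z. a z \<noteq> 0 ==> norm (snd z) <= R"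
  and b: "AE z in lborel. \<bar>b z\<bar> <= B * wt \<alpha> z"
 shows "integrable (lborel \<Otimes>\<^sub>M coll_measure) (%(z, y). kern \<beta> z y * (a z * b (post z y)))"
proof (rule integrableI_bounded)
 obtain K where K: "0 < K" "!!z :: 'n phase. gain \<beta> (%z. ennreal (wt \<alpha> z)) z <= ennreal (K * wt \<alpha> z)"
  using gain_vexp_bound[OF \<beta> \<alpha>, of 0] by (metis atLeastAtMost_iff order_refl)
 let ?S = "{z :: 'n phase. fst z \<in> unit_cell \<and> norm (snd z) <= R}"
 define m where "m = (\<beta> / (2 * pi)) powr (real CARD('n) / 2)"
 have m: "0 <= m" by (simp add: m_def)
 let ?c = "m * (B * exp (\<alpha> * R\<^sup>2)) * (B * (K * exp (\<alpha> * R\<^sup>2)))"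
 have c: "0 <= ?c" using m B K by simp
 have gb: "AE z in lborel. gain \<beta> (%z. ennreal \<bar>b z\<bar>) z <= ennreal (B * (K * wt \<alpha> z))"
 proof -
  have "AE z in lborel. ennreal \<bar>b z\<bar> <= ennreal B * ennreal (wt \<alpha> z)"
   using b B by (auto simp: ennreal_mult'[symmetric] elim!: eventually_mono intro!: ennreal_leI)
  from gain_mono_AE[OF \<beta> _ _ this]
  have "AE z in lborel. gain \<beta> (%z. ennreal \<bar>b z\<bar>) z <= gain \<beta> (%z. ennreal B * ennreal (wt \<alpha> z)) z" by simp
  then show ?thesis
  proof eventually_elim
   case (elim z)
   have "gain \<beta> (%z. ennreal \<bar>b z\<bar>) z <= gain \<beta> (%z. ennreal B * ennreal (wt \<alpha> z)) z" by (rule elim)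
   also have "gain \<beta> (%z. ennreal B * ennreal (wt \<alpha> z)) z = ennreal B * gain \<beta> (%z. ennreal (wt \<alpha> z)) z"
    by (rule gain_cmult) measurable
   also have "... <= ennreal B * ennreal (K * wt \<alpha> z)" by (intro mult_left_mono K) auto
   finally show ?case using B by (simp add: ennreal_mult'[symmetric])
  qed
 qed
 have "(\<integral>\<^sup>+x. ennreal (norm (case x of (z, y) => kern \<beta> z y * (a z * b (post z y)))) \<partial>(lborel \<Otimes>\<^sub>M coll_measure))
  = (\<integral>\<^sup>+z. \<integral>\<^sup>+y. ennreal (kern \<beta> z y * (\<bar>a z\<bar> * \<bar>b (post z y)\<bar>)) \<partial>coll_measure \<partial>lborel)"
  by (subst lborel_sphere.nn_integral_fst[symmetric]) (auto simp: abs_mult)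
 also have "... = (\<integral>\<^sup>+z. indicator unit_cell (fst z) * ennreal (maxwellian \<beta> (snd z) * \<bar>a z\<bar>) * gain \<beta> (%z. ennreal \<bar>b z\<bar>) z \<partial>lborel)"
 proof (rule nn_integral_cong)
  fix z :: "'n phase"
  have "(\<integral>\<^sup>+y. ennreal (kern \<beta> z y * (\<bar>a z\<bar> * \<bar>b (post z y)\<bar>)) \<partial>coll_measure)
   = (\<integral>\<^sup>+y. (indicator unit_cell (fst z) * ennreal (maxwellian \<beta> (snd z) * \<bar>a z\<bar>)) *
     (case y of (w, \<omega>) => ennreal (cross_section (snd z) w \<omega> * maxwellian \<beta> w) * ennreal \<bar>b (fst z, post1 (snd z) w \<omega>)\<bar>) \<partial>coll_measure)"
   by (intro nn_integral_cong) (auto simp: kern_def post_def indicator_def ennreal_mult'[symmetric] mult_ac)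
  also have "... = indicator unit_cell (fst z) * ennreal (maxwellian \<beta> (snd z) * \<bar>a z\<bar>) * gain \<beta> (%z. ennreal \<bar>b z\<bar>) z"
   unfolding gain_def by (rule nn_integral_cmult) measurable
  finally show "(\<integral>\<^sup>+y. ennreal (kern \<beta> z y * (\<bar>a z\<bar> * \<bar>b (post z y)\<bar>)) \<partial>coll_measure) = ..." .
 qed
 also have "... <= (\<integral>\<^sup>+z. ennreal ?c * indicator ?S z \<partial>lborel)"
 proof (rule nn_integral_mono_AE)
  show "AE z in lborel. indicator unit_cell (fst z) * ennreal (maxwellian \<beta> (snd z) * \<bar>a z\<bar>) * gain \<beta> (%z. ennreal \<bar>b z\<bar>) z
    <= ennreal ?c * indicator ?S z"
   using gb a
  proof eventually_elim
   case (elim z)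
   show ?case
   proof (cases "fst z \<in> unit_cell \<and> a z \<noteq> 0")
    case True
    then have R: "norm (snd z) <= R" using supp by blast
    have w: "wt \<alpha> z <= exp (\<alpha> * R\<^sup>2)"
     using R \<alpha> by (auto simp: vexp_def intro!: mult_left_mono power_mono)
    have M: "maxwellian \<beta> (snd z) <= m"
     using m \<beta> by (simp add: maxwellian_def m_def mult_left_le)
    have "\<bar>a z\<bar> <= B * exp (\<alpha> * R\<^sup>2)"
     using elim(2) mult_left_mono[OF w B] by linarith
    then have 1: "ennreal (maxwellian \<beta> (snd z) * \<bar>a z\<bar>) <= ennreal (m * (B * exp (\<alpha> * R\<^sup>2)))"
     using m by (intro ennreal_leI mult_mono M) auto
    have "B * (K * wt \<alpha> z) <= B * (K * exp (\<alpha> * R\<^sup>2))" using w B K by (intro mult_left_mono) auto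
    then have 2: "gain \<beta> (%z. ennreal \<bar>b z\<bar>) z <= ennreal (B * (K * exp (\<alpha> * R\<^sup>2)))"
     using elim(1) by (meson ennreal_leI order_trans)
    have "ennreal (maxwellian \<beta> (snd z) * \<bar>a z\<bar>) * gain \<beta> (%z. ennreal \<bar>b z\<bar>) z
     <= ennreal (m * (B * exp (\<alpha> * R\<^sup>2))) * ennreal (B * (K * exp (\<alpha> * R\<^sup>2)))"
     by (intro mult_mono 1 2) auto
    also have "... = ennreal ?c" using m B by (simp add: ennreal_mult'[symmetric])
    finally show ?thesis using True R by (simp add: indicator_def)
   qed (auto simp: indicator_def)
  qed
 qed
 also have "... < \<infinity>"
  using emeasure_cell_ball_finite[of R, where 'n='n] by (subst nn_integral_cmult_indicator) (auto simp: ennreal_mult_less_top)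
 finally show "(\<integral>\<^sup>+x. ennreal (norm (case x of (z, y) => kern \<beta> z y * (a z * b (post z y)))) \<partial>(lborel \<Otimes>\<^sub>M coll_measure)) < \<infinity>" .
qed measurable

lemma coll_op_bound_AE_finite:
 fixes b :: "'n::finite phase => real"
 assumes \<beta>: "\<beta> > 0" and \<alpha>: "0 < \<alpha>" "\<alpha> < \<beta> / 2"
  and [measurable]: "b \<in> borel_measurable borel"
  and b: "AE z in lborel. \<bar>b z\<bar> <= B * wt \<alpha> z"
 shows "AE z in lborel. gain \<beta> (%z. ennreal \<bar>b z\<bar>) z < \<infinity>"
proof -
 obtain K where K: "0 < K" "!!z :: 'n phase. gain \<beta> (%z. ennreal (wt \<alpha> z)) z <= ennreal (K * wt \<alpha> z)"
  using gain_vexp_bound[OF \<beta> \<alpha>, of 0] by (metis atLeastAtMost_iff order_refl)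
 have "AE z in lborel. ennreal \<bar>b z\<bar> <= ennreal \<bar>B\<bar> * ennreal (wt \<alpha> z)"
  using b
 proof eventually_elim
  case (elim z)
  also have "B * wt \<alpha> z <= \<bar>B\<bar> * wt \<alpha> z" by (intro mult_right_mono) auto
  finally show ?case by (simp add: ennreal_mult'[symmetric] ennreal_leI)
 qed
 from gain_mono_AE[OF \<beta> _ _ this]
 have "AE z in lborel. gain \<beta> (%z. ennreal \<bar>b z\<bar>) z <= gain \<beta> (%z. ennreal \<bar>B\<bar> * ennreal (wt \<alpha> z)) z" by simp
 then show ?thesis
 proof eventually_elim
  case (elim z)
  have "gain \<beta> (%z. ennreal \<bar>b z\<bar>) z <= gain \<beta> (%z. ennreal \<bar>B\<bar> * ennreal (wt \<alpha> z)) z" by (rule elim)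
  also have "... = ennreal \<bar>B\<bar> * gain \<beta> (%z. ennreal (wt \<alpha> z)) z"
   by (rule gain_cmult) measurable
  also have "... <= ennreal \<bar>B\<bar> * ennreal (K * wt \<alpha> z)" by (intro mult_left_mono K) auto
  also have "... < \<infinity>" by (simp add: ennreal_mult'[symmetric])
  finally show ?case .
 qed
qed

text \<open>The first order term of an increment contains \<open>\<psi>(v') - \<psi>(v)\<close>; the symmetry of collisions moves
\<open>\<psi>(v')\<close> to \<open>\<psi>(v)\<close>.  On a direction \<open>\<psi>\<close> the remainder is of second order in \<open>\<epsilon>\<close>, uniformly.\<close>

lemma is_dH_dpI:
 fixes f p q :: "'n::finite phase => real"
 assumes \<beta>: "\<beta> > 0" and \<alpha>: "0 < \<alpha>" "\<alpha> < \<beta> / 2" and B: "0 <= B"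
  and f[measurable]: "f \<in> borel_measurable borel" and p[measurable]: "p \<in> borel_measurable borel"
  and fb: "AE z in lborel. \<bar>f z\<bar> <= B * wt \<alpha> z"
  and pb: "AE z in lborel. exp (p z) <= B * wt \<alpha> z"
  and q: "!!z. q z = maxwellian \<beta> (snd z) * f z * exp (p z)"
 shows "is_dH_dp \<beta> q p (%z. maxwellian \<beta> (snd z) * (exp (p z) * rgain \<beta> f z - f z * rgain \<beta> (%z. exp (p z)) z))"
  (is "is_dH_dp \<beta> q p ?\<kappa>")
 unfolding is_dH_dp_def
proof (rule ballI)
 fix \<psi> assume "\<psi> \<in> directions p"
 then obtain R where [measurable]: "\<psi> \<in> borel_measurable borel" and "lperiodic \<psi>" and R: "0 <= R" "!!z. \<bar>\<psi> z\<bar> <= R"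
  "!!z. \<psi> z \<noteq> 0 ==> norm (snd z) <= R" "!!z. \<psi> z \<noteq> 0 ==> \<bar>p z\<bar> <= R"
  by (rule directionsD) blast
 let ?N = "lborel \<Otimes>\<^sub>M coll_measure :: ('n phase \<times> (real ^ 'n) \<times> (real ^ 'n)) measure"
 let ?P = "%z. exp (p z)"
 let ?\<Delta> = "%z y. \<psi> (post z y) - \<psi> z"
 define S where "S z = (if norm (snd z) <= R \<and> \<bar>p z\<bar> <= R then 1 else 0 :: real)" for z
 have [measurable]: "S \<in> borel_measurable borel" unfolding S_def by measurable
 have pb': "AE z in lborel. \<bar>?P z\<bar> <= B * wt \<alpha> z" using pb by simp
 note local = integrable_kern_local[OF \<beta> \<alpha>]
 define B' where "B' = (R + 1) * B"
 have B': "0 <= B'" using B R(1) by (simp add: B'_def)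
 have BB': "B * w <= B' * w" if "0 <= w" for w
  using R(1) B that by (simp add: B'_def algebra_simps)
 have fb': "AE z in lborel. \<bar>f z\<bar> <= B' * wt \<alpha> z"
  using fb by eventually_elim (erule order_trans, rule BB', simp)
 have pb'': "AE z in lborel. \<bar>?P z\<bar> <= B' * wt \<alpha> z"
  using pb' by eventually_elim (erule order_trans, rule BB', simp)
 have scale: "\<bar>c * x\<bar> <= B' * vexp 0 \<alpha> w" if "\<bar>x\<bar> <= B * vexp 0 \<alpha> w" "\<bar>c\<bar> <= R + 1" for c x :: real and w :: "real ^ 'n"
 proof -
  have "\<bar>c * x\<bar> <= (R + 1) * (B * vexp 0 \<alpha> w)"
   unfolding abs_mult using that R(1) by (intro mult_mono) auto
  then show ?thesis by (simp add: B'_def mult.assoc)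
 qed
 have \<psi>1: "\<bar>\<psi> z\<bar> <= R + 1" for z using R(2)[of z] by simp
 have S1: "\<bar>S z\<bar> <= R + 1" for z using R(1) by (simp add: S_def)
 \<comment> \<open>the two halves of the derivative\<close>
 have \<psi>s: "norm (snd z) <= R" if "\<psi> z * c \<noteq> 0" for z c using that by (intro R(3)) auto
 have Ss: "norm (snd z) <= R" if "S z * c \<noteq> 0" for z c using that by (simp add: S_def split: if_splits)
 have fa: "AE z in lborel. \<bar>\<bar>f z\<bar>\<bar> <= B * wt \<alpha> z" using fb by simp
 have fa': "AE z in lborel. \<bar>\<bar>f z\<bar>\<bar> <= B' * wt \<alpha> z" using fb' by simp
 have ae1: "AE z in lborel. \<bar>\<psi> z * f z\<bar> <= B' * wt \<alpha> z"
  using fb by eventually_elim (rule scale[OF _ \<psi>1])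
 have ae2: "AE z in lborel. \<bar>\<psi> z * ?P z\<bar> <= B' * wt \<alpha> z"
  using pb' by eventually_elim (rule scale[OF _ \<psi>1])
 have ae3: "AE z in lborel. \<bar>S z * \<bar>f z\<bar>\<bar> <= B' * wt \<alpha> z"
  using fa by eventually_elim (rule scale[OF _ S1])
 have ae4: "AE z in lborel. \<bar>S z * ?P z\<bar> <= B' * wt \<alpha> z"
  using pb' by eventually_elim (rule scale[OF _ S1])
 have i1: "integrable ?N (%(z, y). kern \<beta> z y * ((\<psi> z * f z) * ?P (post z y)))"
  by (rule local[OF B' _ _ ae1 \<psi>s pb'']) measurable
 have i2: "integrable ?N (%(z, y). kern \<beta> z y * ((\<psi> z * ?P z) * f (post z y)))"
  by (rule local[OF B' _ _ ae2 \<psi>s fb']) measurable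
 have j1: "integrable ?N (%(z, y). kern \<beta> z y * ((S z * \<bar>f z\<bar>) * ?P (post z y)))"
  by (rule local[OF B' _ _ ae3 Ss pb'']) measurable
 have j2: "integrable ?N (%(z, y). kern \<beta> z y * ((S z * ?P z) * \<bar>f (post z y)\<bar>))"
  by (rule local[OF B' _ _ ae4 Ss fa']) measurable
 have i2': "integrable ?N (%(z, y). kern \<beta> z y * ((\<psi> (post z y) * ?P (post z y)) * f z))"
  and i2_eq: "(LINT (z, y)|?N. kern \<beta> z y * ((\<psi> z * ?P z) * f (post z y))) = (LINT (z, y)|?N. kern \<beta> z y * ((\<psi> (post z y) * ?P (post z y)) * f z))"
  using kern_symmetric[of "%a b. (\<psi> a * ?P a) * f b" \<beta>, OF _ i2] by auto
 have j2': "integrable ?N (%(z, y). kern \<beta> z y * ((S (post z y) * ?P (post z y)) * \<bar>f z\<bar>))"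
  using kern_symmetric[of "%a b. (S a * ?P a) * \<bar>f b\<bar>" \<beta>, OF _ j2] by auto
 define M where "M = (%(z, y). kern \<beta> z y * (\<bar>f z\<bar> * ?P (post z y) * (S z + S (post z y))))"
 have M: "integrable ?N M"
 proof -
  have "integrable ?N (%x. (case x of (z, y) => kern \<beta> z y * ((S z * \<bar>f z\<bar>) * ?P (post z y))) +
    (case x of (z, y) => kern \<beta> z y * ((S (post z y) * ?P (post z y)) * \<bar>f z\<bar>)))"
   by (rule Bochner_Integration.integrable_add[OF j1 j2'])
  then show ?thesis by (rule Bochner_Integration.integrable_cong[OF refl, THEN iffD1, rotated]) (auto simp: M_def algebra_simps)
 qed
 \<comment> \<open>the density tested against \<open>\<psi>\<close>\<close>
 have k1: "integrable phase_measure (%z. maxwellian \<beta> (snd z) * (\<psi> z * ?P z) * rgain \<beta> f z)"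
  and k1': "(LINT z|phase_measure. maxwellian \<beta> (snd z) * (\<psi> z * ?P z) * rgain \<beta> f z) = (LINT (z, y)|?N. kern \<beta> z y * ((\<psi> z * ?P z) * f (post z y)))"
  using phase_coll.integrable_fst[OF i2] phase_coll.integral_fst[OF i2]
  unfolding phase_integral integral_kern_post[of \<beta> _ "%z. \<psi> z * ?P z" f] by auto
 have k2: "integrable phase_measure (%z. maxwellian \<beta> (snd z) * (\<psi> z * f z) * rgain \<beta> ?P z)"
  and k2': "(LINT z|phase_measure. maxwellian \<beta> (snd z) * (\<psi> z * f z) * rgain \<beta> ?P z) = (LINT (z, y)|?N. kern \<beta> z y * ((\<psi> z * f z) * ?P (post z y)))"
  using phase_coll.integrable_fst[OF i1] phase_coll.integral_fst[OF i1]
  unfolding phase_integral integral_kern_post[of \<beta> _ "%z. \<psi> z * f z" ?P] by auto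
 have \<kappa>: "?\<kappa> z * \<psi> z = maxwellian \<beta> (snd z) * (\<psi> z * ?P z) * rgain \<beta> f z - maxwellian \<beta> (snd z) * (\<psi> z * f z) * rgain \<beta> ?P z" for z
  by (simp add: algebra_simps)
 have \<kappa>i: "integrable phase_measure (%z. ?\<kappa> z * \<psi> z)"
  unfolding \<kappa> by (rule Bochner_Integration.integrable_diff[OF k1 k2])
 have \<kappa>_eq: "(LINT z|phase_measure. ?\<kappa> z * \<psi> z) = (LINT (z, y)|?N. kern \<beta> z y * (f z * ?P (post z y) * ?\<Delta> z y))"
 proof -
  have "(LINT z|phase_measure. ?\<kappa> z * \<psi> z) = (LINT (z, y)|?N. kern \<beta> z y * ((\<psi> (post z y) * ?P (post z y)) * f z)) - (LINT (z, y)|?N. kern \<beta> z y * ((\<psi> z * f z) * ?P (post z y)))"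
   unfolding \<kappa> by (subst Bochner_Integration.integral_diff[OF k1 k2]) (simp only: k1' k2' i2_eq)
  also have "... = (LINT x|?N. (case x of (z, y) => kern \<beta> z y * ((\<psi> (post z y) * ?P (post z y)) * f z)) - (case x of (z, y) => kern \<beta> z y * ((\<psi> z * f z) * ?P (post z y))))"
   by (rule Bochner_Integration.integral_diff[OF i2' i1, symmetric])
  also have "... = (LINT (z, y)|?N. kern \<beta> z y * (f z * ?P (post z y) * ?\<Delta> z y))"
   by (intro Bochner_Integration.integral_cong) (auto simp: algebra_simps)
  finally show ?thesis .
 qed
 define J where "J \<epsilon> = (%(z, y). kern \<beta> z y * (f z * ?P (post z y) * (exp (\<epsilon> * ?\<Delta> z y) - 1)))" for \<epsilon>
 define J' where "J' = (%(z, y). kern \<beta> z y * (f z * ?P (post z y) * ?\<Delta> z y))"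
 have [measurable]: "J \<epsilon> \<in> borel_measurable ?N" for \<epsilon> unfolding J_def by measurable
 have [measurable]: "J' \<in> borel_measurable ?N" unfolding J'_def by measurable
 have \<Delta>R: "\<bar>?\<Delta> z y\<bar> <= 2 * R" for z y using R(2)[of z] R(2)[of "post z y"] by linarith
 have SS: "1 <= S z + S (post z y)" if "?\<Delta> z y \<noteq> 0" for z y
 proof -
  from that have "\<psi> z \<noteq> 0 \<or> \<psi> (post z y) \<noteq> 0" by auto
  then show ?thesis using R(3)[of z] R(4)[of z] R(3)[of "post z y"] R(4)[of "post z y"] by (auto simp: S_def)
 qed
 have S0: "0 <= S z" for z by (simp add: S_def)
 have bound: "\<bar>kern \<beta> z y * (f z * ?P (post z y) * h)\<bar> <= k * M (z, y)"
  if "\<bar>h\<bar> <= k" "?\<Delta> z y = 0 ==> h = 0" for h k z y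
 proof (cases "?\<Delta> z y = 0")
  case True
  then show ?thesis using that S0 by (simp add: M_def)
 next
  case False
  have k: "0 <= k" using that(1) by linarith
  have "\<bar>kern \<beta> z y * (f z * ?P (post z y) * h)\<bar> = (kern \<beta> z y * (\<bar>f z\<bar> * ?P (post z y))) * \<bar>h\<bar>"
   by (simp add: abs_mult)
  also have "... <= (kern \<beta> z y * (\<bar>f z\<bar> * ?P (post z y))) * (k * (S z + S (post z y)))"
  proof (intro mult_left_mono)
   have "\<bar>h\<bar> <= k * 1" using that(1) by simp
   also have "... <= k * (S z + S (post z y))" using SS[OF False] k by (rule mult_left_mono)
   finally show "\<bar>h\<bar> <= k * (S z + S (post z y))" .
  qed auto
  also have "... = k * M (z, y)" by (simp add: M_def)
  finally show ?thesis .
 qed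
 have J_int: "integrable ?N (J \<epsilon>)" for \<epsilon>
 proof (rule Bochner_Integration.integrable_bound)
  let ?k = "\<bar>\<epsilon>\<bar> * (2 * R) * exp (\<bar>\<epsilon>\<bar> * (2 * R))"
  show "integrable ?N (%x. ?k * M x)" using M by (rule integrable_mult_right)
  show "AE x in ?N. norm (J \<epsilon> x) <= norm (?k * M x)"
  proof (intro AE_I2)
   fix x :: "'n phase \<times> (real ^ 'n) \<times> (real ^ 'n)" obtain z y where x: "x = (z, y)" by (cases x)
   have "\<bar>exp (\<epsilon> * ?\<Delta> z y) - 1\<bar> <= \<bar>\<epsilon> * ?\<Delta> z y\<bar> * exp \<bar>\<epsilon> * ?\<Delta> z y\<bar>" by (rule abs_exp_minus_one_le)
   also have "... <= ?k"
   proof -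
    have "\<bar>\<epsilon> * ?\<Delta> z y\<bar> <= \<bar>\<epsilon>\<bar> * (2 * R)"
     unfolding abs_mult by (rule mult_left_mono[OF \<Delta>R]) simp
    then show ?thesis using R(1) by (intro mult_mono) (simp_all only: exp_le_cancel_iff exp_ge_zero abs_ge_zero mult_nonneg_nonneg zero_le_numeral)
   qed
   finally have "\<bar>exp (\<epsilon> * ?\<Delta> z y) - 1\<bar> <= ?k" .
   then have "\<bar>J \<epsilon> x\<bar> <= ?k * M x"
    unfolding J_def x prod.case by (rule bound) simp
   then show "norm (J \<epsilon> x) <= norm (?k * M x)" unfolding real_norm_def by linarith
  qed
 qed measurable
 have J'_int: "integrable ?N J'"
 proof (rule Bochner_Integration.integrable_bound)
  show "integrable ?N (%x. (2 * R) * M x)" using M by (rule integrable_mult_right)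
  show "AE x in ?N. norm (J' x) <= norm ((2 * R) * M x)"
  proof (intro AE_I2)
   fix x :: "'n phase \<times> (real ^ 'n) \<times> (real ^ 'n)" obtain z y where x: "x = (z, y)" by (cases x)
   have "\<bar>J' x\<bar> <= (2 * R) * M x"
    unfolding J'_def x by (simp only: prod.case) (rule bound, auto intro: \<Delta>R)
   then show "norm (J' x) <= norm ((2 * R) * M x)" unfolding real_norm_def by linarith
  qed
 qed measurable
 have J_rem: "\<bar>J \<epsilon> x - \<epsilon> * J' x\<bar> <= (\<epsilon>\<^sup>2 * ((2 * R)\<^sup>2 * exp (2 * R))) * M x" if \<epsilon>: "\<bar>\<epsilon>\<bar> <= 1" for \<epsilon> x
 proof -
  obtain z y where x: "x = (z, y)" by (cases x)
  have "J \<epsilon> x - \<epsilon> * J' x = kern \<beta> z y * (f z * ?P (post z y) * (exp (\<epsilon> * ?\<Delta> z y) - 1 - \<epsilon> * ?\<Delta> z y))"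
   by (simp add: J_def J'_def x algebra_simps)
  also have "\<bar>...\<bar> <= (\<epsilon>\<^sup>2 * ((2 * R)\<^sup>2 * exp (2 * R))) * M (z, y)"
  proof (rule bound)
   have "\<bar>exp (\<epsilon> * ?\<Delta> z y) - 1 - \<epsilon> * ?\<Delta> z y\<bar> <= (\<epsilon> * ?\<Delta> z y)\<^sup>2 * exp \<bar>\<epsilon> * ?\<Delta> z y\<bar>" by (rule abs_exp_remainder_le)
   also have "... <= (\<epsilon>\<^sup>2 * (2 * R)\<^sup>2) * exp (1 * (2 * R))"
   proof (rule mult_mono)
    have "(?\<Delta> z y)\<^sup>2 <= (2 * R)\<^sup>2"
     using power_mono[OF \<Delta>R[of z y] abs_ge_zero, of 2] by (simp only: power2_abs)
    then show "(\<epsilon> * ?\<Delta> z y)\<^sup>2 <= \<epsilon>\<^sup>2 * (2 * R)\<^sup>2"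
     unfolding power_mult_distrib[of \<epsilon>] by (rule mult_left_mono) simp
    have "\<bar>\<epsilon> * ?\<Delta> z y\<bar> <= 1 * (2 * R)"
     unfolding abs_mult by (rule mult_mono[OF \<epsilon> \<Delta>R]) auto
    then show "exp \<bar>\<epsilon> * ?\<Delta> z y\<bar> <= exp (1 * (2 * R))" by (simp only: exp_le_cancel_iff)
   qed auto
   finally show "\<bar>exp (\<epsilon> * ?\<Delta> z y) - 1 - \<epsilon> * ?\<Delta> z y\<bar> <= \<epsilon>\<^sup>2 * ((2 * R)\<^sup>2 * exp (2 * R))" by (simp add: mult.assoc)
  qed auto
  finally show ?thesis by (simp add: x)
 qed
 \<comment> \<open>the increments of the Hamiltonian are the marginals of \<open>J\<close>\<close>
 have inc: "AE z in lborel. indicator unit_cell (fst z) * hamiltonian_increment \<beta> q p q (%z. p z + \<epsilon> * \<psi> z) z = (LINT y|coll_measure. J \<epsilon> (z, y))" for \<epsilon>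
 proof -
  let ?Q = "%z. exp (p z + \<epsilon> * \<psi> z)"
  have "AE z in lborel. \<bar>?Q z\<bar> <= (exp (\<bar>\<epsilon>\<bar> * R) * B) * wt \<alpha> z"
   using pb
  proof eventually_elim
   case (elim z)
   have "\<bar>\<epsilon> * \<psi> z\<bar> <= \<bar>\<epsilon>\<bar> * R" unfolding abs_mult by (rule mult_left_mono[OF R(2)]) simp
   then have "\<epsilon> * \<psi> z <= \<bar>\<epsilon>\<bar> * R" by linarith
   then have "exp (p z) * exp (\<epsilon> * \<psi> z) <= (B * wt \<alpha> z) * exp (\<bar>\<epsilon>\<bar> * R)"
    using elim B by (intro mult_mono) auto
   then show ?case by (simp add: exp_add mult_ac)
  qed
  from coll_op_bound_AE_finite[OF \<beta> \<alpha> _ this]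
  have "AE z in lborel. gain \<beta> (%z. ennreal \<bar>?Q z\<bar>) z < \<infinity>" by simp
  moreover have "AE z in lborel. gain \<beta> (%z. ennreal \<bar>?P z\<bar>) z < \<infinity>"
   by (rule coll_op_bound_AE_finite[OF \<beta> \<alpha> _ pb']) simp
  ultimately show ?thesis
  proof eventually_elim
   case (elim z)
   have c1: "coll_rate \<beta> (%z. p z + \<epsilon> * \<psi> z) z = rgain \<beta> ?Q z / ?Q z - freq \<beta> (snd z)"
    by (rule coll_rate_eq[OF \<beta>]) (use elim in auto)
   have c2: "coll_rate \<beta> p z = rgain \<beta> ?P z / ?P z - freq \<beta> (snd z)"
    by (rule coll_rate_eq[OF \<beta>]) (use elim in auto)
   let ?b = "%y. cross_section (snd z) (fst y) (snd y) * maxwellian \<beta> (fst y)"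
   have iQ: "integrable coll_measure (%y. ?b y * ?Q (post z y))"
    using rgain_integrable[of ?Q \<beta> z] elim by (simp add: case_prod_unfold post_def)
   have iP: "integrable coll_measure (%y. ?b y * ?P (post z y))"
    using rgain_integrable[of ?P \<beta> z] elim by (simp add: case_prod_unfold post_def)
   have "hamiltonian_increment \<beta> q p q (%z. p z + \<epsilon> * \<psi> z) z = q z * (rgain \<beta> ?Q z / ?Q z - rgain \<beta> ?P z / ?P z)"
    unfolding hamiltonian_increment_def hamiltonian_density_eq c1 c2 by (simp add: algebra_simps)
   also have "... = maxwellian \<beta> (snd z) * f z * (exp (- \<epsilon> * \<psi> z) * rgain \<beta> ?Q z - rgain \<beta> ?P z)"
    by (simp add: q exp_add exp_minus field_simps)
   also have "... = maxwellian \<beta> (snd z) * f z * (LINT y|coll_measure. exp (- \<epsilon> * \<psi> z) * (?b y * ?Q (post z y)) - ?b y * ?P (post z y))"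
    by (subst Bochner_Integration.integral_diff[OF integrable_mult_right[OF iQ] iP])
     (simp add: rgain_def case_prod_unfold post_def)
   finally have h: "hamiltonian_increment \<beta> q p q (%z. p z + \<epsilon> * \<psi> z) z
     = maxwellian \<beta> (snd z) * f z * (LINT y|coll_measure. exp (- \<epsilon> * \<psi> z) * (?b y * ?Q (post z y)) - ?b y * ?P (post z y))" .
   have "(LINT y|coll_measure. J \<epsilon> (z, y)) = (LINT y|coll_measure. (indicator unit_cell (fst z) * (maxwellian \<beta> (snd z) * f z)) *
     (exp (- \<epsilon> * \<psi> z) * (?b y * ?Q (post z y)) - ?b y * ?P (post z y)))"
   proof (rule Bochner_Integration.integral_cong[OF refl])
    fix y
    have "exp (- \<epsilon> * \<psi> z) * ?Q (post z y) = ?P (post z y) * exp (\<epsilon> * ?\<Delta> z y)"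
     unfolding exp_add[symmetric] by (rule arg_cong[where f=exp]) (simp add: algebra_simps)
    then have "exp (- \<epsilon> * \<psi> z) * (?b y * ?Q (post z y)) = ?b y * (?P (post z y) * exp (\<epsilon> * ?\<Delta> z y))"
     by (simp only: mult.left_commute[of "exp (- \<epsilon> * \<psi> z)" "?b y"])
    then show "J \<epsilon> (z, y) = (indicator unit_cell (fst z) * (maxwellian \<beta> (snd z) * f z)) *
     (exp (- \<epsilon> * \<psi> z) * (?b y * ?Q (post z y)) - ?b y * ?P (post z y))"
     by (simp only: J_def kern_def prod.case) (simp add: algebra_simps)
   qed
   also have "... = indicator unit_cell (fst z) * hamiltonian_increment \<beta> q p q (%z. p z + \<epsilon> * \<psi> z) z"
    unfolding h by (subst integral_mult_right_zero) (simp add: mult.assoc)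
   finally show ?case by simp
  qed
 qed
 have [measurable]: "q \<in> borel_measurable borel" unfolding q[abs_def] by measurable
 have inc_m: "hamiltonian_increment \<beta> q p q (%z. p z + \<epsilon> * \<psi> z) \<in> borel_measurable borel" for \<epsilon>
  unfolding hamiltonian_increment_def[abs_def] hamiltonian_density_eq by measurable
 have marg: "integrable phase_measure (hamiltonian_increment \<beta> q p q (%z. p z + \<epsilon> * \<psi> z)) \<and>
  (LINT z|phase_measure. hamiltonian_increment \<beta> q p q (%z. p z + \<epsilon> * \<psi> z) z) = (LINT x|?N. J \<epsilon> x)" for \<epsilon>
 proof -
  note [measurable] = inc_m[of \<epsilon>]
  have Ji: "integrable lborel (%z. LINT y|coll_measure. J \<epsilon> (z, y))" by (rule phase_coll.integrable_fst'[OF J_int])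
  have inc': "AE z in lborel. (LINT y|coll_measure. J \<epsilon> (z, y)) = indicator unit_cell (fst z) * hamiltonian_increment \<beta> q p q (%z. p z + \<epsilon> * \<psi> z) z"
   using inc[of \<epsilon>] by eventually_elim simp
  have "integrable lborel (%z. indicator unit_cell (fst z) * hamiltonian_increment \<beta> q p q (%z. p z + \<epsilon> * \<psi> z) z)"
   by (rule integrable_cong_AE_imp[OF Ji _ inc']) measurable
  moreover have "(LINT z|lborel. indicator unit_cell (fst z) * hamiltonian_increment \<beta> q p q (%z. p z + \<epsilon> * \<psi> z) z) = (LINT z|lborel. LINT y|coll_measure. J \<epsilon> (z, y))"
   by (rule integral_cong_AE[OF _ borel_measurable_integrable[OF Ji] inc[of \<epsilon>]]) measurable
  moreover have "(LINT z|lborel. LINT y|coll_measure. J \<epsilon> (z, y)) = (LINT x|?N. J \<epsilon> x)"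
   by (rule phase_coll.integral_fst'[OF J_int])
  ultimately show ?thesis unfolding phase_integral by simp
 qed
 have "((%\<epsilon>. LINT x|?N. J \<epsilon> x) has_real_derivative (LINT x|?N. J' x)) (at 0)"
 proof (rule has_derivative_at_0_quadratic)
  fix \<epsilon> :: real assume \<epsilon>: "\<bar>\<epsilon>\<bar> <= 1"
  have "J 0 x = 0" for x by (simp add: J_def split: prod.splits)
  then have "(LINT x|?N. J \<epsilon> x) - (LINT x|?N. J 0 x) - \<epsilon> * (LINT x|?N. J' x) = (LINT x|?N. J \<epsilon> x - \<epsilon> * J' x)"
   using J_int[of \<epsilon>] J'_int by simp
  also have "\<bar>...\<bar> <= (LINT x|?N. \<bar>J \<epsilon> x - \<epsilon> * J' x\<bar>)"
   using integral_norm_bound[of ?N "%x. J \<epsilon> x - \<epsilon> * J' x"] by simp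
  also have "... <= (LINT x|?N. (\<epsilon>\<^sup>2 * ((2 * R)\<^sup>2 * exp (2 * R))) * M x)"
   using J_int[of \<epsilon>] J'_int M J_rem[OF \<epsilon>] by (intro integral_mono) auto
  also have "... = ((2 * R)\<^sup>2 * exp (2 * R) * (LINT x|?N. M x)) * \<epsilon>\<^sup>2" by simp
  finally show "\<bar>(LINT x|?N. J \<epsilon> x) - (LINT x|?N. J 0 x) - \<epsilon> * (LINT x|?N. J' x)\<bar> <= ((2 * R)\<^sup>2 * exp (2 * R) * (LINT x|?N. M x)) * \<epsilon>\<^sup>2" .
 qed
 then show "integrable phase_measure (%z. ?\<kappa> z * \<psi> z) \<and>
   (\<forall>\<^sub>F \<epsilon> in nhds 0. integrable phase_measure (hamiltonian_increment \<beta> q p q (%z. p z + \<epsilon> * \<psi> z))) \<and>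
   ((%\<epsilon>. LINT z|phase_measure. hamiltonian_increment \<beta> q p q (%z. p z + \<epsilon> * \<psi> z) z)
    has_real_derivative (LINT z|phase_measure. ?\<kappa> z * \<psi> z)) (at 0)"
  using \<kappa>i marg unfolding \<kappa>_eq J'_def by (simp add: always_eventually)
qed

section \<open>Iterated collision steps\<close>

text \<open>The weight \<open>S\<close> depends on the segment, so that a single segment can be tested against a null set.\<close>

primrec tree_op ::
 "real => (nat => real => real => 'n::finite phase => ennreal) => (nat => real) => nat =>
  (real => 'n phase => ennreal) => real => 'n phase => ennreal" where
 "tree_op \<beta> S \<sigma> 0 h = h"
| "tree_op \<beta> S \<sigma> (Suc k) h = tree_op \<beta> S \<sigma> k (coll_step \<beta> 1 (S k) (\<sigma> (Suc k)) h)"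

lemma tree_op_cong_signs:
 assumes "!!i. 1 <= i ==> i <= k ==> \<sigma> i = \<sigma>' i"
 shows "tree_op \<beta> S \<sigma> k h = tree_op \<beta> S \<sigma>' k h"
 using assms by (induction k arbitrary: h) auto

lemma tree_op_mono:
 assumes "!!u z. 0 < u ==> u <= s ==> h u z <= h' u z" "0 < s"
 shows "tree_op \<beta> S \<sigma> k h s z <= tree_op \<beta> S \<sigma> k h' s z"
 using assms
proof (induction k arbitrary: h h')
 case (Suc k)
 show ?case unfolding tree_op.simps
 proof (rule Suc.IH)
  fix u z assume "0 < u" "u <= s"
  then show "coll_step \<beta> 1 (S k) (\<sigma> (Suc k)) h u z <= coll_step \<beta> 1 (S k) (\<sigma> (Suc k)) h' u z"
   by (intro coll_step_mono Suc.prems) auto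
 qed (rule Suc.prems)
qed simp

lemma tree_op_cong:
 assumes "!!u z. 0 < u ==> u <= s ==> h u z = h' u z" "0 < s"
 shows "tree_op \<beta> S \<sigma> k h s z = tree_op \<beta> S \<sigma> k h' s z"
 using assms by (intro antisym tree_op_mono) auto

lemma tree_op_add:
 assumes S: "!!i. jointly_measurable3 (S i)"
  and h: "jointly_measurable h"
  and h': "jointly_measurable h'"
 shows "tree_op \<beta> S \<sigma> k (%s z. h s z + h' s z) s z = tree_op \<beta> S \<sigma> k h s z + tree_op \<beta> S \<sigma> k h' s z"
 using h h'
proof (induction k arbitrary: h h')
 case (Suc k)
 have "coll_step \<beta> 1 (S k) (\<sigma> (Suc k)) (%s z. h s z + h' s z)
  = (%s z. coll_step \<beta> 1 (S k) (\<sigma> (Suc k)) h s z + coll_step \<beta> 1 (S k) (\<sigma> (Suc k)) h' s z)"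
  by (intro ext coll_step_add[OF S Suc.prems])
 then show ?case
  using Suc.IH[OF measurable_coll_step[OF S Suc.prems(1)] measurable_coll_step[OF S Suc.prems(2)]] by simp
qed simp

lemma coll_step_AE_zero:
 assumes \<beta>: "\<beta> > 0" and S: "jointly_measurable3 S"
  and h: "jointly_measurable h"
  and zero: "!!s. AE z in lborel. h s z = 0"
 shows "AE z in lborel. coll_step \<beta> 1 S \<sigma> h s z = 0"
proof -
 note [measurable (raw)] = joint_apply3[OF S] joint_apply[OF h]
 have [measurable]: "h s \<in> borel_measurable borel" for s by (rule section_measurable[OF h])
 have "AE z in lborel. coll_op \<beta> \<sigma> (h u) z = 0" for u
 proof (cases "\<sigma> = 1")
  case True
  have "AE z in lborel. gain \<beta> (h u) z = gain \<beta> (%_. 0) z"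
   by (rule gain_cong_AE[OF \<beta> _ _ zero]) auto
  then show ?thesis by eventually_elim (simp add: True coll_op_def, simp add: gain_def split_def)
 next
  case False
  from zero[of u] show ?thesis by eventually_elim (simp add: coll_op_def False)
 qed
 then have flow0: "AE z in lborel. coll_op \<beta> \<sigma> (h u) (free_flow (u - s) z) = 0" for u by (rule AE_lborel_free_flow)
 have "AE u in lborel. AE z in lborel. indicator {0<..<s} u * (S u s z * coll_op \<beta> \<sigma> (h u) (free_flow (1 * (u - s)) z)) = 0"
 proof (rule AE_I2)
  fix u :: real
  have "AE z in lborel. coll_op \<beta> \<sigma> (h u) (free_flow (u - s) z) = 0" by (rule flow0)
  then show "AE z in lborel. indicator {0<..<s} u * (S u s z * coll_op \<beta> \<sigma> (h u) (free_flow (1 * (u - s)) z)) = 0"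
   by eventually_elim simp
 qed
 then have "AE z in lborel. AE u in lborel. indicator {0<..<s} u * (S u s z * coll_op \<beta> \<sigma> (h u) (free_flow (1 * (u - s)) z)) = 0"
  by (subst (asm) AE_lborel_swap) measurable
 then show ?thesis
 proof eventually_elim
  case (elim z)
  then show ?case
   unfolding coll_step_def
   using coll_step_integrand_measurable[OF S h] by (subst nn_integral_0_iff_AE) auto
 qed
qed

lemma tree_op_AE_zero:
 assumes \<beta>: "\<beta> > 0" and S: "!!i. jointly_measurable3 (S i)"
  and h: "jointly_measurable h"
  and zero: "!!s. AE z in lborel. h s z = 0"
 shows "AE z in lborel. tree_op \<beta> S \<sigma> k h s z = 0"
 using h zero
proof (induction k arbitrary: h)
 case (Suc k)
 show ?case unfolding tree_op.simps
  by (rule Suc.IH[OF measurable_coll_step[OF S Suc.prems(1)] coll_step_AE_zero[OF \<beta> S Suc.prems]])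
qed simp

lemma tree_op_AE_zero_segment:
 assumes \<beta>: "\<beta> > 0" and S: "!!i. jointly_measurable3 (S i)"
  and h: "jointly_measurable h"
  and zero: "!!s. AE z in lborel. \<forall>u. S n u s z = 0" and n: "n < k"
 shows "AE z in lborel. tree_op \<beta> S \<sigma> k h s z = 0"
 using h n
proof (induction k arbitrary: h)
 case (Suc k)
 note m = measurable_coll_step[OF S Suc.prems(1)]
 show ?case
 proof (cases "n = k")
  case False
  then show ?thesis using Suc.prems(2) unfolding tree_op.simps by (intro Suc.IH m) auto
 next
  case True
  have "AE z in lborel. coll_step \<beta> 1 (S k) (\<sigma> (Suc k)) h s z = 0" for s
   using zero[of s] by eventually_elim (simp add: coll_step_def True)
  then show ?thesis unfolding tree_op.simps by (intro tree_op_AE_zero[OF \<beta> S] m)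
 qed
qed simp

subsection \<open>Integration over collision trees\<close>

interpretation pv: product_sigma_finite "%_ :: nat. lborel :: (real ^ 'n::finite) measure" ..
interpretation pw: product_sigma_finite "%_ :: nat. sphere_measure :: (real ^ 'n::finite) measure" ..
interpretation pt: product_sigma_finite "%_ :: nat. lborel :: real measure" ..

lemma sigma_finite_tree_parts:
 "sigma_finite_measure (Pi\<^sub>M {1..k :: nat} (%_. lborel :: (real ^ 'n::finite) measure))"
 "sigma_finite_measure (Pi\<^sub>M {1..k :: nat} (%_. sphere_measure :: (real ^ 'n::finite) measure))"
 "sigma_finite_measure (Pi\<^sub>M {1..k :: nat} (%_. lborel :: real measure))"
 by (auto intro: pv.sigma_finite pw.sigma_finite pt.sigma_finite)

lemma sigma_finite_tree: "sigma_finite_measure (tree_measure k :: 'n::finite tree_data measure)"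
 unfolding tree_measure_def
 by (intro sigma_finite_pair_measure sigma_finite_tree_parts)

lemma nn_integral_PiM_Suc:
 assumes M: "product_sigma_finite (%_ :: nat. M)" and f: "f \<in> borel_measurable (Pi\<^sub>M {1..Suc k} (%_. M))"
 shows "(\<integral>\<^sup>+x. f x \<partial>Pi\<^sub>M {1..Suc k} (%_. M)) = (\<integral>\<^sup>+x. \<integral>\<^sup>+y. f (x(Suc k := y)) \<partial>M \<partial>Pi\<^sub>M {1..k} (%_. M))"
proof -
 interpret product_sigma_finite "%_ :: nat. M" by (rule M)
 have "{1..Suc k} = insert (Suc k) {1..k}" by auto
 then show ?thesis using f by (simp add: product_nn_integral_insert)
qed

lemma measurable_update_Suc [measurable (raw)]:
 assumes "f \<in> N \<rightarrow>\<^sub>M Pi\<^sub>M {1..k} (%_. M)" "g \<in> N \<rightarrow>\<^sub>M M"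
 shows "(%x. (f x)(Suc k := g x)) \<in> N \<rightarrow>\<^sub>M Pi\<^sub>M {1..Suc k} (%_. M)"
 by (rule measurable_fun_upd[OF _ assms]) auto

lemma update_in_space [simp]:
 assumes "x \<in> space (Pi\<^sub>M {Suc 0..k} (%_. M))" "y \<in> space M"
 shows "x(Suc k := y) \<in> space (Pi\<^sub>M {Suc 0..Suc k} (%_. M))"
 using assms by (auto simp: space_PiM PiE_def extensional_def Pi_def)

text \<open>The collision with the earliest time is integrated first.\<close>

lemma tree_peel:
 fixes f :: "'n::finite tree_data => ennreal"
 assumes f: "f \<in> borel_measurable (tree_measure (Suc k))"
 shows "(\<integral>\<^sup>+x. f x \<partial>tree_measure (Suc k)) =
  (\<integral>\<^sup>+(vs, \<omega>s, \<tau>). (\<integral>\<^sup>+u. \<integral>\<^sup>+(w, \<omega>). f (vs(Suc k := w), \<omega>s(Suc k := \<omega>), \<tau>(Suc k := u))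
   \<partial>coll_measure \<partial>lborel) \<partial>tree_measure k)"
proof -
 let ?A = "%k. Pi\<^sub>M {1..k :: nat} (%_. lborel :: (real ^ 'n) measure)"
 let ?B = "%k. Pi\<^sub>M {1..k :: nat} (%_. sphere_measure :: (real ^ 'n) measure)"
 let ?C = "%k. Pi\<^sub>M {1..k :: nat} (%_. lborel :: real measure)"
 interpret A: sigma_finite_measure "?A k" by (rule sigma_finite_tree_parts)
 interpret B: sigma_finite_measure "?B k" by (rule sigma_finite_tree_parts)
 interpret C: sigma_finite_measure "?C k" by (rule sigma_finite_tree_parts)
 interpret A': sigma_finite_measure "?A (Suc k)" by (rule sigma_finite_tree_parts)
 interpret B': sigma_finite_measure "?B (Suc k)" by (rule sigma_finite_tree_parts)
 interpret C': sigma_finite_measure "?C (Suc k)" by (rule sigma_finite_tree_parts)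
 interpret BC': pair_sigma_finite "?B (Suc k)" "?C (Suc k)" ..
 interpret BC: pair_sigma_finite "?B k" "?C k" ..
 interpret vB: pair_sigma_finite "lborel :: (real ^ 'n) measure" "?B k" ..
 interpret vC: pair_sigma_finite "lborel :: (real ^ 'n) measure" "?C k" ..
 interpret wC: pair_sigma_finite "sphere_measure :: (real ^ 'n) measure" "?C k" ..
 interpret wt: pair_sigma_finite "sphere_measure :: (real ^ 'n) measure" "lborel :: real measure" ..
 have F[measurable (raw)]: "(%x. f (a x, b x, c x)) \<in> borel_measurable N"
  if [measurable]: "a \<in> N \<rightarrow>\<^sub>M ?A (Suc k)" "b \<in> N \<rightarrow>\<^sub>M ?B (Suc k)" "c \<in> N \<rightarrow>\<^sub>M ?C (Suc k)" for N :: "'k measure" and a b c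
  by (rule measurable_compose[OF _ f[unfolded tree_measure_def]]) (intro measurable_Pair that)
 let ?g = "%vs w \<omega>s \<omega> \<tau> u. f (vs(Suc k := w), \<omega>s(Suc k := \<omega>), \<tau>(Suc k := u))"
 have "(\<integral>\<^sup>+x. f x \<partial>tree_measure (Suc k)) = (\<integral>\<^sup>+vs. \<integral>\<^sup>+\<omega>s. \<integral>\<^sup>+\<tau>. f (vs, \<omega>s, \<tau>) \<partial>?C (Suc k) \<partial>?B (Suc k) \<partial>?A (Suc k))"
 proof -
  note f' = f[unfolded tree_measure_def]
  have "(\<integral>\<^sup>+x. f x \<partial>tree_measure (Suc k)) = (\<integral>\<^sup>+vs. \<integral>\<^sup>+y. f (vs, y) \<partial>(?B (Suc k) \<Otimes>\<^sub>M ?C (Suc k)) \<partial>?A (Suc k))"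
   unfolding tree_measure_def by (rule BC'.nn_integral_fst[OF f', symmetric])
  also have "... = (\<integral>\<^sup>+vs. \<integral>\<^sup>+\<omega>s. \<integral>\<^sup>+\<tau>. f (vs, \<omega>s, \<tau>) \<partial>?C (Suc k) \<partial>?B (Suc k) \<partial>?A (Suc k))"
   by (intro nn_integral_cong C'.nn_integral_fst[symmetric] measurable_Pair2[OF f'])
  finally show ?thesis .
 qed
 also have "... = (\<integral>\<^sup>+vs. \<integral>\<^sup>+w. \<integral>\<^sup>+\<omega>s. \<integral>\<^sup>+\<omega>. \<integral>\<^sup>+\<tau>. \<integral>\<^sup>+u. ?g vs w \<omega>s \<omega> \<tau> u \<partial>lborel \<partial>?C k \<partial>sphere_measure \<partial>?B k \<partial>lborel \<partial>?A k)"
 proof -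
  have "(\<integral>\<^sup>+vs. \<integral>\<^sup>+\<omega>s. \<integral>\<^sup>+\<tau>. f (vs, \<omega>s, \<tau>) \<partial>?C (Suc k) \<partial>?B (Suc k) \<partial>?A (Suc k))
   = (\<integral>\<^sup>+vs. \<integral>\<^sup>+w. \<integral>\<^sup>+\<omega>s. \<integral>\<^sup>+\<tau>. f (vs(Suc k := w), \<omega>s, \<tau>) \<partial>?C (Suc k) \<partial>?B (Suc k) \<partial>lborel \<partial>?A k)"
   by (rule nn_integral_PiM_Suc[OF pv.product_sigma_finite_axioms]) measurable
  also have "... = (\<integral>\<^sup>+vs. \<integral>\<^sup>+w. \<integral>\<^sup>+\<omega>s. \<integral>\<^sup>+\<omega>. \<integral>\<^sup>+\<tau>. f (vs(Suc k := w), \<omega>s(Suc k := \<omega>), \<tau>) \<partial>?C (Suc k) \<partial>sphere_measure \<partial>?B k \<partial>lborel \<partial>?A k)"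
   by (intro nn_integral_cong nn_integral_PiM_Suc[OF pw.product_sigma_finite_axioms]) measurable
  also have "... = (\<integral>\<^sup>+vs. \<integral>\<^sup>+w. \<integral>\<^sup>+\<omega>s. \<integral>\<^sup>+\<omega>. \<integral>\<^sup>+\<tau>. \<integral>\<^sup>+u. ?g vs w \<omega>s \<omega> \<tau> u \<partial>lborel \<partial>?C k \<partial>sphere_measure \<partial>?B k \<partial>lborel \<partial>?A k)"
   by (intro nn_integral_cong nn_integral_PiM_Suc[OF pt.product_sigma_finite_axioms]) measurable
  finally show ?thesis .
 qed
 also have "... = (\<integral>\<^sup>+vs. \<integral>\<^sup>+\<omega>s. \<integral>\<^sup>+w. \<integral>\<^sup>+\<omega>. \<integral>\<^sup>+\<tau>. \<integral>\<^sup>+u. ?g vs w \<omega>s \<omega> \<tau> u \<partial>lborel \<partial>?C k \<partial>sphere_measure \<partial>lborel \<partial>?B k \<partial>?A k)"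
  by (intro nn_integral_cong vB.Fubini'[symmetric]) measurable
 also have "... = (\<integral>\<^sup>+vs. \<integral>\<^sup>+\<omega>s. \<integral>\<^sup>+w. \<integral>\<^sup>+\<tau>. \<integral>\<^sup>+\<omega>. \<integral>\<^sup>+u. ?g vs w \<omega>s \<omega> \<tau> u \<partial>lborel \<partial>sphere_measure \<partial>?C k \<partial>lborel \<partial>?B k \<partial>?A k)"
  by (intro nn_integral_cong wC.Fubini'[symmetric]) measurable
 also have "... = (\<integral>\<^sup>+vs. \<integral>\<^sup>+\<omega>s. \<integral>\<^sup>+\<tau>. \<integral>\<^sup>+w. \<integral>\<^sup>+\<omega>. \<integral>\<^sup>+u. ?g vs w \<omega>s \<omega> \<tau> u \<partial>lborel \<partial>sphere_measure \<partial>lborel \<partial>?C k \<partial>?B k \<partial>?A k)"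
  by (intro nn_integral_cong vC.Fubini'[symmetric]) measurable
 also have "... = (\<integral>\<^sup>+vs. \<integral>\<^sup>+\<omega>s. \<integral>\<^sup>+\<tau>. \<integral>\<^sup>+w. \<integral>\<^sup>+u. \<integral>\<^sup>+\<omega>. ?g vs w \<omega>s \<omega> \<tau> u \<partial>sphere_measure \<partial>lborel \<partial>lborel \<partial>?C k \<partial>?B k \<partial>?A k)"
  by (intro nn_integral_cong wt.Fubini'[symmetric]) measurable
 also have "... = (\<integral>\<^sup>+vs. \<integral>\<^sup>+\<omega>s. \<integral>\<^sup>+\<tau>. \<integral>\<^sup>+u. \<integral>\<^sup>+w. \<integral>\<^sup>+\<omega>. ?g vs w \<omega>s \<omega> \<tau> u \<partial>sphere_measure \<partial>lborel \<partial>lborel \<partial>?C k \<partial>?B k \<partial>?A k)"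
  by (intro nn_integral_cong lborel_pair.Fubini'[symmetric]) measurable
 also have "... = (\<integral>\<^sup>+vs. \<integral>\<^sup>+\<omega>s. \<integral>\<^sup>+\<tau>. \<integral>\<^sup>+u. \<integral>\<^sup>+y. ?g vs (fst y) \<omega>s (snd y) \<tau> u \<partial>coll_measure \<partial>lborel \<partial>?C k \<partial>?B k \<partial>?A k)"
 proof (intro nn_integral_cong)
  fix vs \<omega>s \<tau> and u :: real
  assume s: "vs \<in> space (?A k)" "\<omega>s \<in> space (?B k)" "\<tau> \<in> space (?C k)"
  have "(%y. ?g vs (fst y) \<omega>s (snd y) \<tau> u) \<in> borel_measurable coll_measure"
   using s by measurable
  from sphere.nn_integral_fst[OF this]
  show "(\<integral>\<^sup>+w. \<integral>\<^sup>+\<omega>. ?g vs w \<omega>s \<omega> \<tau> u \<partial>sphere_measure \<partial>lborel) = (\<integral>\<^sup>+y. ?g vs (fst y) \<omega>s (snd y) \<tau> u \<partial>coll_measure)"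
   by simp
 qed
 also have "... = (\<integral>\<^sup>+x. (\<integral>\<^sup>+u. \<integral>\<^sup>+y. ?g (fst x) (fst y) (fst (snd x)) (snd y) (snd (snd x)) u \<partial>coll_measure \<partial>lborel) \<partial>tree_measure k)"
 proof -
  let ?G = "%x. \<integral>\<^sup>+u. \<integral>\<^sup>+y. ?g (fst x) (fst y) (fst (snd x)) (snd y) (snd (snd x)) u \<partial>coll_measure \<partial>lborel"
  have G: "?G \<in> borel_measurable (?A k \<Otimes>\<^sub>M (?B k \<Otimes>\<^sub>M ?C k))" by measurable
  have "(\<integral>\<^sup>+x. ?G x \<partial>tree_measure k) = (\<integral>\<^sup>+vs. \<integral>\<^sup>+y. ?G (vs, y) \<partial>(?B k \<Otimes>\<^sub>M ?C k) \<partial>?A k)"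
   unfolding tree_measure_def by (rule BC.nn_integral_fst[OF G, symmetric])
  also have "... = (\<integral>\<^sup>+vs. \<integral>\<^sup>+\<omega>s. \<integral>\<^sup>+\<tau>. ?G (vs, \<omega>s, \<tau>) \<partial>?C k \<partial>?B k \<partial>?A k)"
   by (intro nn_integral_cong C.nn_integral_fst[symmetric] measurable_Pair2[OF G])
  finally show ?thesis by simp
 qed
 finally show ?thesis by (simp add: case_prod_unfold)
qed

lemma measurable_tree_parts:
 "(%x. fst (snd x)) \<in> N \<Otimes>\<^sub>M tree_measure k \<rightarrow>\<^sub>M Pi\<^sub>M {1..k} (%_. lborel)"
 "(%x. fst (snd (snd x))) \<in> N \<Otimes>\<^sub>M tree_measure k \<rightarrow>\<^sub>M Pi\<^sub>M {1..k} (%_. sphere_measure)"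
 "(%x. snd (snd (snd x))) \<in> N \<Otimes>\<^sub>M tree_measure k \<rightarrow>\<^sub>M Pi\<^sub>M {1..k} (%_. lborel)"
 unfolding tree_measure_def by measurable

lemma measurable_tree_components:
 assumes "i \<in> {1..k}"
 shows "(%x. fst (snd x) i) \<in> borel_measurable (N \<Otimes>\<^sub>M tree_measure k)"
  and "(%x. fst (snd (snd x)) i) \<in> borel_measurable (N \<Otimes>\<^sub>M tree_measure k)"
  and "(%x. snd (snd (snd x)) i) \<in> borel_measurable (N \<Otimes>\<^sub>M tree_measure k)"
proof -
 show "(%x. fst (snd x) i) \<in> borel_measurable (N \<Otimes>\<^sub>M tree_measure k)"
  using measurable_compose[OF measurable_tree_parts(1)[of N k] measurable_component_singleton[OF assms]] by simp
 show "(%x. snd (snd (snd x)) i) \<in> borel_measurable (N \<Otimes>\<^sub>M tree_measure k)"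
  using measurable_compose[OF measurable_tree_parts(3)[of N k] measurable_component_singleton[OF assms]] by simp
 have "(%x. fst (snd (snd x)) i) \<in> (N \<Otimes>\<^sub>M tree_measure k) \<rightarrow>\<^sub>M sphere_measure"
  by (rule measurable_compose[OF measurable_tree_parts(2)[of N k] measurable_component_singleton[OF assms]])
 then show "(%x. fst (snd (snd x)) i) \<in> borel_measurable (N \<Otimes>\<^sub>M tree_measure k)"
  by (subst (asm) measurable_cong_sets[OF refl sets_sphere_measure])
qed

abbreviation (input) "tvel \<sigma> i x \<equiv> traj_vel \<sigma> (fst (snd x)) (fst (snd (snd x))) (snd (fst x)) i"
abbreviation (input) "tpos t \<sigma> i x \<equiv> traj_pos t \<sigma> (fst (snd x)) (fst (snd (snd x))) (snd (snd (snd x))) (fst x) i"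

lemma measurable_traj_vel:
 assumes "i <= k"
 shows "(%x. tvel \<sigma> i x) \<in> borel_measurable ((borel :: 'n::finite phase measure) \<Otimes>\<^sub>M tree_measure k)"
 using assms
proof (induction i)
 case (Suc i)
 then have i: "Suc i \<in> {1..k}" by auto
 note [measurable] = Suc.IH[OF Suc_leD[OF Suc.prems]] measurable_tree_components[OF i]
 show ?case by (cases "\<sigma> (Suc i) = 1") simp_all
qed simp

lemma measurable_traj_time:
 assumes "i <= k"
 shows "(%x. traj_time t (snd (snd (snd x))) i) \<in> borel_measurable (N \<Otimes>\<^sub>M (tree_measure k ::
   'n::finite tree_data measure))"
 using assms measurable_tree_components(3)[of i k N] by (cases "i = 0") (auto simp: traj_time_def)

lemma measurable_traj_pos:
 assumes "i <= k"
 shows "(%x. tpos t \<sigma> i x) \<in> borel_measurable ((borel :: 'n::finite phase measure) \<Otimes>\<^sub>M tree_measure k)"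
 using assms
proof (induction i)
 case (Suc i)
 then have i: "i <= k" "Suc i <= k" by auto
 note [measurable] = Suc.IH[OF i(1)] measurable_traj_vel[OF i(1)] measurable_traj_time[OF i(1)] measurable_traj_time[OF i(2)]
 show ?case by simp
qed simp

lemma measurable_collision_times:
 "(%x. indicator (collision_times t k) (snd (snd (snd x))) :: 'b::{zero_neq_one, topological_space}) \<in> borel_measurable (N \<Otimes>\<^sub>M (tree_measure k ::
   'n::finite tree_data measure))"
proof -
 note [measurable] = measurable_tree_components(3)
 have "Measurable.pred (N \<Otimes>\<^sub>M (tree_measure k :: 'n tree_data measure))
   (%x. snd (snd (snd x)) \<in> collision_times t k)"
  unfolding collision_times_def mem_Collect_eq by measurable
 then have "(%x. if snd (snd (snd x)) \<in> collision_times t k then 1 else 0 :: 'b) \<in> borel_measurable (N \<Otimes>\<^sub>M (tree_measure k ::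
   'n tree_data measure))"
  by measurable
 then show ?thesis by (simp add: indicator_def of_bool_def)
qed

text \<open>The Maxwellians of the tree are kept with the cross sections, since collisions exchange their factors.\<close>

definition tree_weight ::
 "real => real => nat => (nat => real) => real ^ 'n::finite => 'n tree_data => real" where
 "tree_weight \<beta> t k \<sigma> v = (%(vs, \<omega>s, \<tau>). indicator (collision_times t k) \<tau> *
   (\<Prod>i\<in>{1..k}. cross_section (traj_vel \<sigma> vs \<omega>s v (i - 1)) (vs i) (\<omega>s i) * maxwellian \<beta> (background_vel \<sigma> vs \<omega>s v i)) *
   maxwellian \<beta> (traj_vel \<sigma> vs \<omega>s v k))"

lemma tree_weight_nonneg [simp]: "0 <= tree_weight \<beta> t k \<sigma> v x"
 by (auto simp: tree_weight_def split_beta intro!: mult_nonneg_nonneg prod_nonneg)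

lemma measurable_background_vel:
 assumes i: "i \<in> {1..k}"
 shows "(%x. background_vel \<sigma> (fst (snd x)) (fst (snd (snd x))) (snd (fst x)) i) \<in> borel_measurable ((borel :: 'n::finite phase measure) \<Otimes>\<^sub>M tree_measure k)"
proof -
 have "i - 1 <= k" using i by auto
 note [measurable] = measurable_traj_vel[OF this] measurable_tree_components[OF i]
 show ?thesis unfolding background_vel_def by (cases "\<sigma> i = 1"; simp only: if_True if_False simp_thms; measurable)
qed

lemma measurable_tree_weight:
 "(%x. tree_weight \<beta> t k \<sigma> (snd (fst x)) (snd x)) \<in> borel_measurable ((borel :: 'n::finite phase measure) \<Otimes>\<^sub>M tree_measure k)"
proof -
 have "(%x. cross_section (tvel \<sigma> (i - 1) x) (fst (snd x) i) (fst (snd (snd x)) i) *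
   maxwellian \<beta> (background_vel \<sigma> (fst (snd x)) (fst (snd (snd x))) (snd (fst x)) i))
   \<in> borel_measurable ((borel :: 'n::finite phase measure) \<Otimes>\<^sub>M tree_measure k)" if i: "i \<in> {1..k}" for i
 proof -
  have "i - 1 <= k" using i by auto
  note [measurable] = measurable_traj_vel[OF this] measurable_tree_components[OF i] measurable_background_vel[OF i]
  show ?thesis by measurable
 qed
 note [measurable] = this measurable_traj_vel[OF order_refl] measurable_collision_times
 show ?thesis unfolding tree_weight_def split_beta by measurable
qed

lemma traj_vel_update: "i <= k ==> traj_vel \<sigma> (vs(Suc k := w)) (\<omega>s(Suc k := \<omega>)) v i = traj_vel \<sigma> vs \<omega>s v i"
 by (induction i) auto

lemma traj_time_update: "i <= k ==> traj_time t (\<tau>(Suc k := u)) i = traj_time t \<tau> i"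
 by (simp add: traj_time_def)

lemma traj_pos_update: "i <= k ==> traj_pos t \<sigma> (vs(Suc k := w)) (\<omega>s(Suc k := \<omega>)) (\<tau>(Suc k := u)) z i = traj_pos t \<sigma> vs \<omega>s \<tau> z i"
 by (induction i) (auto simp: traj_vel_update traj_time_update)

lemma background_vel_update:
 "i \<in> {1..k} ==> background_vel \<sigma> (vs(Suc k := w)) (\<omega>s(Suc k := \<omega>)) v i = background_vel \<sigma> vs \<omega>s v i"
 unfolding background_vel_def by (subst traj_vel_update) auto

lemma collision_times_update:
 "\<tau>(Suc k := u) \<in> collision_times t (Suc k) \<longleftrightarrow> \<tau> \<in> collision_times t k \<and> 0 < u \<and> u < traj_time t \<tau> k"
proof (cases "k = 0")
 case True
 then show ?thesis by (auto simp: collision_times_def traj_time_def)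
next
 case False
 have 1: "{1..Suc k} = insert (Suc k) {1..k}" by auto
 have "(\<forall>i\<in>{1..k}. u < \<tau> i) \<longleftrightarrow> u < \<tau> k" if "\<tau> \<in> collision_times t k"
 proof
  assume u: "u < \<tau> k"
  show "\<forall>i\<in>{1..k}. u < \<tau> i"
  proof
   fix i assume i: "i \<in> {1..k}"
   then have "\<tau> k <= \<tau> i" using that False by (cases "i = k") (auto simp: collision_times_def intro: less_imp_le)
   with u show "u < \<tau> i" by simp
  qed
 qed (use False in auto)
 note below = this
 let ?\<tau> = "\<tau>(Suc k := u)"
 have kk: "k \<in> {1..k}" "k \<in> {1..Suc k}" "Suc k \<in> {1..Suc k}" using False by auto
 have tk: "traj_time t \<tau> k = \<tau> k" using False by (simp add: traj_time_def)
 show ?thesis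
  unfolding tk
 proof
  assume L: "?\<tau> \<in> collision_times t (Suc k)"
  then have L1: "\<forall>i\<in>{1..Suc k}. 0 < ?\<tau> i \<and> ?\<tau> i < t"
   and L2: "\<forall>i\<in>{1..Suc k}. \<forall>j\<in>{1..Suc k}. i < j --> ?\<tau> j < ?\<tau> i"
   unfolding collision_times_def by blast+
  have "\<tau> \<in> collision_times t k"
   unfolding collision_times_def mem_Collect_eq
  proof (intro conjI ballI impI)
   fix i assume i: "i \<in> {1..k}"
   then have "i \<in> {1..Suc k}" "i \<noteq> Suc k" by auto
   with L1[rule_format, of i] show "0 < \<tau> i" "\<tau> i < t" by auto
   fix j assume j: "j \<in> {1..k}" "i < j"
   then have "j \<in> {1..Suc k}" "j \<noteq> Suc k" by auto
   with L2[rule_format, of i j] \<open>i \<in> {1..Suc k}\<close> \<open>i \<noteq> Suc k\<close> j show "\<tau> j < \<tau> i" by auto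
  qed
  moreover have "0 < u" using L1[rule_format, OF kk(3)] by simp
  moreover have "u < \<tau> k" using L2[rule_format, OF kk(2,3)] by simp
  ultimately show "\<tau> \<in> collision_times t k \<and> 0 < u \<and> u < \<tau> k" by simp
 next
  assume R: "\<tau> \<in> collision_times t k \<and> 0 < u \<and> u < \<tau> k"
  then have R1: "\<forall>i\<in>{1..k}. 0 < \<tau> i \<and> \<tau> i < t"
   and R2: "\<forall>i\<in>{1..k}. \<forall>j\<in>{1..k}. i < j --> \<tau> j < \<tau> i"
   unfolding collision_times_def by blast+
  have R3: "\<forall>i\<in>{1..k}. u < \<tau> i" using below R by blast
  have R4: "u < t" using R1[rule_format, OF kk(1)] R by simp
  show "?\<tau> \<in> collision_times t (Suc k)"
   unfolding collision_times_def mem_Collect_eq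
  proof (intro conjI ballI impI)
   fix i assume i: "i \<in> {1..Suc k}"
   then have "i = Suc k \<or> i \<in> {1..k}" by auto
   then show "0 < ?\<tau> i" "?\<tau> i < t" using R R1 R4 by auto
   fix j assume j: "j \<in> {1..Suc k}" "i < j"
   then have i': "i \<in> {1..k}" using i by auto
   have "j = Suc k \<or> j \<in> {1..k}" using j by auto
   then show "?\<tau> j < ?\<tau> i" using R2 R3 i' j(2) by auto
  qed
 qed
qed

text \<open>A collision conserves energy: \<open>M(v') M(w') = M(v) M(w)\<close>.  So the Maxwellians of one collision reduce to
\<open>M(w)\<close>, the weight in the gain operator.\<close>

lemma tree_weight_Suc:
 assumes "\<sigma> (Suc k) = 1 ==> norm \<omega> = 1"
 shows "tree_weight \<beta> t (Suc k) \<sigma> v (vs(Suc k := w), \<omega>s(Suc k := \<omega>), \<tau>(Suc k := u))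
  = tree_weight \<beta> t k \<sigma> v (vs, \<omega>s, \<tau>) * (indicator {0<..<traj_time t \<tau> k} u * (cross_section (traj_vel \<sigma> vs \<omega>s v k) w \<omega> * maxwellian \<beta> w))"
proof -
 let ?v = "traj_vel \<sigma> vs \<omega>s v k"
 let ?P = "\<Prod>i\<in>{1..k}. cross_section (traj_vel \<sigma> vs \<omega>s v (i - 1)) (vs i) (\<omega>s i) * maxwellian \<beta> (background_vel \<sigma> vs \<omega>s v i)"
 have "(\<Prod>i\<in>{1..Suc k}. cross_section (traj_vel \<sigma> (vs(Suc k := w)) (\<omega>s(Suc k := \<omega>)) v (i - 1)) ((vs(Suc k := w)) i) ((\<omega>s(Suc k := \<omega>)) i) *
   maxwellian \<beta> (background_vel \<sigma> (vs(Suc k := w)) (\<omega>s(Suc k := \<omega>)) v i))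
  = ?P * (cross_section ?v w \<omega> * maxwellian \<beta> (background_vel \<sigma> (vs(Suc k := w)) (\<omega>s(Suc k := \<omega>)) v (Suc k)))"
 proof -
  have "(\<Prod>i\<in>{1..k}. cross_section (traj_vel \<sigma> (vs(Suc k := w)) (\<omega>s(Suc k := \<omega>)) v (i - 1)) ((vs(Suc k := w)) i) ((\<omega>s(Suc k := \<omega>)) i) *
   maxwellian \<beta> (background_vel \<sigma> (vs(Suc k := w)) (\<omega>s(Suc k := \<omega>)) v i)) = ?P"
   by (intro prod.cong refl) (auto simp: traj_vel_update background_vel_update)
  then show ?thesis by (simp add: traj_vel_update)
 qed
 note A = this
 have Bm: "maxwellian \<beta> (background_vel \<sigma> (vs(Suc k := w)) (\<omega>s(Suc k := \<omega>)) v (Suc k)) * maxwellian \<beta> (traj_vel \<sigma> (vs(Suc k := w)) (\<omega>s(Suc k := \<omega>)) v (Suc k))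
  = maxwellian \<beta> ?v * maxwellian \<beta> w"
  using assms maxwellian_collision[of \<omega> \<beta> ?v w]
  by (cases "\<sigma> (Suc k) = 1") (auto simp: background_vel_def traj_vel_update mult.commute)
 have C: "indicat_real (collision_times t (Suc k)) (\<tau>(Suc k := u)) = indicator (collision_times t k) \<tau> * indicator {0<..<traj_time t \<tau> k} u"
  by (simp add: indicator_def collision_times_update)
 have regroup: "a * b * (c * (d * e)) * e' = a * c * g * (b * (d * g'))" if "e * e' = g * g'" for a b c d e e' g g' :: real
 proof -
  have "a * b * (c * (d * e)) * e' = a * b * c * d * (e * e')" by (simp only: mult_ac)
  also have "... = a * c * g * (b * (d * g'))" unfolding that by (simp only: mult_ac)
  finally show ?thesis .
 qed
 show ?thesis unfolding tree_weight_def prod.case A C by (rule regroup[OF Bm])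
qed

section \<open>Integrals over collision trees\<close>

definition tree_state ::
 "real => (nat => real) => 'n::finite phase => nat => 'n tree_data => 'n phase" where
 "tree_state t \<sigma> z i x = (traj_pos t \<sigma> (fst x) (fst (snd x)) (snd (snd x)) z i, traj_vel \<sigma> (fst x) (fst (snd x)) (snd z) i)"

definition tree_time :: "real => nat => 'n::finite tree_data => real" where
 "tree_time t i x = traj_time t (snd (snd x)) i"

definition tree_integrand ::
 "real => real => nat => (nat => real) => (nat => real => real => 'n::finite phase => ennreal) =>
  (real => 'n phase => ennreal) => 'n phase => 'n tree_data => ennreal" where
 "tree_integrand \<beta> t k \<sigma> S h z x = ennreal (tree_weight \<beta> t k \<sigma> (snd z) x) *
   ((\<Prod>i<k. S i (tree_time t (Suc i) x) (tree_time t i x) (tree_state t \<sigma> z i x)) *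
   h (tree_time t k x) (tree_state t \<sigma> z k x))"

lemma measurable_tree_state:
 assumes "i <= k"
 shows "(%x. tree_state t \<sigma> (fst x) i (snd x)) \<in> borel_measurable ((borel :: 'n::finite phase measure) \<Otimes>\<^sub>M tree_measure k)"
 using measurable_traj_pos[OF assms] measurable_traj_vel[OF assms]
 unfolding tree_state_def by (rule borel_measurable_Pair)

lemma measurable_tree_time:
 assumes "i <= k"
 shows "(%x. tree_time t i (snd x)) \<in> borel_measurable ((borel :: 'n::finite phase measure) \<Otimes>\<^sub>M tree_measure k)"
 unfolding tree_time_def by (rule measurable_traj_time[OF assms])

lemma measurable_tree_integrand:
 fixes h :: "real => 'n::finite phase => ennreal"
 assumes S: "!!i. jointly_measurable3 (S i)"
  and h: "jointly_measurable h"
 shows "(%x. tree_integrand \<beta> t k \<sigma> S h (fst x) (snd x)) \<in> borel_measurable ((borel :: 'n phase measure) \<Otimes>\<^sub>M tree_measure k)"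
proof -
 have "(%x. S i (tree_time t (Suc i) (snd x)) (tree_time t i (snd x)) (tree_state t \<sigma> (fst x) i (snd x)))
   \<in> borel_measurable ((borel :: 'n phase measure) \<Otimes>\<^sub>M tree_measure k)" if "i \<in> {..<k}" for i
  using that by (intro joint_apply3[OF S] measurable_tree_time measurable_tree_state) auto
 moreover have "(%x. h (tree_time t k (snd x)) (tree_state t \<sigma> (fst x) k (snd x))) \<in> borel_measurable ((borel :: 'n phase measure) \<Otimes>\<^sub>M tree_measure k)"
  by (intro joint_apply[OF h] measurable_tree_time measurable_tree_state) auto
 ultimately show ?thesis
  unfolding tree_integrand_def
  by (intro borel_measurable_times_ennreal borel_measurable_prod_ennreal measurable_compose[OF measurable_tree_weight measurable_ennreal]) auto
qed

lemma measurable_tree_section: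
 fixes f :: "'n::finite phase \<times> 'n tree_data => 'b"
 assumes "f \<in> measurable ((borel :: 'n phase measure) \<Otimes>\<^sub>M tree_measure k) M"
 shows "(%x. f (z, x)) \<in> measurable (tree_measure k) M"
 using measurable_Pair2[OF assms, of z] by simp

lemma coll_op_eq_integral:
 fixes f :: "'n::finite phase => ennreal"
 assumes \<beta>: "\<beta> > 0" and [measurable]: "f \<in> borel_measurable borel"
 shows "(\<integral>\<^sup>+y. ennreal (cross_section (snd z) (fst y) (snd y) * maxwellian \<beta> (fst y)) *
   f (fst z, if \<sigma> = 1 then post1 (snd z) (fst y) (snd y) else snd z) \<partial>coll_measure) = coll_op \<beta> \<sigma> f z"
proof (cases "\<sigma> = 1")
 case True
 then show ?thesis by (simp add: coll_op_def gain_def case_prod_unfold)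
next
 case False
 have "(\<integral>\<^sup>+y. ennreal (cross_section (snd z) (fst y) (snd y) * maxwellian \<beta> (fst y)) * f z \<partial>coll_measure)
  = gain \<beta> (%_. 1) z * f z"
  by (subst nn_integral_multc) (auto simp: gain_def case_prod_unfold)
 then show ?thesis using False by (simp add: coll_op_def gain_one[OF \<beta>])
qed

text \<open>Integrating out the earliest collision replaces the function at the initial end by a collision step
applied to it.\<close>

lemma tree_identity:
 fixes h :: "real => 'n::finite phase => ennreal"
 assumes \<beta>: "\<beta> > 0" and S: "!!i. jointly_measurable3 (S i)"
  and h: "jointly_measurable h"
 shows "(\<integral>\<^sup>+x. tree_integrand \<beta> t k \<sigma> S h z x \<partial>tree_measure k) = ennreal (maxwellian \<beta> (snd z)) * tree_op \<beta> S \<sigma> k h t z"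
 using h
proof (induction k arbitrary: h)
 case 0
 have 1: "emeasure (tree_measure 0 :: 'n tree_data measure) (space (tree_measure 0)) = 1"
 proof -
  interpret a: prob_space "Pi\<^sub>M {} (%_::nat. lborel :: (real ^ 'n) measure)"
   by (rule prob_spaceI) (simp add: space_PiM PiM_empty)
  interpret b: prob_space "Pi\<^sub>M {} (%_::nat. sphere_measure :: (real ^ 'n) measure)"
   by (rule prob_spaceI) (simp add: space_PiM PiM_empty)
  interpret c: prob_space "Pi\<^sub>M {} (%_::nat. lborel :: real measure)"
   by (rule prob_spaceI) (simp add: space_PiM PiM_empty)
  interpret bc: pair_prob_space "Pi\<^sub>M {} (%_::nat. sphere_measure :: (real ^ 'n) measure)" "Pi\<^sub>M {} (%_::nat. lborel :: real measure)" ..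
  interpret abc: pair_prob_space "Pi\<^sub>M {} (%_::nat. lborel :: (real ^ 'n) measure)"
   "Pi\<^sub>M {} (%_::nat. sphere_measure :: (real ^ 'n) measure) \<Otimes>\<^sub>M Pi\<^sub>M {} (%_::nat. lborel :: real measure)" ..
  show ?thesis using abc.P.emeasure_space_1 by (simp add: tree_measure_def)
 qed
 have "tree_integrand \<beta> t 0 \<sigma> S h z x = ennreal (maxwellian \<beta> (snd z)) * h t z" for x
  by (simp add: tree_integrand_def tree_weight_def tree_time_def tree_state_def traj_time_def collision_times_def split_beta)
 then show ?case using 1 by simp
next
 case (Suc k)
 note h = Suc.prems
 note hm [measurable (raw)] = joint_apply[OF h]
 note Sm [measurable (raw)] = joint_apply3[OF S]
 let ?h' = "coll_step \<beta> 1 (S k) (\<sigma> (Suc k)) h"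
 have "(\<integral>\<^sup>+x. tree_integrand \<beta> t (Suc k) \<sigma> S h z x \<partial>tree_measure (Suc k)) =
  (\<integral>\<^sup>+(vs, \<omega>s, \<tau>). (\<integral>\<^sup>+u. \<integral>\<^sup>+(w, \<omega>). tree_integrand \<beta> t (Suc k) \<sigma> S h z (vs(Suc k := w), \<omega>s(Suc k := \<omega>), \<tau>(Suc k := u))
   \<partial>coll_measure \<partial>lborel) \<partial>tree_measure k)"
  by (rule tree_peel, rule measurable_tree_section[OF measurable_tree_integrand[OF S h], simplified])
 also have "... = (\<integral>\<^sup>+x. tree_integrand \<beta> t k \<sigma> S ?h' z x \<partial>tree_measure k)"
 proof (rule nn_integral_cong)
  fix x :: "'n tree_data"
  obtain vs \<omega>s \<tau> where x: "x = (vs, \<omega>s, \<tau>)" by (cases x)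
  let ?s = "tree_time t k x" and ?y = "tree_state t \<sigma> z k x"
  let ?W = "ennreal (tree_weight \<beta> t k \<sigma> (snd z) x) * (\<Prod>i<k. S i (tree_time t (Suc i) x) (tree_time t i x) (tree_state t \<sigma> z i x))"
  let ?up = "%u y. (vs(Suc k := fst y), \<omega>s(Suc k := snd y), \<tau>(Suc k := u))"
  have step: "tree_integrand \<beta> t (Suc k) \<sigma> S h z (?up u y) = ?W * (indicator {0<..<?s} u * (S k u ?s ?y *
    (ennreal (cross_section (snd ?y) (fst y) (snd y) * maxwellian \<beta> (fst y)) *
    h u (fst (free_flow (1 * (u - ?s)) ?y), if \<sigma> (Suc k) = 1 then post1 (snd ?y) (fst y) (snd y) else snd ?y))))"
   if y: "norm (snd y) = 1" for u y
  proof -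
   have st: "tree_state t \<sigma> z i (?up u y) = tree_state t \<sigma> z i x" if "i <= k" for i
    using that by (simp add: tree_state_def x traj_pos_update traj_vel_update)
   have tm: "tree_time t i (?up u y) = tree_time t i x" if "i <= k" for i
    using that by (simp add: tree_time_def x traj_time_update)
   have tS: "tree_time t (Suc k) (?up u y) = u" by (simp add: tree_time_def traj_time_def)
   have stS: "tree_state t \<sigma> z (Suc k) (?up u y) = (fst (free_flow (1 * (u - ?s)) ?y), if \<sigma> (Suc k) = 1 then post1 (snd ?y) (fst y) (snd y) else snd ?y)"
    by (simp add: tree_state_def x traj_pos_update traj_vel_update traj_time_update free_flow_def tree_time_def)
     (simp add: traj_time_def algebra_simps)
   have pr: "(\<Prod>i<k. S i (tree_time t (Suc i) (?up u y)) (tree_time t i (?up u y)) (tree_state t \<sigma> z i (?up u y)))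
     = (\<Prod>i<k. S i (tree_time t (Suc i) x) (tree_time t i x) (tree_state t \<sigma> z i x))"
    by (intro prod.cong refl) (simp add: st tm)
   have w: "ennreal (tree_weight \<beta> t (Suc k) \<sigma> (snd z) (?up u y)) = ennreal (tree_weight \<beta> t k \<sigma> (snd z) x) *
     (indicator {0<..<?s} u * ennreal (cross_section (snd ?y) (fst y) (snd y) * maxwellian \<beta> (fst y)))"
    by (subst tree_weight_Suc[OF y])
     (simp add: x tree_time_def tree_state_def ennreal_mult' ennreal_indicator[symmetric] del: ennreal_indicator)
   show ?thesis
    unfolding tree_integrand_def w prod.lessThan_Suc pr tS stS
    by (simp only: tm[OF order_refl] st[OF order_refl] mult_ac)
  qed
  have "(\<integral>\<^sup>+u. \<integral>\<^sup>+y. tree_integrand \<beta> t (Suc k) \<sigma> S h z (?up u y) \<partial>coll_measure \<partial>lborel)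
   = (\<integral>\<^sup>+u. ?W * (indicator {0<..<?s} u * (S k u ?s ?y * coll_op \<beta> (\<sigma> (Suc k)) (h u) (free_flow (1 * (u - ?s)) ?y))) \<partial>lborel)"
  proof (rule nn_integral_cong)
   fix u :: real
   let ?F = "%y. ennreal (cross_section (snd ?y) (fst y) (snd y) * maxwellian \<beta> (fst y)) *
    h u (fst (free_flow (1 * (u - ?s)) ?y), if \<sigma> (Suc k) = 1 then post1 (snd ?y) (fst y) (snd y) else snd ?y)"
   have Fm: "?F \<in> borel_measurable coll_measure"
    by (cases "\<sigma> (Suc k) = 1"; simp only: if_True if_False simp_thms; measurable)
   have "(\<integral>\<^sup>+y. tree_integrand \<beta> t (Suc k) \<sigma> S h z (?up u y) \<partial>coll_measure)
    = (\<integral>\<^sup>+y. (?W * (indicator {0<..<?s} u * S k u ?s ?y)) * ?F y \<partial>coll_measure)"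
   proof (rule nn_integral_cong_AE)
    show "AE y in lborel \<Otimes>\<^sub>M sphere_measure. tree_integrand \<beta> t (Suc k) \<sigma> S h z (?up u y) = (?W * (indicator {0<..<?s} u * S k u ?s ?y)) * ?F y"
     using AE_lborel_sphere_norm by eventually_elim (subst step, simp_all only: mult.assoc)
   qed
   also have "... = (?W * (indicator {0<..<?s} u * S k u ?s ?y)) * (\<integral>\<^sup>+y. ?F y \<partial>coll_measure)"
    by (rule nn_integral_cmult[OF Fm])
   also have "(\<integral>\<^sup>+y. ?F y \<partial>coll_measure) = coll_op \<beta> (\<sigma> (Suc k)) (h u) (free_flow (1 * (u - ?s)) ?y)"
    using coll_op_eq_integral[where f="h u" and z="free_flow (1 * (u - ?s)) ?y" and \<sigma>="\<sigma> (Suc k)", OF \<beta> section_measurable[OF h]] by (simp cong: if_cong)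
   finally show "(\<integral>\<^sup>+y. tree_integrand \<beta> t (Suc k) \<sigma> S h z (?up u y) \<partial>coll_measure)
     = ?W * (indicator {0<..<?s} u * (S k u ?s ?y * coll_op \<beta> (\<sigma> (Suc k)) (h u) (free_flow (1 * (u - ?s)) ?y)))"
    by (simp only: mult.assoc)
  qed
  also have "... = ?W * coll_step \<beta> 1 (S k) (\<sigma> (Suc k)) h ?s ?y"
   unfolding coll_step_def using coll_step_integrand_measurable[OF S h, of ?s k ?y] by (intro nn_integral_cmult) simp
  also have "... = tree_integrand \<beta> t k \<sigma> S ?h' z x"
   unfolding tree_integrand_def by (simp only: mult.assoc)
  finally show "(case x of (vs, \<omega>s, \<tau>) => (\<integral>\<^sup>+u. \<integral>\<^sup>+(w, \<omega>). tree_integrand \<beta> t (Suc k) \<sigma> S h z (vs(Suc k := w), \<omega>s(Suc k := \<omega>), \<tau>(Suc k := u))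
   \<partial>coll_measure \<partial>lborel)) = tree_integrand \<beta> t k \<sigma> S ?h' z x"
   by (simp add: x case_prod_unfold)
 qed
 also have "... = ennreal (maxwellian \<beta> (snd z)) * tree_op \<beta> S \<sigma> k ?h' t z"
  by (rule Suc.IH[OF measurable_coll_step[OF S h]])
 finally show ?case by simp
qed

lemma tree_integrand_AE_zero:
 fixes h :: "real => 'n::finite phase => ennreal"
 assumes \<beta>: "\<beta> > 0" and S: "!!i. jointly_measurable3 (S i)"
  and h: "jointly_measurable h"
  and zero: "tree_op \<beta> S \<sigma> k h t z = 0"
 shows "AE x in tree_measure k. tree_integrand \<beta> t k \<sigma> S h z x = 0"
proof (rule nn_integral_0_iff_AE[THEN iffD1])
 show "tree_integrand \<beta> t k \<sigma> S h z \<in> borel_measurable (tree_measure k)"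
  using measurable_tree_section[OF measurable_tree_integrand[where t=t and k=k and \<sigma>=\<sigma> and \<beta>=\<beta>, OF S h], where z=z] by simp
 show "(\<integral>\<^sup>+x. tree_integrand \<beta> t k \<sigma> S h z x \<partial>tree_measure k) = 0"
  using tree_identity[where t=t and k=k and \<sigma>=\<sigma> and z=z, OF \<beta> S h] zero by simp
qed

subsection \<open>Paths of a tree\<close>

definition miss :: "(real => 'n::finite phase => bool) => real => 'n phase => ennreal" where
 "miss N s z = (\<integral>\<^sup>+r. (if N r (free_flow (r - s) z) then 1 else 0) \<partial>lborel)"

lemma measurable_apply_pred2:
 assumes N: "Measurable.pred (borel \<Otimes>\<^sub>M borel) (%(s, z). N s z)"
  and [measurable]: "a \<in> borel_measurable M" "b \<in> borel_measurable M"
 shows "Measurable.pred M (%x. N (a x) (b x))"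
 using measurable_compose[of "%x. (a x, b x)" M _ _ "count_space UNIV", OF _ N] by simp

lemma measurable_miss:
 assumes N: "Measurable.pred (borel \<Otimes>\<^sub>M borel) (%(s, z). N s z)"
 shows "jointly_measurable (miss N)"
proof -
 note [measurable (raw)] = measurable_apply_pred2[OF N]
 show ?thesis unfolding miss_def by measurable
qed

text \<open>A null set of times and states is missed by the characteristic through almost every point.\<close>

lemma miss_AE_zero:
 assumes N: "Measurable.pred (borel \<Otimes>\<^sub>M borel) (%(s, z). N s z)"
  and ae: "AE s in lborel. AE z in lborel. \<not> N s z"
 shows "AE z in lborel. miss N s z = 0"
proof -
 note [measurable (raw)] = measurable_apply_pred2[OF N]
 have N': "Measurable.pred (borel \<Otimes>\<^sub>M borel) (%(s, z). \<not> N s z)"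
  unfolding split_beta by measurable
 have "AE z in lborel. AE r in lborel. \<not> N r (free_flow (1 * r) z)"
  using AE_along_flow_swap[where P="%r z. \<not> N r z" and \<epsilon>=1, OF N'] ae by blast
 then have "AE z in lborel. AE r in lborel. \<not> N r (free_flow (1 * r) (free_flow (- s) z))"
  by (rule AE_lborel_free_flow)
 then show ?thesis
 proof eventually_elim
  case (elim z)
  then have "AE r in lborel. (if N r (free_flow (r - s) z) then 1 else 0 :: ennreal) = 0" by eventually_elim simp
  then show ?case unfolding miss_def by (subst nn_integral_0_iff_AE) measurable
 qed
qed

lemma missD:
 assumes N: "Measurable.pred (borel \<Otimes>\<^sub>M borel) (%(s, z). N s z)" and "miss N s z = 0"
 shows "AE r in lborel. \<not> N r (free_flow (r - s) z)"
proof -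
 note [measurable (raw)] = measurable_apply_pred2[OF N]
 have "AE r in lborel. (if N r (free_flow (r - s) z) then 1 else 0 :: ennreal) = 0"
  using assms(2) unfolding miss_def by (subst (asm) nn_integral_0_iff_AE) measurable
 then show ?thesis by eventually_elim (simp split: if_splits)
qed

lemma collision_timesD:
 assumes "\<tau> \<in> collision_times t k" and "0 <= t"
 shows "i \<in> {1..k} ==> 0 < \<tau> i" "i \<in> {1..k} ==> \<tau> i < t"
  "i \<in> {1..k} ==> j \<in> {1..k} ==> i < j ==> \<tau> j < \<tau> i"
 using assms unfolding collision_times_def by blast+

lemma card_later_collisions:
 assumes \<tau>: "\<tau> \<in> collision_times t k" and t: "0 < t" and m: "m <= k"
  and up: "s < traj_time t \<tau> m" and low: "m < k ==> \<tau> (Suc m) <= s"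
 shows "card {i\<in>{1..k}. s < \<tau> i} = m"
proof -
 note D = collision_timesD[OF \<tau> less_imp_le[OF t]]
 have "{i\<in>{1..k}. s < \<tau> i} = {1..m}"
 proof (intro set_eqI iffI)
  fix i assume "i \<in> {i\<in>{1..k}. s < \<tau> i}"
  then have i: "i \<in> {1..k}" "s < \<tau> i" by auto
  have "\<not> m < i"
  proof
   assume mi: "m < i"
   then have mk: "m < k" "Suc m \<in> {1..k}" using i by auto
   have "\<tau> i <= \<tau> (Suc m)" using mi i mk D(3)[of "Suc m" i] by (cases "i = Suc m") (auto intro: less_imp_le)
   with low[OF mk(1)] i show False by simp
  qed
  then show "i \<in> {1..m}" using i by auto
 next
  fix i assume i: "i \<in> {1..m}"
  then have "i \<in> {1..k}" "m \<in> {1..k}" "m \<noteq> 0" using m by auto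
  then have "\<tau> m <= \<tau> i" using i D(3)[of i m] by (cases "i = m") (auto intro: less_imp_le)
  moreover have "s < \<tau> m" using up \<open>m \<noteq> 0\<close> by (simp add: traj_time_def)
  ultimately show "i \<in> {i\<in>{1..k}. s < \<tau> i}" using \<open>i \<in> {1..k}\<close> by auto
 qed
 then show ?thesis by simp
qed

lemma trajectory_on_segment:
 assumes "card {i\<in>{1..k}. s < \<tau> i} = m"
 shows "trajectory t k \<sigma> vs \<omega>s \<tau> z s = free_flow (s - tree_time t m (vs, \<omega>s, \<tau>)) (tree_state t \<sigma> z m (vs, \<omega>s, \<tau>))"
 using assms by (simp add: trajectory_def Let_def free_flow_def tree_state_def tree_time_def scaleR_diff_left)

lemma trajectory_final:
 assumes "\<tau> \<in> collision_times t k" "0 < t"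
 shows "trajectory t k \<sigma> vs \<omega>s \<tau> z t = z"
proof -
 have "\<not> t < \<tau> i" if "i \<in> {1..k}" for i
  using collision_timesD(2)[OF assms(1) less_imp_le[OF assms(2)] that] by simp
 then have "{i\<in>{1..k}. t < \<tau> i} = {}" by blast
 then have "card {i\<in>{1..k}. t < \<tau> i} = 0" by simp
 from trajectory_on_segment[OF this, of t \<sigma> vs \<omega>s z] show ?thesis
  by (simp add: tree_time_def tree_state_def traj_time_def)
qed

lemma trajectory_initial:
 assumes "\<tau> \<in> collision_times t k" "0 < t"
 shows "trajectory t k \<sigma> vs \<omega>s \<tau> z 0 = free_flow (- tree_time t k (vs, \<omega>s, \<tau>)) (tree_state t \<sigma> z k (vs, \<omega>s, \<tau>))"
proof -
 have "{i\<in>{1..k}. 0 < \<tau> i} = {1..k}"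
  using collision_timesD(1)[OF assms(1) less_imp_le[OF assms(2)]] by blast
 then have "card {i\<in>{1..k}. 0 < \<tau> i} = k" by simp
 from trajectory_on_segment[OF this, of t \<sigma> vs \<omega>s z] show ?thesis by simp
qed

lemma measurable_trajectory:
 assumes [measurable]: "r \<in> borel_measurable N" and x: "x \<in> N \<rightarrow>\<^sub>M ((borel :: 'n::finite phase measure) \<Otimes>\<^sub>M tree_measure k)"
 shows "(%y. trajectory t k \<sigma> (fst (snd (x y))) (fst (snd (snd (x y)))) (snd (snd (snd (x y)))) (fst (x y)) (r y)) \<in> borel_measurable N"
proof -
 let ?\<tau> = "%y. snd (snd (snd (x y)))"
 let ?n = "%y. card {i\<in>{1..k}. r y < ?\<tau> y i}"
 have tau[measurable]: "(%y. ?\<tau> y i) \<in> borel_measurable N" if "i \<in> {1..k}" for i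
  using measurable_compose[OF x measurable_tree_components(3)[OF that]] by simp
 have "{y \<in> space N. i \<in> {i\<in>{1..k}. r y < ?\<tau> y i}} \<in> sets N" for i
 proof (cases "i \<in> {1..k}")
  case True
  note [measurable] = tau[OF True]
  have "{y \<in> space N. r y < ?\<tau> y i} \<in> sets N" by measurable
  then show ?thesis using True by simp
 next
  case False
  then have "{y \<in> space N. i \<in> {i\<in>{1..k}. r y < ?\<tau> y i}} = {}" by auto
  then show ?thesis by (simp only: sets.empty_sets)
 qed
 then have n: "?n \<in> measurable N (count_space UNIV)" by (rule measurable_card)
 have le: "?n y <= k" for y
 proof -
  have "?n y <= card {1..k}" by (rule card_mono) auto
  then show ?thesis by simp
 qed
 have "(%y. free_flow (r y - tree_time t (min m k) (snd (x y))) (tree_state t \<sigma> (fst (x y)) (min m k) (snd (x y)))) \<in> borel_measurable N" for m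
  using measurable_compose[OF x measurable_tree_time[of "min m k" k t]] measurable_compose[OF x measurable_tree_state[of "min m k" k t \<sigma>]]
  by (intro borel_measurable_free_flow borel_measurable_diff assms) auto
 from measurable_compose_countable[OF this n]
 have "(%y. free_flow (r y - tree_time t (min (?n y) k) (snd (x y))) (tree_state t \<sigma> (fst (x y)) (min (?n y) k) (snd (x y)))) \<in> borel_measurable N" .
 also have "(%y. free_flow (r y - tree_time t (min (?n y) k) (snd (x y))) (tree_state t \<sigma> (fst (x y)) (min (?n y) k) (snd (x y))))
  = (%y. trajectory t k \<sigma> (fst (snd (x y))) (fst (snd (snd (x y)))) (snd (snd (snd (x y)))) (fst (x y)) (r y))"
  using le by (intro ext) (simp add: trajectory_on_segment[OF refl] min_absorb1)
 finally show ?thesis .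
qed

context
 fixes V F :: "real => 'n::finite phase => real" and C t :: real
 assumes V: "jointly_measurable V" and V_bound: "!!s z. \<bar>V s z\<bar> <= C"
  and F: "jointly_measurable F" and t: "0 < t"
begin

lemma measurable_differ: "Measurable.pred (borel \<Otimes>\<^sub>M borel) (%(s, z). s \<in> {0..t} \<and> F s z \<noteq> V s z)"
proof -
 note [measurable (raw)] = joint_apply[OF V] joint_apply[OF F]
 show ?thesis by measurable
qed

lemma V_segment_integrable:
 "integrable lborel (%r. indicator {a..b} r *\<^sub>R V r (free_flow (r - s) y))"
proof (rule Bochner_Integration.integrable_bound)
 show "integrable lborel (%r. C * indicator {a..b::real} r)"
  by (intro integrable_mult_right integrable_real_indicator) (auto simp: emeasure_lborel_Icc_eq)
 note [measurable (raw)] = joint_apply[OF V]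
 show "(%r. indicator {a..b} r *\<^sub>R V r (free_flow (r - s) y)) \<in> borel_measurable lborel" by measurable
 show "AE r in lborel. norm (indicator {a..b} r *\<^sub>R V r (free_flow (r - s) y)) <= norm (C * indicator {a..b} r)"
 proof (rule AE_I2)
  fix r :: real
  have "\<bar>V r (free_flow (r - s) y)\<bar> <= \<bar>C\<bar>" by (rule order_trans[OF V_bound abs_ge_self])
  then show "norm (indicator {a..b} r *\<^sub>R V r (free_flow (r - s) y)) <= norm (C * indicator {a..b} r)"
   by (simp split: split_indicator)
 qed
qed

text \<open>The collision times cut the trajectory into free segments, so its exponential weight is a product.\<close>

lemma integral_along_trajectory:
 fixes x :: "'n tree_data"
 assumes x: "x \<in> space (tree_measure k)" and \<tau>: "snd (snd x) \<in> collision_times t k"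
  and good: "!!n. n <= k ==> miss (%s z. s \<in> {0..t} \<and> F s z \<noteq> V s z) (tree_time t n x) (tree_state t \<sigma> z n x) = 0"
 shows "ennreal (exp (- (LINT s:{0..t}|lborel. F s (trajectory t k \<sigma> (fst x) (fst (snd x)) (snd (snd x)) z s)))) =
  (\<Prod>i<k. path_weight 1 V (tree_time t (Suc i) x) (tree_time t i x) (tree_state t \<sigma> z i x)) *
  path_weight 1 V 0 (tree_time t k x) (tree_state t \<sigma> z k x)"
proof -
 let ?\<tau> = "snd (snd x)"
 note D = collision_timesD[OF \<tau> less_imp_le[OF t]]
 define th where "th n = (if n <= k then tree_time t n x else 0)" for n
 have th0: "th 0 = t" by (simp add: th_def tree_time_def traj_time_def)
 have th_tau: "th n = ?\<tau> n" if "n \<in> {1..k}" for n using that by (simp add: th_def tree_time_def traj_time_def)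
 have thS: "th (Suc k) = 0" by (simp add: th_def)
 have dec: "th (Suc n) < th n" if n: "n <= k" for n
 proof (cases "n = k")
  case True
  then show ?thesis using D(1)[of k] t th0 th_tau[of k] thS by (cases "k = 0") auto
 next
  case False
  then have k: "Suc n \<in> {1..k}" using n by auto
  show ?thesis
  proof (cases "n = 0")
   case True
   then show ?thesis using D(2)[OF k] th_tau[OF k] th0 by simp
  next
   case nz: False
   then have "n \<in> {1..k}" using n by auto
   then show ?thesis using D(3)[of n "Suc n"] k th_tau by simp
  qed
 qed
 have mono: "th b <= th a" if "a <= b" "b <= Suc k" for a b
  using that
 proof (induction b rule: dec_induct)
  case (step m)
  then have "th m <= th a" "th (Suc m) < th m" using dec[of m] by simp_all
  then show ?case by simp
 qed simp
 let ?G = "%n s. V s (free_flow (s - th n) (tree_state t \<sigma> z n x))"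
 let ?Z = "%s. trajectory t k \<sigma> (fst x) (fst (snd x)) ?\<tau> z s"
 have fin: "AE s in lborel. \<forall>n\<in>{..Suc k}. s \<noteq> th n"
  by (rule AE_finite_allI) (auto intro: AE_lborel_singleton)
 have "AE s in lborel. \<forall>n\<in>{..k}. \<not> (s \<in> {0..t} \<and> F s (free_flow (s - th n) (tree_state t \<sigma> z n x)) \<noteq> ?G n s)"
 proof (rule AE_finite_allI)
  fix n assume "n \<in> {..k}"
  then have n: "n <= k" by simp
  from missD[OF measurable_differ good[OF n]]
  show "AE s in lborel. \<not> (s \<in> {0..t} \<and> F s (free_flow (s - th n) (tree_state t \<sigma> z n x)) \<noteq> ?G n s)"
   using n by (simp add: th_def)
 qed simp
 with fin have eq: "AE s in lborel. indicator {0..t} s *\<^sub>R F s (?Z s) = (\<Sum>n\<le>k. indicator {th (Suc n)..th n} s *\<^sub>R ?G n s)"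
 proof eventually_elim
  case (elim s)
  show ?case
  proof (cases "s \<in> {0..t}")
   case True
   have "\<exists>n<m. th (Suc n) < s \<and> s < th n" if "m <= Suc k" "th m < s" for m
    using that
   proof (induction m)
    case 0
    then show ?case using True th0 by simp
   next
    case (Suc m)
    show ?case
    proof (cases "th m < s")
     case True
     then obtain n where "n < m" "th (Suc n) < s \<and> s < th n" using Suc.IH Suc.prems(1) by auto
     then show ?thesis by (intro exI[of _ n]) simp
    next
     case False
     moreover have "s \<noteq> th m" using elim(1) Suc.prems by auto
     ultimately show ?thesis using Suc.prems by (intro exI[of _ m]) auto
    qed
   qed
   note ex = this
   have "s \<noteq> th (Suc k)" using elim(1) by simp
   then have "th (Suc k) < s" using True thS by simp
   from ex[OF order_refl this] obtain m where "m < Suc k" "th (Suc m) < s" "s < th m" by blast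
   then have m: "m <= k" "th (Suc m) < s" "s < th m" by simp_all
   have "card {i\<in>{1..k}. s < ?\<tau> i} = m"
   proof (rule card_later_collisions[OF \<tau> t m(1)])
    show "s < traj_time t ?\<tau> m" using m by (simp add: th_def tree_time_def)
    show "?\<tau> (Suc m) <= s" if "m < k" using m th_tau[of "Suc m"] that by simp
   qed
   from trajectory_on_segment[OF this, of t \<sigma> "fst x" "fst (snd x)" z]
   have "?Z s = free_flow (s - th m) (tree_state t \<sigma> z m x)" using m by (simp add: th_def)
   moreover have "F s (free_flow (s - th m) (tree_state t \<sigma> z m x)) = ?G m s" using elim(2) m(1) True by blast
   ultimately have "F s (?Z s) = ?G m s" by simp
   moreover have "(\<Sum>n\<le>k. indicator {th (Suc n)..th n} s *\<^sub>R ?G n s) = (\<Sum>n\<in>{m}. indicator {th (Suc n)..th n} s *\<^sub>R ?G n s)"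
   proof (rule sum.mono_neutral_right)
    show "\<forall>n\<in>{..k} - {m}. indicator {th (Suc n)..th n} s *\<^sub>R ?G n s = 0"
    proof
     fix n assume n: "n \<in> {..k} - {m}"
     have "s \<notin> {th (Suc n)..th n}"
     proof (cases "n < m")
      case True
      then have "th m <= th (Suc n)" using m by (intro mono) auto
      then show ?thesis using m by auto
     next
      case False
      then have "th n <= th (Suc m)" using n by (intro mono) auto
      then show ?thesis using m by auto
     qed
     then show "indicator {th (Suc n)..th n} s *\<^sub>R ?G n s = 0" by simp
    qed
   qed (use m in auto)
   ultimately show ?thesis using True m by simp
  next
   case False
   have "s \<notin> {th (Suc n)..th n}" if "n <= k" for n
    using False mono[of 0 n] mono[of "Suc n" "Suc k"] that th0 thS by auto
   then show ?thesis using False by simp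
  qed
 qed
 have Zm: "?Z \<in> borel_measurable borel"
  using measurable_trajectory[of "%r. r" borel "%_. (z, x)" k t \<sigma>] x by (simp add: space_pair_measure)
 have "(LINT s:{0..t}|lborel. F s (?Z s)) = (LINT s|lborel. (\<Sum>n\<le>k. indicator {th (Suc n)..th n} s *\<^sub>R ?G n s))"
  unfolding set_lebesgue_integral_def
 proof (rule integral_cong_AE[OF _ _ eq])
  show "(%s. indicator {0..t} s *\<^sub>R F s (?Z s)) \<in> borel_measurable lborel"
   using Zm by (intro borel_measurable_scaleR joint_apply[OF F]) auto
  show "(%s. \<Sum>n\<le>k. indicator {th (Suc n)..th n} s *\<^sub>R ?G n s) \<in> borel_measurable lborel"
   by (intro borel_measurable_sum borel_measurable_integrable V_segment_integrable)
 qed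
 also have "... = (\<Sum>n\<le>k. LINT s:{th (Suc n)..th n}|lborel. ?G n s)"
  unfolding set_lebesgue_integral_def by (intro Bochner_Integration.integral_sum V_segment_integrable)
 finally have "ennreal (exp (- (LINT s:{0..t}|lborel. F s (?Z s)))) = (\<Prod>n\<le>k. ennreal (exp (- (LINT s:{th (Suc n)..th n}|lborel. ?G n s))))"
  by (simp add: sum_negf[symmetric] exp_sum prod_ennreal)
 also have "... = (\<Prod>n\<le>k. path_weight 1 V (th (Suc n)) (th n) (tree_state t \<sigma> z n x))"
  by (simp add: path_weight_def)
 also have "... = (\<Prod>n<k. path_weight 1 V (th (Suc n)) (th n) (tree_state t \<sigma> z n x)) * path_weight 1 V (th (Suc k)) (th k) (tree_state t \<sigma> z k x)"
  unfolding lessThan_Suc_atMost[symmetric] by simp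
 also have "(\<Prod>n<k. path_weight 1 V (th (Suc n)) (th n) (tree_state t \<sigma> z n x)) = (\<Prod>n<k. path_weight 1 V (tree_time t (Suc n) x) (tree_time t n x) (tree_state t \<sigma> z n x))"
  by (intro prod.cong refl) (simp add: th_def)
 finally show ?thesis by (simp add: thS) (simp add: th_def)
qed

end

section \<open>Summation of the collision trees\<close>

definition signs :: "nat => (nat => real) set" where
 "signs k = {1..k} \<rightarrow>\<^sub>E {-1, 1}"

lemma finite_signs [simp]: "finite (signs k)"
 unfolding signs_def by (intro finite_PiE) auto

lemma sum_signs_Suc:
 fixes F :: "(nat => real) => 'b::comm_monoid_add"
 shows "(\<Sum>\<sigma>\<in>signs (Suc k). F \<sigma>) = (\<Sum>\<sigma>\<in>signs k. F (\<sigma>(Suc k := 1)) + F (\<sigma>(Suc k := - 1)))"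
proof -
 have "{1..Suc k} = insert (Suc k) {1..k}" by auto
 then have "signs (Suc k) = (%(y, \<sigma>). \<sigma>(Suc k := y)) ` ({-1, 1} \<times> signs k)"
  unfolding signs_def by (simp only: PiE_insert_eq)
 moreover have "inj_on (%(y, \<sigma>). \<sigma>(Suc k := y)) ({-1, 1 :: real} \<times> signs k)"
  unfolding signs_def using inj_combinator[of "Suc k" "{1..k}" "%_. {-1, 1}"] by simp
 ultimately have "(\<Sum>\<sigma>\<in>signs (Suc k). F \<sigma>) = (\<Sum>(y, \<sigma>)\<in>{-1, 1} \<times> signs k. F (\<sigma>(Suc k := y)))"
  by (simp add: sum.reindex case_prod_unfold)
 also have "... = (\<Sum>\<sigma>\<in>signs k. \<Sum>y\<in>{-1, 1}. F (\<sigma>(Suc k := y)))"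
  by (subst sum.swap) (simp only: sum.cartesian_product)
 also have "... = (\<Sum>\<sigma>\<in>signs k. F (\<sigma>(Suc k := 1)) + F (\<sigma>(Suc k := - 1)))"
  by (intro sum.cong refl) (simp add: add.commute)
 finally show ?thesis .
qed

context bounded_potential
begin

context
 fixes \<phi> :: "'n phase => real" and \<alpha> A :: real
 assumes \<epsilon>1: "\<epsilon> = 1" and \<phi>_meas [measurable]: "\<phi> \<in> borel_measurable borel"
  and \<phi>_nonneg: "!!z. 0 <= \<phi> z" and \<phi>_per: "lperiodic \<phi>"
  and \<alpha>: "0 < \<alpha>" "\<alpha> < \<beta> / 2" and \<phi>_bound: "!!z. \<phi> z <= A * wt \<alpha> z"
begin

abbreviation (input) "fsol \<equiv> dyson_sum \<beta> 1 (path_weight 1 damped) (%z. ennreal (\<phi> z))"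
abbreviation (input) "PV \<equiv> path_weight 1 V"
abbreviation (input) "h0 \<equiv> %s z. PV 0 s z * ennreal (\<phi> (free_flow (- s) z))"

lemmas sol_facts = \<phi>_meas \<phi>_nonneg \<phi>_per \<alpha> \<phi>_bound

lemma PV_meas: "jointly_measurable3 PV"
 by (rule measurable_path_weight[OF V_meas])

lemma fsol_meas: "jointly_measurable fsol"
 using dsol_meas[OF sol_facts] by (simp add: \<epsilon>1)

lemma h0_meas: "jointly_measurable h0"
proof -
 note [measurable (raw)] = joint_apply3[OF PV_meas]
 show ?thesis by measurable
qed

lemma ennreal_fsol: "0 <= s ==> ennreal (lin_sol \<phi> s z) = fsol s z"
 using ennreal_lin_sol[OF sol_facts] by (simp add: \<epsilon>1)

text \<open>The loss term, absorbed in the damping when the solution was built, is moved back to the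
  other side as a collision step with sign \<open>- 1\<close>.  No subtraction occurs, so the identity makes
  sense for functions with values in \<open>[0, \<infinity>]\<close>.\<close>

lemma fsol_balance:
 assumes s: "0 <= s"
 shows "fsol s z + coll_step \<beta> 1 PV (- 1) fsol s z = h0 s z + coll_step \<beta> 1 PV 1 fsol s z"
proof -
 define z0 where "z0 = free_flow (- s) z"
 have z: "z = free_flow (1 * s) z0" by (simp add: z0_def)
 let ?y = "%u. lin_sol \<phi> u (free_flow (1 * u) z0)"
 let ?G = "%u. rgain \<beta> (lin_sol \<phi> u) (free_flow (1 * u) z0)"
 let ?L = "%u. freq \<beta> (snd z0) * ?y u"
 let ?c = "%u. V u (free_flow (1 * u) z0)"
 let ?A = "%s. LINT r:{0..s}|lborel. ?c r"
 have y: "primitive_on s ?y (%u. (?G u - ?L u) - ?c u * ?y u)"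
  using lin_sol_primitive[OF sol_facts, of s z0] by (simp add: \<epsilon>1 algebra_simps)
 have c: "set_integrable lborel {0..s} ?c"
  by (rule integrable_along[OF s]) measurable
 have G: "set_integrable lborel {0..s} ?G"
  using rgain_lin_sol_integrable[OF sol_facts, of s z0] by (simp add: \<epsilon>1)
 have L: "set_integrable lborel {0..s} ?L"
  using borel_integrable_atLeastAtMost'[OF primitive_on_continuous[OF y]] by (rule set_integrable_mult_right)
 have y0: "0 <= ?y u" for u by (rule lin_sol_nonneg[OF sol_facts])
 note [measurable (raw)] = joint_apply[OF lin_sol_meas[OF sol_facts]]
 have G0: "0 <= ?G u" for u by (simp add: rgain_nonneg_eq lin_sol_nonneg[OF sol_facts])
 have L0: "0 <= ?L u" for u using y0 by simp
 have cG: "coll_op \<beta> 1 (fsol u) (free_flow (1 * u) z0) = ennreal (?G u)" if "0 <= u" "u <= s" for u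
  using ennreal_rgain_lin_sol[OF sol_facts that(1)] by (simp add: coll_op_def \<epsilon>1)
 have cL: "coll_op \<beta> (- 1) (fsol u) (free_flow (1 * u) z0) = ennreal (?L u)" if "0 <= u" "u <= s" for u
  using ennreal_fsol[OF that(1)] y0[of u] by (simp add: coll_op_def ennreal_mult')
 have "?y s = exp (- ?A s) * (?y 0 + (LINT r:{0..s}|lborel. exp (?A r) * (?G r - ?L r)))"
  by (rule primitive_on_duhamel[OF c y s order_refl])
 moreover have "(LINT r:{0..s}|lborel. exp (?A r - ?A s) * ?G r) - (LINT r:{0..s}|lborel. exp (?A r - ?A s) * ?L r)
   = exp (- ?A s) * (LINT r:{0..s}|lborel. exp (?A r) * (?G r - ?L r))"
 proof -
  have cont: "continuous_on {0..s} (%r. exp (?A r - ?A s))"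
   by (intro continuous_intros continuous_on_LINT_Icc[OF c])
  have i: "set_integrable lborel {0..s} (%r. exp (?A r - ?A s) * k r)" if "set_integrable lborel {0..s} k" for k
   using set_integrable_mult_continuous[OF that cont] by (simp add: mult.commute)
  have "(LINT r:{0..s}|lborel. exp (?A r - ?A s) * ?G r) - (LINT r:{0..s}|lborel. exp (?A r - ?A s) * ?L r)
   = (LINT r:{0..s}|lborel. exp (?A r - ?A s) * ?G r - exp (?A r - ?A s) * ?L r)"
   by (rule set_integral_diff(2)[symmetric, OF i[OF G] i[OF L]])
  also have "... = (LINT r:{0..s}|lborel. exp (- ?A s) * (exp (?A r) * (?G r - ?L r)))"
   by (intro set_lebesgue_integral_cong) (auto simp: exp_diff exp_minus field_simps)
  finally show ?thesis by simp
 qed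
 ultimately have real: "?y s + (LINT r:{0..s}|lborel. exp (?A r - ?A s) * ?L r)
   = exp (- ?A s) * \<phi> z0 + (LINT r:{0..s}|lborel. exp (?A r - ?A s) * ?G r)"
  by (simp add: lin_sol_0[OF sol_facts] distrib_left)
 have "fsol s z = ennreal (?y s)" using ennreal_fsol[OF s, of z] by (simp add: z)
 moreover have "coll_step \<beta> 1 PV (- 1) fsol s z = ennreal (LINT r:{0..s}|lborel. exp (?A r - ?A s) * ?L r)"
  unfolding z by (rule coll_step_along(1)[where W=V and \<epsilon>=1 and z=z0 and h=fsol and \<beta>=\<beta> and \<sigma>="- 1", OF c L L0 cL])
 moreover have "coll_step \<beta> 1 PV 1 fsol s z = ennreal (LINT r:{0..s}|lborel. exp (?A r - ?A s) * ?G r)"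
  unfolding z by (rule coll_step_along(1)[where W=V and \<epsilon>=1 and z=z0 and h=fsol and \<beta>=\<beta> and \<sigma>=1, OF c G G0 cG])
 moreover have "h0 s z = ennreal (exp (- ?A s) * \<phi> z0)"
  using path_weight_along[where W=V and \<epsilon>=1 and z=z0, OF c order_refl s] \<phi>_nonneg[of z0]
  by (simp add: z LINT_Icc_0_0 ennreal_mult' del: atLeastAtMost_singleton)
 moreover have "0 <= (LINT r:{0..s}|lborel. exp (?A r - ?A s) * ?L r)"
  by (rule coll_step_along(2)[where W=V and \<epsilon>=1 and z=z0 and h=fsol and \<beta>=\<beta> and \<sigma>="- 1", OF c L L0 cL])
 moreover have "0 <= (LINT r:{0..s}|lborel. exp (?A r - ?A s) * ?G r)"
  by (rule coll_step_along(2)[where W=V and \<epsilon>=1 and z=z0 and h=fsol and \<beta>=\<beta> and \<sigma>=1, OF c G G0 cG])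
 ultimately show ?thesis
  using real y0[of s] \<phi>_nonneg[of z0] by (simp add: ennreal_plus[symmetric] del: ennreal_plus)
qed

abbreviation (input) "TV \<sigma> k h \<equiv> tree_op \<beta> (%_. PV) \<sigma> k h"

lemma tree_op_last:
 "TV (\<sigma>(Suc k := y)) (Suc k) h = TV \<sigma> k (coll_step \<beta> 1 PV y h)"
proof -
 have "TV (\<sigma>(Suc k := y)) k h' = TV \<sigma> k h'" for h' by (rule tree_op_cong_signs) simp
 then show ?thesis by simp
qed

text \<open>Iterating the inequality, the sum over trees with fewer than \<open>n\<close> collisions and a nonnegative
remainder stay below \<open>W\<close>.\<close>

lemma supersolution_bounds_trees:
 fixes W :: "real => 'n phase => ennreal"
 assumes h: "jointly_measurable h"
  and W: "jointly_measurable W" and t: "0 < t"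
  and super: "!!u z. 0 < u ==> u <= t ==> h u z + (coll_step \<beta> 1 PV 1 W u z + coll_step \<beta> 1 PV (- 1) W u z) <= W u z"
 shows "(\<Sum>k<n. \<Sum>\<sigma>\<in>signs k. TV \<sigma> k h t z) + (\<Sum>\<sigma>\<in>signs n. TV \<sigma> n W t z) <= W t z"
proof (induction n)
 case 0
 then show ?case by (simp add: signs_def)
next
 case (Suc n)
 note S = PV_meas
 note m = measurable_coll_step[OF S W, of \<beta> 1]
 have m2: "(%(s, z). coll_step \<beta> 1 PV 1 W s z + coll_step \<beta> 1 PV (- 1) W s z) \<in> borel_measurable (borel \<Otimes>\<^sub>M borel)"
  using borel_measurable_add[OF m[of 1] m[of "- 1"]] by (simp add: split_beta)
 have "(\<Sum>\<sigma>\<in>signs n. TV \<sigma> n h t z) + (\<Sum>\<sigma>\<in>signs (Suc n). TV \<sigma> (Suc n) W t z)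
  = (\<Sum>\<sigma>\<in>signs n. TV \<sigma> n h t z + (TV \<sigma> n (coll_step \<beta> 1 PV 1 W) t z + TV \<sigma> n (coll_step \<beta> 1 PV (- 1) W) t z))"
  by (simp only: sum_signs_Suc tree_op_last sum.distrib)
 also have "... = (\<Sum>\<sigma>\<in>signs n. TV \<sigma> n (%s z. h s z + (coll_step \<beta> 1 PV 1 W s z + coll_step \<beta> 1 PV (- 1) W s z)) t z)"
  by (intro sum.cong refl) (simp only: tree_op_add[OF S h m2] tree_op_add[OF S m m])
 also have "... <= (\<Sum>\<sigma>\<in>signs n. TV \<sigma> n W t z)"
  by (intro sum_mono tree_op_mono super t)
 finally have "(\<Sum>k<Suc n. \<Sum>\<sigma>\<in>signs k. TV \<sigma> k h t z) + (\<Sum>\<sigma>\<in>signs (Suc n). TV \<sigma> (Suc n) W t z)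
   <= (\<Sum>k<n. \<Sum>\<sigma>\<in>signs k. TV \<sigma> k h t z) + (\<Sum>\<sigma>\<in>signs n. TV \<sigma> n W t z)"
  by (simp add: add.assoc add_left_mono)
 also have "... <= W t z" by (rule Suc.IH)
 finally show ?case .
qed

lemma path_weight_le: "u <= s ==> PV u s z <= ennreal (exp (C * (s - u)))"
proof -
 assume us: "u <= s"
 have i: "set_integrable lborel {u..s} (%r. V r (free_flow (1 * (r - s)) z))"
  by (rule integrable_along[OF us]) measurable
 have "set_integrable lborel {u..s} (%_. - C)"
  using borel_integrable_atLeastAtMost'[of u s "%_. - C"] by simp
 then have "(LINT r:{u..s}|lborel. - C) <= (LINT r:{u..s}|lborel. V r (free_flow (1 * (r - s)) z))"
  using i by (rule set_integral_mono) (use V_bound in \<open>simp add: abs_le_iff minus_le_iff\<close>)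
 then show ?thesis
  using us by (auto simp: path_weight_def set_lebesgue_integral_def mult.commute intro!: ennreal_leI)
qed

text \<open>The weight \<open>e\<^bsup>a |v| s\<^esup>\<close> grows in time at the rate \<open>a |v|\<close>, which dominates the collision
  frequency; so it beats the loss term, whose sign cannot be used here.\<close>

lemma supersolution_exists:
 assumes t: "0 < t"
 obtains W :: "real => 'n phase => ennreal"
 where "jointly_measurable W" "!!z. W t z < \<top>"
  "!!u z. 0 < u ==> u <= t ==> fsol u z + (coll_step \<beta> 1 PV 1 W u z + coll_step \<beta> 1 PV (- 1) W u z) <= W u z"
proof -
 obtain c where c: "0 < c" "!!v :: real ^ 'n. freq \<beta> v <= c * (1 + norm v)" using freq_bound[OF \<beta>] by blast
 obtain K where K: "0 < K" "!!a (z :: 'n phase). a \<in> {0..2 * c * t} ==>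
   gain \<beta> (%z. ennreal (vexp a \<alpha> (snd z))) z <= ennreal (K * vexp a \<alpha> (snd z))"
  using gain_vexp_bound[OF \<beta> \<alpha>, of "2 * c * t"] c(1) t by (metis less_imp_le mult_nonneg_nonneg zero_le_numeral)
 obtain B where B: "0 <= B" "!!s z. s \<in> {0..t} ==> fsol s z <= ennreal (B * wt \<alpha> z)"
  using lin_sol_bound[OF sol_facts, of t] unfolding \<epsilon>1 by blast
 define b where "b = C + 2 * K + 2 * c"
 define W where "W s z = ennreal (2 * B * exp (b * s) * vexp (2 * c * s) \<alpha> (snd z))" for s and z :: "'n phase"
 have [measurable]: "(%x. vexp (2 * c * fst x) \<alpha> (snd (snd x))) \<in> borel_measurable (borel \<Otimes>\<^sub>M (borel :: 'n phase measure))"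
  unfolding vexp_def by measurable
 have Wm: "jointly_measurable W"
  unfolding W_def split_beta by measurable
 have "fsol u z + (coll_step \<beta> 1 PV 1 W u z + coll_step \<beta> 1 PV (- 1) W u z) <= W u z" if u: "0 < u" "u <= t" for u z
 proof -
  let ?v = "snd z"
  define b' where "b' = b + 2 * c * norm ?v"
  define w where "w = 2 * B * vexp 0 \<alpha> ?v"
  have w0: "0 <= w" using B(1) by (simp add: w_def)
  have W_eq: "W r (free_flow a z) = ennreal (w * exp (b' * r))" for r a
   by (simp add: W_def w_def b'_def vexp_def exp_add[symmetric] algebra_simps)
  have gap: "b' - C = 2 * (K + c * (1 + norm ?v))" by (simp add: b'_def b_def algebra_simps)
  have pos: "0 < K + c * (1 + norm ?v)" using K(1) c(1) by (intro add_pos_nonneg) auto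
  have PV_le: "PV r u z <= ennreal (exp (C * (u - r)))" if "0 < r" "r < u" for r
   using that by (intro path_weight_le) simp
  have "coll_step \<beta> 1 PV 1 W u z <= ennreal (K * w / (b' - C) * exp (b' * u))"
  proof (rule coll_step_le_exp[where S=PV and s=u and z=z and C=C, OF PV_le])
   fix r assume r: "0 < r" "r < u"
   have "gain \<beta> (W r) (free_flow (1 * (r - u)) z)
    = ennreal (2 * B * exp (b * r)) * gain \<beta> (%z. ennreal (vexp (2 * c * r) \<alpha> (snd z))) (free_flow (1 * (r - u)) z)"
    unfolding W_def using B(1) by (subst gain_cmult[symmetric]) (auto simp: ennreal_mult')
   also have "... <= ennreal (2 * B * exp (b * r)) * ennreal (K * vexp (2 * c * r) \<alpha> (snd (free_flow (1 * (r - u)) z)))"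
    using r u c(1) by (intro mult_left_mono K(2)) auto
   also have "... = ennreal (K * w * exp (b' * r))"
    using B(1) K(1) by (simp add: ennreal_mult'[symmetric] w_def b'_def vexp_def exp_add[symmetric] algebra_simps)
   finally show "coll_op \<beta> 1 (W r) (free_flow (1 * (r - u)) z) <= ennreal (K * w * exp (b' * r))"
    by (simp add: coll_op_def)
  qed (use gap pos w0 K(1) u in auto)
  moreover have "coll_step \<beta> 1 PV (- 1) W u z <= ennreal (c * (1 + norm ?v) * w / (b' - C) * exp (b' * u))"
  proof (rule coll_step_le_exp[where S=PV and s=u and z=z and C=C, OF PV_le])
   fix r
   have "freq \<beta> ?v * (w * exp (b' * r)) <= c * (1 + norm ?v) * (w * exp (b' * r))"
    using c(2)[of ?v] w0 by (intro mult_right_mono) auto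
   then show "coll_op \<beta> (- 1) (W r) (free_flow (1 * (r - u)) z) <= ennreal (c * (1 + norm ?v) * w * exp (b' * r))"
    using w0 by (simp add: coll_op_def W_eq ennreal_mult'[symmetric] ennreal_leI mult.assoc)
  qed (use gap pos w0 c(1) u in auto)
  moreover have "fsol u z <= ennreal (w / 2 * exp (b' * u))"
  proof -
   have "0 <= b' * u" using K(1) c(1) u C_nonneg by (auto simp: b'_def b_def intro!: mult_nonneg_nonneg)
   then have "w / 2 * 1 <= w / 2 * exp (b' * u)" using w0 by (intro mult_left_mono) auto
   then have "B * vexp 0 \<alpha> ?v <= w / 2 * exp (b' * u)" by (simp add: w_def)
   then have "ennreal (B * vexp 0 \<alpha> ?v) <= ennreal (w / 2 * exp (b' * u))" by (rule ennreal_leI)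
   moreover have "fsol u z <= ennreal (B * vexp 0 \<alpha> ?v)" using u by (intro B(2)) simp
   ultimately show ?thesis by (rule order_trans[rotated])
  qed
  ultimately have "fsol u z + (coll_step \<beta> 1 PV 1 W u z + coll_step \<beta> 1 PV (- 1) W u z)
   <= ennreal (w / 2 * exp (b' * u)) + (ennreal (K * w / (b' - C) * exp (b' * u)) + ennreal (c * (1 + norm ?v) * w / (b' - C) * exp (b' * u)))"
   by (intro add_mono)
  also have "... = ennreal (w / 2 * exp (b' * u) + (K * w / (b' - C) * exp (b' * u) + c * (1 + norm ?v) * w / (b' - C) * exp (b' * u)))"
   using gap pos w0 K(1) c(1) by (simp add: ennreal_plus[symmetric] del: ennreal_plus)
  also have "w / 2 * exp (b' * u) + (K * w / (b' - C) * exp (b' * u) + c * (1 + norm ?v) * w / (b' - C) * exp (b' * u))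
   = (w / 2 + (K + c * (1 + norm ?v)) * w / (b' - C)) * exp (b' * u)"
   by (simp only: distrib_right add_divide_distrib)
  also have "(K + c * (1 + norm ?v)) * w / (b' - C) = w / 2"
  proof -
   have "x * w / (2 * x) = w / 2" if "0 < x" for x :: real using that by simp
   from this[OF pos] show ?thesis unfolding gap .
  qed
  also have "ennreal ((w / 2 + w / 2) * exp (b' * u)) = W u z" using W_eq[of u 0] by simp
  finally show ?thesis .
 qed
 note super = this
 show thesis
 proof (rule that[where W=W])
  show "jointly_measurable W" by (rule Wm)
  show "W t z < \<top>" for z by (simp add: W_def)
 qed (rule super)
qed

text \<open>Summed over the trees with \<open>k\<close> collisions and with signs, the balance of the solution
  telescopes.\<close>

lemma signed_trees_sum:
 assumes t: "0 < t"
 shows "(%k. \<Sum>\<sigma>\<in>signs k. (\<Prod>i\<in>{1..k}. \<sigma> i) * enn2real (TV \<sigma> k h0 t z)) sums lin_sol \<phi> t z"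
proof -
 obtain W :: "real => 'n phase => ennreal"
  where W: "jointly_measurable W" and fin: "!!z. W t z < \<top>"
  and super: "!!u z. 0 < u ==> u <= t ==> fsol u z + (coll_step \<beta> 1 PV 1 W u z + coll_step \<beta> 1 PV (- 1) W u z) <= W u z"
 proof (rule supersolution_exists[OF t], goal_cases)
  case (1 W)
  show ?case by (rule 1(1)[OF 1(2-4)])
 qed
 define B where "B k = (\<Sum>\<sigma>\<in>signs k. TV \<sigma> k fsol t z)" for k
 define N where "N k = (\<Sum>\<sigma>\<in>signs k. (\<Prod>i\<in>{1..k}. \<sigma> i) * enn2real (TV \<sigma> k fsol t z))" for k
 have part: "(\<Sum>k<n. B k) <= W t z" for n
 proof -
  have "x <= x + y" for x y :: ennreal by simp
  from order_trans[OF this supersolution_bounds_trees[OF fsol_meas W t super, where n=n and z=z]]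
  show ?thesis unfolding B_def .
 qed
 have B_fin: "B k < \<top>" for k
 proof -
  have "B k <= (\<Sum>k<Suc k. B k)" by simp
  also have "... <= W t z" by (rule part)
  finally show ?thesis using fin by (rule order.strict_trans1)
 qed
 have T_fin: "TV \<sigma> k fsol t z < \<top>" if "\<sigma> \<in> signs k" for \<sigma> k
  using B_fin[of k] that unfolding B_def by (simp add: ennreal_sum_less_top)
 have "summable (%k. enn2real (B k))"
 proof (rule summableI_nonneg_bounded)
  show "(\<Sum>k<n. enn2real (B k)) <= enn2real (W t z)" for n
  proof -
   have "(\<Sum>k<n. enn2real (B k)) = enn2real (\<Sum>k<n. B k)"
    using B_fin by (simp add: enn2real_sum)
   also have "... <= enn2real (W t z)" using part fin by (intro enn2real_mono) auto
   finally show ?thesis .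
  qed
 qed simp
 then have B0: "(%k. enn2real (B k)) \<longlonglongrightarrow> 0" by (rule summable_LIMSEQ_zero)
 have prod1: "\<bar>\<Prod>i\<in>{1..k}. \<sigma> i\<bar> = 1" if "\<sigma> \<in> signs k" for \<sigma> k
 proof -
  have "\<bar>\<sigma> i\<bar> = 1" if "i \<in> {1..k}" for i 
   using \<open>\<sigma> \<in> signs k\<close>[unfolded signs_def PiE_iff, THEN conjunct1, rule_format, OF that] by auto
  then show ?thesis by (simp add: abs_prod)
 qed
 have "\<bar>N k\<bar> <= enn2real (B k)" for k
 proof -
  have "\<bar>N k\<bar> <= (\<Sum>\<sigma>\<in>signs k. \<bar>(\<Prod>i\<in>{1..k}. \<sigma> i) * enn2real (TV \<sigma> k fsol t z)\<bar>)"
   unfolding N_def by (rule sum_abs)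
  also have "... = (\<Sum>\<sigma>\<in>signs k. enn2real (TV \<sigma> k fsol t z))"
   by (intro sum.cong refl) (simp only: abs_mult prod1 mult_1_left abs_of_nonneg[OF enn2real_nonneg])
  also have "... = enn2real (B k)"
   unfolding B_def using T_fin by (simp add: enn2real_sum)
  finally show ?thesis .
 qed
 then have N0: "N \<longlonglongrightarrow> 0" by (intro tendsto_rabs_zero_cancel[OF tendsto_sandwich[OF _ _ tendsto_const B0]]) auto
 have step: "(\<Sum>\<sigma>\<in>signs k. (\<Prod>i\<in>{1..k}. \<sigma> i) * enn2real (TV \<sigma> k h0 t z)) = N k - N (Suc k)" for k
 proof -
  have single: "enn2real (TV \<sigma> k h0 t z) = enn2real (TV \<sigma> k fsol t z)
    - (enn2real (TV (\<sigma>(Suc k := 1)) (Suc k) fsol t z) - enn2real (TV (\<sigma>(Suc k := - 1)) (Suc k) fsol t z))"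
   if \<sigma>: "\<sigma> \<in> signs k" for \<sigma>
  proof -
   let ?P = "TV (\<sigma>(Suc k := 1)) (Suc k) fsol t z" and ?M = "TV (\<sigma>(Suc k := - 1)) (Suc k) fsol t z"
   have in_signs: "\<sigma>(Suc k := y) \<in> signs (Suc k)" if "y \<in> {-1, 1}" for y
    using \<sigma> that unfolding signs_def PiE_iff by (auto simp: extensional_def le_Suc_eq)
   have eq: "TV \<sigma> k fsol t z + ?M = TV \<sigma> k h0 t z + ?P"
   proof -
    have "TV \<sigma> k (%s z. fsol s z + coll_step \<beta> 1 PV (- 1) fsol s z) t z = TV \<sigma> k (%s z. h0 s z + coll_step \<beta> 1 PV 1 fsol s z) t z"
     by (rule tree_op_cong[OF _ t]) (rule fsol_balance, simp)
    then show ?thesis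
     unfolding tree_op_last
     by (simp only: tree_op_add[OF PV_meas fsol_meas measurable_coll_step[OF PV_meas fsol_meas]]
       tree_op_add[OF PV_meas h0_meas measurable_coll_step[OF PV_meas fsol_meas]])
   qed
   have P: "?P < \<top>" and M: "?M < \<top>" by (rule T_fin[OF in_signs], simp)+
   have "TV \<sigma> k h0 t z <= TV \<sigma> k fsol t z + ?M" unfolding eq by simp
   also have "... < \<top>" using T_fin[OF \<sigma>] M by simp
   finally have H: "TV \<sigma> k h0 t z < \<top>" .
   have "enn2real (TV \<sigma> k fsol t z + ?M) = enn2real (TV \<sigma> k h0 t z + ?P)" by (simp only: eq)
   then show ?thesis using T_fin[OF \<sigma>] P M H by (simp add: enn2real_plus del: fun_upd_apply tree_op.simps)
  qed
  have prodS: "(\<Prod>i\<in>{1..Suc k}. (\<sigma>(Suc k := y)) i) = (\<Prod>i\<in>{1..k}. \<sigma> i) * y" for \<sigma> :: "nat => real" and y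
   by (simp add: mult.commute)
  have "N (Suc k) = (\<Sum>\<sigma>\<in>signs k. (\<Prod>i\<in>{1..k}. \<sigma> i) *
    (enn2real (TV (\<sigma>(Suc k := 1)) (Suc k) fsol t z) - enn2real (TV (\<sigma>(Suc k := - 1)) (Suc k) fsol t z)))"
   unfolding N_def sum_signs_Suc prodS by (intro sum.cong refl) (simp add: right_diff_distrib del: tree_op.simps fun_upd_apply)
  then show ?thesis
   by (simp only: N_def sum_subtractf[symmetric] right_diff_distrib[symmetric])
    (intro sum.cong refl, simp only: single)
 qed
 have "(%k. N k - N (Suc k)) sums (N 0 - 0)" by (rule telescope_sums'[OF N0])
 moreover have "N 0 = lin_sol \<phi> t z"
  using ennreal_fsol[of t z] t lin_sol_nonneg[OF sol_facts, of t z]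
  by (simp add: N_def signs_def) (metis enn2real_ennreal less_imp_le)
 ultimately show ?thesis by (simp only: step diff_0_right)
qed

end

end

section \<open>Duality of the forward and the backward equation\<close>

lemma dyson_periodic:
 assumes "!!u s. lperiodic (S u s)" "lperiodic \<phi>"
 shows "lperiodic (dyson \<beta> \<epsilon> S \<phi> k s)"
proof (induction k arbitrary: s)
 case 0
 show ?case
  using lperiodicD[OF assms(1)] lperiodicD[OF lperiodic_free_flow[OF assms(2)]]
  by (intro lperiodicI) simp
next
 case (Suc k)
 show ?case using coll_step_periodic[OF Suc.IH assms(1)] by simp
qed

lemma gain_periodic: "lperiodic f ==> lperiodic (gain \<beta> f)"
 using coll_op_periodic[of f \<beta> 1] by (simp add: coll_op_def lperiodic_def)

text \<open>Read backwards, the damping collected on a segment is the same.\<close>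

lemma path_weight_time_reversal:
 "path_weight (- 1) (%r. W (t - r)) (t - u) (t - s) z = path_weight 1 W s u (free_flow (u - s) z)"
proof -
 have "(LINT r:{t - u..t - s}|lborel. W (t - r) (free_flow (- 1 * (r - (t - s))) z))
  = (LINT r|lborel. (%r. indicator {s..u} r *\<^sub>R W r (free_flow (1 * (r - u)) (free_flow (u - s) z))) (t + (- 1) * r))"
  unfolding set_lebesgue_integral_def
  by (intro Bochner_Integration.integral_cong refl) (auto simp: indicator_def algebra_simps)
 also have "... = (LINT r:{s..u}|lborel. W r (free_flow (1 * (r - u)) (free_flow (u - s) z)))"
  unfolding set_lebesgue_integral_def
  using lborel_integral_real_affine[of "- 1" "%r. indicator {s..u} r *\<^sub>R W r (free_flow (1 * (r - u)) (free_flow (u - s) z))" t] by simp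
 finally show ?thesis by (simp add: path_weight_def)
qed

lemma nn_integral_eq_cmult:
 fixes c :: ennreal
 assumes "f \<in> borel_measurable M" "!!x. g x = c * f x"
 shows "c * (\<integral>\<^sup>+x. f x \<partial>M) = (\<integral>\<^sup>+x. g x \<partial>M)"
 using assms by (simp add: nn_integral_cmult)

lemma gain_symmetric_phase:
 fixes \<phi> \<psi> :: "'n::finite phase => ennreal"
 assumes "\<phi> \<in> borel_measurable borel" "\<psi> \<in> borel_measurable borel"
 shows "(\<integral>\<^sup>+z. ennreal (maxwellian \<beta> (snd z)) * \<psi> z * gain \<beta> \<phi> z \<partial>phase_measure)
   = (\<integral>\<^sup>+z. ennreal (maxwellian \<beta> (snd z)) * \<phi> z * gain \<beta> \<psi> z \<partial>phase_measure)"
proof -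
 have "(indicator unit_cell :: real ^ 'n => ennreal) \<in> borel_measurable borel"
  using unit_cell_measurable by measurable
 from gain_symmetric[OF assms this] show ?thesis unfolding nn_integral_phase .
qed

context
 fixes \<beta> t :: real and W :: "real => 'n::finite phase => real"
 assumes W: "jointly_measurable W" and W_per: "!!s. lperiodic (W s)"
begin

abbreviation (input) "SF \<equiv> path_weight 1 W"
abbreviation (input) "SB \<equiv> path_weight (- 1) (%r. W (t - r))"

lemma SF_meas: "jointly_measurable3 SF"
 by (rule measurable_path_weight[OF W])

lemma SB_meas: "jointly_measurable3 SB"
proof (rule measurable_path_weight)
 note [measurable (raw)] = joint_apply[OF W]
 show "(%(r, z). W (t - r) z) \<in> borel_measurable (borel \<Otimes>\<^sub>M borel)" by measurable
qed

lemma shift_along_flow: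
 assumes [measurable]: "a \<in> borel_measurable borel" "c \<in> borel_measurable borel"
  and a: "lperiodic a" and c: "lperiodic c"
 shows "(\<integral>\<^sup>+z. ennreal (maxwellian \<beta> (snd z)) * a z * (SB (t - u) (t - s) z * c (free_flow (u - s) z)) \<partial>phase_measure)
  = (\<integral>\<^sup>+z. ennreal (maxwellian \<beta> (snd z)) * c z * (SF s u z * a (free_flow (s - u) z)) \<partial>phase_measure)"
proof -
 let ?G = "%z. ennreal (maxwellian \<beta> (snd z)) * c z * (SF s u z * a (free_flow (s - u) z))"
 note [measurable (raw)] = joint_apply3[OF SF_meas]
 have "lperiodic ?G"
  using lperiodicD[OF c] lperiodicD[OF lperiodic_free_flow[OF a]]
   lperiodicD[OF path_weight_periodic[OF W_per]]
  by (intro lperiodicI) simp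
 moreover have "?G \<in> borel_measurable borel" by measurable
 ultimately have "(\<integral>\<^sup>+z. ?G (free_flow (u - s) z) \<partial>phase_measure) = (\<integral>\<^sup>+z. ?G z \<partial>phase_measure)"
  by (intro nn_integral_phase_free_flow)
 then show ?thesis by (simp add: path_weight_time_reversal mult_ac)
qed

lemma coll_step_backward:
 assumes b: "jointly_measurable b"
 shows "coll_step \<beta> (- 1) SB 1 b (t - s) z =
  (\<integral>\<^sup>+u. indicator {s<..<t} u * (SB (t - u) (t - s) z * gain \<beta> (b (t - u)) (free_flow (u - s) z)) \<partial>lborel)"
proof -
 have "coll_step \<beta> (- 1) SB 1 b (t - s) z = (\<integral>\<^sup>+u. (%u. indicator {0<..<t - s} u * (SB u (t - s) z * coll_op \<beta> 1 (b u) (free_flow (- 1 * (u - (t - s))) z))) (t - u) \<partial>lborel)"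
  unfolding coll_step_def
  by (rule nn_integral_lborel_minus_left[symmetric], rule coll_step_integrand_measurable[OF SB_meas b])
 also have "... = (\<integral>\<^sup>+u. indicator {s<..<t} u * (SB (t - u) (t - s) z * gain \<beta> (b (t - u)) (free_flow (u - s) z)) \<partial>lborel)"
  by (intro nn_integral_cong) (auto simp: indicator_def coll_op_def algebra_simps)
 finally show ?thesis .
qed

text \<open>A backward step on one factor becomes a forward step on the other one: Fubini's theorem for
  the two times, invariance of the cell under the flow, and symmetry of the gain operator.\<close>

lemma exchange_step:
 fixes h b :: "real => 'n phase => ennreal"
 assumes h: "jointly_measurable h" "!!s. lperiodic (h s)"
  and b: "jointly_measurable b" "!!s. lperiodic (b s)"
 shows "(\<integral>\<^sup>+s. indicator {0<..<t} s * (\<integral>\<^sup>+z. ennreal (maxwellian \<beta> (snd z)) * gain \<beta> (h s) z * coll_step \<beta> (- 1) SB 1 b (t - s) z \<partial>phase_measure) \<partial>lborel)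
  = (\<integral>\<^sup>+u. indicator {0<..<t} u * (\<integral>\<^sup>+z. ennreal (maxwellian \<beta> (snd z)) * gain \<beta> (coll_step \<beta> 1 SF 1 h u) z * b (t - u) z \<partial>phase_measure) \<partial>lborel)"
proof -
 note [measurable] = unit_cell_measurable
 note [measurable (raw)] = joint_apply[OF h(1)] joint_apply[OF b(1)]
  joint_apply3[OF SF_meas] joint_apply3[OF SB_meas]
  joint_apply[OF measurable_coll_step[OF SF_meas h(1)]]
 let ?cell = "%z :: 'n phase. indicator unit_cell (fst z) :: ennreal" and ?M = "%z :: 'n phase. ennreal (maxwellian \<beta> (snd z))"
 define \<Phi> where "\<Phi> s u z = ?cell z * (?M z * gain \<beta> (h s) z * (SB (t - u) (t - s) z * gain \<beta> (b (t - u)) (free_flow (u - s) z)))" for s u z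
 define \<Psi> where "\<Psi> s u z = ?cell z * (?M z * gain \<beta> (b (t - u)) z * (SF s u z * gain \<beta> (h s) (free_flow (s - u) z)))" for s u z
 define T where "T s u = (if 0 < s \<and> s < u \<and> u < t then 1 else 0 :: ennreal)" for s u
 have T_eq: "T s u = indicator {0<..<t} s * indicator {s<..<t} u" and T_eq': "T s u = indicator {0<..<t} u * indicator {0<..<u} s" for s u
  by (auto simp: T_def indicator_def)
 have [measurable]: "(%x. T (f x) (g x)) \<in> borel_measurable N" if [measurable]: "f \<in> borel_measurable N" "g \<in> borel_measurable N" for f g and N :: "'m measure"
  unfolding T_def by measurable
 have [measurable]: "(%x. \<Phi> (f x) (g x) (k x)) \<in> borel_measurable N" "(%x. \<Psi> (f x) (g x) (k x)) \<in> borel_measurable N"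
  if [measurable]: "f \<in> borel_measurable N" "g \<in> borel_measurable N" "k \<in> borel_measurable N" for f g k and N :: "'m measure"
  unfolding \<Phi>_def \<Psi>_def by measurable
 have "(\<integral>\<^sup>+s. indicator {0<..<t} s * (\<integral>\<^sup>+z. ?M z * gain \<beta> (h s) z * coll_step \<beta> (- 1) SB 1 b (t - s) z \<partial>phase_measure) \<partial>lborel)
  = (\<integral>\<^sup>+s. \<integral>\<^sup>+z. \<integral>\<^sup>+u. T s u * \<Phi> s u z \<partial>lborel \<partial>lborel \<partial>lborel)"
 proof (intro nn_integral_cong)
  fix s
  have "indicator {0<..<t} s * (\<integral>\<^sup>+z. ?M z * gain \<beta> (h s) z * coll_step \<beta> (- 1) SB 1 b (t - s) z \<partial>phase_measure)
   = (\<integral>\<^sup>+z. indicator {0<..<t} s * (?cell z * (?M z * gain \<beta> (h s) z * coll_step \<beta> (- 1) SB 1 b (t - s) z)) \<partial>lborel)"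
   unfolding nn_integral_phase coll_step_backward[OF b(1)] by (rule nn_integral_cmult[symmetric]) measurable
  also have "... = (\<integral>\<^sup>+z. \<integral>\<^sup>+u. T s u * \<Phi> s u z \<partial>lborel \<partial>lborel)"
  proof (rule nn_integral_cong)
   fix z
   have "(indicator {0<..<t} s * (?cell z * (?M z * gain \<beta> (h s) z))) *
     (\<integral>\<^sup>+u. indicator {s<..<t} u * (SB (t - u) (t - s) z * gain \<beta> (b (t - u)) (free_flow (u - s) z)) \<partial>lborel)
    = (\<integral>\<^sup>+u. T s u * \<Phi> s u z \<partial>lborel)"
   proof (rule nn_integral_eq_cmult)
    show "T s u * \<Phi> s u z = (indicator {0<..<t} s * (?cell z * (?M z * gain \<beta> (h s) z))) *
     (indicator {s<..<t} u * (SB (t - u) (t - s) z * gain \<beta> (b (t - u)) (free_flow (u - s) z)))" for u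
     unfolding T_eq \<Phi>_def by (simp only: mult_ac)
   qed measurable
   then show "indicator {0<..<t} s * (?cell z * (?M z * gain \<beta> (h s) z * coll_step \<beta> (- 1) SB 1 b (t - s) z)) = (\<integral>\<^sup>+u. T s u * \<Phi> s u z \<partial>lborel)"
    unfolding coll_step_backward[OF b(1)] by (simp only: mult.assoc)
  qed
  finally show "indicator {0<..<t} s * (\<integral>\<^sup>+z. ?M z * gain \<beta> (h s) z * coll_step \<beta> (- 1) SB 1 b (t - s) z \<partial>phase_measure)
   = (\<integral>\<^sup>+z. \<integral>\<^sup>+u. T s u * \<Phi> s u z \<partial>lborel \<partial>lborel)" .
 qed
 also have "... = (\<integral>\<^sup>+s. \<integral>\<^sup>+u. \<integral>\<^sup>+z. T s u * \<Phi> s u z \<partial>lborel \<partial>lborel \<partial>lborel)"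
  by (intro nn_integral_cong lborel_pair.Fubini') measurable
 also have "... = (\<integral>\<^sup>+u. \<integral>\<^sup>+s. \<integral>\<^sup>+z. T s u * \<Phi> s u z \<partial>lborel \<partial>lborel \<partial>lborel)"
  by (intro lborel_pair.Fubini') measurable
 also have "... = (\<integral>\<^sup>+u. \<integral>\<^sup>+s. \<integral>\<^sup>+z. T s u * \<Psi> s u z \<partial>lborel \<partial>lborel \<partial>lborel)"
 proof (rule nn_integral_cong, rule nn_integral_cong)
  fix u s
  have "(\<integral>\<^sup>+z. \<Phi> s u z \<partial>lborel) = (\<integral>\<^sup>+z. \<Psi> s u z \<partial>lborel)"
   using shift_along_flow[where a="gain \<beta> (h s)" and c="gain \<beta> (b (t - u))" and s=s and u=u, OF _ _ gain_periodic[OF h(2)] gain_periodic[OF b(2)]]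
   unfolding nn_integral_phase \<Phi>_def \<Psi>_def by simp
  then show "(\<integral>\<^sup>+z. T s u * \<Phi> s u z \<partial>lborel) = (\<integral>\<^sup>+z. T s u * \<Psi> s u z \<partial>lborel)"
   by (simp add: nn_integral_cmult)
 qed
 also have "... = (\<integral>\<^sup>+u. \<integral>\<^sup>+z. \<integral>\<^sup>+s. T s u * \<Psi> s u z \<partial>lborel \<partial>lborel \<partial>lborel)"
  by (intro nn_integral_cong lborel_pair.Fubini') measurable
 also have "... = (\<integral>\<^sup>+u. indicator {0<..<t} u * (\<integral>\<^sup>+z. ?M z * coll_step \<beta> 1 SF 1 h u z * gain \<beta> (b (t - u)) z \<partial>phase_measure) \<partial>lborel)"
 proof (intro nn_integral_cong)
  fix u
  have "indicator {0<..<t} u * (\<integral>\<^sup>+z. ?M z * coll_step \<beta> 1 SF 1 h u z * gain \<beta> (b (t - u)) z \<partial>phase_measure)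
   = (\<integral>\<^sup>+z. indicator {0<..<t} u * (?cell z * (?M z * gain \<beta> (b (t - u)) z * coll_step \<beta> 1 SF 1 h u z)) \<partial>lborel)"
   unfolding nn_integral_phase by (subst nn_integral_cmult[symmetric], measurable) (simp add: mult_ac)
  also have "... = (\<integral>\<^sup>+z. \<integral>\<^sup>+s. T s u * \<Psi> s u z \<partial>lborel \<partial>lborel)"
  proof (rule nn_integral_cong)
   fix z
   have "(indicator {0<..<t} u * (?cell z * (?M z * gain \<beta> (b (t - u)) z))) *
     (\<integral>\<^sup>+s. indicator {0<..<u} s * (SF s u z * gain \<beta> (h s) (free_flow (s - u) z)) \<partial>lborel)
    = (\<integral>\<^sup>+s. T s u * \<Psi> s u z \<partial>lborel)"
   proof (rule nn_integral_eq_cmult)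
    show "T s u * \<Psi> s u z = (indicator {0<..<t} u * (?cell z * (?M z * gain \<beta> (b (t - u)) z))) *
     (indicator {0<..<u} s * (SF s u z * gain \<beta> (h s) (free_flow (s - u) z)))" for s
     unfolding T_eq' \<Psi>_def by (simp only: mult_ac)
   qed measurable
   then show "indicator {0<..<t} u * (?cell z * (?M z * gain \<beta> (b (t - u)) z * coll_step \<beta> 1 SF 1 h u z)) = (\<integral>\<^sup>+s. T s u * \<Psi> s u z \<partial>lborel)"
    unfolding coll_step_def coll_op_def by (simp only: mult.assoc mult_1_left refl if_True)
  qed
  finally show "(\<integral>\<^sup>+z. \<integral>\<^sup>+s. T s u * \<Psi> s u z \<partial>lborel \<partial>lborel) = indicator {0<..<t} u * (\<integral>\<^sup>+z. ?M z * coll_step \<beta> 1 SF 1 h u z * gain \<beta> (b (t - u)) z \<partial>phase_measure)" ..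
 qed
 also have "... = (\<integral>\<^sup>+u. indicator {0<..<t} u * (\<integral>\<^sup>+z. ?M z * gain \<beta> (coll_step \<beta> 1 SF 1 h u) z * b (t - u) z \<partial>phase_measure) \<partial>lborel)"
  by (subst gain_symmetric_phase, measurable) (simp add: mult_ac)
 finally show ?thesis .
qed

context
 fixes \<phi> \<psi> :: "'n phase => ennreal"
 assumes \<phi> [measurable]: "\<phi> \<in> borel_measurable borel" and \<psi> [measurable]: "\<psi> \<in> borel_measurable borel"
  and per: "lperiodic \<phi>" "lperiodic \<psi>"
begin

abbreviation (input) "DF \<equiv> dyson \<beta> 1 SF \<phi>"
abbreviation (input) "DB \<equiv> dyson \<beta> (- 1) SB \<psi>"

lemma dyson_facts:
 "jointly_measurable (DF k)" "!!s. lperiodic (DF k s)"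
 "jointly_measurable (DB k)" "!!s. lperiodic (DB k s)"
 using W_per per
 by (intro measurable_dyson[OF SF_meas] measurable_dyson[OF SB_meas] \<phi> \<psi> dyson_periodic path_weight_periodic; blast)+

lemma exchange_steps:
 "(\<integral>\<^sup>+s. indicator {0<..<t} s * (\<integral>\<^sup>+z. ennreal (maxwellian \<beta> (snd z)) * gain \<beta> (DF j s) z * DB k (t - s) z \<partial>phase_measure) \<partial>lborel)
  = (\<integral>\<^sup>+s. indicator {0<..<t} s * (\<integral>\<^sup>+z. ennreal (maxwellian \<beta> (snd z)) * gain \<beta> (DF (j + k) s) z * DB 0 (t - s) z \<partial>phase_measure) \<partial>lborel)"
proof (induction k arbitrary: j)
 case (Suc k)
 show ?case
  using exchange_step[OF dyson_facts(1,2)[of j] dyson_facts(3,4)[of k]] Suc.IH[of "Suc j"]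
  by (simp del: dyson.simps(1))
qed simp

text \<open>All backward steps are exchanged for forward steps one at a time; at either end
the free flow moves the datum itself.\<close>

lemma dyson_duality:
 assumes t: "0 <= t"
 shows "(\<integral>\<^sup>+z. ennreal (maxwellian \<beta> (snd z)) * \<psi> z * DF k t z \<partial>phase_measure)
  = (\<integral>\<^sup>+z. ennreal (maxwellian \<beta> (snd z)) * \<phi> z * DB k t z \<partial>phase_measure)"
proof (cases k)
 case 0
 then show ?thesis using shift_along_flow[OF \<phi> \<psi> per, of t 0] by simp
next
 case (Suc k)
 note [measurable] = unit_cell_measurable
 note [measurable (raw)] = joint_apply[OF dyson_facts(1)] joint_apply[OF dyson_facts(3)]
  joint_apply3[OF SF_meas] joint_apply3[OF SB_meas]
 let ?cell = "%z :: 'n phase. indicator unit_cell (fst z) :: ennreal" and ?M = "%z :: 'n phase. ennreal (maxwellian \<beta> (snd z))"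
 have "(\<integral>\<^sup>+z. ?M z * \<psi> z * DF (Suc k) t z \<partial>phase_measure)
  = (\<integral>\<^sup>+z. \<integral>\<^sup>+s. indicator {0<..<t} s * (?cell z * (?M z * \<psi> z * (SF s t z * gain \<beta> (DF k s) (free_flow (s - t) z)))) \<partial>lborel \<partial>lborel)"
  unfolding nn_integral_phase dyson.simps coll_step_def
 proof (rule nn_integral_cong)
  fix z
  have "(?cell z * (?M z * \<psi> z)) * (\<integral>\<^sup>+s. indicator {0<..<t} s * (SF s t z * gain \<beta> (DF k s) (free_flow (s - t) z)) \<partial>lborel)
   = (\<integral>\<^sup>+s. indicator {0<..<t} s * (?cell z * (?M z * \<psi> z * (SF s t z * gain \<beta> (DF k s) (free_flow (s - t) z)))) \<partial>lborel)"
   by (rule nn_integral_eq_cmult) (measurable, simp only: mult_ac)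
  then show "?cell z * (?M z * \<psi> z * (\<integral>\<^sup>+s. indicator {0<..<t} s * (SF s t z * coll_op \<beta> 1 (DF k s) (free_flow (1 * (s - t)) z)) \<partial>lborel))
   = (\<integral>\<^sup>+s. indicator {0<..<t} s * (?cell z * (?M z * \<psi> z * (SF s t z * gain \<beta> (DF k s) (free_flow (s - t) z)))) \<partial>lborel)"
   unfolding coll_op_def by (simp only: mult.assoc mult_1_left refl if_True)
 qed
 also have "... = (\<integral>\<^sup>+s. \<integral>\<^sup>+z. indicator {0<..<t} s * (?cell z * (?M z * \<psi> z * (SF s t z * gain \<beta> (DF k s) (free_flow (s - t) z)))) \<partial>lborel \<partial>lborel)"
  by (intro lborel_pair.Fubini') measurable
 also have "... = (\<integral>\<^sup>+s. indicator {0<..<t} s * (\<integral>\<^sup>+z. ?M z * gain \<beta> (DF k s) z * DB 0 (t - s) z \<partial>phase_measure) \<partial>lborel)"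
 proof (intro nn_integral_cong)
  fix s
  have e: "(\<integral>\<^sup>+z. ?cell z * (?M z * \<psi> z * (SF s t z * gain \<beta> (DF k s) (free_flow (s - t) z))) \<partial>lborel)
   = (\<integral>\<^sup>+z. ?M z * gain \<beta> (DF k s) z * DB 0 (t - s) z \<partial>phase_measure)"
   using shift_along_flow[where a="gain \<beta> (DF k s)" and c=\<psi> and s=s and u=t, OF _ \<psi> gain_periodic[OF dyson_facts(2)] per(2)]
   unfolding nn_integral_phase by simp
  show "(\<integral>\<^sup>+z. indicator {0<..<t} s * (?cell z * (?M z * \<psi> z * (SF s t z * gain \<beta> (DF k s) (free_flow (s - t) z)))) \<partial>lborel)
   = indicator {0<..<t} s * (\<integral>\<^sup>+z. ?M z * gain \<beta> (DF k s) z * DB 0 (t - s) z \<partial>phase_measure)"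
   unfolding e[symmetric] by (rule nn_integral_cmult) measurable
 qed
 also have "... = (\<integral>\<^sup>+s. indicator {0<..<t} s * (\<integral>\<^sup>+z. ?M z * gain \<beta> (DF 0 s) z * DB k (t - s) z \<partial>phase_measure) \<partial>lborel)"
  using exchange_steps[of 0 k] by (simp only: add_0)
 also have "... = (\<integral>\<^sup>+s. indicator {0<..<t} s * (\<integral>\<^sup>+z. ?M z * DF 0 s z * gain \<beta> (DB k (t - s)) z \<partial>phase_measure) \<partial>lborel)"
 proof -
  have "(\<integral>\<^sup>+z. ?M z * gain \<beta> (DF 0 s) z * DB k (t - s) z \<partial>phase_measure) = (\<integral>\<^sup>+z. ?M z * DF 0 s z * gain \<beta> (DB k (t - s)) z \<partial>phase_measure)" for s
   using gain_symmetric_phase[OF section_measurable[OF dyson_facts(1), of 0 s] section_measurable[OF dyson_facts(3), of k "t - s"], of \<beta>]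
   by (simp only: mult_ac)
  then show ?thesis by simp
 qed
 also have "... = (\<integral>\<^sup>+s. \<integral>\<^sup>+z. indicator {0<..<t} s * (?cell z * (?M z * \<phi> z * (SB (t - s) t z * gain \<beta> (DB k (t - s)) (free_flow s z)))) \<partial>lborel \<partial>lborel)"
 proof (intro nn_integral_cong)
  fix s
  have e: "(\<integral>\<^sup>+z. ?M z * DF 0 s z * gain \<beta> (DB k (t - s)) z \<partial>phase_measure)
   = (\<integral>\<^sup>+z. ?cell z * (?M z * \<phi> z * (SB (t - s) t z * gain \<beta> (DB k (t - s)) (free_flow s z))) \<partial>lborel)"
   using shift_along_flow[where a=\<phi> and c="gain \<beta> (DB k (t - s))" and s=0 and u=s, OF \<phi> _ per(1) gain_periodic[OF dyson_facts(4)]]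
   unfolding nn_integral_phase by (simp add: mult_ac)
  show "indicator {0<..<t} s * (\<integral>\<^sup>+z. ?M z * DF 0 s z * gain \<beta> (DB k (t - s)) z \<partial>phase_measure)
   = (\<integral>\<^sup>+z. indicator {0<..<t} s * (?cell z * (?M z * \<phi> z * (SB (t - s) t z * gain \<beta> (DB k (t - s)) (free_flow s z)))) \<partial>lborel)"
   unfolding e by (rule nn_integral_cmult[symmetric]) measurable
 qed
 also have "... = (\<integral>\<^sup>+z. \<integral>\<^sup>+s. indicator {0<..<t} s * (?cell z * (?M z * \<phi> z * (SB (t - s) t z * gain \<beta> (DB k (t - s)) (free_flow s z)))) \<partial>lborel \<partial>lborel)"
  by (intro lborel_pair.Fubini'[symmetric]) measurable
 also have "... = (\<integral>\<^sup>+z. ?M z * \<phi> z * DB (Suc k) t z \<partial>phase_measure)"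
  unfolding nn_integral_phase dyson.simps
 proof (rule nn_integral_cong)
  fix z
  have "(?cell z * (?M z * \<phi> z)) * (\<integral>\<^sup>+s. indicator {0<..<t} s * (SB (t - s) t z * gain \<beta> (DB k (t - s)) (free_flow s z)) \<partial>lborel)
   = (\<integral>\<^sup>+s. indicator {0<..<t} s * (?cell z * (?M z * \<phi> z * (SB (t - s) t z * gain \<beta> (DB k (t - s)) (free_flow s z)))) \<partial>lborel)"
   by (rule nn_integral_eq_cmult) (measurable, simp only: mult_ac)
  moreover have "coll_step \<beta> (- 1) SB 1 (DB k) t z = (\<integral>\<^sup>+s. indicator {0<..<t} s * (SB (t - s) t z * gain \<beta> (DB k (t - s)) (free_flow s z)) \<partial>lborel)"
   using coll_step_backward[OF dyson_facts(3)[of k], where s=0 and z=z] by simp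
  ultimately show "(\<integral>\<^sup>+s. indicator {0<..<t} s * (?cell z * (?M z * \<phi> z * (SB (t - s) t z * gain \<beta> (DB k (t - s)) (free_flow s z)))) \<partial>lborel)
   = ?cell z * (?M z * \<phi> z * coll_step \<beta> (- 1) SB 1 (DB k) t z)"
   by (simp only: mult.assoc)
 qed
 finally show ?thesis by (simp only: Suc)
qed

lemma dyson_sum_duality:
 assumes t: "0 <= t"
 shows "(\<integral>\<^sup>+z. ennreal (maxwellian \<beta> (snd z)) * \<psi> z * dyson_sum \<beta> 1 SF \<phi> t z \<partial>phase_measure)
  = (\<integral>\<^sup>+z. ennreal (maxwellian \<beta> (snd z)) * \<phi> z * dyson_sum \<beta> (- 1) SB \<psi> t z \<partial>phase_measure)"
proof -
 note [measurable] = section_measurable[OF dyson_facts(1)] section_measurable[OF dyson_facts(3)]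
 have a: "(%z. ennreal (maxwellian \<beta> (snd z)) * \<psi> z * DF i t z) \<in> borel_measurable phase_measure" for i
  by (rule sets_phase_measurable) measurable
 have b: "(%z. ennreal (maxwellian \<beta> (snd z)) * \<phi> z * DB i t z) \<in> borel_measurable phase_measure" for i
  by (rule sets_phase_measurable) measurable
 show ?thesis
  unfolding dyson_sum_def ennreal_suminf_cmult[symmetric]
  by (simp only: nn_integral_suminf[OF a] nn_integral_suminf[OF b] dyson_duality[OF t])
qed

end

end

section \<open>Evaluation of the path integral\<close>

abbreviation (input) tree_path ::
 "real => nat => (nat => real) => 'n::finite phase => 'n tree_data => real => 'n phase" where
 "tree_path t k \<sigma> z x \<equiv> trajectory t k \<sigma> (fst x) (fst (snd x)) (snd (snd x)) z"

definition tree_density ::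
 "real => real => nat => (nat => real) => (real => 'n::finite phase => real) => ('n phase => real) => 'n phase =>
  'n tree_data => real" where
 "tree_density \<beta> t k \<sigma> F \<phi> z x = tree_weight \<beta> t k \<sigma> (snd z) x *
   (exp (- (LINT s:{0..t}|lborel. F s (tree_path t k \<sigma> z x s))) * \<phi> (tree_path t k \<sigma> z x 0))"

lemma tree_weight_nonzeroD: "tree_weight \<beta> t k \<sigma> v x \<noteq> 0 ==> snd (snd x) \<in> collision_times t k"
 by (auto simp: tree_weight_def split_beta indicator_def split: if_splits)

lemma tree_integral_alt:
 assumes t: "0 < t"
 shows "tree_integral \<beta> \<phi> t (%\<zeta>. exp (G (\<zeta> t) - (LINT s:{0..t}|lborel. F s (\<zeta> s)))) k \<sigma> z
  = (\<Prod>i\<in>{1..k}. \<sigma> i) * (exp (G z) * (LINT x|tree_measure k. tree_density \<beta> t k \<sigma> F \<phi> z x))"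
proof -
 have "(case x of (vs, \<omega>s, \<tau>) => indicator (collision_times t k) \<tau> *
    (\<Prod>i\<in>{1..k}. \<sigma> i * cross_section (traj_vel \<sigma> vs \<omega>s (snd z) (i - 1)) (vs i) (\<omega>s i)) *
    exp (G (trajectory t k \<sigma> vs \<omega>s \<tau> z t) - (LINT s:{0..t}|lborel. F s (trajectory t k \<sigma> vs \<omega>s \<tau> z s))) *
    \<phi> (trajectory t k \<sigma> vs \<omega>s \<tau> z 0) *
    maxwellian \<beta> (snd (trajectory t k \<sigma> vs \<omega>s \<tau> z 0)) *
    (\<Prod>i\<in>{1..k}. maxwellian \<beta> (background_vel \<sigma> vs \<omega>s (snd z) i)))
   = (\<Prod>i\<in>{1..k}. \<sigma> i) * (exp (G z) * tree_density \<beta> t k \<sigma> F \<phi> z x)" for x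
 proof -
  obtain vs \<omega>s \<tau> where x: "x = (vs, \<omega>s, \<tau>)" by (cases x)
  show ?thesis
  proof (cases "\<tau> \<in> collision_times t k")
   case True
   have "snd (trajectory t k \<sigma> vs \<omega>s \<tau> z 0) = traj_vel \<sigma> vs \<omega>s (snd z) k"
    by (simp add: trajectory_initial[OF True t] tree_state_def)
   then show ?thesis
    by (simp only: x prod.case prod.distrib trajectory_final[OF True t] tree_density_def tree_weight_def
      fst_conv snd_conv exp_diff exp_minus divide_inverse mult_ac)
  next
   case False
   then show ?thesis by (simp add: x tree_density_def tree_weight_def)
  qed
 qed
 note integrand = this
 show ?thesis
  unfolding tree_integral_def integral_mult_right_zero[symmetric]
  by (rule Bochner_Integration.integral_cong[OF refl integrand])
qed

lemma measurable_tree_density: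
 fixes F :: "real => 'n::finite phase => real"
 assumes F: "jointly_measurable F" and [measurable]: "\<phi> \<in> borel_measurable borel"
 shows "(%x. tree_density \<beta> t k \<sigma> F \<phi> (fst x) (snd x)) \<in> borel_measurable ((borel :: 'n phase measure) \<Otimes>\<^sub>M tree_measure k)"
proof -
 let ?N = "(borel :: 'n phase measure) \<Otimes>\<^sub>M tree_measure k"
 have [measurable]: "(%y. tree_path t k \<sigma> (fst (fst y)) (snd (fst y)) (snd y)) \<in> borel_measurable (?N \<Otimes>\<^sub>M lborel)"
  using measurable_trajectory[of snd "?N \<Otimes>\<^sub>M lborel" fst k t \<sigma>] by simp
 have [measurable]: "(%y. tree_path t k \<sigma> (fst y) (snd y) 0) \<in> borel_measurable ?N"
  using measurable_trajectory[of "%_. 0" ?N "%y. y" k t \<sigma>] by simp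
 have "(%(x, s). indicator {0..t} s *\<^sub>R F s (tree_path t k \<sigma> (fst x) (snd x) s)) \<in> borel_measurable (?N \<Otimes>\<^sub>M lborel)"
  unfolding split_beta by (intro borel_measurable_scaleR joint_apply[OF F]) measurable
 then have [measurable]: "(%x. LINT s:{0..t}|lborel. F s (tree_path t k \<sigma> (fst x) (snd x) s)) \<in> borel_measurable ?N"
  unfolding set_lebesgue_integral_def by (rule lborel.borel_measurable_lebesgue_integral)
 note [measurable] = measurable_tree_weight
 show ?thesis unfolding tree_density_def by measurable
qed

lemma measurable_tree_integral:
 fixes F :: "real => 'n::finite phase => real"
 assumes F: "jointly_measurable F" and \<phi>: "\<phi> \<in> borel_measurable borel"
  and [measurable]: "G \<in> borel_measurable borel" and t: "0 < t"
 shows "(%z. tree_integral \<beta> \<phi> t (%\<zeta>. exp (G (\<zeta> t) - (LINT s:{0..t}|lborel. F s (\<zeta> s)))) k \<sigma> z) \<in> borel_measurable borel"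
proof -
 interpret sigma_finite_measure "tree_measure k :: 'n tree_data measure"
  by (rule sigma_finite_tree)
 have [measurable]: "(%z. LINT x|tree_measure k. tree_density \<beta> t k \<sigma> F \<phi> z x) \<in> borel_measurable borel"
  using measurable_tree_density[OF F \<phi>] by (intro borel_measurable_lebesgue_integral) (simp add: split_beta)
 show ?thesis unfolding tree_integral_alt[OF t] by measurable
qed

text \<open>Almost every tree avoids the exceptional sets of \<open>F\<close> and \<open>\<phi>0\<close>.  For one segment this follows from the identity between integrals over trees and iterated collision steps, with
  the time spent in the exceptional set as the weight of that segment.\<close>

lemma tree_integral_eq:
 fixes V F :: "real => 'n::finite phase => real"
 assumes \<beta>: "\<beta> > 0" and t: "0 < t"
  and V: "jointly_measurable V" and V_bound: "!!s z. \<bar>V s z\<bar> <= C"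
  and F: "jointly_measurable F"
  and FV: "AE s in lborel. AE z in lborel. \<not> (s \<in> {0..t} \<and> F s z \<noteq> V s z)"
  and \<phi>0: "\<phi>0 \<in> borel_measurable borel" "!!z. 0 <= \<phi>0 z" and \<phi> [measurable]: "\<phi> \<in> borel_measurable borel"
  and \<phi>_eq: "AE z in lborel. \<phi>0 z = \<phi> z"
 shows "AE z in lborel. tree_integral \<beta> \<phi>0 t (%\<zeta>. exp (G (\<zeta> t) - (LINT s:{0..t}|lborel. F s (\<zeta> s)))) k \<sigma> z
  = (\<Prod>i\<in>{1..k}. \<sigma> i) * (exp (G z) * (maxwellian \<beta> (snd z) * enn2real (tree_op \<beta> (%_. path_weight 1 V) \<sigma> k
    (%s z. path_weight 1 V 0 s z * ennreal (\<phi> (free_flow (- s) z))) t z)))"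
proof -
 note [measurable] = \<phi>0(1)
 note F' = F
 let ?N = "%s z. s \<in> {0..t} \<and> F s z \<noteq> V s z"
 note N = measurable_differ[OF V V_bound F t]
 note N' = measurable_miss[OF N]
 note [measurable (raw)] = joint_apply[OF N'] 
 define S where "S n i u s z = (if i = n then miss ?N s z else 1)" for n i :: nat and u s :: real and z :: "'n phase"
 define h where "h n s z = (if n = k then miss ?N s z else 1)" for n :: nat and s :: real and z :: "'n phase"
 define hd where "hd s z = (if \<phi>0 (free_flow (- s) z) \<noteq> \<phi> (free_flow (- s) z) then 1 else 0 :: ennreal)" for s and z :: "'n phase"
 let ?one = "%(_ :: nat) (_ :: real) (_ :: real) (_ :: 'n phase). 1 :: ennreal"
 have Sm: "jointly_measurable3 (S n i)" for n i
  unfolding S_def by (cases "i = n"; simp only: if_True if_False simp_thms; measurable)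
 have hm: "jointly_measurable (h n)" for n
  unfolding h_def by (cases "n = k"; simp only: if_True if_False simp_thms; measurable)
 have hdm: "jointly_measurable hd"
  unfolding hd_def by measurable
 have onem: "(%(u, s, z). ?one i u s z) \<in> borel_measurable (borel \<Otimes>\<^sub>M borel \<Otimes>\<^sub>M borel)" for i by simp
 have miss0: "AE z in lborel. miss ?N s z = 0" for s
  by (rule miss_AE_zero[OF N FV])
 have z1: "AE z in lborel. tree_op \<beta> (S n) \<sigma> k (h n) t z = 0" if "n \<in> {..k}" for n
 proof (cases "n = k")
  case True
  show ?thesis by (rule tree_op_AE_zero[OF \<beta> Sm hm]) (use miss0 True in \<open>simp add: h_def\<close>)
 next
  case False
  then have "n < k" using that by simp
  show ?thesis by (rule tree_op_AE_zero_segment[OF \<beta> Sm hm _ \<open>n < k\<close>]) (use miss0 in \<open>simp add: S_def\<close>)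
 qed
 have z2: "AE z in lborel. tree_op \<beta> ?one \<sigma> k hd t z = 0"
 proof (rule tree_op_AE_zero[OF \<beta> onem hdm])
  fix s
  show "AE z in lborel. hd s z = 0"
   using AE_lborel_free_flow[OF \<phi>_eq, of "- s"] by eventually_elim (simp add: hd_def)
 qed
 have "AE z in lborel. \<forall>n\<in>{..k}. tree_op \<beta> (S n) \<sigma> k (h n) t z = 0"
  by (rule AE_finite_allI[OF finite_atMost z1])
 with z2 show ?thesis
 proof eventually_elim
  case (elim z)
  let ?h0 = "%s z. path_weight 1 V 0 s z * ennreal (\<phi> (free_flow (- s) z))"
  note PV = measurable_path_weight[OF V, of 1]
  have h0m: "(%(s, z). ?h0 s z) \<in> borel_measurable (borel \<Otimes>\<^sub>M borel)"
  proof -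
   note [measurable (raw)] = joint_apply3[OF PV]
   show ?thesis by measurable
  qed
  have "AE x in tree_measure k. \<forall>n\<in>{..k}. tree_integrand \<beta> t k \<sigma> (S n) (h n) z x = 0"
   using elim(2) by (intro AE_finite_allI finite_atMost tree_integrand_AE_zero[OF \<beta> Sm hm]) blast
  moreover have "AE x in tree_measure k. tree_integrand \<beta> t k \<sigma> ?one hd z x = 0"
   by (rule tree_integrand_AE_zero[OF \<beta> onem hdm elim(1)])
  moreover have "AE x in tree_measure k. x \<in> space (tree_measure k)" by (rule AE_space)
  ultimately have "AE x in tree_measure k. ennreal (tree_density \<beta> t k \<sigma> F \<phi>0 z x) = tree_integrand \<beta> t k \<sigma> (%_. path_weight 1 V) ?h0 z x"
  proof eventually_elim
   case (elim x)
   show ?case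
   proof (cases "tree_weight \<beta> t k \<sigma> (snd z) x = 0")
    case True
    then show ?thesis by (simp add: tree_density_def tree_integrand_def)
   next
    case False
    then have "0 < tree_weight \<beta> t k \<sigma> (snd z) x" using tree_weight_nonneg[of \<beta> t k \<sigma> "snd z" x] by (auto simp: less_le)
    then have w: "ennreal (tree_weight \<beta> t k \<sigma> (snd z) x) \<noteq> 0" by simp
    note \<tau> = tree_weight_nonzeroD[OF False]
    have init: "tree_path t k \<sigma> z x 0 = free_flow (- tree_time t k x) (tree_state t \<sigma> z k x)"
     using trajectory_initial[OF \<tau> t, of \<sigma> "fst x" "fst (snd x)" z] by simp
    have "miss ?N (tree_time t n x) (tree_state t \<sigma> z n x) = 0" if n: "n <= k" for n
    proof -
     have "tree_integrand \<beta> t k \<sigma> (S n) (h n) z x = 0" using elim(1) n by blast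
     then have "(\<Prod>i<k. S n i (tree_time t (Suc i) x) (tree_time t i x) (tree_state t \<sigma> z i x)) = 0 \<or> h n (tree_time t k x) (tree_state t \<sigma> z k x) = 0"
      using w by (simp add: tree_integrand_def)
     then show ?thesis
     proof
      assume "(\<Prod>i<k. S n i (tree_time t (Suc i) x) (tree_time t i x) (tree_state t \<sigma> z i x)) = 0"
      then obtain i where "S n i (tree_time t (Suc i) x) (tree_time t i x) (tree_state t \<sigma> z i x) = 0"
       by (auto simp: prod_zero_iff)
      then show ?thesis by (simp add: S_def split: if_splits)
     next
      assume "h n (tree_time t k x) (tree_state t \<sigma> z k x) = 0"
      then show ?thesis by (simp add: h_def split: if_splits)
     qed
    qed
    note along = integral_along_trajectory[OF V V_bound F' t elim(3) \<tau> this]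
    have "hd (tree_time t k x) (tree_state t \<sigma> z k x) = 0" using elim(2) w by (simp add: tree_integrand_def)
    then have "\<phi>0 (tree_path t k \<sigma> z x 0) = \<phi> (free_flow (- tree_time t k x) (tree_state t \<sigma> z k x))"
     by (simp add: hd_def init split: if_splits)
    note init_value = this
    have "ennreal (tree_density \<beta> t k \<sigma> F \<phi>0 z x) = ennreal (tree_weight \<beta> t k \<sigma> (snd z) x) *
      (ennreal (exp (- (LINT s:{0..t}|lborel. F s (tree_path t k \<sigma> z x s)))) * ennreal (\<phi> (free_flow (- tree_time t k x) (tree_state t \<sigma> z k x))))"
     by (simp only: tree_density_def init_value ennreal_mult' tree_weight_nonneg exp_ge_zero)
    then show ?thesis by (simp only: along tree_integrand_def mult_ac)
   qed
  qed
  then have "(\<integral>\<^sup>+x. ennreal (tree_density \<beta> t k \<sigma> F \<phi>0 z x) \<partial>tree_measure k)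
    = ennreal (maxwellian \<beta> (snd z)) * tree_op \<beta> (%_. path_weight 1 V) \<sigma> k ?h0 t z"
   by (subst tree_identity[OF \<beta> PV h0m, symmetric]) (rule nn_integral_cong_AE)
  moreover have "(LINT x|tree_measure k. tree_density \<beta> t k \<sigma> F \<phi>0 z x) = enn2real (\<integral>\<^sup>+x. ennreal (tree_density \<beta> t k \<sigma> F \<phi>0 z x) \<partial>tree_measure k)"
   using measurable_tree_section[OF measurable_tree_density[OF F' \<phi>0(1)], where z=z] \<phi>0(2)
   by (intro integral_eq_nn_integral) (auto simp: tree_density_def)
  ultimately show ?case
   by (simp add: tree_integral_alt[OF t] enn2real_mult maxwellian_nonneg)
 qed
qed

context bounded_potential
begin

lemma path_integral_eq_solution:
 fixes F :: "real => 'n phase => real"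
 assumes \<epsilon>1: "\<epsilon> = 1" and t: "0 < t"
  and F: "jointly_measurable F"
  and FV: "AE s in lborel. AE z in lborel. s \<in> {0..t} --> F s z = V s z"
  and \<phi>0: "\<phi>0 \<in> borel_measurable borel" "!!z. 0 <= \<phi>0 z" and \<phi>_eq: "AE z in lborel. \<phi>0 z = \<phi> z"
  and G: "G \<in> borel_measurable borel"
  and \<phi>: "\<phi> \<in> borel_measurable borel" "!!z. 0 <= \<phi> z" "lperiodic \<phi>"
  and \<alpha>: "0 < \<alpha>" "\<alpha> < \<beta> / 2" and \<phi>_bound: "!!z. \<phi> z <= A * wt \<alpha> z"
 shows "path_integral \<beta> \<phi>0 t (%\<zeta>. exp (G (\<zeta> t) - (LINT s:{0..t}|lborel. F s (\<zeta> s))))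
  = (LINT z|phase_measure. maxwellian \<beta> (snd z) * (exp (G z) * lin_sol \<phi> t z))"
 unfolding path_integral_def
proof (rule integral_cong_AE)
 let ?T = "tree_integral \<beta> \<phi>0 t (%\<zeta>. exp (G (\<zeta> t) - (LINT s:{0..t}|lborel. F s (\<zeta> s))))"
 note [measurable] = measurable_tree_integral[OF F \<phi>0(1) G t] G
 note [measurable (raw)] = joint_apply[OF lin_sol_meas[OF \<phi> \<alpha> \<phi>_bound]]
 show "(%z. \<Sum>k. \<Sum>\<sigma>\<in>{1..k} \<rightarrow>\<^sub>E {-1, 1}. ?T k \<sigma> z) \<in> borel_measurable phase_measure"
  by (rule sets_phase_measurable) measurable
 show "(%z. maxwellian \<beta> (snd z) * (exp (G z) * lin_sol \<phi> t z)) \<in> borel_measurable phase_measure"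
  by (rule sets_phase_measurable) measurable
 let ?e = "%k \<sigma> z. (\<Prod>i\<in>{1..k}. \<sigma> i) * (exp (G z) * (maxwellian \<beta> (snd z) * enn2real (tree_op \<beta> (%_. path_weight 1 V) \<sigma> k
    (%s z. path_weight 1 V 0 s z * ennreal (\<phi> (free_flow (- s) z))) t z)))"
 have "AE s in lborel. AE z in lborel. \<not> (s \<in> {0..t} \<and> F s z \<noteq> V s z)"
  using FV by (rule eventually_mono) (erule eventually_mono, blast)
 note tree_integral_eq[OF \<beta> t V_meas V_bound F this \<phi>0 \<phi>(1) \<phi>_eq]
 then have "AE z in lborel. \<forall>k. \<forall>\<sigma>\<in>signs k. ?T k \<sigma> z = ?e k \<sigma> z"
  by (simp only: AE_all_countable) (intro allI AE_finite_allI finite_signs, blast)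
 then have "AE z in lborel. (\<Sum>k. \<Sum>\<sigma>\<in>{1..k} \<rightarrow>\<^sub>E {-1, 1}. ?T k \<sigma> z) = maxwellian \<beta> (snd z) * (exp (G z) * lin_sol \<phi> t z)"
 proof eventually_elim
  case (elim z)
  have "(%k. (maxwellian \<beta> (snd z) * exp (G z)) * (\<Sum>\<sigma>\<in>signs k. (\<Prod>i\<in>{1..k}. \<sigma> i) * enn2real (tree_op \<beta> (%_. path_weight 1 V) \<sigma> k
    (%s z. path_weight 1 V 0 s z * ennreal (\<phi> (free_flow (- s) z))) t z))) sums ((maxwellian \<beta> (snd z) * exp (G z)) * lin_sol \<phi> t z)"
   by (rule sums_mult[OF signed_trees_sum[OF \<epsilon>1 \<phi> \<alpha> \<phi>_bound t]])
  moreover have "(maxwellian \<beta> (snd z) * exp (G z)) * (\<Sum>\<sigma>\<in>signs k. (\<Prod>i\<in>{1..k}. \<sigma> i) * enn2real (tree_op \<beta> (%_. path_weight 1 V) \<sigma> k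
    (%s z. path_weight 1 V 0 s z * ennreal (\<phi> (free_flow (- s) z))) t z)) = (\<Sum>\<sigma>\<in>signs k. ?T k \<sigma> z)" for k
   unfolding sum_distrib_left using elim by (intro sum.cong refl) (simp only: mult_ac)
  ultimately show ?case by (simp add: sums_iff signs_def mult.assoc)
 qed
 then show "AE z in phase_measure. (\<Sum>k. \<Sum>\<sigma>\<in>{1..k} \<rightarrow>\<^sub>E {-1, 1}. ?T k \<sigma> z) = maxwellian \<beta> (snd z) * (exp (G z) * lin_sol \<phi> t z)"
  by (rule AE_lborel_imp_phase)
qed

end

section \<open>Bounds encoded in the function spaces\<close>

text \<open>Functions on \<open>[0, T] \<times> D\<close> are extended by zero to make them measurable on the whole line.\<close>

definition on_interval :: "real => (real => 'a => real) => real => 'a => real" where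
 "on_interval T h s z = (if s \<in> {0..T} then h s z else 0)"

lemma on_interval_eq [simp]: "0 <= s ==> s <= T ==> on_interval T h s = h s"
 by (simp add: on_interval_def fun_eq_iff)

lemma on_interval_measurable:
 fixes h :: "real => 'n::finite phase => real"
 assumes "time_phase_fun T h"
 shows "jointly_measurable (on_interval T h)"
 unfolding on_interval_def by (rule borel_measurable_time_phase[OF assms])

lemma on_interval_periodic:
 fixes h :: "real => 'n::finite phase => real"
 assumes "time_phase_fun T h"
 shows "lperiodic (on_interval T h s)"
proof (cases "s \<in> {0..T}")
 case True
 then show ?thesis using time_phase_fun_section(2)[OF assms True] by simp
next
 case False
 then show ?thesis by (intro lperiodicI) (simp only: on_interval_def if_False)
qed

lemma transported_values:
 assumes "!!s z. 0 <= s ==> s <= T ==> h s z = h' s z" "!!s z. 0 <= s ==> s <= T ==> F s z = F' s z"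
 shows "transported \<epsilon> T h F \<longleftrightarrow> transported \<epsilon> T h' F'"
proof -
 have "primitive_on T (%s. h s (free_flow (\<epsilon> * s) z)) (%s. F s (free_flow (\<epsilon> * s) z)) \<longleftrightarrow>
  primitive_on T (%s. h' s (free_flow (\<epsilon> * s) z)) (%s. F' s (free_flow (\<epsilon> * s) z))" for z
  by (rule primitive_on_values) (simp_all add: assms)
 then show ?thesis unfolding transported_def by simp
qed

lemma transported_cong_AE:
 fixes h F F' :: "real => 'n::finite phase => real"
 assumes h: "transported \<epsilon> T h F"
  and F: "jointly_measurable F"
  and F': "jointly_measurable F'"
  and eq: "AE s in lborel. AE z in lborel. s \<in> {0..T} --> F s z = F' s z"
 shows "transported \<epsilon> T h F'"
proof -
 note [measurable (raw)] = joint_apply[OF F] joint_apply[OF F']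
 have "Measurable.pred (borel \<Otimes>\<^sub>M borel) (%(s, z). s \<in> {0..T} --> F s z = F' s z)" by measurable
 from AE_along_flow_swap[where P="%s z. s \<in> {0..T} --> F s z = F' s z" and \<epsilon>=\<epsilon>, OF this] eq
 have "AE z in lborel. AE s in lborel. s \<in> {0..T} --> F s (free_flow (\<epsilon> * s) z) = F' s (free_flow (\<epsilon> * s) z)" by blast
 with h[unfolded transported_def] show ?thesis
  unfolding transported_def
 proof eventually_elim
  case (elim z)
  show ?case
   by (rule primitive_on_cong[OF elim(1) refl elim(2)]) (unfold set_borel_measurable_def, measurable)
 qed
qed

lemma AE_le_of_esssup:
 assumes "esssup M (%z. ereal (f z)) <= ereal c"
 shows "AE z in M. f z <= c"
 using esssup_AE[of "%z. ereal (f z)" M]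
proof eventually_elim
 case (elim z)
 from order_trans[OF elim assms] show ?case by simp
qed

lemma esssup_finite_bound:
 assumes "esssup M (%z. ereal (f z)) < \<infinity>"
 obtains c where "0 <= c" "AE z in M. f z <= c"
proof -
 have "esssup M (%z. ereal (f z)) \<noteq> \<infinity>" using assms by simp
 then obtain n :: nat where "esssup M (%z. ereal (f z)) < ereal (real n)"
  by (rule exE[OF less_PInf_Ex_of_nat[THEN iffD1]])
 then have "AE z in M. f z <= real n" by (intro AE_le_of_esssup) simp
 then show thesis by (rule that[rotated]) simp
qed

lemma AE_phase_velocity_bound:
 fixes f :: "'n::finite phase => real"
 assumes "lperiodic f" "AE z in phase_measure. f z <= b (snd z)"
 shows "AE z in lborel. f z <= b (snd z)"
proof (rule AE_phase_imp_lborel[OF _ assms(2)])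
 show "lperiodic (%z. f z <= b (snd z))"
  using lperiodicD[OF assms(1)] by (intro lperiodicI) simp
qed

lemma maxwellian_vexp: "maxwellian \<beta> v * vexp 0 (\<beta> / 2) v = (\<beta> / (2 * pi)) powr (real CARD('n) / 2)" for v :: "real ^ 'n::finite"
 by (simp add: maxwellian_def vexp_def exp_add[symmetric] mult.assoc)

lemma datum_bound:
 fixes \<phi>0 :: "'n::finite phase => real"
 assumes \<beta>: "\<beta> > 0" and "phase_fun \<phi>0"
  and "esssup phase_measure (%z. ereal (\<phi>0 z * maxwellian (\<beta> / 2) (snd z))) < \<infinity>"
 obtains A where "0 <= A" "AE z in lborel. \<phi>0 z <= A * wt (\<beta> / 4) z"
proof -
 obtain c where c: "0 <= c" "AE z in phase_measure. \<phi>0 z * maxwellian (\<beta> / 2) (snd z) <= c"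
  using esssup_finite_bound[OF assms(3)] by blast
 let ?m = "(\<beta> / 2 / (2 * pi)) powr (real CARD('n) / 2)"
 have m: "0 < ?m" using \<beta> by simp
 have le: "\<phi>0 z <= c / ?m * wt (\<beta> / 4) z" if "\<phi>0 z * maxwellian (\<beta> / 2) (snd z) <= c" for z
 proof -
  have "\<phi>0 z * ?m = \<phi>0 z * maxwellian (\<beta> / 2) (snd z) * wt (\<beta> / 4) z"
   using maxwellian_vexp[of "\<beta> / 2" "snd z"] by (simp add: mult.assoc)
  also have "... <= c * wt (\<beta> / 4) z" by (rule mult_right_mono[OF that]) simp
  finally show ?thesis using m by (simp add: pos_le_divide_eq)
 qed
 have "lperiodic \<phi>0" using assms(2) by (simp add: phase_fun_def periodic_iff)
 then have "AE z in lborel. \<phi>0 z <= c / ?m * wt (\<beta> / 4) z"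
  by (rule AE_phase_velocity_bound) (rule eventually_mono[OF c(2) le])
 then show thesis by (rule that[rotated]) (use c(1) m in simp)
qed

text \<open>The derivative of an observable may be changed on null sets, so that it becomes bounded.\<close>

lemma observables_bounded_derivative:
 fixes g :: "real => 'n::finite phase => real"
 assumes t: "0 < t" and g: "g \<in> observables t \<beta>"
 obtains V C where "time_phase_fun t g" "transported 1 t g V"
  "jointly_measurable V" "!!s z. \<bar>V s z\<bar> <= C" "!!s. lperiodic (V s)"
  "AE z in lborel. g t z <= \<beta> / 4 * (norm (snd z))\<^sup>2 + C"
proof -
 obtain F C where F: "has_transport_deriv t g F" and
  C: "!!s. s \<in> {0..t} ==> Linfty_norm (%(x, v). max 0 (g s (x, v) - \<beta> / 4 * (norm v)\<^sup>2)) + Linfty_norm (F s) < ereal C"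
  using g unfolding observables_def by blast
 have gp: "time_phase_fun t g" and Fp: "time_phase_fun t F" and tr: "transported 1 t g F"
  using F unfolding has_transport_deriv_iff by blast+
 have both: "AE z in phase_measure. max 0 (g s z - \<beta> / 4 * (norm (snd z))\<^sup>2) + \<bar>F s z\<bar> <= C" if s: "s \<in> {0..t}" for s
 proof (rule AE_le_of_esssup)
  have "esssup phase_measure (%z. ereal (max 0 (g s z - \<beta> / 4 * (norm (snd z))\<^sup>2) + \<bar>F s z\<bar>))
   = esssup phase_measure (%z. ereal \<bar>max 0 (g s z - \<beta> / 4 * (norm (snd z))\<^sup>2)\<bar> + ereal \<bar>F s z\<bar>)"
   by (simp only: plus_ereal.simps(1) abs_of_nonneg[OF max.cobounded1])
  also have "... <= esssup phase_measure (%z. ereal \<bar>max 0 (g s z - \<beta> / 4 * (norm (snd z))\<^sup>2)\<bar>) + esssup phase_measure (%z. ereal \<bar>F s z\<bar>)"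
   by (rule esssup_add)
  also have "... <= ereal C" using C[OF s] unfolding Linfty_norm_def by (simp add: case_prod_unfold)
  finally show "esssup phase_measure (%z. ereal (max 0 (g s z - \<beta> / 4 * (norm (snd z))\<^sup>2) + \<bar>F s z\<bar>)) <= ereal C" .
 qed
 define V where "V s z = max (- \<bar>C\<bar>) (min \<bar>C\<bar> (on_interval t F s z))" for s z
 note [measurable (raw)] = joint_apply[OF on_interval_measurable[OF Fp]]
 have Vm: "jointly_measurable V" unfolding V_def by measurable
 have per: "lperiodic (V s)" for s
  using lperiodicD[OF on_interval_periodic[OF Fp]] by (intro lperiodicI) (simp add: V_def)
 have FV: "AE z in lborel. s \<in> {0..t} --> on_interval t F s z = V s z" for s
 proof (cases "s \<in> {0..t}")
  case True
  have "AE z in phase_measure. \<bar>F s z\<bar> <= C" using both[OF True] by eventually_elim linarith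
  moreover have "lperiodic (%z. \<bar>F s z\<bar>)"
   using lperiodicD[OF time_phase_fun_section(2)[OF Fp True]] by (intro lperiodicI) simp
  ultimately have "AE z in lborel. \<bar>F s z\<bar> <= C" by (intro AE_phase_velocity_bound[where b="%_. C"])
  then show ?thesis
  proof eventually_elim
   case (elim z)
   then have "F s z <= \<bar>C\<bar>" "- \<bar>C\<bar> <= F s z" by linarith+
   then show ?case using True by (simp add: V_def)
  qed
 next
  case False
  then show ?thesis by (intro AE_I2 impI) blast
 qed
 have "transported 1 t g (on_interval t F)" using tr by (subst transported_values[where h'=g and F'=F]) simp_all
 then have "transported 1 t g V"
  by (rule transported_cong_AE[OF _ on_interval_measurable[OF Fp] Vm]) (simp only: FV AE_I2)
 moreover have "AE z in lborel. g t z <= \<beta> / 4 * (norm (snd z))\<^sup>2 + \<bar>C\<bar>"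
 proof (rule AE_phase_velocity_bound[where b="%v. \<beta> / 4 * (norm v)\<^sup>2 + \<bar>C\<bar>"])
  show "lperiodic (g t)" using time_phase_fun_section(2)[OF gp, of t] t by simp
  have "t \<in> {0..t}" using t by simp
  from both[OF this] show "AE z in phase_measure. g t z <= \<beta> / 4 * (norm (snd z))\<^sup>2 + \<bar>C\<bar>"
   by eventually_elim linarith
 qed
 moreover have "\<bar>V s z\<bar> <= \<bar>C\<bar>" for s z unfolding V_def by linarith
 ultimately show thesis using that[OF gp _ Vm _ per] by blast
qed

lemma Linfty_FI:
 fixes h :: "real => 'n::finite phase => real"
 assumes h: "time_phase_fun t h"
  and b: "!!s z. s \<in> {0..t} ==> \<bar>h s z\<bar> * exp (\<alpha> * (norm (snd z))\<^sup>2) <= B"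
 shows "h \<in> Linfty_F t \<alpha>"
proof -
 have w: "weighted_norm \<alpha> (h s) <= ereal B" if s: "s \<in> {0..t}" for s
  unfolding weighted_norm_def Linfty_norm_def
 proof (rule esssup_I)
  note [measurable] = time_phase_fun_section(1)[OF h s]
  show "(%z. ereal \<bar>case z of (x, v) => h s (x, v) * exp (\<alpha> * (norm v)\<^sup>2)\<bar>) \<in> borel_measurable phase_measure"
   by (rule sets_phase_measurable) (simp add: split_beta)
  show "AE z in phase_measure. ereal \<bar>case z of (x, v) => h s (x, v) * exp (\<alpha> * (norm v)\<^sup>2)\<bar> <= ereal B"
   using b[OF s] by (intro AE_I2) (simp add: split_beta abs_mult)
 qed
 then have "h s \<in> F_space \<alpha> \<and> weighted_norm \<alpha> (h s) <= ereal B" if s: "s \<in> {0..t}" for s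
  using w[OF s] time_phase_fun_section(3)[OF h s] by (auto simp: F_space_def intro: order.strict_trans1)
 then show ?thesis unfolding Linfty_F_def using h by blast
qed

text \<open>The converse of the previous bound, with the exceptional set taken in the whole space.\<close>

lemma Linfty_FD:
 fixes h :: "real => 'n::finite phase => real"
 assumes "h \<in> Linfty_F t \<alpha>"
 obtains B where "0 <= B" "AE s in lborel. AE z in lborel. s \<in> {0..t} --> \<bar>h s z\<bar> <= B * exp (- \<alpha> * (norm (snd z))\<^sup>2)"
proof -
 from assms obtain B where h: "time_phase_fun t h" and
  B: "AE s in lborel. s \<in> {0..t} --> h s \<in> F_space \<alpha> \<and> weighted_norm \<alpha> (h s) <= ereal B"
  unfolding Linfty_F_def by blast
 have "AE s in lborel. AE z in lborel. s \<in> {0..t} --> \<bar>h s z\<bar> <= \<bar>B\<bar> * exp (- \<alpha> * (norm (snd z))\<^sup>2)"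
  using B
 proof eventually_elim
  case (elim s)
  show ?case
  proof (cases "s \<in> {0..t}")
   case True
   then have "esssup phase_measure (%z. ereal \<bar>h s z * exp (\<alpha> * (norm (snd z))\<^sup>2)\<bar>) <= ereal B"
    using elim by (simp add: weighted_norm_def Linfty_norm_def case_prod_unfold)
   from AE_le_of_esssup[OF this]
   have "AE z in phase_measure. \<bar>h s z\<bar> <= \<bar>B\<bar> * exp (- \<alpha> * (norm (snd z))\<^sup>2)"
   proof eventually_elim
    case (elim z)
    then have "\<bar>h s z\<bar> * exp (\<alpha> * (norm (snd z))\<^sup>2) <= \<bar>B\<bar>" by (simp add: abs_mult)
    then have "\<bar>h s z\<bar> * exp (\<alpha> * (norm (snd z))\<^sup>2) * exp (- \<alpha> * (norm (snd z))\<^sup>2) <= \<bar>B\<bar> * exp (- \<alpha> * (norm (snd z))\<^sup>2)"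
     by (rule mult_right_mono) simp
    then show ?case by (simp add: mult.assoc exp_add[symmetric])
   qed
   moreover have "lperiodic (%z. \<bar>h s z\<bar>)"
    using lperiodicD[OF time_phase_fun_section(2)[OF h True]] by (intro lperiodicI) simp
   ultimately have "AE z in lborel. \<bar>h s z\<bar> <= \<bar>B\<bar> * exp (- \<alpha> * (norm (snd z))\<^sup>2)"
    by (intro AE_phase_velocity_bound[where b="%v. \<bar>B\<bar> * exp (- \<alpha> * (norm v)\<^sup>2)"])
   then show ?thesis by eventually_elim simp
  next
   case False
   then show ?thesis by (intro AE_I2 impI) blast
  qed
 qed
 then show thesis by (rule that[rotated]) simp
qed

lemma is_dH_dp_unique:
 assumes p: "phase_fun p" and \<kappa>: "phase_fun \<kappa>" "phase_fun \<kappa>'" and "is_dH_dp \<beta> q p \<kappa>" "is_dH_dp \<beta> q p \<kappa>'"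
 shows "AE z in lborel. \<kappa> z = \<kappa>' z"
proof (rule directions_density_unique[OF p \<kappa>])
 fix \<psi> assume \<psi>: "\<psi> \<in> directions p"
 note a = assms(4)[unfolded is_dH_dp_def, rule_format, OF \<psi>] and b = assms(5)[unfolded is_dH_dp_def, rule_format, OF \<psi>]
 show "integrable phase_measure (%z. \<kappa> z * \<psi> z) \<and> integrable phase_measure (%z. \<kappa>' z * \<psi> z) \<and>
   (LINT z|phase_measure. \<kappa> z * \<psi> z) = (LINT z|phase_measure. \<kappa>' z * \<psi> z)"
  using a b DERIV_unique by blast
qed

section \<open>The system in the Cole-Hopf variables\<close>

lemma rgain_periodic:
 assumes "lperiodic f"
 shows "lperiodic (rgain \<beta> f)"
 using lperiodicD[OF assms] by (intro lperiodicI) (simp add: rgain_def)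

lemma AE_lborel_minus_left:
 fixes Q :: "real => bool"
 assumes "AE s in lborel. Q s"
 shows "AE s in lborel. Q (t - s)"
proof -
 from assms obtain N where N: "{s \<in> space lborel. \<not> Q s} \<subseteq> N" "emeasure lborel N = 0" "N \<in> sets lborel"
  by (rule AE_E)
 then have [measurable]: "N \<in> sets borel" by simp
 have "(\<integral>\<^sup>+s. indicator N (t - s) \<partial>lborel) = (0 :: ennreal)"
  using nn_integral_lborel_minus_left[of "indicator N" t] N(2) by simp
 then have "AE s in lborel. indicator N (t - s) = (0 :: ennreal)"
  by (subst (asm) nn_integral_0_iff_AE) measurable
 then show ?thesis
 proof eventually_elim
  case (elim s)
  then have "t - s \<notin> N" by (simp add: indicator_eq_0_iff)
  then show ?case using N(1) by auto
 qed
qed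

lemma time_phase_fun_diff:
 assumes "time_phase_fun t a" "time_phase_fun t b"
 shows "time_phase_fun t (%s z. a s z - b s z)"
proof -
 have "(%x. (case x of (s, z) => a s z) - (case x of (s, z) => b s z)) \<in> borel_measurable (restrict_space borel ({0..t} \<times> UNIV))"
  using assms by (intro borel_measurable_diff) (simp_all add: time_phase_fun_def)
 then show ?thesis using assms by (simp add: time_phase_fun_def periodic_def split_beta)
qed

text \<open>The functions \<open>V\<close>, \<open>\<phi>\<close> and \<open>\<psi>\<close> are the transport derivative of \<open>g\<close>, the initial datum and \<open>e\<^bsup>g(t)\<^esup>\<close>, changed on
null sets so that their bounds hold everywhere.\<close>

locale hj_data =
 fixes \<beta> t C A A' :: real and g V :: "real => 'n::finite phase => real" and \<phi>0 \<phi> \<psi> :: "'n phase => real"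
 assumes \<beta>_pos: "\<beta> > 0" and t_pos: "0 < t"
  and V_meas: "jointly_measurable V"
  and V_bound: "!!s z. \<bar>V s z\<bar> <= C" and V_per: "!!s. lperiodic (V s)"
  and g: "time_phase_fun t g" and gV: "transported 1 t g V"
  and \<phi>0: "phase_fun \<phi>0" "!!z. 0 <= \<phi>0 z"
  and \<phi>_meas: "\<phi> \<in> borel_measurable borel" and \<phi>_nonneg: "!!z. 0 <= \<phi> z" and \<phi>_per: "lperiodic \<phi>"
  and \<phi>_bound: "!!z. \<phi> z <= A * wt (\<beta> / 4) z" and \<phi>_eq: "AE z in lborel. \<phi>0 z = \<phi> z"
  and \<psi>_meas: "\<psi> \<in> borel_measurable borel" and \<psi>_pos: "!!z. 0 < \<psi> z" and \<psi>_per: "lperiodic \<psi>"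
  and \<psi>_bound: "!!z. \<psi> z <= A' * wt (\<beta> / 4) z" and \<psi>_eq: "AE z in lborel. exp (g t z) = \<psi> z"
begin

sublocale fwd: bounded_potential \<beta> 1 C V
 by (rule bounded_potential.intro[OF \<beta>_pos V_meas V_bound V_per])

lemma V_reversed_meas: "(%(s, z). V (t - s) z) \<in> borel_measurable (borel \<Otimes>\<^sub>M borel)"
 by measurable

sublocale bwd: bounded_potential \<beta> "- 1" C "%r. V (t - r)"
 by (rule bounded_potential.intro[OF \<beta>_pos V_reversed_meas V_bound V_per])

lemma \<alpha>: "0 < \<beta> / 4" "\<beta> / 4 < \<beta> / 2"
 using \<beta>_pos by auto

lemma \<psi>_nonneg: "0 <= \<psi> z"
 using \<psi>_pos by (rule less_imp_le)

lemmas \<phi>_facts = \<phi>_meas \<phi>_nonneg \<phi>_per \<alpha> \<phi>_bound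
lemmas \<psi>_facts = \<psi>_meas \<psi>_nonneg \<psi>_per \<alpha> \<psi>_bound

abbreviation "M \<equiv> maxwellian \<beta>"
abbreviation "F \<equiv> fwd.lin_sol \<phi>"
abbreviation "Q \<equiv> bwd.lin_sol \<psi>"
definition P where "P s = Q (t - s)"
definition p where "p s z = ln (P s z)"
definition q where "q s z = M (snd z) * F s z * P s z"
definition Dq where "Dq s z = M (snd z) * (P s z * rgain \<beta> (F s) z - F s z * rgain \<beta> (P s) z)"
definition Dr where "Dr s z = freq \<beta> (snd z) - rgain \<beta> (P s) z / P s z"

lemmas F_meas = fwd.lin_sol_meas[OF \<phi>_facts]
lemmas F_measurable [measurable (raw)] = joint_apply[OF F_meas]
lemmas Q_measurable [measurable (raw)] = joint_apply[OF bwd.lin_sol_meas[OF \<psi>_facts]]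

lemma P_meas: "jointly_measurable P"
 unfolding P_def by measurable

lemmas P_measurable [measurable (raw)] = joint_apply[OF P_meas]

lemma p_meas: "jointly_measurable p"
 and q_meas: "jointly_measurable q"
 and Dq_meas: "jointly_measurable Dq"
 and Dr_meas: "jointly_measurable Dr"
 unfolding p_def q_def Dq_def Dr_def by measurable

lemma F_per: "lperiodic (F s)" and P_per: "lperiodic (P s)"
 unfolding P_def by (rule fwd.lin_sol_per[OF \<phi>_facts], rule bwd.lin_sol_per[OF \<psi>_facts])

lemma p_per: "lperiodic (p s)" and q_per: "lperiodic (q s)"
 and Dq_per: "lperiodic (Dq s)" and Dr_per: "lperiodic (Dr s)"
 using lperiodicD[OF F_per] lperiodicD[OF P_per]
  lperiodicD[OF rgain_periodic[OF F_per]] lperiodicD[OF rgain_periodic[OF P_per]]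
 by (intro lperiodicI; simp add: p_def q_def Dq_def Dr_def)+

lemma F_nonneg: "0 <= F s z"
 by (rule fwd.lin_sol_nonneg[OF \<phi>_facts])

lemma P_pos: "s <= t ==> 0 < P s z"
 unfolding P_def by (rule bwd.lin_sol_pos[OF \<psi>_facts \<psi>_pos]) simp

lemma exp_p: "s <= t ==> exp (p s z) = P s z"
 by (simp add: p_def P_pos)

lemma FP_bound:
 obtains B where "0 <= B" "!!s z. s \<in> {0..t} ==> F s z <= B * wt (\<beta> / 4) z"
  "!!s z. s \<in> {0..t} ==> P s z <= B * wt (\<beta> / 4) z"
proof -
 obtain B where B: "0 <= B" "!!s z. s \<in> {0..t} ==> F s z <= B * wt (\<beta> / 4) z"
  using fwd.lin_sol_bound[OF \<phi>_facts, of t] by blast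
 obtain B' where B': "0 <= B'" "!!s z. s \<in> {0..t} ==> Q s z <= B' * wt (\<beta> / 4) z"
  using bwd.lin_sol_bound[OF \<psi>_facts, of t] by blast
 show thesis
 proof (rule that[of "B + B'"])
  show "F s z <= (B + B') * wt (\<beta> / 4) z" if "s \<in> {0..t}" for s z
   using B(2)[OF that, of z] B'(1) by (simp add: distrib_right add_increasing2)
  show "P s z <= (B + B') * wt (\<beta> / 4) z" if "s \<in> {0..t}" for s z
   using B'(2)[of "t - s" z] B(1) that by (simp add: P_def distrib_right add_increasing)
 qed (use B B' in simp)
qed

lemma gain_F: "0 <= s ==> gain \<beta> (%z. ennreal \<bar>F s z\<bar>) y = ennreal (rgain \<beta> (F s) y)"
 using fwd.ennreal_rgain_lin_sol[OF \<phi>_facts] by (simp add: F_nonneg fwd.ennreal_lin_sol[OF \<phi>_facts])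

lemma gain_P: "s <= t ==> gain \<beta> (%z. ennreal \<bar>P s z\<bar>) y = ennreal (rgain \<beta> (P s) y)"
 using bwd.ennreal_rgain_lin_sol[OF \<psi>_facts] bwd.lin_sol_nonneg[OF \<psi>_facts]
 by (simp add: P_def bwd.ennreal_lin_sol[OF \<psi>_facts])

lemma rgain_P_nonneg: "s <= t ==> 0 <= rgain \<beta> (P s) z"
 by (subst rgain_nonneg_eq) (auto simp: P_pos less_imp_le)

lemma F_transported: "transported 1 t F (%s z. rgain \<beta> (F s) z - (V s z + freq \<beta> (snd z)) * F s z)"
 unfolding transported_def by (rule AE_I2) (rule fwd.lin_sol_primitive[OF \<phi>_facts])

lemma P_transported: "transported 1 t P (%s z. (V s z + freq \<beta> (snd z)) * P s z - rgain \<beta> (P s) z)"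
proof -
 have "transported (- 1) t Q (%s z. rgain \<beta> (Q s) z - (V (t - s) z + freq \<beta> (snd z)) * Q s z)"
  unfolding transported_def by (rule AE_I2) (rule bwd.lin_sol_primitive[OF \<psi>_facts])
 from transported_reflect[OF this] show ?thesis by (simp add: P_def[abs_def])
qed

lemma q_transported: "transported 1 t q Dq"
 using F_transported P_transported unfolding transported_def
proof eventually_elim
 case (elim z)
 from primitive_on_mult_left[where c="M (snd z)", OF primitive_on_mult[OF elim]]
 show ?case
  by (rule primitive_on_values[THEN iffD1, rotated 2]) (simp_all add: q_def Dq_def algebra_simps)
qed

lemma r_transported: "transported 1 t (%s z. p s z - g s z) Dr"
 using P_transported gV unfolding transported_def
proof eventually_elim
 case (elim z)
 have "0 < P s (free_flow (1 * s) z)" if "0 <= s" "s <= t" for s using P_pos[OF that(2)] .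
 from primitive_on_diff[OF primitive_on_ln[OF elim(1) this] elim(2)]
 show ?case
 proof (rule primitive_on_values[THEN iffD1, rotated 2])
  fix s assume "s \<in> {0..t}"
  then have "P s (free_flow (1 * s) z) \<noteq> 0" using P_pos[of s "free_flow (1 * s) z"] by simp
  then show "((V s (free_flow (1 * s) z) + freq \<beta> (snd (free_flow (1 * s) z))) * P s (free_flow (1 * s) z) - rgain \<beta> (P s) (free_flow (1 * s) z)) /
    P s (free_flow (1 * s) z) - V s (free_flow (1 * s) z) = Dr s (free_flow (1 * s) z)"
   by (simp add: Dr_def diff_divide_distrib)
 qed (simp_all add: p_def)
qed

lemma coll_rate_p: "s <= t ==> coll_rate \<beta> (p s) z = - Dr s z"
proof -
 assume s: "s <= t"
 have [measurable]: "p s \<in> borel_measurable borel" by (rule section_measurable[OF p_meas])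
 have "gain \<beta> (%z. ennreal (exp (p s z))) z < \<infinity>"
  using gain_P[OF s, of z] P_pos[OF s] by (simp add: exp_p[OF s] less_imp_le)
 from coll_rate_eq[OF \<beta>_pos _ this] show ?thesis by (simp add: exp_p[OF s] Dr_def)
qed

text \<open>On a direction \<open>p\<close> is bounded, so \<open>P\<close> is bounded below there.\<close>

lemma coll_rate_p_integrable:
 assumes s: "s \<in> {0..t}" and \<eta>: "\<eta> \<in> directions (p s)"
 shows "integrable phase_measure (%z. coll_rate \<beta> (p s) z * \<eta> z)"
proof -
 obtain R where R: "\<eta> \<in> borel_measurable borel" "lperiodic \<eta>" "0 <= R" "!!z. \<bar>\<eta> z\<bar> <= R"
  "!!z. \<eta> z \<noteq> 0 ==> norm (snd z) <= R" "!!z. \<eta> z \<noteq> 0 ==> \<bar>p s z\<bar> <= R"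
  using directionsD[OF \<eta>] by blast
 note [measurable] = R(1) section_measurable[OF p_meas]
 obtain c where c: "0 < c" "!!v :: real ^ 'n. freq \<beta> v <= c * (1 + norm v)" using freq_bound[OF \<beta>_pos] by blast
 have st: "s <= t" and ts: "t - s \<in> {0..t}" using s by auto
 obtain D where D: "0 <= D" "!!z. rgain \<beta> (P s) z <= D * wt (\<beta> / 4) z"
 proof -
  obtain D where D: "0 <= D" "\<forall>r\<in>{0..t}. \<forall>z. gain \<beta> (dyson_sum \<beta> (- 1) (path_weight (- 1) bwd.damped) (%z. ennreal (\<psi> z)) r) z <= ennreal (D * wt (\<beta> / 4) z)"
   using bwd.gain_dsol_bound[OF \<psi>_facts, of t] by blast
  have "rgain \<beta> (P s) z <= D * wt (\<beta> / 4) z" for z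
  proof -
   have "ennreal (rgain \<beta> (P s) z) <= ennreal (D * wt (\<beta> / 4) z)"
    using D(2)[rule_format, OF ts, of z] bwd.ennreal_rgain_lin_sol[OF \<psi>_facts, of "t - s" z] st by (simp add: P_def)
   then show ?thesis using D(1) by (subst (asm) ennreal_le_iff) auto
  qed
  then show thesis using that D(1) by blast
 qed
 let ?c = "(D * exp (\<beta> / 4 * R\<^sup>2) * exp R + c * (1 + R)) * R"
 have pos: "0 <= D * exp (\<beta> / 4 * R\<^sup>2) * exp R + c * (1 + R)" using D(1) c(1) R(3) by (intro add_nonneg_nonneg mult_nonneg_nonneg) auto
 have "\<bar>coll_rate \<beta> (p s) z * \<eta> z\<bar> <= ?c" for z
 proof (cases "\<eta> z = 0")
  case True
  then show ?thesis using pos R(3) by simp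
 next
  case False
  have v: "norm (snd z) <= R" and pz: "\<bar>p s z\<bar> <= R" using R(5,6)[OF False] by auto
  have "(norm (snd z))\<^sup>2 <= R\<^sup>2" using v by (intro power_mono) auto
  then have "wt (\<beta> / 4) z <= exp (\<beta> / 4 * R\<^sup>2)" using \<alpha>(1) by (simp add: vexp_def)
  then have "D * wt (\<beta> / 4) z <= D * exp (\<beta> / 4 * R\<^sup>2)" using D(1) by (rule mult_left_mono)
  with D(2)[of z] have g1: "rgain \<beta> (P s) z <= D * exp (\<beta> / 4 * R\<^sup>2)" by linarith
  have "inverse (P s z) = exp (- p s z)" using exp_p[OF st, of z] by (simp add: exp_minus)
  moreover have "exp (- p s z) <= exp R" using pz by simp
  ultimately have "rgain \<beta> (P s) z * inverse (P s z) <= D * exp (\<beta> / 4 * R\<^sup>2) * exp R"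
   using g1 rgain_P_nonneg[OF st, of z] D(1) by (intro mult_mono) auto
  moreover have "0 <= rgain \<beta> (P s) z * inverse (P s z)" using rgain_P_nonneg[OF st, of z] P_pos[OF st, of z] by simp
  moreover have "freq \<beta> (snd z) <= c * (1 + R)"
  proof -
   have "c * (1 + norm (snd z)) <= c * (1 + R)" using v c(1) by simp
   then show ?thesis using c(2)[of "snd z"] by linarith
  qed
  moreover have "0 <= freq \<beta> (snd z)" by simp
  ultimately have "\<bar>coll_rate \<beta> (p s) z\<bar> <= D * exp (\<beta> / 4 * R\<^sup>2) * exp R + c * (1 + R)"
   unfolding coll_rate_p[OF st] Dr_def divide_inverse by linarith
  then show ?thesis unfolding abs_mult using R(4)[of z] pos by (intro mult_mono) auto
 qed
 then show ?thesis
  by (intro integrable_phase_bounded_support[where c="?c" and R=R] AE_I2) (measurable, use R(5) in auto)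
qed

lemma solution: "HJ_solution \<beta> \<phi>0 t g q p"
proof -
 obtain B where B: "0 <= B" "!!s z. s \<in> {0..t} ==> F s z <= B * wt (\<beta> / 4) z"
  "!!s z. s \<in> {0..t} ==> P s z <= B * wt (\<beta> / 4) z"
  using FP_bound by blast
 have tp: "time_phase_fun t q" "time_phase_fun t p" "time_phase_fun t Dq" "time_phase_fun t Dr"
  by (intro time_phase_funI q_meas q_per p_meas p_per Dq_meas Dq_per Dr_meas Dr_per)+
 have dp: "is_dH_dp \<beta> (q s) (p s) (Dq s)" if s: "s \<in> {0..t}" for s
 proof -
  have st: "s <= t" using s by simp
  have Dq_eq: "Dq s = (%z. M (snd z) * (exp (p s z) * rgain \<beta> (F s) z - F s z * rgain \<beta> (%z. exp (p s z)) z))"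
   by (simp add: fun_eq_iff Dq_def exp_p[OF st])
  show ?thesis unfolding Dq_eq
  proof (rule is_dH_dpI[OF \<beta>_pos \<alpha> B(1) section_measurable[OF F_meas] section_measurable[OF p_meas]])
   show "AE z in lborel. \<bar>F s z\<bar> <= B * wt (\<beta> / 4) z" using B(2)[OF s] F_nonneg by (intro AE_I2) simp
   show "AE z in lborel. exp (p s z) <= B * wt (\<beta> / 4) z" using B(3)[OF s] by (intro AE_I2) (simp add: exp_p[OF st])
   show "q s z = M (snd z) * F s z * exp (p s z)" for z by (simp add: q_def exp_p[OF st])
  qed
 qed
 have dq: "is_dH_dq \<beta> (q s) (p s) (%z. - Dr s z)" if s: "s \<in> {0..t}" for s
 proof -
  have "(%z. - Dr s z) = coll_rate \<beta> (p s)" using s by (simp add: fun_eq_iff coll_rate_p)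
  then show ?thesis using is_dH_dqI[OF coll_rate_p_integrable[OF s]] by simp
 qed
 have init: "AE z in phase_measure. q 0 z = M (snd z) * \<phi>0 z * exp (p 0 z)"
  using AE_lborel_imp_phase[OF \<phi>_eq] by eventually_elim (use t_pos in \<open>simp add: q_def exp_p fwd.lin_sol_0[OF \<phi>_facts]\<close>)
 have final: "AE z in phase_measure. p t z = g t z"
  using AE_lborel_imp_phase[OF \<psi>_eq]
 proof eventually_elim
  case (elim z)
  then show ?case by (simp add: p_def P_def bwd.lin_sol_0[OF \<psi>_facts] flip: elim)
 qed
 have "\<exists>D. has_transport_deriv t q D \<and> (AE s in lborel. s \<in> {0..t} --> is_dH_dp \<beta> (q s) (p s) (D s))"
  unfolding has_transport_deriv_iff
  by (intro exI[of _ Dq] conjI tp q_transported AE_I2 impI dp; assumption)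
 moreover have "\<exists>D. has_transport_deriv t (%s z. p s z - g s z) D \<and> (AE s in lborel. s \<in> {0..t} --> is_dH_dq \<beta> (q s) (p s) (%z. - D s z))"
  unfolding has_transport_deriv_iff
  by (intro exI[of _ Dr] conjI tp time_phase_fun_diff[OF tp(2) g] r_transported AE_I2 impI dq; assumption)
 ultimately show ?thesis
  unfolding HJ_solution_def using tp init final by blast
qed

lemma in_class: "solution_class \<beta> t q p"
proof -
 obtain B where B: "0 <= B" "!!s z. s \<in> {0..t} ==> F s z <= B * wt (\<beta> / 4) z"
  "!!s z. s \<in> {0..t} ==> P s z <= B * wt (\<beta> / 4) z"
  using FP_bound by blast
 note [measurable (raw)] = joint_apply[OF p_meas] joint_apply[OF q_meas]
 let ?m = "(\<beta> / (2 * pi)) powr (real CARD('n) / 2)"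
 have "(%s z. q s z * exp (- p s z)) \<in> Linfty_F t (\<beta> / 4)"
 proof (rule Linfty_FI)
  show "time_phase_fun t (%s z. q s z * exp (- p s z))"
  proof (rule time_phase_funI)
   show "(%(s, z). q s z * exp (- p s z)) \<in> borel_measurable (borel \<Otimes>\<^sub>M borel)" by measurable
   show "lperiodic (%z. q s z * exp (- p s z))" for s
    using lperiodicD[OF q_per] lperiodicD[OF p_per] by (intro lperiodicI) simp
  qed
  fix s and z :: "'n phase" assume s: "s \<in> {0..t}"
  have "q s z * exp (- p s z) = M (snd z) * F s z"
   using s P_pos[of s z] by (simp add: q_def exp_minus exp_p)
  moreover have "exp (\<beta> / 4 * (norm (snd z))\<^sup>2) = wt (\<beta> / 4) z" by (simp add: vexp_def)
  ultimately have "\<bar>q s z * exp (- p s z)\<bar> * exp (\<beta> / 4 * (norm (snd z))\<^sup>2) = M (snd z) * F s z * wt (\<beta> / 4) z"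
   using F_nonneg[of s z] maxwellian_nonneg[of \<beta> "snd z"] by simp
  also have "... <= M (snd z) * (B * wt (\<beta> / 4) z) * wt (\<beta> / 4) z"
   using B(2)[OF s, of z] maxwellian_nonneg[of \<beta> "snd z"] by (intro mult_right_mono mult_left_mono) auto
  also have "... = B * (M (snd z) * vexp 0 (\<beta> / 2) (snd z))"
   by (simp add: vexp_def exp_add[symmetric] mult_ac)
  finally show "\<bar>q s z * exp (- p s z)\<bar> * exp (\<beta> / 4 * (norm (snd z))\<^sup>2) <= B * ?m" by (simp only: maxwellian_vexp)
 qed
 moreover have "(%s z. exp (p s z)) \<in> Linfty_F t (- \<beta> / 4)"
 proof (rule Linfty_FI)
  show "time_phase_fun t (%s z. exp (p s z))"
  proof (rule time_phase_funI)
   show "(%(s, z). exp (p s z)) \<in> borel_measurable (borel \<Otimes>\<^sub>M borel)" by measurable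
   show "lperiodic (%z. exp (p s z))" for s
    using lperiodicD[OF p_per] by (intro lperiodicI) simp
  qed
  fix s and z :: "'n phase" assume s: "s \<in> {0..t}"
  have "\<bar>exp (p s z)\<bar> * exp (- \<beta> / 4 * (norm (snd z))\<^sup>2) <= B * wt (\<beta> / 4) z * exp (- \<beta> / 4 * (norm (snd z))\<^sup>2)"
   using B(3)[OF s, of z] s P_pos[of s z] by (intro mult_right_mono) (auto simp: exp_p)
  also have "... = B" by (simp add: vexp_def exp_add[symmetric] mult.assoc)
  finally show "\<bar>exp (p s z)\<bar> * exp (- \<beta> / 4 * (norm (snd z))\<^sup>2) <= B" .
 qed
 ultimately show ?thesis unfolding solution_class_def by blast
qed

end

section \<open>Uniqueness\<close>

lemma AE_AE_imp:
 assumes "AE x in M. AE y in N. A x y" "!!x y. A x y ==> P x ==> B x y"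
 shows "AE x in M. AE y in N. P x --> B x y"
 using assms(1)
proof (rule eventually_mono)
 fix x assume "AE y in N. A x y"
 then show "AE y in N. P x --> B x y" by (rule eventually_mono) (use assms(2) in blast)
qed

context hj_data
begin

context
 fixes q' p' :: "real => 'n phase => real"
 assumes sol: "HJ_solution \<beta> \<phi>0 t g q' p'" and cls: "solution_class \<beta> t q' p'"
begin

definition "pe = on_interval t p'"
definition "qe = on_interval t q'"
definition "P' s z = exp (pe s z)"
definition "F' s z = qe s z * exp (- pe s z) / M (snd z)"

lemma tq': "time_phase_fun t q'" and tp': "time_phase_fun t p'"
 using sol unfolding HJ_solution_def by blast+

lemmas pe_measurable [measurable (raw)] = joint_apply[OF on_interval_measurable[OF tp', folded pe_def]]
lemmas qe_measurable [measurable (raw)] = joint_apply[OF on_interval_measurable[OF tq', folded qe_def]]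

lemma P'_meas: "jointly_measurable P'"
 and F'_meas: "jointly_measurable F'"
 unfolding P'_def F'_def by measurable

lemmas P'_measurable [measurable (raw)] = joint_apply[OF P'_meas]
lemmas F'_measurable [measurable (raw)] = joint_apply[OF F'_meas]

lemma P'_per: "lperiodic (P' s)" and F'_per: "lperiodic (F' s)"
 using lperiodicD[OF on_interval_periodic[OF tp', folded pe_def]] lperiodicD[OF on_interval_periodic[OF tq', folded qe_def]]
 by (intro lperiodicI; simp add: P'_def F'_def)+

lemma P'_pos: "0 < P' s z" by (simp add: P'_def)

lemma M_pos: "0 < M v" by (rule maxwellian_pos[OF \<beta>_pos])

lemma P'_eq: "0 <= s ==> s <= t ==> P' s z = exp (p' s z)"
 by (simp add: P'_def pe_def)

lemma q'_eq: "0 <= s ==> s <= t ==> q' s z = M (snd z) * F' s z * P' s z"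
 using M_pos[of "snd z"] by (simp add: F'_def P'_def qe_def pe_def exp_minus)

lemma class_bound:
 obtains B where "0 <= B" "AE s in lborel. AE z in lborel. s \<in> {0..t} --> \<bar>F' s z\<bar> <= B * wt (\<beta> / 4) z"
  "AE s in lborel. AE z in lborel. s \<in> {0..t} --> \<bar>P' s z\<bar> <= B * wt (\<beta> / 4) z"
proof -
 from cls have c1: "(%s z. q' s z * exp (- p' s z)) \<in> Linfty_F t (\<beta> / 4)" and c2: "(%s z. exp (p' s z)) \<in> Linfty_F t (- \<beta> / 4)"
  unfolding solution_class_def by blast+
 obtain B1 where B1: "0 <= B1" "AE s in lborel. AE z in lborel. s \<in> {0..t} --> \<bar>q' s z * exp (- p' s z)\<bar> <= B1 * exp (- (\<beta> / 4) * (norm (snd z))\<^sup>2)"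
  using Linfty_FD[OF c1] by blast
 obtain B2 where B2: "0 <= B2" "AE s in lborel. AE z in lborel. s \<in> {0..t} --> \<bar>exp (p' s z)\<bar> <= B2 * exp (- (- \<beta> / 4) * (norm (snd z))\<^sup>2)"
  using Linfty_FD[OF c2] by blast
 let ?m = "(\<beta> / (2 * pi)) powr (real CARD('n) / 2)"
 have m: "0 < ?m" using \<beta>_pos by simp
 have le: "c * vexp 0 (\<beta> / 4) v <= (B1 / ?m + B2) * vexp 0 (\<beta> / 4) v" if "c = B1 / ?m \<or> c = B2" for c and v :: "real ^ 'n"
  using that B1(1) B2(1) m by (intro mult_right_mono) auto
 show thesis
 proof (rule that[of "B1 / ?m + B2"])
  show "0 <= B1 / ?m + B2" using B1(1) B2(1) m by simp
  show "AE s in lborel. AE z in lborel. s \<in> {0..t} --> \<bar>F' s z\<bar> <= (B1 / ?m + B2) * wt (\<beta> / 4) z"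
   using B1(2)
  proof (rule AE_AE_imp)
   fix s and z :: "'n phase" assume b: "s \<in> {0..t} --> \<bar>q' s z * exp (- p' s z)\<bar> <= B1 * exp (- (\<beta> / 4) * (norm (snd z))\<^sup>2)" and s: "s \<in> {0..t}"
   have cancel: "a / m = a * w / (m * w)" if "0 < w" for a m w :: real using that by simp
   have EW: "exp (- (\<beta> / 4) * (norm (snd z))\<^sup>2) * vexp 0 (\<beta> / 2) (snd z) = wt (\<beta> / 4) z"
    by (simp add: vexp_def exp_add[symmetric])
   have "\<bar>F' s z\<bar> = \<bar>q' s z * exp (- p' s z)\<bar> / M (snd z)"
    using s M_pos[of "snd z"] by (simp add: F'_def qe_def pe_def abs_mult)
   also have "... <= B1 * exp (- (\<beta> / 4) * (norm (snd z))\<^sup>2) / M (snd z)"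
    using b s M_pos[of "snd z"] by (intro divide_right_mono) auto
   also have "... = B1 * exp (- (\<beta> / 4) * (norm (snd z))\<^sup>2) * vexp 0 (\<beta> / 2) (snd z) / (M (snd z) * vexp 0 (\<beta> / 2) (snd z))"
    by (rule cancel[OF vexp_pos])
   also have "... = B1 / ?m * wt (\<beta> / 4) z"
    unfolding maxwellian_vexp mult.assoc EW by simp
   also have "B1 / ?m * wt (\<beta> / 4) z <= (B1 / ?m + B2) * wt (\<beta> / 4) z" by (rule le) simp
   finally show "\<bar>F' s z\<bar> <= (B1 / ?m + B2) * wt (\<beta> / 4) z" .
  qed
  show "AE s in lborel. AE z in lborel. s \<in> {0..t} --> \<bar>P' s z\<bar> <= (B1 / ?m + B2) * wt (\<beta> / 4) z"
   using B2(2)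
  proof (rule AE_AE_imp)
   fix s and z :: "'n phase" assume b: "s \<in> {0..t} --> \<bar>exp (p' s z)\<bar> <= B2 * exp (- (- \<beta> / 4) * (norm (snd z))\<^sup>2)" and s: "s \<in> {0..t}"
   then have "\<bar>P' s z\<bar> <= B2 * wt (\<beta> / 4) z" by (simp add: P'_eq vexp_def)
   also have "... <= (B1 / ?m + B2) * wt (\<beta> / 4) z" by (rule le) simp
   finally show "\<bar>P' s z\<bar> <= (B1 / ?m + B2) * wt (\<beta> / 4) z" .
  qed
 qed
qed

lemma gains_finite:
 "AE s in lborel. AE z in lborel. s \<in> {0..t} --> gain \<beta> (%z. ennreal \<bar>P' s z\<bar>) z < \<infinity>"
 "AE s in lborel. AE z in lborel. s \<in> {0..t} --> gain \<beta> (%z. ennreal \<bar>F' s z\<bar>) z < \<infinity>"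
proof -
 obtain B where B: "AE s in lborel. AE z in lborel. s \<in> {0..t} --> \<bar>F' s z\<bar> <= B * wt (\<beta> / 4) z"
  "AE s in lborel. AE z in lborel. s \<in> {0..t} --> \<bar>P' s z\<bar> <= B * wt (\<beta> / 4) z"
  using class_bound by blast
 have fin: "AE z in lborel. s \<in> {0..t} --> gain \<beta> (%z. ennreal \<bar>b s z\<bar>) z < \<infinity>"
  if b: "AE z in lborel. s \<in> {0..t} --> \<bar>b s z\<bar> <= B * wt (\<beta> / 4) z"
   and m: "b s \<in> borel_measurable borel" for b :: "real => 'n phase => real" and s
 proof (cases "s \<in> {0..t}")
  case True
  with b have "AE z in lborel. \<bar>b s z\<bar> <= B * wt (\<beta> / 4) z" by simp
  from coll_op_bound_AE_finite[OF \<beta>_pos \<alpha> m this] show ?thesis by eventually_elim simp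
 next
  case False
  then show ?thesis by (intro AE_I2 impI) blast
 qed
 show "AE s in lborel. AE z in lborel. s \<in> {0..t} --> gain \<beta> (%z. ennreal \<bar>P' s z\<bar>) z < \<infinity>"
  using B(2) by (rule eventually_mono) (erule fin, rule section_measurable[OF P'_meas])
 show "AE s in lborel. AE z in lborel. s \<in> {0..t} --> gain \<beta> (%z. ennreal \<bar>F' s z\<bar>) z < \<infinity>"
  using B(1) by (rule eventually_mono) (erule fin, rule section_measurable[OF F'_meas])
qed

definition "X s z = freq \<beta> (snd z) - rgain \<beta> (P' s) z / P' s z"

lemma X_meas: "jointly_measurable X"
 unfolding X_def by measurable

lemma r'_transported: "transported 1 t (%s z. p' s z - g s z) X"
proof -
 obtain D where D: "has_transport_deriv t (%s z. p' s z - g s z) D" and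
  d: "AE s in lborel. s \<in> {0..t} --> is_dH_dq \<beta> (q' s) (p' s) (%z. - D s z)"
  using sol unfolding HJ_solution_def by blast
 have tD: "time_phase_fun t D" and tr: "transported 1 t (%s z. p' s z - g s z) D"
  using D unfolding has_transport_deriv_iff by blast+
 have "AE s in lborel. AE z in lborel. s \<in> {0..t} --> on_interval t D s z = X s z"
  using d gains_finite(1)
 proof eventually_elim
  case (elim s)
  show ?case
  proof (cases "s \<in> {0..t}")
   case True
   note p's = time_phase_fun_section[OF tp' True] and Ds = time_phase_fun_section[OF tD True]
   have "phase_fun (%z. - D s z)"
    using Ds(1) lperiodicD[OF Ds(2)] by (auto simp: phase_fun_def periodic_iff intro!: lperiodicI)
   from is_dH_dq_unique[OF p's(3) this] elim(1) True
   have "AE z in lborel. - D s z = coll_rate \<beta> (p' s) z" by blast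
   with elim(2) show ?thesis
   proof eventually_elim
    case (elim z)
    have Ps: "P' s = (%z. exp (p' s z))" using True by (simp add: fun_eq_iff P'_eq)
    have "gain \<beta> (%z. ennreal (exp (p' s z))) z < \<infinity>" using elim(1) True by (simp add: Ps)
    from coll_rate_eq[OF \<beta>_pos p's(1) this] elim(2) show ?case using True by (simp add: X_def Ps)
   qed
  next
   case False
   then show ?thesis by (intro AE_I2 impI) blast
  qed
 qed
 moreover have "transported 1 t (%s z. p' s z - g s z) (on_interval t D)"
  using tr by (subst transported_values[where h'="%s z. p' s z - g s z" and F'=D]) simp_all
 ultimately show ?thesis by (intro transported_cong_AE[OF _ on_interval_measurable[OF tD] X_meas])
qed

lemma P'_transported: "transported 1 t P' (%s z. (V s z + freq \<beta> (snd z)) * P' s z - rgain \<beta> (P' s) z)"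
 using r'_transported gV unfolding transported_def
proof eventually_elim
 case (elim z)
 from primitive_on_exp[OF primitive_on_add[OF elim]] show ?case
 proof (rule primitive_on_values[THEN iffD1, rotated 2])
  fix s assume "s \<in> {0..t}"
  then have e: "exp (p' s (free_flow (1 * s) z) - g s (free_flow (1 * s) z) + g s (free_flow (1 * s) z)) = P' s (free_flow (1 * s) z)"
   by (simp add: P'_eq)
  show "exp (p' s (free_flow (1 * s) z) - g s (free_flow (1 * s) z) + g s (free_flow (1 * s) z)) = P' s (free_flow (1 * s) z)" by (rule e)
  have "P' s (free_flow (1 * s) z) \<noteq> 0" using P'_pos[of s "free_flow (1 * s) z"] by simp
  then show "(X s (free_flow (1 * s) z) + V s (free_flow (1 * s) z)) * exp (p' s (free_flow (1 * s) z) - g s (free_flow (1 * s) z) + g s (free_flow (1 * s) z))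
   = (V s (free_flow (1 * s) z) + freq \<beta> (snd (free_flow (1 * s) z))) * P' s (free_flow (1 * s) z) - rgain \<beta> (P' s) (free_flow (1 * s) z)"
   unfolding e X_def by (simp add: field_simps)
 qed
qed

text \<open>Both exponentials solve the same linear backward equation with the same final value.\<close>

lemma P'_unique:
 assumes s: "s \<in> {0..t}"
 shows "AE z in lborel. P' s z = P s z"
proof -
 define d where "d s z = P' s z - P s z" for s z
 have dm: "jointly_measurable d" unfolding d_def by measurable
 note [measurable (raw)] = joint_apply[OF dm]
 have "transported 1 t d (%s z. ((V s z + freq \<beta> (snd z)) * P' s z - rgain \<beta> (P' s) z) - ((V s z + freq \<beta> (snd z)) * P s z - rgain \<beta> (P s) z))"
  using P'_transported P_transported unfolding transported_def d_def by eventually_elim (rule primitive_on_diff)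
 then have "transported 1 t d (%s z. (V s z + freq \<beta> (snd z)) * d s z - rgain \<beta> (d s) z)"
 proof (rule transported_cong_AE)
  show "AE s in lborel. AE z in lborel. s \<in> {0..t} --> ((V s z + freq \<beta> (snd z)) * P' s z - rgain \<beta> (P' s) z) -
    ((V s z + freq \<beta> (snd z)) * P s z - rgain \<beta> (P s) z) = (V s z + freq \<beta> (snd z)) * d s z - rgain \<beta> (d s) z"
   using gains_finite(1)
  proof (rule AE_AE_imp)
   fix s and z :: "'n phase" assume f: "s \<in> {0..t} --> gain \<beta> (%z. ennreal \<bar>P' s z\<bar>) z < \<infinity>" and s: "s \<in> {0..t}"
   have "rgain \<beta> (%z. P' s z - P s z) z = rgain \<beta> (P' s) z - rgain \<beta> (P s) z"
    using f s gain_P[of s z] by (intro rgain_diff section_measurable[OF P'_meas] section_measurable[OF P_meas]) auto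
   then show "((V s z + freq \<beta> (snd z)) * P' s z - rgain \<beta> (P' s) z) - ((V s z + freq \<beta> (snd z)) * P s z - rgain \<beta> (P s) z)
    = (V s z + freq \<beta> (snd z)) * d s z - rgain \<beta> (d s) z"
    by (simp add: d_def[abs_def] right_diff_distrib)
  qed
 qed measurable
 from transported_reflect[OF this]
 have tr: "transported (- 1) t (%s. d (t - s)) (%s z. rgain \<beta> (d (t - s)) z - bwd.damped s z * d (t - s) z)" by simp
 obtain B where B: "0 <= B" "AE s in lborel. AE z in lborel. s \<in> {0..t} --> \<bar>P' s z\<bar> <= B * wt (\<beta> / 4) z"
  using class_bound by blast
 obtain B' where B': "0 <= B'" "!!s z. s \<in> {0..t} ==> F s z <= B' * wt (\<beta> / 4) z"
  "!!s z. s \<in> {0..t} ==> P s z <= B' * wt (\<beta> / 4) z"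
  using FP_bound by blast
 have bnd: "AE s in lborel. AE z in lborel. s \<in> {0..t} --> \<bar>d (t - s) z\<bar> <= (B + B') * wt (\<beta> / 4) z"
  using AE_lborel_minus_left[OF B(2), of t]
 proof (rule AE_AE_imp)
  fix s and z :: "'n phase" assume b: "t - s \<in> {0..t} --> \<bar>P' (t - s) z\<bar> <= B * wt (\<beta> / 4) z" and s: "s \<in> {0..t}"
  then have "\<bar>P' (t - s) z\<bar> <= B * wt (\<beta> / 4) z" "P (t - s) z <= B' * wt (\<beta> / 4) z" "0 < P (t - s) z"
   using B'(3)[of "t - s" z] P_pos[of "t - s" z] by auto
  then show "\<bar>d (t - s) z\<bar> <= (B + B') * wt (\<beta> / 4) z" unfolding d_def distrib_right by linarith
 qed
 have init: "AE z in lborel. d (t - 0) z = 0"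
 proof -
  have "AE z in phase_measure. p' t z = g t z" using sol unfolding HJ_solution_def by blast
  then have "AE z in lborel. p' t z = g t z"
  proof (rule AE_phase_imp_lborel[rotated])
   have "t \<in> {0..t}" using t_pos by simp
   then show "lperiodic (%z. p' t z = g t z)"
    using lperiodicD[OF time_phase_fun_section(2)[OF tp']] lperiodicD[OF time_phase_fun_section(2)[OF g]]
    by (intro lperiodicI) simp
  qed
  with \<psi>_eq show ?thesis
  proof eventually_elim
   case (elim z)
   then show ?case using t_pos by (simp add: d_def P'_eq P_def bwd.lin_sol_0[OF \<psi>_facts])
  qed
 qed
 have dm': "(%(s, z). d (t - s) z) \<in> borel_measurable (borel \<Otimes>\<^sub>M borel)" by measurable
 have "t - s \<in> {0..t}" using s by auto
 from bwd.lin_unique[where \<delta>="%s. d (t - s)" and D="B + B'" and T=t, OF dm' \<alpha> _ bnd tr init this] B(1) B'(1)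
 have "AE z in lborel. d (t - (t - s)) z = 0" by simp
 then show ?thesis by eventually_elim (simp add: d_def)
qed

definition "\<kappa>' s z = M (snd z) * (P' s z * rgain \<beta> (F' s) z - F' s z * rgain \<beta> (P' s) z)"

text \<open>The derivative of \<open>q'\<close> and the density computed from \<open>F'\<close> and \<open>P'\<close> are both densities of the same
partial derivative.\<close>

lemma q'_transported: "transported 1 t q' \<kappa>'"
proof -
 obtain D where D: "has_transport_deriv t q' D" and
  d: "AE s in lborel. s \<in> {0..t} --> is_dH_dp \<beta> (q' s) (p' s) (D s)"
  using sol unfolding HJ_solution_def by blast
 have tD: "time_phase_fun t D" and tr: "transported 1 t q' D"
  using D unfolding has_transport_deriv_iff by blast+
 have \<kappa>m: "jointly_measurable \<kappa>'" unfolding \<kappa>'_def by measurable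
 have \<kappa>per: "lperiodic (\<kappa>' s)" for s
  using lperiodicD[OF F'_per] lperiodicD[OF P'_per]
   lperiodicD[OF rgain_periodic[OF F'_per]] lperiodicD[OF rgain_periodic[OF P'_per]]
  by (intro lperiodicI) (simp add: \<kappa>'_def)
 obtain B where B: "0 <= B" "AE s in lborel. AE z in lborel. s \<in> {0..t} --> \<bar>F' s z\<bar> <= B * wt (\<beta> / 4) z"
  "AE s in lborel. AE z in lborel. s \<in> {0..t} --> \<bar>P' s z\<bar> <= B * wt (\<beta> / 4) z"
  using class_bound by blast
 have "AE s in lborel. AE z in lborel. s \<in> {0..t} --> on_interval t D s z = \<kappa>' s z"
  using d B(2,3)
 proof eventually_elim
  case (elim s)
  show ?case
  proof (cases "s \<in> {0..t}")
   case True
   note p's = time_phase_fun_section[OF tp' True] and Ds = time_phase_fun_section[OF tD True]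
   have ps: "P' s z = exp (p' s z)" for z using True by (simp add: P'_eq)
   have \<kappa>_eq: "\<kappa>' s = (%z. M (snd z) * (exp (p' s z) * rgain \<beta> (F' s) z - F' s z * rgain \<beta> (%z. exp (p' s z)) z))"
    by (simp add: fun_eq_iff \<kappa>'_def ps[abs_def])
   have "is_dH_dp \<beta> (q' s) (p' s) (\<kappa>' s)" unfolding \<kappa>_eq
   proof (rule is_dH_dpI[OF \<beta>_pos \<alpha> B(1) section_measurable[OF F'_meas] p's(1)])
    show "AE z in lborel. \<bar>F' s z\<bar> <= B * wt (\<beta> / 4) z" using elim(2) True by simp
    show "AE z in lborel. exp (p' s z) <= B * wt (\<beta> / 4) z" using elim(3) True by (simp add: ps)
    show "q' s z = M (snd z) * F' s z * exp (p' s z)" for z using q'_eq[of s z] True by (simp add: ps)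
   qed
   moreover have "phase_fun (\<kappa>' s)" using section_measurable[OF \<kappa>m] \<kappa>per by (simp add: phase_fun_def periodic_iff)
   moreover have "is_dH_dp \<beta> (q' s) (p' s) (D s)" using elim(1) True by blast
   ultimately have "AE z in lborel. D s z = \<kappa>' s z" using is_dH_dp_unique[OF p's(3) Ds(3)] by blast
   then show ?thesis using True by eventually_elim simp
  next
   case False
   then show ?thesis by (intro AE_I2 impI) blast
  qed
 qed
 moreover have "transported 1 t q' (on_interval t D)"
  using tr by (subst transported_values[where h'=q' and F'=D]) simp_all
 ultimately show ?thesis by (intro transported_cong_AE[OF _ on_interval_measurable[OF tD] \<kappa>m])
qed

lemma F'_transported: "transported 1 t F' (%s z. rgain \<beta> (F' s) z - (V s z + freq \<beta> (snd z)) * F' s z)"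
 using q'_transported r'_transported gV unfolding transported_def
proof eventually_elim
 case (elim z)
 have alg: "1 / m * (m * (a * rf - f * rp) * inverse a + (- 1 * (n - rp / a + v)) * inverse a * (m * f * a)) = rf - (v + n) * f"
  if "0 < m" "0 < a" for m a rf f rp n v :: real
  using that by (simp add: field_simps)
 from primitive_on_mult_left[where c="1 / M (snd z)", OF primitive_on_mult[OF elim(1) primitive_on_exp[OF primitive_on_mult_left[where c="- 1", OF primitive_on_add[OF elim(2,3)]]]]]
 show ?case
 proof (rule primitive_on_values[THEN iffD1, rotated 2])
  fix s assume s: "s \<in> {0..t}"
  let ?y = "free_flow (1 * s) z"
  have e: "exp (- 1 * (p' s ?y - g s ?y + g s ?y)) = inverse (P' s ?y)"
   using s by (simp add: P'_eq exp_minus)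
  have q: "q' s ?y = M (snd z) * F' s ?y * P' s ?y" using q'_eq[of s ?y] s by simp
  show "1 / M (snd z) * (q' s ?y * exp (- 1 * (p' s ?y - g s ?y + g s ?y))) = F' s ?y"
   unfolding e q using M_pos[of "snd z"] P'_pos[of s ?y] by simp
  show "1 / M (snd z) * (\<kappa>' s ?y * exp (- 1 * (p' s ?y - g s ?y + g s ?y)) + (- 1 * (X s ?y + V s ?y)) * exp (- 1 * (p' s ?y - g s ?y + g s ?y)) * q' s ?y)
   = rgain \<beta> (F' s) ?y - (V s ?y + freq \<beta> (snd ?y)) * F' s ?y"
   unfolding e q X_def \<kappa>'_def snd_free_flow by (rule alg[OF M_pos P'_pos])
 qed
qed

lemma F'_unique:
 assumes s: "s \<in> {0..t}"
 shows "AE z in lborel. F' s z = F s z"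
proof -
 define d where "d s z = F' s z - F s z" for s z
 have dm: "jointly_measurable d" unfolding d_def by measurable
 note [measurable (raw)] = joint_apply[OF dm]
 have "transported 1 t d (%s z. (rgain \<beta> (F' s) z - (V s z + freq \<beta> (snd z)) * F' s z) - (rgain \<beta> (F s) z - (V s z + freq \<beta> (snd z)) * F s z))"
  using F'_transported F_transported unfolding transported_def d_def by eventually_elim (rule primitive_on_diff)
 then have tr: "transported 1 t d (%s z. rgain \<beta> (d s) z - fwd.damped s z * d s z)"
 proof (rule transported_cong_AE)
  show "AE s in lborel. AE z in lborel. s \<in> {0..t} --> (rgain \<beta> (F' s) z - (V s z + freq \<beta> (snd z)) * F' s z) -
    (rgain \<beta> (F s) z - (V s z + freq \<beta> (snd z)) * F s z) = rgain \<beta> (d s) z - fwd.damped s z * d s z"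
   using gains_finite(2)
  proof (rule AE_AE_imp)
   fix s and z :: "'n phase" assume f: "s \<in> {0..t} --> gain \<beta> (%z. ennreal \<bar>F' s z\<bar>) z < \<infinity>" and s: "s \<in> {0..t}"
   have "rgain \<beta> (%z. F' s z - F s z) z = rgain \<beta> (F' s) z - rgain \<beta> (F s) z"
    using f s gain_F[of s z] by (intro rgain_diff section_measurable[OF F'_meas] section_measurable[OF F_meas]) auto
   then show "(rgain \<beta> (F' s) z - (V s z + freq \<beta> (snd z)) * F' s z) - (rgain \<beta> (F s) z - (V s z + freq \<beta> (snd z)) * F s z)
    = rgain \<beta> (d s) z - fwd.damped s z * d s z"
    by (simp add: d_def[abs_def] right_diff_distrib)
  qed
 qed measurable
 obtain B where B: "0 <= B" "AE s in lborel. AE z in lborel. s \<in> {0..t} --> \<bar>F' s z\<bar> <= B * wt (\<beta> / 4) z"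
  using class_bound by blast
 obtain B' where B': "0 <= B'" "!!s z. s \<in> {0..t} ==> F s z <= B' * wt (\<beta> / 4) z"
  "!!s z. s \<in> {0..t} ==> P s z <= B' * wt (\<beta> / 4) z"
  using FP_bound by blast
 have bnd: "AE s in lborel. AE z in lborel. s \<in> {0..t} --> \<bar>d s z\<bar> <= (B + B') * wt (\<beta> / 4) z"
  using B(2)
 proof (rule AE_AE_imp)
  fix s and z :: "'n phase" assume b: "s \<in> {0..t} --> \<bar>F' s z\<bar> <= B * wt (\<beta> / 4) z" and s: "s \<in> {0..t}"
  then have "\<bar>F' s z\<bar> <= B * wt (\<beta> / 4) z" "F s z <= B' * wt (\<beta> / 4) z" "0 <= F s z"
   using B'(2)[of s z] F_nonneg[of s z] by auto
  then show "\<bar>d s z\<bar> <= (B + B') * wt (\<beta> / 4) z" unfolding d_def distrib_right by linarith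
 qed
 have init: "AE z in lborel. d 0 z = 0"
 proof -
  have "AE z in phase_measure. q' 0 z = M (snd z) * \<phi>0 z * exp (p' 0 z)" using sol unfolding HJ_solution_def by blast
  then have "AE z in lborel. q' 0 z = M (snd z) * \<phi>0 z * exp (p' 0 z)"
  proof (rule AE_phase_imp_lborel[rotated])
   have "0 \<in> {0..t}" using t_pos by simp
   then show "lperiodic (%z. q' 0 z = M (snd z) * \<phi>0 z * exp (p' 0 z))"
    using lperiodicD[OF time_phase_fun_section(2)[OF tp']] lperiodicD[OF time_phase_fun_section(2)[OF tq']]
     \<phi>0(1)[unfolded phase_fun_def periodic_iff, THEN conjunct2, THEN lperiodicD]
    by (intro lperiodicI) simp
  qed
  with \<phi>_eq show ?thesis
  proof eventually_elim
   case (elim z)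
   then show ?case using t_pos M_pos[of "snd z"] P'_pos[of 0 z] q'_eq[of 0 z] P'_eq[of 0 z]
    by (simp add: d_def fwd.lin_sol_0[OF \<phi>_facts])
  qed
 qed
 from fwd.lin_unique[where \<delta>=d and D="B + B'" and T=t, OF dm \<alpha> _ bnd tr init s] B(1) B'(1)
 have "AE z in lborel. d s z = 0" by simp
 then show ?thesis by eventually_elim (simp add: d_def)
qed

lemma solution_unique:
 assumes s: "s \<in> {0..t}"
 shows "AE z in phase_measure. q' s z = q s z \<and> p' s z = p s z"
 using AE_lborel_imp_phase[OF P'_unique[OF s]] AE_lborel_imp_phase[OF F'_unique[OF s]]
proof eventually_elim
 case (elim z)
 have "p' s z = ln (P' s z)" using s by (simp add: P'_eq)
 then show ?case using s q'_eq[of s z] elim by (simp add: p_def q_def)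
qed

end

end

section \<open>The two functionals\<close>

lemma on_interval_LINT:
 "(LINT s:{0..t}|lborel. h s (\<zeta> s)) = (LINT s:{0..t}|lborel. on_interval t h s (\<zeta> s))"
 by (rule set_lebesgue_integral_cong) (simp_all add: on_interval_def)

lemma transport_deriv_unique:
 fixes h D :: "real => 'n::finite phase => real"
 assumes h: "has_transport_deriv t h D" and D: "jointly_measurable D"
 shows "time_phase_fun t (transport_deriv t h)"
  "AE s in lborel. AE z in lborel. s \<in> {0..t} --> on_interval t (transport_deriv t h) s z = D s z"
proof -
 have T: "has_transport_deriv t h (transport_deriv t h)"
  unfolding transport_deriv_def by (rule someI[of "has_transport_deriv t h", OF h])
 then show tp: "time_phase_fun t (transport_deriv t h)" unfolding has_transport_deriv_iff by blast
 have "transported 1 t h (transport_deriv t h)" using T unfolding has_transport_deriv_iff by blast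
 then have 1: "transported 1 t h (on_interval t (transport_deriv t h))"
  by (subst transported_values[where h'=h and F'="transport_deriv t h"]) simp_all
 have 2: "transported 1 t h D" using h unfolding has_transport_deriv_iff by blast
 show "AE s in lborel. AE z in lborel. s \<in> {0..t} --> on_interval t (transport_deriv t h) s z = D s z"
  by (rule transported_unique[OF 1 2 on_interval_measurable[OF tp] D])
qed

lemma measurable_phase_LINT:
 fixes h :: "real => 'n::finite phase => real"
 assumes h: "jointly_measurable h"
 shows "(%s. LINT z|phase_measure. h s z) \<in> borel_measurable lborel"
proof (rule sigma_finite_measure.borel_measurable_lebesgue_integral[OF sigma_finite_phase])
 have [measurable]: "(snd :: real \<times> 'n phase => _) \<in> borel_measurable (lborel \<Otimes>\<^sub>M phase_measure)"
  using measurable_compose[OF measurable_snd sets_phase_measurable[of "%z. z"]] by simp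
 show "(%(s, z). h s z) \<in> borel_measurable (lborel \<Otimes>\<^sub>M phase_measure)"
  unfolding split_beta by (intro joint_apply[OF h]) measurable
qed

context hj_data
begin

abbreviation "mass \<equiv> LINT z|phase_measure. M (snd z) * (\<phi> z * P 0 z)"

lemma initial_functional: "cumulant_functional \<beta> \<phi>0 0 p = mass"
 unfolding cumulant_functional_0
proof (rule integral_cong_AE)
 have [measurable]: "\<phi>0 \<in> borel_measurable borel" "p 0 \<in> borel_measurable borel"
  using \<phi>0(1) section_measurable[OF p_meas] by (auto simp: phase_fun_def)
 note [measurable] = \<phi>_meas
 show "(%z. M (snd z) * \<phi>0 z * exp (p 0 z)) \<in> borel_measurable phase_measure"
  "(%z. M (snd z) * (\<phi> z * P 0 z)) \<in> borel_measurable phase_measure"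
  by (rule sets_phase_measurable; measurable)+
 show "AE z in phase_measure. M (snd z) * \<phi>0 z * exp (p 0 z) = M (snd z) * (\<phi> z * P 0 z)"
  using AE_lborel_imp_phase[OF \<phi>_eq] by eventually_elim (use t_pos in \<open>simp add: exp_p\<close>)
qed

text \<open>The transport derivative of \<open>p - g\<close> is minus the collision rate, whose product with \<open>q\<close> is the density
of the Hamiltonian; so the two integrals cancel.\<close>

lemma HJ_functional_eq: "HJ_functional \<beta> \<phi>0 t g q p = mass"
proof -
 let ?r = "%s z. p s z - g s z"
 let ?G = "%s. LINT z|phase_measure. q s z * Dr s z"
 note [measurable (raw)] = joint_apply[OF q_meas] joint_apply[OF Dr_meas]
 have tp: "time_phase_fun t p" "time_phase_fun t Dr"
  by (intro time_phase_funI p_meas p_per Dr_meas Dr_per)+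
 have "has_transport_deriv t ?r Dr"
  unfolding has_transport_deriv_iff using time_phase_fun_diff[OF tp(1) g] tp(2) r_transported by blast
 note D = transport_deriv_unique[OF this Dr_meas]
 let ?D = "transport_deriv t ?r"
 note [measurable (raw)] = joint_apply[OF on_interval_measurable[OF D(1)]]
 have A: "(LINT s:{0..t}|lborel. LINT z|phase_measure. q s z * ?D s z) = (LINT s:{0..t}|lborel. ?G s)"
 proof -
  have "(LINT s:{0..t}|lborel. LINT z|phase_measure. q s z * ?D s z) = (LINT s:{0..t}|lborel. LINT z|phase_measure. q s z * on_interval t ?D s z)"
   by (rule set_lebesgue_integral_cong) simp_all
  also have "... = (LINT s:{0..t}|lborel. ?G s)"
   unfolding set_lebesgue_integral_def
  proof (rule integral_cong_AE)
   have a: "(%s. LINT z|phase_measure. q s z * on_interval t ?D s z) \<in> borel_measurable lborel"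
    by (rule measurable_phase_LINT) measurable
   have b: "?G \<in> borel_measurable lborel" by (rule measurable_phase_LINT) measurable
   show "(%s. indicat_real {0..t} s *\<^sub>R (LINT z|phase_measure. q s z * on_interval t ?D s z)) \<in> borel_measurable lborel"
    by (rule borel_measurable_scaleR[OF _ a]) measurable
   show "(%s. indicat_real {0..t} s *\<^sub>R ?G s) \<in> borel_measurable lborel"
    by (rule borel_measurable_scaleR[OF _ b]) measurable
   show "AE s in lborel. indicat_real {0..t} s *\<^sub>R (LINT z|phase_measure. q s z * on_interval t ?D s z) = indicat_real {0..t} s *\<^sub>R ?G s"
    using D(2)
   proof eventually_elim
    case (elim s)
    show ?case
    proof (cases "s \<in> {0..t}")
     case True
     have "(LINT z|phase_measure. q s z * on_interval t ?D s z) = ?G s"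
     proof (rule integral_cong_AE)
      show "(%z. q s z * on_interval t ?D s z) \<in> borel_measurable phase_measure"
       "(%z. q s z * Dr s z) \<in> borel_measurable phase_measure"
       by (rule sets_phase_measurable; measurable)+
      have "AE z in lborel. on_interval t ?D s z = Dr s z" using elim True by (simp only: simp_thms)
      then show "AE z in phase_measure. q s z * on_interval t ?D s z = q s z * Dr s z"
       by (rule eventually_mono[OF AE_lborel_imp_phase]) simp
     qed
     then show ?thesis by simp
    qed simp
   qed
  qed
  finally show ?thesis .
 qed
 have "hamiltonian \<beta> (q s) (p s) = - ?G s" if "s \<in> {0..t}" for s
  using that by (simp add: hamiltonian_def hamiltonian_density_eq coll_rate_p)
 then have "(LINT s:{0..t}|lborel. hamiltonian \<beta> (q s) (p s)) = (LINT s:{0..t}|lborel. - ?G s)"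
  by (intro set_lebesgue_integral_cong) auto
 also have "... = - (LINT s:{0..t}|lborel. ?G s)"
  unfolding set_lebesgue_integral_def scaleR_minus_right by (rule Bochner_Integration.integral_minus)
 finally show ?thesis unfolding HJ_functional_def A initial_functional by simp
qed

text \<open>The path integral gives the forward solution at time \<open>t\<close>, and duality moves it to the backward solution
at time \<open>0\<close>.\<close>

lemma cumulant_functional_eq: "cumulant_functional \<beta> \<phi>0 t g = mass"
proof -
 have tV: "time_phase_fun t V" by (rule time_phase_funI[OF V_meas V_per])
 have "has_transport_deriv t g V" unfolding has_transport_deriv_iff using g tV gV by blast
 note T = transport_deriv_unique[OF this V_meas]
 have gt: "g t \<in> borel_measurable borel" using time_phase_fun_section(1)[OF g] t_pos by simp
 note [measurable] = gt \<psi>_meas \<phi>_meas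
 have \<phi>0m: "\<phi>0 \<in> borel_measurable borel" using \<phi>0(1) by (simp add: phase_fun_def)
 have "cumulant_functional \<beta> \<phi>0 t g = (LINT z|phase_measure. M (snd z) * (exp (g t z) * F t z))"
  unfolding cumulant_functional_def on_interval_LINT[where h="transport_deriv t g"]
  by (rule fwd.path_integral_eq_solution[OF refl t_pos on_interval_measurable[OF T(1)] T(2) \<phi>0m \<phi>0(2) \<phi>_eq gt \<phi>_facts])
 also have "... = (LINT z|phase_measure. M (snd z) * (\<psi> z * F t z))"
 proof (rule integral_cong_AE)
  show "(%z. M (snd z) * (exp (g t z) * F t z)) \<in> borel_measurable phase_measure"
   "(%z. M (snd z) * (\<psi> z * F t z)) \<in> borel_measurable phase_measure"
   by (rule sets_phase_measurable; measurable)+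
  show "AE z in phase_measure. M (snd z) * (exp (g t z) * F t z) = M (snd z) * (\<psi> z * F t z)"
   using AE_lborel_imp_phase[OF \<psi>_eq] by eventually_elim simp
 qed
 also have "... = enn2real (\<integral>\<^sup>+z. ennreal (M (snd z) * (\<psi> z * F t z)) \<partial>phase_measure)"
 proof (rule integral_eq_nn_integral)
  show "(%z. M (snd z) * (\<psi> z * F t z)) \<in> borel_measurable phase_measure" by (rule sets_phase_measurable) measurable
  show "AE z in phase_measure. 0 <= M (snd z) * (\<psi> z * F t z)"
   by (rule AE_I2) (intro mult_nonneg_nonneg maxwellian_nonneg \<psi>_nonneg F_nonneg)
 qed
 also have "(\<integral>\<^sup>+z. ennreal (M (snd z) * (\<psi> z * F t z)) \<partial>phase_measure)
  = (\<integral>\<^sup>+z. ennreal (M (snd z)) * ennreal (\<psi> z) * dyson_sum \<beta> 1 (path_weight 1 fwd.damped) (%z. ennreal (\<phi> z)) t z \<partial>phase_measure)"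
  by (rule nn_integral_cong) (use t_pos in \<open>simp add: ennreal_mult' fwd.ennreal_lin_sol[OF \<phi>_facts, symmetric] mult.assoc \<psi>_nonneg maxwellian_nonneg\<close>)
 also have "... = (\<integral>\<^sup>+z. ennreal (M (snd z)) * ennreal (\<phi> z) * dyson_sum \<beta> (- 1) (path_weight (- 1) (%r. fwd.damped (t - r))) (%z. ennreal (\<psi> z)) t z \<partial>phase_measure)"
 proof (rule dyson_sum_duality[OF fwd.damped_meas fwd.damped_per])
  show "lperiodic (%z. ennreal (\<phi> z))" "lperiodic (%z. ennreal (\<psi> z))"
   using lperiodicD[OF \<phi>_per] lperiodicD[OF \<psi>_per] by (intro lperiodicI; simp)+
 qed (use t_pos in \<open>measurable, simp\<close>)
 also have "... = (\<integral>\<^sup>+z. ennreal (M (snd z) * (\<phi> z * P 0 z)) \<partial>phase_measure)"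
  by (rule nn_integral_cong)
   (use t_pos in \<open>simp add: P_def ennreal_mult' bwd.ennreal_lin_sol[OF \<psi>_facts, symmetric] mult.assoc \<phi>_nonneg maxwellian_nonneg\<close>)
 also have "enn2real ... = mass"
 proof (rule integral_eq_nn_integral[symmetric])
  show "(%z. M (snd z) * (\<phi> z * P 0 z)) \<in> borel_measurable phase_measure" by (rule sets_phase_measurable) measurable
  have "0 <= P 0 z" for z using P_pos[of 0 z] t_pos by simp
  then show "AE z in phase_measure. 0 <= M (snd z) * (\<phi> z * P 0 z)"
   by (intro AE_I2 mult_nonneg_nonneg maxwellian_nonneg \<phi>_nonneg)
 qed
 finally show ?thesis .
qed

end

theorem proposition2p11p2:
 fixes \<phi>0 :: "'n::finite phase => real"
  and g :: "real => 'n phase => real"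
  and \<beta> t :: real
 assumes "\<beta> > 0"
  and "phase_fun \<phi>0"
  and "!!z. \<phi>0 z \<ge> 0"
  and "esssup phase_measure (%z. ereal (\<phi>0 z * maxwellian (\<beta> / 2) (snd z))) < \<infinity>"
  and "t > 0"
  and "g \<in> observables t \<beta>"
 shows "\<exists>q p. HJ_solution \<beta> \<phi>0 t g q p \<and> solution_class \<beta> t q p \<and>
  (\<forall>q' p'. HJ_solution \<beta> \<phi>0 t g q' p' \<and> solution_class \<beta> t q' p' -->
    (\<forall>s\<in>{0..t}. AE z in phase_measure. q' s z = q s z \<and> p' s z = p s z)) \<and>
  cumulant_functional \<beta> \<phi>0 t g = HJ_functional \<beta> \<phi>0 t g q p"
proof -
 obtain A where A: "0 <= A" "AE z in lborel. \<phi>0 z <= A * wt (\<beta> / 4) z"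
  by (rule datum_bound[OF assms(1,2,4)])
 obtain V C where V: "time_phase_fun t g" "transported 1 t g V"
  "jointly_measurable V" "!!s z. \<bar>V s z\<bar> <= C" "!!s. lperiodic (V s)"
  "AE z in lborel. g t z <= \<beta> / 4 * (norm (snd z))\<^sup>2 + C"
 proof (rule observables_bounded_derivative[OF assms(5,6)], goal_cases)
  case (1 V C)
  show ?case by (rule 1(1)[OF 1(2-7)])
 qed
 define \<phi> where "\<phi> z = min (\<phi>0 z) (A * wt (\<beta> / 4) z)" for z
 define \<psi> where "\<psi> z = min (exp (g t z)) (exp C * wt (\<beta> / 4) z)" for z
 have [measurable]: "\<phi>0 \<in> borel_measurable borel" and \<phi>0_per: "lperiodic \<phi>0"
  using assms(2) by (auto simp: phase_fun_def periodic_iff)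
 have "t \<in> {0..t}" using assms(5) by simp
 note gt = time_phase_fun_section(1,2)[OF V(1) this]
 note [measurable] = gt(1)
 interpret hj_data \<beta> t C A "exp C" g V \<phi>0 \<phi> \<psi>
 proof (rule hj_data.intro[OF assms(1,5) V(3,4,5,1,2) assms(2,3)])
  show "\<phi> \<in> borel_measurable borel" "\<psi> \<in> borel_measurable borel" unfolding \<phi>_def \<psi>_def by measurable
  show "0 <= \<phi> z" "0 < \<psi> z" for z using assms(3)[of z] A(1) by (simp_all add: \<phi>_def \<psi>_def)
  show "lperiodic \<phi>" "lperiodic \<psi>"
   using lperiodicD[OF \<phi>0_per] lperiodicD[OF gt(2)] by (intro lperiodicI; simp add: \<phi>_def \<psi>_def)+
  show "\<phi> z <= A * wt (\<beta> / 4) z" "\<psi> z <= exp C * wt (\<beta> / 4) z" for z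
   by (simp_all add: \<phi>_def \<psi>_def)
  show "AE z in lborel. \<phi>0 z = \<phi> z" using A(2) by eventually_elim (simp add: \<phi>_def)
  show "AE z in lborel. exp (g t z) = \<psi> z" using V(6)
  proof eventually_elim
   case (elim z)
   then have "exp (g t z) <= exp (\<beta> / 4 * (norm (snd z))\<^sup>2 + C)" by simp
   also have "... = exp C * wt (\<beta> / 4) z" by (simp add: vexp_def exp_add)
   finally show ?case by (simp add: \<psi>_def)
  qed
 qed
 show ?thesis
  using solution in_class solution_unique cumulant_functional_eq HJ_functional_eq
  by (intro exI[of _ q] exI[of _ p] conjI allI impI ballI) auto
qed

end
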